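(* Let $k\in\mathbb{N}$, $\tilde{k}>0$, $d\in\mathbb{R}$ and let $m=(m(n))_{n\ge0}$ be a regular sequence of moments of order $\frac{1}{\tilde{k}}$. Let $P(\zeta)$ be a polynomial of degree $q$ with complex coefficients such that $P(0)\neq 0$, and let $a_1,\dots,a_l\in\mathbb{C}$ be the (distinct) roots of $P(\zeta)=0$, with multiplicities $p_1,\dots,p_l$ respectively, $\sum_{i=1}^l p_i=q$. Let $f(z)$ be holomorphic in a complex neighbourhood of the origin, and let $\hat{x}(\varepsilon,z)\in\mathbb{E}[[\varepsilon]]$ be a formal solution of the equation $$P\left(\varepsilon^k\partial_{m,z}\right)x(\varepsilon,z)=f(z).$$ Then the following are equivalent: (i) for every $i=1,\dots,l$, $f$ can be continued analytically in some sector in the direction $kd-\arg a_i$ and its continuation is of exponential growth of order (at most) $\tilde{k}$; (ii) $\hat{x}(\varepsilon,z)$ is $k\tilde{k}$-summable in the direction $d$.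
   Context: $D_r=\{z\in\mathbb{C}:|z|<r\}$. Here $\mathbb{E}$ is the Banach space $\mathcal{O}$ of functions holomorphic on $D_r$ and continuous on $\overline{D}_r$, for some $r>0$, with norm $\|\varphi\|=\sup_{|z|\le r}|\varphi(z)|$; the radius $r$ is not prescribed and may be decreased if necessary. $\mathbb{E}[[\varepsilon]]$ is the space of formal power series $\sum_{n\ge0}x_n(z)\varepsilon^n$ with $x_n\in\mathbb{E}$. Sectors: $S(d,\alpha)=\{\rho e^{i\phi}:\rho>0,\ |\phi-d|<\alpha/2\}$ and $\hat{S}_d(\alpha,r)=S(d,\alpha)\cup D_r$, written $\hat{S}_d$ when $\alpha>0$ and $r>0$ are unimportant. A (Banach-space valued) function $g$ holomorphic on $\hat{S}_d(\alpha,r)$ has exponential growth at most $K$ there if for every $\alpha'\in(0,\alpha)$, $r'\in(0,r)$ there are constants $C,a<\infty$ with $\|g(t)\|\le Ce^{a|t|^K}$ on $\hat{S}_d(\alpha',r')$. Saying that $f$ continues analytically in some sector in direction $\theta$ with exponential growth of order $K$ means that $f$ extends to a holomorphic function of exponential growth at most $K$ on some $\hat{S}_\theta(\alpha,r)$. Summability: for $K>0$, $\hat{\mathcal{B}}_K\big(\sum x_n\varepsilon^n\big)=\sum \frac{x_n}{\Gamma(1+n/K)}\varepsilon^n$. A series $\hat{x}\in\mathbb{E}[[\varepsilon]]$ is $K$-summable in the direction $d$ if $\hat{\mathcal{B}}_K\hat{x}$ converges near $\varepsilon=0$ and its sum extends to an $\mathbb{E}$-valued holomorphic function on some $\hat{S}_d$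 with exponential growth at most $K$. Kernel functions and moments: a pair $e(t),E(t)$ is a pair of kernel functions of order $K>\frac12$ if: $e$ is holomorphic in $S(0,\pi/K)$ and $t^{-1}e(t)$ is integrable at the origin, i.e. $\int_0^{x_0}x^{-1}|e(xe^{i\tau})|\,dx<\infty$ for all $x_0>0$ and $2K|\tau|<\pi$; for each $\delta>0$ there are $c,L>0$ with $|e(t)|\le c\exp[-(|t|/L)^K]$ for $2K|\arg t|\le\pi-\delta$; $e(x)>0$ for $x>0$; $E$ is entire with $|E(t)|\le Me^{N|t|^K}$ for some $M,N>0$, and $t^{-1}E(1/t)$ is integrable at the origin in $S(\pi,\pi(2-\frac1K))$; and $E(t)=\sum_{n\ge0}\frac{t^n}{m(n)}$, where $m(u)=\int_0^\infty x^{u-1}e(x)\,dx$ ($\mathrm{Re}\,u\ge0$) is the moment function of order $\frac1K$, normalized by $m(0)=1$. For $K\le\frac12$, take $p\in\mathbb{N}$ with $pK>\frac12$; $e,E$ are kernel functions of order $K$ if there are kernel functions $\tilde e,\tilde E$ of order $pK$ with moment function $\tilde m$ such that $e(t)=\tilde e(t^{1/p})/p$ and $E(t)=\sum_n t^n/\tilde m(pn)$, the moment function being $m(u)=\tilde m(pu)$. A sequence of moments of order $\frac1K$ is $m=(m(n))_{n\ge0}$ with $m(u)$ a moment function of order $\frac1K$; it is regular if there are $c,C>0$ with $c\,n^{1/K}\le\frac{m(n)}{m(n-1)}\le C\,n^{1/K}$ for all $n\ge1$. The moment differential operator is $\partial_{m,z}\left(\sum_{n\ge0}\frac{a_n}{m(n)}z^n\right)=\sum_{n\ge0}\frac{a_{n+1}}{m(n)}z^n$;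 it acts on the coefficients of series in $\varepsilon$. *)

theory Defs
  imports "HOL-Complex_Analysis.Complex_Analysis" "HOL-Computational_Algebra.Polynomial"
begin

definition sector :: "real \<Rightarrow> real \<Rightarrow> complex set" where
  "sector d \<alpha> = {of_real \<rho> * cis \<phi> | \<rho> \<phi>. 0 < \<rho> \<and> \<bar>\<phi> - d\<bar> < \<alpha> / 2}"

definition disc_sector :: "real \<Rightarrow> real \<Rightarrow> real \<Rightarrow> complex set" where
  "disc_sector d \<alpha> r = sector d \<alpha> \<union> ball 0 r"

text \<open>The argument \<open>\<nu>\<close> is the map sending \<open>t\<close> to the norm of \<open>g t\<close>, so that the same definition
  serves scalar-valued and Banach-space-valued \<open>g\<close>.\<close>

definition exp_growth :: "real \<Rightarrow> real \<Rightarrow> real \<Rightarrow> real \<Rightarrow> (complex \<Rightarrow> real) \<Rightarrow> bool" where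
  "exp_growth K d \<alpha> r \<nu> \<longleftrightarrow>
     (\<forall>\<alpha>' r'. 0 < \<alpha>' \<and> \<alpha>' < \<alpha> \<and> 0 < r' \<and> r' < r \<longrightarrow>
        (\<exists>C a. \<forall>t\<in>disc_sector d \<alpha>' r'. \<nu> t \<le> C * exp (a * norm t powr K)))"

definition continues_with_growth :: "real \<Rightarrow> real \<Rightarrow> (complex \<Rightarrow> complex) \<Rightarrow> bool" where
  "continues_with_growth K \<theta> f \<longleftrightarrow>
     (\<exists>\<alpha> r g. 0 < \<alpha> \<and> 0 < r \<and> g holomorphic_on disc_sector \<theta> \<alpha> r \<and>
        (\<forall>\<^sub>F z in nhds 0. g z = f z) \<and> exp_growth K \<theta> \<alpha> r (\<lambda>t. norm (g t)))"

text \<open>The Banach space of functions holomorphic on the open disc of radius \<open>r\<close> and continuous on its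
  closure. Since \<open>r\<close> is a variable, it is modelled as a set of functions of which only
  the values on \<open>cball 0 r\<close> matter.\<close>

definition disc_space :: "real \<Rightarrow> (complex \<Rightarrow> complex) set" where
  "disc_space r = {\<phi>. \<phi> holomorphic_on ball 0 r \<and> continuous_on (cball 0 r) \<phi>}"

definition disc_norm :: "real \<Rightarrow> (complex \<Rightarrow> complex) \<Rightarrow> real" where
  "disc_norm r \<phi> = (SUP z\<in>cball 0 r. norm (\<phi> z))"

text \<open>Complex differentiability, in \<open>disc_norm r\<close>, of a \<open>disc_space r\<close>-valued function; it is used
  for open \<open>U\<close> only.\<close>

definition disc_valued_holomorphic_on ::
    "real \<Rightarrow> (complex \<Rightarrow> complex \<Rightarrow> complex) \<Rightarrow> complex set \<Rightarrow> bool" where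
  "disc_valued_holomorphic_on r g U \<longleftrightarrow>
     (\<forall>t\<in>U. g t \<in> disc_space r) \<and>
     (\<forall>t\<in>U. \<exists>D\<in>disc_space r.
        ((\<lambda>s. disc_norm r (\<lambda>z. (g s z - g t z) / (s - t) - D z)) \<longlongrightarrow> 0) (at t within U))"

text \<open>A formal power series in \<open>\<epsilon>\<close> over \<open>disc_space r\<close> is given by its coefficient sequence \<open>x\<close>.\<close>

definition borel_transform ::
    "real \<Rightarrow> (nat \<Rightarrow> complex \<Rightarrow> complex) \<Rightarrow> nat \<Rightarrow> complex \<Rightarrow> complex" where
  "borel_transform K x n z = x n z / of_real (Gamma (1 + real n / K))"

definition summable_in_direction ::
    "real \<Rightarrow> real \<Rightarrow> real \<Rightarrow> (nat \<Rightarrow> complex \<Rightarrow> complex) \<Rightarrow> bool" where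
  "summable_in_direction r K d x \<longleftrightarrow>
     (\<forall>n. x n \<in> disc_space r) \<and>
     (\<exists>g \<alpha> \<rho> \<delta>. 0 < \<alpha> \<and> 0 < \<rho> \<and> 0 < \<delta> \<and>
        (\<forall>t\<in>ball 0 \<delta>.
           (\<lambda>N. disc_norm r (\<lambda>z. (\<Sum>n<N. borel_transform K x n z * t ^ n) - g t z))
             \<longlonglongrightarrow> 0) \<and>
        disc_valued_holomorphic_on r g (disc_sector d \<alpha> \<rho>) \<and>
        exp_growth K d \<alpha> \<rho> (\<lambda>t. disc_norm r (g t)))"

definition kernel_moment :: "(complex \<Rightarrow> complex) \<Rightarrow> complex \<Rightarrow> complex" where
  "kernel_moment e u =
     set_lebesgue_integral lborel {0<..} (\<lambda>x. of_real x powr (u - 1) * e (of_real x))"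

text \<open>Kernel functions of order \<open>K > 1/2\<close>.\<close>

definition kernel_pair :: "real \<Rightarrow> (complex \<Rightarrow> complex) \<Rightarrow> (complex \<Rightarrow> complex) \<Rightarrow> bool" where
  "kernel_pair K e E \<longleftrightarrow>
     K > 1 / 2 \<and>
     e holomorphic_on sector 0 (pi / K) \<and>
     (\<forall>x0 \<tau>. 0 < x0 \<and> 2 * K * \<bar>\<tau>\<bar> < pi \<longrightarrow>
        set_integrable lborel {0<..x0} (\<lambda>x. norm (e (of_real x * cis \<tau>)) / x)) \<and>
     (\<forall>\<delta>>0. \<exists>c>0. \<exists>L>0. \<forall>t. t \<noteq> 0 \<and> 2 * K * \<bar>Arg t\<bar> \<le> pi - \<delta> \<longrightarrow>
        norm (e t) \<le> c * exp (- ((norm t / L) powr K))) \<and>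
     (\<forall>x::real. 0 < x \<longrightarrow> e (of_real x) \<in> \<real> \<and> 0 < Re (e (of_real x))) \<and>
     E holomorphic_on UNIV \<and>
     (\<exists>M>0. \<exists>N>0. \<forall>t. norm (E t) \<le> M * exp (N * norm t powr K)) \<and>
     (\<forall>x0 \<tau>. 0 < x0 \<and> \<bar>\<tau> - pi\<bar> < pi * (2 - 1 / K) / 2 \<longrightarrow>
        set_integrable lborel {0<..x0} (\<lambda>x. norm (E (1 / (of_real x * cis \<tau>))) / x)) \<and>
     (\<forall>t. (\<lambda>n. t ^ n / kernel_moment e (of_nat n)) sums E t) \<and>
     kernel_moment e 0 = 1"

text \<open>Kernel functions \<open>e\<close>, \<open>E\<close> of arbitrary order \<open>K > 0\<close> together with their moment function
  \<open>\<mu>\<close>, which matters on the closed right half-plane only. For \<open>K \<le> 1/2\<close> the function \<open>e\<close> lives on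
  the Riemann surface of the logarithm; here \<open>e\<close> denotes its restriction to the principal sheet,
  which determines it by analytic continuation.\<close>

definition kernel_functions ::
    "real \<Rightarrow> (complex \<Rightarrow> complex) \<Rightarrow> (complex \<Rightarrow> complex) \<Rightarrow> (complex \<Rightarrow> complex) \<Rightarrow> bool" where
  "kernel_functions K e E \<mu> \<longleftrightarrow>
     (if K > 1 / 2 then
        kernel_pair K e E \<and> (\<forall>u. 0 \<le> Re u \<longrightarrow> \<mu> u = kernel_moment e u)
      else
        0 < K \<and>
        (\<exists>p::nat. \<exists>e' E'. real p * K > 1 / 2 \<and> kernel_pair (real p * K) e' E' \<and>
           (\<forall>t. t \<notin> \<real>\<^sub>\<le>\<^sub>0 \<longrightarrow> e t = e' (t powr (1 / of_nat p)) / of_nat p) \<and>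
           (\<forall>t. (\<lambda>n. t ^ n / kernel_moment e' (of_nat p * of_nat n)) sums E t) \<and>
           (\<forall>u. 0 \<le> Re u \<longrightarrow> \<mu> u = kernel_moment e' (of_nat p * u))))"

text \<open>Moments at natural numbers are positive reals, so sequences of moments are taken
  real-valued. The parameter \<open>s\<close> is the order of the moments, i.e. \<open>1 / K\<close> for kernels of
  order \<open>K\<close>.\<close>

definition moment_sequence :: "real \<Rightarrow> (nat \<Rightarrow> real) \<Rightarrow> bool" where
  "moment_sequence s m \<longleftrightarrow>
     (\<exists>e E \<mu>. kernel_functions (1 / s) e E \<mu> \<and> (\<forall>n. of_real (m n) = \<mu> (of_nat n)))"

definition regular_moment_sequence :: "real \<Rightarrow> (nat \<Rightarrow> real) \<Rightarrow> bool" where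
  "regular_moment_sequence s m \<longleftrightarrow>
     moment_sequence s m \<and>
     (\<exists>c>0. \<exists>C>0. \<forall>n\<ge>1. c * real n powr s \<le> m n / m (n - 1) \<and>
        m n / m (n - 1) \<le> C * real n powr s)"

text \<open>A power series \<open>F\<close> is written as the sum of \<open>a n / m n * z ^ n\<close> with
  \<open>a n = m n * fps_nth F n\<close>.\<close>

definition moment_deriv :: "(nat \<Rightarrow> real) \<Rightarrow> complex fps \<Rightarrow> complex fps" where
  "moment_deriv m F = Abs_fps (\<lambda>n. (of_real (m (Suc n)) * fps_nth F (Suc n)) / of_real (m n))"

text \<open>In \<open>complex fps fps\<close> the outer variable is \<open>\<epsilon>\<close> and the inner one is \<open>z\<close>.\<close>

definition eps_moment_deriv ::
    "(nat \<Rightarrow> real) \<Rightarrow> nat \<Rightarrow> complex fps fps \<Rightarrow> complex fps fps" where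
  "eps_moment_deriv m k X = fps_X ^ k * Abs_fps (\<lambda>n. moment_deriv m (fps_nth X n))"

definition poly_operator ::
    "complex poly \<Rightarrow> (complex fps fps \<Rightarrow> complex fps fps) \<Rightarrow> complex fps fps \<Rightarrow> complex fps fps"
  where
  "poly_operator P T X = (\<Sum>j\<le>degree P. fps_const (fps_const (coeff P j)) * (T ^^ j) X)"

text \<open>Functions holomorphic near the origin are identified with their Taylor series in \<open>z\<close>.\<close>

definition formal_solution ::
    "complex poly \<Rightarrow> nat \<Rightarrow> (nat \<Rightarrow> real) \<Rightarrow> (complex \<Rightarrow> complex) \<Rightarrow>
     (nat \<Rightarrow> complex \<Rightarrow> complex) \<Rightarrow> bool" where
  "formal_solution P k m f x \<longleftrightarrow>
     poly_operator P (eps_moment_deriv m k) (Abs_fps (\<lambda>n. fps_expansion (x n) 0)) =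
       fps_const (fps_expansion f 0)"

end

theory Submission
  imports Defs "HOL-Computational_Algebra.Fundamental_Theorem_Algebra"
begin

text \<open>Comparing coefficients, the Borel transform of the solution has at \<open>\<epsilon> ^ (k * j) * z ^ n\<close> the
  coefficient \<open>b j * f (n + j) * m (n + j) / (m n * Gamma (1 + j / kt))\<close>, where \<open>f j\<close> are the Taylor
  coefficients of \<open>f\<close> and \<open>b j\<close> those of \<open>1 / P\<close>. So the claim is about the scalar power series in
  \<open>\<epsilon>\<close> for fixed \<open>n\<close>, with bounds that are geometric in \<open>n\<close>.

  The series with coefficients \<open>m (n + j) / Gamma (1 + j / kt)\<close> and \<open>Gamma (1 + j / kt) / m (j + l)\<close>
  continue with exponential growth to every direction except the positive axis, since the numerators
  are moments of kernels whose decay compensates the Mittag-Leffler function and the kernel \<open>E\<close>,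
  respectively. Hence Hadamard multiplication by them preserves continuability in a given direction,
  and the moments and Gamma values can be inserted or removed. (For \<open>kt \<le> 1/2\<close> one first passes to
  the variable \<open>t ^ p\<close>.)

  What remains is the factor \<open>b j\<close>. By partial fractions, \<open>b\<close> is a combination of sequences
  \<open>(s + j choose s) / a ^ j\<close> with \<open>P a = 0\<close>, which amounts to Euler operators and to a rotation by
  \<open>Arg a\<close>. Conversely, writing \<open>P = (1 - \<zeta> / a) * Q\<close>, a combination of shifted series with the
  coefficients of \<open>Q\<close> turns \<open>b j * f j\<close> into \<open>f j / a ^ j\<close>.\<close>

section \<open>Sectors and continuable coefficient families\<close>

text \<open>Each multiplier is singular on the positive axis alone, and singularities of a Hadamard
  product lie among products of singularities; so multiplication preserves every direction of
  continuation, and having a multiplier together with its inverse makes the argument an equivalence.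
  The values in a Banach space are the second obstacle: all coefficients in z must continue to one
  sector with one growth rate. A bound geometric in n is harmless, since a smaller radius in z sums
  it. The shifted kernel \<open>t ^ (p * n) * e t\<close>, however, costs a factor of size
  \<open>fact n powr (1 / kt)\<close>. Regularity of m gives a lower bound for \<open>m n\<close> of
  the same size, so that the division by \<open>m n\<close> pays for it. The converse needs no
  uniformity in n. To isolate a root, the coefficient of \<open>z ^ l\<close> is shifted by l in the
  other variable: both operations move the index of f, in opposite senses, so \<open>f j\<close>
  factors out and only \<open>b\<close> is convolved with the coefficients of
  \<open>Q\<close>.\<close>

definition wedge :: "real \<Rightarrow> real \<Rightarrow> complex set" where
  "wedge x y = {of_real \<rho> * cis \<phi> | \<rho> \<phi>. 0 < \<rho> \<and> x < \<phi> \<and> \<phi> < y}"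

text \<open>Overlaps and unions of sectors are decided by their end angles, hence the passage from
  centre and opening.\<close>

lemma sector_eq_wedge: "sector d \<alpha> = wedge (d - \<alpha> / 2) (d + \<alpha> / 2)"
proof -
  have "\<bar>\<phi> - d\<bar> < \<alpha> / 2 \<longleftrightarrow> d - \<alpha> / 2 < \<phi> \<and> \<phi> < d + \<alpha> / 2" for \<phi>
    by (simp only: abs_less_iff) (simp add: field_simps, argo)
  then show ?thesis unfolding sector_def wedge_def by simp
qed

text \<open>The logarithm turns a sector into a convex strip, and a truncated sector into a
  half-strip. Openness then comes from the open mapping theorem and connectedness from convexity,
  for every opening.\<close>

lemma wedge_eq_exp_image: "wedge x y = exp ` {\<zeta>. x < Im \<zeta> \<and> Im \<zeta> < y}"
proof (intro set_eqI iffI)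
  fix t assume "t \<in> wedge x y"
  then obtain \<rho> \<phi> where *: "t = of_real \<rho> * cis \<phi>" "0 < \<rho>" "x < \<phi>" "\<phi> < y"
    unfolding wedge_def by blast
  have "t = exp (Complex (ln \<rho>) \<phi>)"
    using * by (simp add: exp_eq_polar)
  then show "t \<in> exp ` {\<zeta>. x < Im \<zeta> \<and> Im \<zeta> < y}"
    using * by (intro image_eqI[of _ _ "Complex (ln \<rho>) \<phi>"]) auto
next
  fix t assume "t \<in> exp ` {\<zeta>. x < Im \<zeta> \<and> Im \<zeta> < y}"
  then obtain \<zeta> where "t = exp \<zeta>" "x < Im \<zeta>" "Im \<zeta> < y" by blast
  then show "t \<in> wedge x y"
    unfolding wedge_def using exp_eq_polar[of \<zeta>] by (intro CollectI exI[of _ "exp (Re \<zeta>)"] exI[of _ "Im \<zeta>"]) auto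
qed

lemma open_strip: "open {\<zeta>. x < Im \<zeta> \<and> Im \<zeta> < y}"
  by (intro open_Collect_conj open_Collect_less continuous_intros)

lemma exp_not_constant_on_strip:
  assumes "open S" "S \<noteq> {}" shows "\<not> (exp :: complex \<Rightarrow> complex) constant_on S"
proof
  assume "(exp :: complex \<Rightarrow> complex) constant_on S"
  then obtain c where c: "\<And>z. z \<in> S \<Longrightarrow> exp z = c" unfolding constant_on_def by blast
  obtain z where z: "z \<in> S" using assms by blast
  then obtain e where e: "e > 0" "ball z e \<subseteq> S" using assms open_contains_ball by blast
  have "z + of_real (e / 2) \<in> S" using e by (auto simp: dist_norm)
  then have "exp (z + of_real (e / 2)) = exp z" using c z by metis
  then have "exp (of_real (e / 2)) = (1::complex)" by (simp add: exp_add)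
  then have "exp (e / 2) = 1" by (metis exp_of_real of_real_eq_1_iff)
  then show False using e by simp
qed

lemma open_wedge: "open (wedge x y)"
proof (cases "{\<zeta>. x < Im \<zeta> \<and> Im \<zeta> < y} = {}")
  case False
  have "connected {\<zeta>. x < Im \<zeta> \<and> Im \<zeta> < y}"
    by (intro convex_connected) (simp add: Collect_conj_eq convex_Int convex_halfspace_Im_gt convex_halfspace_Im_lt)
  then show ?thesis
    unfolding wedge_eq_exp_image
    using open_mapping_thm[of exp "{\<zeta>. x < Im \<zeta> \<and> Im \<zeta> < y}" "{\<zeta>. x < Im \<zeta> \<and> Im \<zeta> < y}"] open_strip
      exp_not_constant_on_strip[OF open_strip False] by (auto intro!: holomorphic_intros)
next
  case True
  then show ?thesis unfolding wedge_eq_exp_image by (simp only: True image_empty open_empty)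
qed

lemma open_sector: "open (sector d \<alpha>)"
  by (simp add: sector_eq_wedge open_wedge)

lemma open_disc_sector: "open (disc_sector d \<alpha> r)"
  by (simp add: disc_sector_def open_sector open_Un)

lemma wedge_Int_ball:
  assumes "R > 0"
  shows "wedge x y \<inter> ball 0 R = exp ` {\<zeta>. x < Im \<zeta> \<and> Im \<zeta> < y \<and> Re \<zeta> < ln R}"
proof -
  have *: "exp \<zeta> \<in> ball 0 R \<longleftrightarrow> Re \<zeta> < ln R" for \<zeta> :: complex
    using assms by (simp add: norm_exp_eq_Re) (metis exp_less_cancel_iff exp_ln)
  show ?thesis
    unfolding wedge_eq_exp_image using * by blast
qed

lemma connected_wedge: "connected (wedge x y)"
  unfolding wedge_eq_exp_image
  by (intro connected_continuous_image continuous_intros convex_connected)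
     (simp add: Collect_conj_eq convex_Int convex_halfspace_Im_gt convex_halfspace_Im_lt)

lemma connected_wedge_Int_ball:
  assumes "R > 0" shows "connected (wedge x y \<inter> ball 0 R)"
  unfolding wedge_Int_ball[OF assms]
  by (intro connected_continuous_image continuous_intros convex_connected)
     (simp add: Collect_conj_eq convex_Int convex_halfspace_Im_gt convex_halfspace_Im_lt convex_halfspace_Re_lt)

lemma wedge_Int_ball_nonempty:
  assumes "x < y" "R > 0" shows "wedge x y \<inter> ball 0 R \<noteq> {}"
proof -
  have "Complex (ln R - 1) ((x + y) / 2) \<in> {\<zeta>. x < Im \<zeta> \<and> Im \<zeta> < y \<and> Re \<zeta> < ln R}"
    using assms by (auto simp: field_simps)
  then show ?thesis unfolding wedge_Int_ball[OF assms(2)] by blast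
qed

lemma wedge_mono: "x \<le> x' \<Longrightarrow> y' \<le> y \<Longrightarrow> wedge x' y' \<subseteq> wedge x y"
  unfolding wedge_def by fastforce

lemma disc_sector_mono: "\<alpha>' \<le> \<alpha> \<Longrightarrow> r' \<le> r \<Longrightarrow> disc_sector d \<alpha>' r' \<subseteq> disc_sector d \<alpha> r"
  using wedge_mono[of "d - \<alpha> / 2" "d - \<alpha>' / 2" "d + \<alpha>' / 2" "d + \<alpha> / 2"]
  unfolding disc_sector_def sector_eq_wedge by (intro Un_mono) auto

lemma exp_in_sector: "\<bar>Im \<zeta> - d\<bar> < \<alpha> / 2 \<Longrightarrow> exp \<zeta> \<in> sector d \<alpha>"
  unfolding sector_def
  by (intro CollectI exI[of _ "exp (Re \<zeta>)"] exI[of _ "Im \<zeta>"]) (auto simp: exp_eq_polar[of \<zeta>])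

lemma sectorI: "t = of_real \<rho> * cis \<phi> \<Longrightarrow> 0 < \<rho> \<Longrightarrow> \<bar>\<phi> - d\<bar> < \<alpha> / 2 \<Longrightarrow> t \<in> sector d \<alpha>"
  unfolding sector_def by blast

lemma sectorE:
  assumes "t \<in> sector d \<alpha>"
  obtains \<rho> \<phi> where "t = of_real \<rho> * cis \<phi>" "0 < \<rho>" "\<bar>\<phi> - d\<bar> < \<alpha> / 2" "norm t = \<rho>"
  using assms unfolding sector_def by (auto simp: norm_mult)

lemma zero_notin_sector: "0 \<notin> sector d \<alpha>"
  unfolding sector_def by auto

text \<open>Here the growth bound holds with fixed constants on the whole set, whereas
  \<open>exp_growth\<close> allows new ones on each smaller set. The constants are arguments so that
  a family of extensions can share them.\<close>

definition sector_extension ::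
    "real \<Rightarrow> real \<Rightarrow> real \<Rightarrow> real \<Rightarrow> real \<Rightarrow> real \<Rightarrow> (nat \<Rightarrow> complex) \<Rightarrow> (complex \<Rightarrow> complex) \<Rightarrow> bool"
  where
  "sector_extension K \<theta> \<alpha> r M a c g \<longleftrightarrow>
     g holomorphic_on disc_sector \<theta> \<alpha> r \<and>
     (\<forall>t\<in>disc_sector \<theta> \<alpha> r. norm (g t) \<le> M * exp (a * norm t powr K)) \<and>
     (\<forall>t\<in>ball 0 r. (\<lambda>j. c j * t ^ j) sums g t)"

lemma sector_extension_mono:
  assumes g: "sector_extension K \<theta> \<alpha> r M a c g"
    and "\<alpha>' \<le> \<alpha>" "r' \<le> r" "M \<le> M'" "a \<le> a'" "0 \<le> M'"
  shows "sector_extension K \<theta> \<alpha>' r' M' a' c g"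
  unfolding sector_extension_def
proof (intro conjI ballI)
  have sub: "disc_sector \<theta> \<alpha>' r' \<subseteq> disc_sector \<theta> \<alpha> r" using assms by (intro disc_sector_mono)
  show "g holomorphic_on disc_sector \<theta> \<alpha>' r'"
    using g sub holomorphic_on_subset unfolding sector_extension_def by blast
  fix t assume t: "t \<in> disc_sector \<theta> \<alpha>' r'"
  then have "norm (g t) \<le> M * exp (a * norm t powr K)"
    using g sub unfolding sector_extension_def by blast
  also have "\<dots> \<le> M' * exp (a' * norm t powr K)"
    using assms by (intro mult_mono) (auto intro!: mult_right_mono)
  finally show "norm (g t) \<le> M' * exp (a' * norm t powr K)" .
next
  fix t assume "t \<in> ball (0::complex) r'"
  then show "(\<lambda>j. c j * t ^ j) sums g t"
    using g \<open>r' \<le> r\<close> unfolding sector_extension_def by auto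
qed

text \<open>The factor \<open>A ^ n\<close> leaves room for the geometric losses that occur at every step, so that the
  weight \<open>B\<close> only has to record the factorial growth in \<open>n\<close>.\<close>

definition uniformly_continuable ::
    "real \<Rightarrow> real \<Rightarrow> (nat \<Rightarrow> real) \<Rightarrow> (nat \<Rightarrow> nat \<Rightarrow> complex) \<Rightarrow> bool" where
  "uniformly_continuable K \<theta> B c \<longleftrightarrow>
     (\<exists>\<alpha>>0. \<exists>r>0. \<exists>C\<ge>0. \<exists>A>0. \<exists>a\<ge>0. \<forall>n. \<exists>g.
        sector_extension K \<theta> \<alpha> r (C * A ^ n * B n) a (c n) g)"

lemma uniformly_continuableI:
  assumes "\<alpha> > 0" "r > 0" "C \<ge> 0" "A > 0" "a \<ge> 0"
    and "\<And>n. \<exists>g. sector_extension K \<theta> \<alpha> r (C * A ^ n * B n) a (c n) g"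
  shows "uniformly_continuable K \<theta> B c"
  using assms unfolding uniformly_continuable_def by blast

text \<open>Fixes one extension for each n by choice. The cap \<alpha>0 lets a caller ask for a
  small opening, since the sector may always be shrunk.\<close>

lemma uniformly_continuableE:
  assumes "uniformly_continuable K \<theta> B c" "\<And>n. 0 \<le> B n" "\<alpha>0 > 0"
  obtains \<alpha> r C A a g where "0 < \<alpha>" "\<alpha> \<le> \<alpha>0" "0 < r" "0 \<le> C" "0 < A" "0 \<le> a"
    "\<forall>n. sector_extension K \<theta> \<alpha> r (C * A ^ n * B n) a (c n) (g n)"
proof -
  obtain \<alpha> r C A a where *: "0 < \<alpha>" "0 < r" "0 \<le> C" "0 < A" "0 \<le> a"
    "\<forall>n. \<exists>g. sector_extension K \<theta> \<alpha> r (C * A ^ n * B n) a (c n) g"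
    using assms(1) unfolding uniformly_continuable_def by blast
  from choice[OF *(6)] obtain g
    where g: "\<And>n. sector_extension K \<theta> \<alpha> r (C * A ^ n * B n) a (c n) (g n)" by blast
  show thesis
  proof (rule that[of "min \<alpha> \<alpha>0" r C A a g])
    show "\<forall>n. sector_extension K \<theta> (min \<alpha> \<alpha>0) r (C * A ^ n * B n) a (c n) (g n)"
      by (intro allI, rule sector_extension_mono[OF g]) (use * assms in \<open>auto intro!: mult_nonneg_nonneg\<close>)
  qed (use * assms in auto)
qed

lemma uniformly_continuable_const:
  assumes "sector_extension K \<theta> \<alpha> r M a c g" "\<alpha> > 0" "r > 0"
  shows "uniformly_continuable K \<theta> (\<lambda>_. 1) (\<lambda>_. c)"
proof (rule uniformly_continuableI[of \<alpha> r "\<bar>M\<bar>" 1 "\<bar>a\<bar>"])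
  show "\<exists>g. sector_extension K \<theta> \<alpha> r (\<bar>M\<bar> * 1 ^ n * 1) \<bar>a\<bar> c g" for n
    by (rule exI[of _ g], simp, rule sector_extension_mono[OF assms(1)]) auto
qed (use assms in auto)

text \<open>Halving opening and radius turns the growth condition into a bound with fixed constants,
  and agreement near 0 identifies the Taylor coefficients. So the continuation of f becomes a
  property of its coefficient sequence, on which multipliers act.\<close>

lemma continues_with_growth_iff:
  assumes "f analytic_on {0}"
  shows "continues_with_growth K \<theta> f \<longleftrightarrow>
    uniformly_continuable K \<theta> (\<lambda>_. 1) (\<lambda>_. fps_nth (fps_expansion f 0))"
proof
  assume "continues_with_growth K \<theta> f"
  then obtain \<alpha> r g where g: "0 < \<alpha>" "0 < r" "g holomorphic_on disc_sector \<theta> \<alpha> r"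
    "\<forall>\<^sub>F z in nhds 0. g z = f z" "exp_growth K \<theta> \<alpha> r (\<lambda>t. norm (g t))"
    unfolding continues_with_growth_def by blast
  obtain C a where Ca: "\<forall>t\<in>disc_sector \<theta> (\<alpha>/2) (r/2). norm (g t) \<le> C * exp (a * norm t powr K)"
    using g(5)[unfolded exp_growth_def, rule_format, of "\<alpha>/2" "r/2"] g(1,2) by auto
  have "sector_extension K \<theta> (\<alpha>/2) (r/2) C a (fps_nth (fps_expansion f 0)) g"
    unfolding sector_extension_def
  proof (intro conjI ballI)
    show "g holomorphic_on disc_sector \<theta> (\<alpha>/2) (r/2)"
      by (rule holomorphic_on_subset[OF g(3)]) (rule disc_sector_mono; use g in simp)
    fix t assume t: "t \<in> ball (0::complex) (r/2)"
    then have "norm t < r / 2" by simp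
    then have tr: "norm t < r" using g(2) by linarith
    have "g holomorphic_on ball 0 r"
      using g(3) by (rule holomorphic_on_subset) (auto simp: disc_sector_def)
    then have "(\<lambda>n. (deriv ^^ n) g 0 / fact n * (t - 0) ^ n) sums g t"
      by (rule holomorphic_power_series) (use tr in simp)
    moreover have "(deriv ^^ n) g 0 = (deriv ^^ n) f 0" for n
      using g(4) by (intro higher_deriv_cong_ev) auto
    ultimately show "(\<lambda>j. fps_nth (fps_expansion f 0) j * t ^ j) sums g t"
      by (simp add: fps_expansion_def)
  qed (use Ca in auto)
  then show "uniformly_continuable K \<theta> (\<lambda>_. 1) (\<lambda>_. fps_nth (fps_expansion f 0))"
    by (rule uniformly_continuable_const) (use g in auto)
next
  assume *: "uniformly_continuable K \<theta> (\<lambda>_. 1) (\<lambda>_. fps_nth (fps_expansion f 0))"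
  obtain \<alpha> r C A a g where
    g: "0 < \<alpha>" "0 < r" "0 \<le> C" "0 < A" "0 \<le> a"
       "\<forall>n. sector_extension K \<theta> \<alpha> r (C * A ^ n * 1) a (fps_nth (fps_expansion f 0)) (g n)"
    by (rule uniformly_continuableE[OF *, of 1]) auto
  \<comment> \<open>The family is constant in n, so its member at 0 carries all the information and
    the factor \<open>A ^ n\<close> disappears.\<close>
  have g0: "sector_extension K \<theta> \<alpha> r C a (fps_nth (fps_expansion f 0)) (g 0)"
    using spec[OF g(6), of 0] by simp
  obtain e where e: "e > 0" "f holomorphic_on ball 0 e"
    using assms unfolding analytic_on_def by blast
  show "continues_with_growth K \<theta> f"
    unfolding continues_with_growth_def
  proof (rule exI[of _ \<alpha>], rule exI[of _ r], rule exI[of _ "g 0"], intro conjI)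
    show "\<forall>\<^sub>F z in nhds 0. g 0 z = f z"
    proof (rule eventually_nhds_in_open[of "ball 0 (min e r)", THEN eventually_mono])
      fix z :: complex assume z: "z \<in> ball 0 (min e r)"
      have "(\<lambda>n. (deriv ^^ n) f 0 / fact n * (z - 0) ^ n) sums f z"
        by (rule holomorphic_power_series[OF e(2)]) (use z in auto)
      moreover have "(\<lambda>j. fps_nth (fps_expansion f 0) j * z ^ j) sums g 0 z"
        using g0 z unfolding sector_extension_def by auto
      ultimately show "g 0 z = f z"
        by (simp add: fps_expansion_def sums_iff)
    qed (use e g in auto)
    have "disc_sector \<theta> \<alpha>' r' \<subseteq> disc_sector \<theta> \<alpha> r" if "\<alpha>' < \<alpha>" "r' < r" for \<alpha>' r'
      using that by (intro disc_sector_mono) auto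
    with g0 show "exp_growth K \<theta> \<alpha> r (\<lambda>t. norm (g 0 t))"
      unfolding sector_extension_def exp_growth_def by blast
  qed (use g g0 in \<open>auto simp: sector_extension_def\<close>)
qed

lemma power_div_fact_le_exp:
  assumes "0 \<le> (x::real)" shows "x ^ n / fact n \<le> exp x"
proof -
  have s: "(\<lambda>n. x ^ n / fact n) sums exp x"
    using exp_converges[of x] by (simp add: divide_inverse mult.commute scaleR_conv_of_real)
  have "(\<Sum>i\<in>{n}. x ^ i / fact i) \<le> (\<Sum>i. x ^ i / fact i)"
    by (rule sum_le_suminf) (use s assms in \<open>auto simp: sums_iff\<close>)
  then show ?thesis using s by (simp add: sums_iff)
qed

text \<open>Polynomial factors, which come from shifts and from lengths of contours, are absorbed
  into growth of order K by raising the type. Beyond 1, \<open>x ^ l\<close> is compared with a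
  single term of the exponential series in \<open>x powr K\<close>.\<close>

lemma power_le_exp_powr:
  fixes K :: real
  assumes "K > 0"
  obtains C where "C \<ge> 0" "\<And>x. 0 \<le> x \<Longrightarrow> x ^ l \<le> C * exp (x powr K)"
proof -
  obtain n :: nat where n: "real l / K \<le> real n" using real_arch_simple by blast
  show thesis
  proof (rule that[of "fact n"])
    fix x :: real assume x: "0 \<le> x"
    show "x ^ l \<le> fact n * exp (x powr K)"
    proof (cases "x \<le> 1")
      case True
      have "x ^ l \<le> 1" using x True by (rule power_le_one)
      also have "1 \<le> fact n * (1::real)" by simp
      also have "\<dots> \<le> fact n * exp (x powr K)" by (intro mult_left_mono) auto
      finally show ?thesis .
    next
      case False
      have "x ^ l = x powr real l" using False by (simp add: powr_realpow)
      also have "\<dots> \<le> x powr (K * real n)"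
        using False n assms by (intro powr_mono) (auto simp: field_simps)
      also have "\<dots> = (x powr K) ^ n" using False powr_realpow[of "x powr K" n] by (simp add: powr_powr)
      also have "\<dots> \<le> fact n * exp (x powr K)"
        using power_div_fact_le_exp[of "x powr K" n] by (simp add: field_simps)
      finally show ?thesis .
    qed
  qed auto
qed

section \<open>Operations that preserve uniform continuability\<close>

lemma uniformly_continuable_cmult:
  assumes "uniformly_continuable K \<theta> B c" "\<And>n. 0 \<le> B n"
  shows "uniformly_continuable K \<theta> B (\<lambda>n j. q * c n j)"
proof -
  obtain \<alpha> r C A a g where
    g: "0 < \<alpha>" "0 < r" "0 \<le> C" "0 < A" "0 \<le> a"
       "\<forall>n. sector_extension K \<theta> \<alpha> r (C * A ^ n * B n) a (c n) (g n)"
    by (rule uniformly_continuableE[OF assms, of 1]) auto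
  show ?thesis
  proof (rule uniformly_continuableI[of \<alpha> r "norm q * C" A a])
    fix n
    show "\<exists>g. sector_extension K \<theta> \<alpha> r (norm q * C * A ^ n * B n) a (\<lambda>j. q * c n j) g"
      using spec[OF g(6), of n] unfolding sector_extension_def
      by (intro exI[of _ "\<lambda>t. q * g n t"])
         (auto simp: norm_mult mult.assoc intro!: mult_left_mono holomorphic_intros sums_mult)
  qed (use g in auto)
qed

lemma uniformly_continuable_add:
  assumes c: "uniformly_continuable K \<theta> B c" and c': "uniformly_continuable K \<theta> B c'"
    and B: "\<And>n. 0 \<le> B n"
  shows "uniformly_continuable K \<theta> B (\<lambda>n j. c n j + c' n j)"
proof -
  obtain \<alpha> r C A a g where
    g: "0 < \<alpha>" "0 < r" "0 \<le> C" "0 < A" "0 \<le> a"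
       "\<forall>n. sector_extension K \<theta> \<alpha> r (C * A ^ n * B n) a (c n) (g n)"
    by (rule uniformly_continuableE[OF c B, of 1]) auto
  obtain \<alpha>' r' C' A' a' g' where
    g': "0 < \<alpha>'" "0 < r'" "0 \<le> C'" "0 < A'" "0 \<le> a'"
       "\<forall>n. sector_extension K \<theta> \<alpha>' r' (C' * A' ^ n * B n) a' (c' n) (g' n)"
    by (rule uniformly_continuableE[OF c' B, of 1]) auto
  define \<alpha>'' r'' A'' a'' where d: "\<alpha>'' = min \<alpha> \<alpha>'" "r'' = min r r'" "A'' = max A A'" "a'' = max a a'"
  show ?thesis
  proof (rule uniformly_continuableI[of \<alpha>'' r'' "C + C'" A'' a''])
    fix n
    have 1: "sector_extension K \<theta> \<alpha>'' r'' (C * A'' ^ n * B n) a'' (c n) (g n)"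
      by (rule sector_extension_mono[OF spec[OF g(6), of n]])
         (use g g' B in \<open>auto simp: d intro!: mult_mono power_mono mult_nonneg_nonneg\<close>)
    have 2: "sector_extension K \<theta> \<alpha>'' r'' (C' * A'' ^ n * B n) a'' (c' n) (g' n)"
      by (rule sector_extension_mono[OF spec[OF g'(6), of n]])
         (use g g' B in \<open>auto simp: d intro!: mult_mono power_mono mult_nonneg_nonneg\<close>)
    show "\<exists>g. sector_extension K \<theta> \<alpha>'' r'' ((C + C') * A'' ^ n * B n) a'' (\<lambda>j. c n j + c' n j) g"
      unfolding sector_extension_def
    proof (intro exI[of _ "\<lambda>t. g n t + g' n t"] conjI ballI)
      show "(\<lambda>t. g n t + g' n t) holomorphic_on disc_sector \<theta> \<alpha>'' r''"
        using 1 2 unfolding sector_extension_def by (auto intro!: holomorphic_intros)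
      fix t assume t: "t \<in> disc_sector \<theta> \<alpha>'' r''"
      have "norm (g n t + g' n t) \<le> norm (g n t) + norm (g' n t)" by (rule norm_triangle_ineq)
      also have "\<dots> \<le> C * A'' ^ n * B n * exp (a'' * norm t powr K) + C' * A'' ^ n * B n * exp (a'' * norm t powr K)"
        using 1 2 t unfolding sector_extension_def by (intro add_mono) auto
      finally show "norm (g n t + g' n t) \<le> (C + C') * A'' ^ n * B n * exp (a'' * norm t powr K)"
        by (simp add: algebra_simps)
    next
      fix t assume t: "t \<in> ball (0::complex) r''"
      show "(\<lambda>j. (c n j + c' n j) * t ^ j) sums (g n t + g' n t)"
        unfolding distrib_right
        using 1 2 t unfolding sector_extension_def by (intro sums_add) auto
    qed
  qed (use g g' in \<open>auto simp: d\<close>)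
qed

lemma uniformly_continuable_zero: "uniformly_continuable K \<theta> B (\<lambda>n j. 0)"
  by (rule uniformly_continuableI[of 1 1 0 1 0])
     (auto simp: sector_extension_def intro!: exI[of _ "\<lambda>_. 0"])

lemma uniformly_continuable_sum:
  assumes "finite I" "\<And>i. i \<in> I \<Longrightarrow> uniformly_continuable K \<theta> B (c i)" "\<And>n. 0 \<le> B n"
  shows "uniformly_continuable K \<theta> B (\<lambda>n j. \<Sum>i\<in>I. c i n j)"
  using assms
  by (induction I rule: finite_induct)
     (auto simp: uniformly_continuable_zero intro!: uniformly_continuable_add)

text \<open>Moves a factor depending on n alone from the coefficients into the weight. In this way
  the weight m left by the kernel bounds becomes 1.\<close>

lemma uniformly_continuable_reweight:
  assumes "uniformly_continuable K \<theta> B c" "\<And>n. 0 \<le> B n" "\<And>n. 0 < w n"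
  shows "uniformly_continuable K \<theta> (\<lambda>n. B n / w n) (\<lambda>n j. c n j / of_real (w n))"
proof -
  obtain \<alpha> r C A a g where
    g: "0 < \<alpha>" "0 < r" "0 \<le> C" "0 < A" "0 \<le> a"
       "\<forall>n. sector_extension K \<theta> \<alpha> r (C * A ^ n * B n) a (c n) (g n)"
    by (rule uniformly_continuableE[OF assms(1,2), of 1]) auto
  show ?thesis
  proof (rule uniformly_continuableI[of \<alpha> r C A a])
    fix n
    show "\<exists>g. sector_extension K \<theta> \<alpha> r (C * A ^ n * (B n / w n)) a (\<lambda>j. c n j / of_real (w n)) g"
      using spec[OF g(6), of n] assms(3)[of n] unfolding sector_extension_def
      by (intro exI[of _ "\<lambda>t. g n t / of_real (w n)"])
         (auto simp: norm_divide intro!: divide_right_mono holomorphic_intros sums_divide)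
  qed (use g in auto)
qed

text \<open>By scaling and rotation the claim concerns the point 1, where it is continuity of
  \<open>Arg\<close>. The disc grows in proportion to \<open>norm t\<close>, so a Cauchy estimate on
  it bounds \<open>t * deriv g t\<close> without an extra power of t.\<close>

lemma sector_ball:
  assumes "\<alpha> > 0"
  obtains \<kappa> where "0 < \<kappa>" "\<kappa> < 1" "\<And>\<theta> t s. t \<in> sector \<theta> (\<alpha> / 2) \<Longrightarrow> norm (s - t) \<le> \<kappa> * norm t \<Longrightarrow> s \<in> sector \<theta> \<alpha>"
proof -
  have "isCont Arg 1" by (rule continuous_at_Arg) auto
  then obtain e where e: "e > 0" "\<And>x. norm (x - 1) < e \<Longrightarrow> \<bar>Arg x\<bar> < \<alpha> / 4"
    using assms unfolding continuous_at_eps_delta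
    by (metis Arg_1 diff_zero dist_norm dist_real_def divide_pos_pos zero_less_numeral)
  define \<kappa> where "\<kappa> = min (e / 2) (1 / 2)"
  show thesis
  proof (rule that[of \<kappa>])
    fix \<theta> t s assume t: "t \<in> sector \<theta> (\<alpha> / 2)" and s: "norm (s - t) \<le> \<kappa> * norm t"
    obtain \<rho> \<phi> where *: "t = of_real \<rho> * cis \<phi>" "0 < \<rho>" "\<bar>\<phi> - \<theta>\<bar> < \<alpha> / 2 / 2" "norm t = \<rho>"
      using t by (rule sectorE)
    have t0: "t \<noteq> 0" using * by auto
    have "norm (s / t - 1) = norm (s - t) / norm t" using t0 by (simp add: divide_simps norm_divide)
    also have "\<dots> \<le> \<kappa>" using s t0 by (simp add: field_simps)
    finally have "norm (s / t - 1) \<le> \<kappa>" .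
    then have A: "\<bar>Arg (s / t)\<bar> < \<alpha> / 4" and "norm (s / t - 1) < 1"
      using e by (auto simp: \<kappa>_def)
    then have "s / t \<noteq> 0" by auto
    have "s = t * (s / t)" using t0 by simp
    also have "\<dots> = of_real \<rho> * cis \<phi> * (of_real (norm (s / t)) * cis (Arg (s / t)))"
      using *(1) \<open>s / t \<noteq> 0\<close> by (metis mult.commute cis_Arg complex_norm_eq_1_exp rcis_cmod_Arg rcis_def)
    also have "\<dots> = of_real (\<rho> * norm (s / t)) * cis (\<phi> + Arg (s / t))"
      by (simp add: cis_mult [symmetric])
    finally have "s = of_real (\<rho> * norm (s / t)) * cis (\<phi> + Arg (s / t))" .
    moreover have "0 < \<rho> * norm (s / t)" using * \<open>s / t \<noteq> 0\<close> by simp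
    moreover have "\<bar>\<phi> + Arg (s / t) - \<theta>\<bar> < \<alpha> / 2" using A *(3) by argo
    ultimately show "s \<in> sector \<theta> \<alpha>" by (rule sectorI)
  qed (use e in \<open>auto simp: \<kappa>_def\<close>)
qed

lemma norm_deriv_le:
  assumes "g holomorphic_on S" "open S" "cball t \<rho> \<subseteq> S" "\<rho> > 0" "\<And>s. s \<in> cball t \<rho> \<Longrightarrow> norm (g s) \<le> M"
  shows "norm (deriv g t) \<le> M / \<rho>"
proof -
  have "norm ((deriv ^^ 1) g t) \<le> fact 1 * M / \<rho> ^ 1"
  proof (rule Cauchy_inequality)
    show "g holomorphic_on ball t \<rho>"
      using assms(1,3) ball_subset_cball holomorphic_on_subset by blast
    show "continuous_on (cball t \<rho>) g"
      using assms(1,3) holomorphic_on_imp_continuous_on continuous_on_subset by blast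
  qed (use assms in \<open>auto simp: dist_norm norm_minus_commute\<close>)
  then show ?thesis by simp
qed

text \<open>Multiplication of the coefficients by \<open>j\<close> is the Euler operator \<open>t d/dt\<close>.\<close>

lemma uniformly_continuable_times_index:
  assumes K: "K > 0" and c: "uniformly_continuable K \<theta> B c" and B: "\<And>n. 0 \<le> B n"
  shows "uniformly_continuable K \<theta> B (\<lambda>n j. of_nat j * c n j)"
proof -
  obtain \<alpha> r C A a g where
    g: "0 < \<alpha>" "0 < r" "0 \<le> C" "0 < A" "0 \<le> a"
       "\<forall>n. sector_extension K \<theta> \<alpha> r (C * A ^ n * B n) a (c n) (g n)"
    by (rule uniformly_continuableE[OF c B, of 1]) auto
  obtain \<kappa> where \<kappa>: "0 < \<kappa>" "\<kappa> < 1" 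
    "\<And>\<theta> t s. t \<in> sector \<theta> (\<alpha> / 2) \<Longrightarrow> norm (s - t) \<le> \<kappa> * norm t \<Longrightarrow> s \<in> sector \<theta> \<alpha>"
    using sector_ball[OF g(1)] by blast
  \<comment> \<open>The summand \<open>1 / \<kappa>\<close> is the Cauchy constant for discs of
    radius \<open>\<kappa> * norm t\<close> in the sector, the summand 1 that for discs of radius
    \<open>r / 2\<close> about points of the inner disc. The factor
    \<open>exp (a * r powr K)\<close> covers points near 0 whose norm is not bounded by
    \<open>2 * norm t\<close>.\<close>
  define C' where "C' = (1 / \<kappa> + 1) * exp (a * r powr K) * C"
  have C': "C' \<ge> 0" using g \<kappa> by (simp add: C'_def)
  show ?thesis
  proof (rule uniformly_continuableI[of "\<alpha> / 2" "r / 2" C' A "a * 2 powr K"])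
    fix n
    define M where "M = C * A ^ n * B n"
    have M: "M \<ge> 0" using g B by (simp add: M_def)
    have hol: "g n holomorphic_on disc_sector \<theta> \<alpha> r"
      and bd: "\<And>t. t \<in> disc_sector \<theta> \<alpha> r \<Longrightarrow> norm (g n t) \<le> M * exp (a * norm t powr K)"
      and sm: "\<And>t. t \<in> ball 0 r \<Longrightarrow> (\<lambda>j. c n j * t ^ j) sums g n t"
      using spec[OF g(6), of n] unfolding sector_extension_def M_def by auto
    have sub: "disc_sector \<theta> (\<alpha> / 2) (r / 2) \<subseteq> disc_sector \<theta> \<alpha> r"
      by (rule disc_sector_mono) (use g in simp_all)
    show "\<exists>g. sector_extension K \<theta> (\<alpha> / 2) (r / 2) (C' * A ^ n * B n) (a * 2 powr K) (\<lambda>j. of_nat j * c n j) g"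
      unfolding sector_extension_def
    proof (intro exI[of _ "\<lambda>t. t * deriv (g n) t"] conjI ballI)
      show "(\<lambda>t. t * deriv (g n) t) holomorphic_on disc_sector \<theta> (\<alpha> / 2) (r / 2)"
        by (intro holomorphic_intros holomorphic_on_subset[OF holomorphic_deriv[OF hol open_disc_sector] sub])
      fix t assume t: "t \<in> disc_sector \<theta> (\<alpha> / 2) (r / 2)"
      have ineq: "exp (a * x powr K) \<le> exp (a * r powr K) * exp (a * 2 powr K * norm t powr K)"
        if "0 \<le> x" "x \<le> 2 * norm t \<or> x \<le> r" for x
      proof -
        have "x powr K \<le> r powr K + (2 * norm t) powr K"
          using that powr_mono2[of K x r] powr_mono2[of K x "2 * norm t"] K
            powr_ge_zero[of r K] powr_ge_zero[of "2 * norm t" K] by linarith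
        then have "a * x powr K \<le> a * r powr K + a * 2 powr K * norm t powr K"
          using mult_left_mono[OF _ g(5)] by (fastforce simp: powr_mult algebra_simps)
        then show ?thesis by (simp flip: exp_add)
      qed
      have "norm (t * deriv (g n) t) \<le> (1 / \<kappa> + 1) * (M * (exp (a * r powr K) * exp (a * 2 powr K * norm t powr K)))"
      proof (cases "t \<in> ball 0 (r / 2)")
        case True
        have "norm (deriv (g n) t) \<le> (M * (exp (a * r powr K) * exp (a * 2 powr K * norm t powr K))) / (r / 2)"
        proof (rule norm_deriv_le[OF hol open_disc_sector])
          fix s assume s: "s \<in> cball t (r / 2)"
          have "norm s \<le> norm t + norm (s - t)" by (metis add.commute diff_add_cancel norm_triangle_ineq)
          also have "\<dots> < r" using s True by (simp add: dist_norm norm_minus_commute)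
          finally have "norm s < r" .
          then show "norm (g n s) \<le> M * (exp (a * r powr K) * exp (a * 2 powr K * norm t powr K))"
            using bd[of s] ineq[of "norm s"] M by (auto simp: disc_sector_def intro: order_trans mult_left_mono)
        next
          show "cball t (r / 2) \<subseteq> disc_sector \<theta> \<alpha> r"
          proof
            fix s assume s: "s \<in> cball t (r / 2)"
            have "norm s \<le> norm t + norm (s - t)" by (metis add.commute diff_add_cancel norm_triangle_ineq)
            also have "\<dots> < r" using s True by (simp add: dist_norm norm_minus_commute)
            finally show "s \<in> disc_sector \<theta> \<alpha> r" by (simp add: disc_sector_def)
          qed
        qed (use g in auto)
        then have "norm t * norm (deriv (g n) t) \<le> (r / 2) * ((M * (exp (a * r powr K) * exp (a * 2 powr K * norm t powr K))) / (r / 2))"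
          using True g by (intro mult_mono) auto
        also have "\<dots> \<le> (1 / \<kappa> + 1) * (M * (exp (a * r powr K) * exp (a * 2 powr K * norm t powr K)))"
          using g \<kappa> M by (simp add: field_simps)
        finally show ?thesis by (simp add: norm_mult)
      next
        case False
        then have ts: "t \<in> sector \<theta> (\<alpha> / 2)" using t by (auto simp: disc_sector_def)
        then have t0: "norm t > 0" using zero_notin_sector by auto
        have "norm (deriv (g n) t) \<le> (M * (exp (a * r powr K) * exp (a * 2 powr K * norm t powr K))) / (\<kappa> * norm t)"
        proof (rule norm_deriv_le[OF hol open_disc_sector])
          show sub: "cball t (\<kappa> * norm t) \<subseteq> disc_sector \<theta> \<alpha> r"
            using \<kappa>(3)[OF ts] by (auto simp: disc_sector_def dist_norm norm_minus_commute)
          fix s assume s: "s \<in> cball t (\<kappa> * norm t)"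
          have "norm s \<le> norm t + norm (s - t)" by (metis add.commute diff_add_cancel norm_triangle_ineq)
          also have "\<dots> \<le> norm t + \<kappa> * norm t" using s by (simp add: dist_norm norm_minus_commute)
          also have "\<dots> \<le> 2 * norm t" using \<kappa> by (simp add: mult_left_le_one_le)
          finally have "norm s \<le> 2 * norm t" .
          then show "norm (g n s) \<le> M * (exp (a * r powr K) * exp (a * 2 powr K * norm t powr K))"
            using order_trans[OF bd[of s] mult_left_mono[OF ineq[of "norm s"] M]] sub s by auto
        qed (use t0 \<kappa> in auto)
        then have "norm t * norm (deriv (g n) t) \<le> norm t * ((M * (exp (a * r powr K) * exp (a * 2 powr K * norm t powr K))) / (\<kappa> * norm t))"
          by (intro mult_left_mono) auto
        also have "\<dots> \<le> (1 / \<kappa> + 1) * (M * (exp (a * r powr K) * exp (a * 2 powr K * norm t powr K)))"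
          using t0 \<kappa> M by (simp add: field_simps)
        finally show ?thesis by (simp add: norm_mult)
      qed
      then show "norm (t * deriv (g n) t) \<le> C' * A ^ n * B n * exp (a * 2 powr K * norm t powr K)"
        by (simp add: C'_def M_def mult_ac)
    next
      fix t assume t: "t \<in> ball (0::complex) (r / 2)"
      then have "norm t < r / 2" by simp
      then have tr: "norm t < r" using g by linarith
      have "(\<lambda>j. diffs (c n) j * t ^ j) sums deriv (g n) t"
      proof (rule termdiffs_sums_strong[of r "c n" "g n"])
        show "(g n has_field_derivative deriv (g n) t) (at t)"
          by (rule holomorphic_derivI[OF hol open_disc_sector]) (use tr in \<open>simp add: disc_sector_def\<close>)
      qed (use sm tr in auto)
      from sums_mult[OF this, of t]
      have "(\<lambda>j. of_nat (Suc j) * c n (Suc j) * t ^ Suc j) sums (t * deriv (g n) t)"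
        by (simp add: diffs_def mult_ac)
      then show "(\<lambda>j. of_nat j * c n j * t ^ j) sums (t * deriv (g n) t)"
        using sums_Suc_iff[of "\<lambda>j. of_nat j * c n j * t ^ j"] by simp
    qed
  qed (use g C' in auto)
qed

text \<open>Multiplication by \<open>t ^ l\<close>, whose size is absorbed by raising the type by
  1.\<close>

lemma uniformly_continuable_shift:
  assumes K: "K > 0" and c: "uniformly_continuable K \<theta> B c" and B: "\<And>n. 0 \<le> B n"
  shows "uniformly_continuable K \<theta> B (\<lambda>n j. if l \<le> j then c n (j - l) else 0)"
proof -
  obtain \<alpha> r C A a g where
    g: "0 < \<alpha>" "0 < r" "0 \<le> C" "0 < A" "0 \<le> a"
       "\<forall>n. sector_extension K \<theta> \<alpha> r (C * A ^ n * B n) a (c n) (g n)"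
    by (rule uniformly_continuableE[OF c B, of 1]) auto
  obtain D where D: "D \<ge> 0" "\<And>x. 0 \<le> x \<Longrightarrow> x ^ l \<le> D * exp (x powr K)"
    using power_le_exp_powr[OF K] by blast
  show ?thesis
  proof (rule uniformly_continuableI[of \<alpha> r "D * C" A "a + 1"])
    fix n
    have ext: "sector_extension K \<theta> \<alpha> r (C * A ^ n * B n) a (c n) (g n)" using g by blast
    show "\<exists>g. sector_extension K \<theta> \<alpha> r (D * C * A ^ n * B n) (a + 1)
            (\<lambda>j. if l \<le> j then c n (j - l) else 0) g"
      unfolding sector_extension_def
    proof (intro exI[of _ "\<lambda>t. t ^ l * g n t"] conjI ballI)
      show "(\<lambda>t. t ^ l * g n t) holomorphic_on disc_sector \<theta> \<alpha> r"
        using ext unfolding sector_extension_def by (auto intro!: holomorphic_intros)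
      fix t assume t: "t \<in> disc_sector \<theta> \<alpha> r"
      have "norm (t ^ l * g n t) = norm t ^ l * norm (g n t)" by (simp add: norm_mult norm_power)
      also have "\<dots> \<le> (D * exp (norm t powr K)) * (C * A ^ n * B n * exp (a * norm t powr K))"
        using D ext t unfolding sector_extension_def by (intro mult_mono) auto
      finally show "norm (t ^ l * g n t) \<le> D * C * A ^ n * B n * exp ((a + 1) * norm t powr K)"
        by (simp add: algebra_simps exp_add)
    next
      fix t assume t: "t \<in> ball (0::complex) r"
      have "(\<lambda>j. t ^ l * (c n j * t ^ j)) sums (t ^ l * g n t)"
        using ext t unfolding sector_extension_def by (intro sums_mult) auto
      then have "(\<lambda>j. (if l \<le> j + l then c n (j + l - l) else 0) * t ^ (j + l)) sums (t ^ l * g n t)"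
        by (simp add: power_add mult_ac)
      then show "(\<lambda>j. (if l \<le> j then c n (j - l) else 0) * t ^ j) sums (t ^ l * g n t)"
        by (subst (asm) sums_zero_iff_shift) auto
    qed
  qed (use g D in auto)
qed

lemma power_powr:
  assumes "0 \<le> (x::real)" "k \<ge> 1" shows "(x ^ k) powr K = x powr (real k * K)"
  using assms by (cases "x = 0") (auto simp: powr_powr powr_realpow [symmetric])

text \<open>This is the substitution of \<open>q * t ^ k\<close> with
  \<open>q = of_real \<rho>0 * cis \<eta>\<close>: it maps the direction d to \<theta>, multiplies
  the order by k and moves the coefficients to the multiples of k. For \<open>k = 1\<close> it is a
  rotation with a scaling.\<close>

lemma uniformly_continuable_power:
  assumes K: "K > 0" and k: "k \<ge> 1" and \<rho>0: "\<rho>0 > 0" and \<theta>: "\<theta> = real k * d + \<eta>"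
    and c: "uniformly_continuable K \<theta> B c" and B: "\<And>n. 0 \<le> B n"
  shows "uniformly_continuable (real k * K) d B
    (\<lambda>n i. if k dvd i then c n (i div k) * (of_real \<rho>0 * cis \<eta>) ^ (i div k) else 0)"
proof -
  obtain \<alpha> r C A a g where
    g: "0 < \<alpha>" "0 < r" "0 \<le> C" "0 < A" "0 \<le> a"
       "\<forall>n. sector_extension K \<theta> \<alpha> r (C * A ^ n * B n) a (c n) (g n)"
    by (rule uniformly_continuableE[OF c B, of 1]) auto
  define q where "q = of_real \<rho>0 * cis \<eta>"
  define r' where "r' = root k (r / \<rho>0)"
  have nq: "norm q = \<rho>0" using \<rho>0 by (simp add: q_def norm_mult)
  have r': "r' > 0" "\<rho>0 * r' ^ k = r" using k \<rho>0 g by (auto simp: r'_def)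
  have ball: "q * t ^ k \<in> ball 0 r" if "t \<in> ball 0 r'" for t
  proof -
    have "norm t ^ k < r' ^ k" using that k by (intro power_strict_mono) auto
    then have "\<rho>0 * norm t ^ k < \<rho>0 * r' ^ k" using \<rho>0 by simp
    then show ?thesis using r' by (simp add: norm_mult norm_power nq)
  qed
  have into: "q * t ^ k \<in> disc_sector \<theta> \<alpha> r" if t: "t \<in> disc_sector d (\<alpha> / real k) r'" for t
  proof (cases "t \<in> ball 0 r'")
    case True
    then show ?thesis using ball[of t] by (simp add: disc_sector_def)
  next
    case False
    then have "t \<in> sector d (\<alpha> / real k)" using t by (auto simp: disc_sector_def)
    then obtain \<rho> \<phi> where *: "t = of_real \<rho> * cis \<phi>" "0 < \<rho>" "\<bar>\<phi> - d\<bar> < \<alpha> / real k / 2"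
      by (rule sectorE)
    have "q * t ^ k = of_real (\<rho>0 * \<rho> ^ k) * cis (\<eta> + real k * \<phi>)"
      by (simp add: q_def * power_mult_distrib Complex.DeMoivre cis_mult [symmetric])
    moreover have "0 < \<rho>0 * \<rho> ^ k" using \<rho>0 * by simp
    moreover have "\<bar>\<eta> + real k * \<phi> - \<theta>\<bar> < \<alpha> / 2"
    proof -
      have "\<eta> + real k * \<phi> - \<theta> = real k * (\<phi> - d)" by (simp add: \<theta> algebra_simps)
      then have "\<bar>\<eta> + real k * \<phi> - \<theta>\<bar> = real k * \<bar>\<phi> - d\<bar>" by (simp add: abs_mult)
      then show ?thesis using *(3) k by (simp add: field_simps)
    qed
    ultimately have "q * t ^ k \<in> sector \<theta> \<alpha>" by (rule sectorI)
    then show ?thesis by (simp add: disc_sector_def)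
  qed
  show ?thesis
  proof (rule uniformly_continuableI[of "\<alpha> / real k" r' C A "a * \<rho>0 powr K"])
    fix n
    have ext: "sector_extension K \<theta> \<alpha> r (C * A ^ n * B n) a (c n) (g n)" using g by blast
    show "\<exists>g. sector_extension (real k * K) d (\<alpha> / real k) r' (C * A ^ n * B n) (a * \<rho>0 powr K)
       (\<lambda>i. if k dvd i then c n (i div k) * (of_real \<rho>0 * cis \<eta>) ^ (i div k) else 0) g"
      unfolding sector_extension_def
    proof (intro exI[of _ "\<lambda>t. g n (q * t ^ k)"] conjI ballI)
      have "(g n \<circ> (\<lambda>t. q * t ^ k)) holomorphic_on disc_sector d (\<alpha> / real k) r'"
        using ext into unfolding sector_extension_def
        by (intro holomorphic_on_compose_gen[where t = "disc_sector \<theta> \<alpha> r"])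
           (auto intro!: holomorphic_intros)
      then show "(\<lambda>t. g n (q * t ^ k)) holomorphic_on disc_sector d (\<alpha> / real k) r'"
        by (simp add: o_def)
      fix t assume t: "t \<in> disc_sector d (\<alpha> / real k) r'"
      have "norm (q * t ^ k) powr K = \<rho>0 powr K * norm t powr (real k * K)"
        using k \<rho>0 by (simp add: norm_mult norm_power nq powr_mult power_powr)
      then show "norm (g n (q * t ^ k)) \<le> C * A ^ n * B n * exp (a * \<rho>0 powr K * norm t powr (real k * K))"
        using ext into[OF t] unfolding sector_extension_def by (auto simp: mult.assoc)
    next
      fix t assume t: "t \<in> ball (0::complex) r'"
      have "(\<lambda>j. c n j * (q * t ^ k) ^ j) sums g n (q * t ^ k)"
        using ext ball[OF t] unfolding sector_extension_def by blast
      then have "(\<lambda>j. (if k dvd k * j then c n (k * j div k) * q ^ (k * j div k) else 0) * t ^ (k * j)) sums g n (q * t ^ k)"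
        using k by (simp add: power_mult power_mult_distrib mult.assoc)
      then show "(\<lambda>i. (if k dvd i then c n (i div k) * (of_real \<rho>0 * cis \<eta>) ^ (i div k) else 0) * t ^ i) sums g n (q * t ^ k)"
        unfolding q_def [symmetric]
        by (subst (asm) sums_mono_reindex[of "\<lambda>j. k * j"]) (use k in \<open>auto simp: strict_mono_def\<close>)
    qed
  qed (use g r' k \<rho>0 in auto)
qed

text \<open>The inverse substitution. In the disc no branch of the root is at stake, because only
  exponents divisible by p occur; in the sector a branch is fixed.\<close>

lemma uniformly_continuable_root:
  assumes K: "K > 0" and p: "p \<ge> 1" and c: "uniformly_continuable (real p * K) \<theta> B c"
    and c0: "\<And>n i. \<not> p dvd i \<Longrightarrow> c n i = 0" and B: "\<And>n. 0 \<le> B n"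
  shows "uniformly_continuable K (real p * \<theta>) B (\<lambda>n j. c n (p * j))"
proof -
  \<comment> \<open>The cap makes the opening \<open>real p * \<alpha>\<close> of the image at most
    a full turn, so the branch cut stays outside it.\<close>
  obtain \<alpha> r C A a g where
    g: "0 < \<alpha>" "\<alpha> \<le> 2 * pi / real p" "0 < r" "0 \<le> C" "0 < A" "0 \<le> a"
       "\<forall>n. sector_extension (real p * K) \<theta> \<alpha> r (C * A ^ n * B n) a (c n) (g n)"
    by (rule uniformly_continuableE[OF c B, of "2 * pi / real p"]) (use p in auto)
  \<comment> \<open>Rotating by \<open>- (real p * \<theta>)\<close> first puts the cut of the
    principal root opposite to the sector.\<close>
  define rt :: "complex \<Rightarrow> complex" where
    "rt = (\<lambda>\<tau>. cis \<theta> * ((\<tau> * cis (- (real p * \<theta>))) powr (1 / of_nat p)))"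
  have norm_rt: "norm (rt \<tau>) = norm \<tau> powr (1 / real p)" for \<tau>
    by (simp add: rt_def norm_mult norm_powr_real_powr')
  have rt_power: "rt \<tau> ^ p = \<tau>" for \<tau>
  proof (cases "\<tau> = 0")
    case False
    have "((\<tau> * cis (- (real p * \<theta>))) powr (1 / of_nat p)) ^ p = \<tau> * cis (- (real p * \<theta>))"
      using False p exp_of_nat_mult[of p "1 / of_nat p * Ln (\<tau> * cis (- (real p * \<theta>)))"]
      by (simp add: powr_def)
    then show ?thesis using p
      by (simp add: rt_def power_mult_distrib Complex.DeMoivre cis_mult mult.left_commute)
  qed (use p in \<open>simp add: rt_def\<close>)
  have sec: "rt \<tau> \<in> sector \<theta> \<alpha> \<and> \<tau> * cis (- (real p * \<theta>)) \<notin> \<real>\<^sub>\<le>\<^sub>0"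
    if t: "\<tau> \<in> sector (real p * \<theta>) (real p * \<alpha>)" for \<tau>
  proof -
    obtain \<rho> \<phi> where *: "\<tau> = of_real \<rho> * cis \<phi>" "0 < \<rho>" "\<bar>\<phi> - real p * \<theta>\<bar> < real p * \<alpha> / 2"
      using t by (rule sectorE)
    define \<zeta> where "\<zeta> = Complex (ln \<rho>) (\<phi> - real p * \<theta>)"
    have "real p * \<alpha> / 2 \<le> pi" using g(2) p by (simp add: field_simps)
    then have "\<bar>\<phi> - real p * \<theta>\<bar> < pi" using *(3) by linarith
    then have im: "- pi < Im \<zeta>" "Im \<zeta> < pi" by (auto simp: \<zeta>_def abs_less_iff)
    have e: "\<tau> * cis (- (real p * \<theta>)) = exp \<zeta>"
      using * by (simp add: \<zeta>_def exp_eq_polar cis_mult)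
    have Ln: "Ln (exp \<zeta>) = \<zeta>" using im by (intro Ln_exp) auto
    have "rt \<tau> = cis \<theta> * exp (\<zeta> / of_nat p)"
      unfolding rt_def e powr_def Ln by simp
    then have "rt \<tau> = exp (\<i> * of_real \<theta> + \<zeta> / of_nat p)"
      by (simp add: exp_add cis_conv_exp)
    moreover have "\<bar>Im (\<i> * of_real \<theta> + \<zeta> / of_nat p) - \<theta>\<bar> < \<alpha> / 2"
    proof -
      have "Im (\<i> * of_real \<theta> + \<zeta> / of_nat p) - \<theta> = (\<phi> - real p * \<theta>) / real p"
        by (simp add: \<zeta>_def Im_divide_of_nat)
      then show ?thesis using *(3) p by (simp add: field_simps)
    qed
    ultimately have "rt \<tau> \<in> sector \<theta> \<alpha>" using exp_in_sector by metis
    moreover have "exp \<zeta> \<notin> \<real>\<^sub>\<le>\<^sub>0"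
    proof
      assume "exp \<zeta> \<in> \<real>\<^sub>\<le>\<^sub>0"
      then have "Re (exp \<zeta>) \<le> 0" "Im (exp \<zeta>) = 0" by (auto simp: complex_nonpos_Reals_iff)
      moreover from this have "Re (exp \<zeta>) \<noteq> 0" using exp_not_eq_zero[of \<zeta>] by (metis complex_eqI zero_complex.sel)
      ultimately show False using Im_Ln_eq_pi[of "exp \<zeta>"] Ln im by auto
    qed
    ultimately show ?thesis using e by simp
  qed
  have ball: "rt \<tau> \<in> ball 0 r" if "\<tau> \<in> ball 0 (r ^ p)" for \<tau>
  proof -
    have "norm \<tau> powr (1 / real p) < (r ^ p) powr (1 / real p)"
      using that p by (intro powr_less_mono2) auto
    also have "\<dots> = r" using p g by (simp add: power_powr)
    finally show ?thesis by (simp add: norm_rt)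
  qed
  show ?thesis
  proof (rule uniformly_continuableI[of "real p * \<alpha>" "r ^ p" C A a])
    fix n
    have ext: "sector_extension (real p * K) \<theta> \<alpha> r (C * A ^ n * B n) a (c n) (g n)" using g by blast
    have sm: "(\<lambda>j. c n (p * j) * \<tau> ^ j) sums g n (rt \<tau>)" if "\<tau> \<in> ball 0 (r ^ p)" for \<tau>
    proof -
      have "(\<lambda>i. c n i * rt \<tau> ^ i) sums g n (rt \<tau>)"
        using ext ball[OF that] unfolding sector_extension_def by blast
      moreover have "c n i * rt \<tau> ^ i = 0" if "i \<notin> range ((*) p)" for i
        using c0[of i n] that by (auto simp: dvd_def)
      ultimately have "(\<lambda>j. c n (p * j) * rt \<tau> ^ (p * j)) sums g n (rt \<tau>)"
        by (subst sums_mono_reindex[of "\<lambda>j. p * j" "\<lambda>i. c n i * rt \<tau> ^ i"])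
           (use p in \<open>auto simp: strict_mono_def\<close>)
      then show ?thesis by (simp add: power_mult rt_power)
    qed
    show "\<exists>g. sector_extension K (real p * \<theta>) (real p * \<alpha>) (r ^ p) (C * A ^ n * B n) a (\<lambda>j. c n (p * j)) g"
      unfolding sector_extension_def
    proof (intro exI[of _ "\<lambda>\<tau>. g n (rt \<tau>)"] conjI ballI)
      \<comment> \<open>Although \<open>rt\<close> jumps across its cut, the composition is a power
        series in \<tau>.\<close>
      have "(\<lambda>\<tau>. g n (rt \<tau>)) holomorphic_on ball 0 (r ^ p)"
        by (rule power_series_holomorphic[where a = "\<lambda>j. c n (p * j)"]) (use sm in simp)
      moreover have "(g n \<circ> rt) holomorphic_on sector (real p * \<theta>) (real p * \<alpha>)"
      proof (rule holomorphic_on_compose_gen)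
        show "rt holomorphic_on sector (real p * \<theta>) (real p * \<alpha>)"
          unfolding rt_def using sec by (auto intro!: holomorphic_intros)
        show "g n holomorphic_on disc_sector \<theta> \<alpha> r" using ext by (simp add: sector_extension_def)
      qed (use sec in \<open>auto simp: disc_sector_def\<close>)
      ultimately show "(\<lambda>\<tau>. g n (rt \<tau>)) holomorphic_on disc_sector (real p * \<theta>) (real p * \<alpha>) (r ^ p)"
        unfolding disc_sector_def by (intro holomorphic_on_Un open_sector open_ball) (simp_all add: o_def)
      fix \<tau> assume t: "\<tau> \<in> disc_sector (real p * \<theta>) (real p * \<alpha>) (r ^ p)"
      then have "rt \<tau> \<in> disc_sector \<theta> \<alpha> r" using sec ball by (auto simp: disc_sector_def)
      then have "norm (g n (rt \<tau>)) \<le> C * A ^ n * B n * exp (a * norm (rt \<tau>) powr (real p * K))"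
        using ext by (simp add: sector_extension_def)
      then show "norm (g n (rt \<tau>)) \<le> C * A ^ n * B n * exp (a * norm \<tau> powr K)"
        using p by (simp add: norm_rt powr_powr)
    qed (use sm in auto)
  qed (use g p in auto)
qed

section \<open>Gamma integrals\<close>

text \<open>A dominating function for the integrand suffices: Cauchy's estimate on small discs
  bounds its derivative in u, hence the difference quotients, by a multiple of w, and dominated
  convergence passes to the limit.\<close>

lemma holomorphic_integral:
  fixes g :: "complex \<Rightarrow> 'a \<Rightarrow> complex"
  assumes U: "open U"
    and meas: "\<And>u. u \<in> U \<Longrightarrow> g u \<in> borel_measurable M"
    and hol: "\<And>x. x \<in> space M \<Longrightarrow> (\<lambda>u. g u x) holomorphic_on U"
    and dom: "\<And>u0. u0 \<in> U \<Longrightarrow> \<exists>e>0. \<exists>w. integrable M w \<and>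
                 (\<forall>u\<in>ball u0 e \<inter> U. \<forall>x\<in>space M. norm (g u x) \<le> w x)"
  shows "(\<lambda>u. \<integral>x. g u x \<partial>M) holomorphic_on U"
  unfolding holomorphic_on_open[OF U]
proof
  fix u0 assume u0: "u0 \<in> U"
  obtain e0 w where e0: "e0 > 0" and w: "integrable M w"
    and bd0: "\<And>u x. u \<in> ball u0 e0 \<inter> U \<Longrightarrow> x \<in> space M \<Longrightarrow> norm (g u x) \<le> w x"
    using dom[OF u0] by blast
  obtain e1 where e1: "e1 > 0" "ball u0 e1 \<subseteq> U" using U u0 open_contains_ball by blast
  define d where "d = min e0 e1 / 2"
  have d: "d > 0" using e0 e1 by (simp add: d_def)
  have sub: "ball u0 (2 * d) \<subseteq> ball u0 e0 \<inter> U" using e1 by (force simp: d_def)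
  have bd: "norm (g u x) \<le> w x" if "u \<in> ball u0 (2 * d)" "x \<in> space M" for u x
    using bd0 sub that by blast
  have int: "integrable M (g u)" if "u \<in> ball u0 (2 * d)" for u
    by (rule Bochner_Integration.integrable_bound[OF w meas])
       (use sub that bd in \<open>auto intro!: AE_I2 intro: order_trans[OF _ abs_ge_self]\<close>)
  have lip: "norm (g u x - g u0 x) \<le> 2 / d * w x * norm (u - u0)"
    if u: "u \<in> ball u0 d" and x: "x \<in> space M" for u x
  proof (rule field_differentiable_bound[where S = "ball u0 d" and f' = "deriv (\<lambda>u. g u x)"])
    fix v assume v: "v \<in> ball u0 d"
    have vU: "v \<in> U" using v sub d by force
    show "((\<lambda>u. g u x) has_field_derivative deriv (\<lambda>u. g u x) v) (at v within ball u0 d)"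
      by (rule has_field_derivative_at_within[OF holomorphic_derivI[OF hol[OF x] U vU]])
    have sub2: "cball v (d / 2) \<subseteq> ball u0 (2 * d)"
    proof
      fix s assume "s \<in> cball v (d / 2)"
      then have "dist u0 s < d + d / 2"
        using v dist_triangle[of u0 s v] by auto
      then show "s \<in> ball u0 (2 * d)" using d by simp
    qed
    have "norm (deriv (\<lambda>u. g u x) v) \<le> w x / (d / 2)"
      by (rule norm_deriv_le[OF hol[OF x] U]) (use sub sub2 d bd x in auto)
    then show "norm (deriv (\<lambda>u. g u x) v) \<le> 2 / d * w x" by (simp add: field_simps)
  qed (use u d in auto)
  define G where "G = (\<lambda>x. deriv (\<lambda>u. g u x) u0)"
  have "((\<lambda>u. \<integral>x. g u x \<partial>M) has_field_derivative (\<integral>x. G x \<partial>M)) (at u0 within ball u0 d)"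
    unfolding has_field_derivative_iff tendsto_at_iff_sequentially
  proof (intro allI impI)
    fix X :: "nat \<Rightarrow> complex"
    assume X: "\<forall>i. X i \<in> ball u0 d - {u0}" and lim: "X \<longlonglongrightarrow> u0"
    have Xb: "X i \<in> ball u0 (2 * d)" "X i \<in> ball u0 d" "X i \<noteq> u0" for i using spec[OF X, of i] d by auto
    have u0b: "u0 \<in> ball u0 (2 * d)" using d by simp
    have eq: "((\<integral>x. g (X i) x \<partial>M) - (\<integral>x. g u0 x \<partial>M)) / (X i - u0) = (\<integral>x. (g (X i) x - g u0 x) / (X i - u0) \<partial>M)" for i
      using int[OF Xb(1)] int[OF u0b] by (simp add: Bochner_Integration.integral_diff)
    have ptw: "(\<lambda>i. (g (X i) x - g u0 x) / (X i - u0)) \<longlonglongrightarrow> G x" if x: "x \<in> space M" for x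
    proof -
      have "((\<lambda>u. g u x) has_field_derivative G x) (at u0)"
        unfolding G_def by (rule holomorphic_derivI[OF hol[OF x] U u0])
      then show ?thesis
        unfolding has_field_derivative_iff tendsto_at_iff_sequentially
        using Xb(3) lim by (auto simp: o_def)
    qed
    have gm: "(\<lambda>x. (g (X i) x - g u0 x) / (X i - u0)) \<in> borel_measurable M" for i
      using meas[of "X i"] meas[OF u0] Xb(1)[of i] sub by (intro borel_measurable_divide borel_measurable_diff) auto
    have "(\<lambda>i. \<integral>x. (g (X i) x - g u0 x) / (X i - u0) \<partial>M) \<longlonglongrightarrow> (\<integral>x. G x \<partial>M)"
    proof (rule integral_dominated_convergence[where w = "\<lambda>x. 2 / d * w x"])
      show "G \<in> borel_measurable M"
        by (rule borel_measurable_LIMSEQ_metric[OF gm ptw])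
      show "AE x in M. (\<lambda>i. (g (X i) x - g u0 x) / (X i - u0)) \<longlonglongrightarrow> G x"
        using ptw by (intro AE_I2)
      show "AE x in M. norm ((g (X i) x - g u0 x) / (X i - u0)) \<le> 2 / d * w x" for i
      proof (rule AE_I2)
        fix x assume "x \<in> space M"
        from lip[OF Xb(2) this, of i] show "norm ((g (X i) x - g u0 x) / (X i - u0)) \<le> 2 / d * w x"
          using Xb(3)[of i] by (simp add: norm_divide divide_le_eq)
      qed
    qed (use w gm in auto)
    then show "((\<lambda>y. ((\<integral>x. g y x \<partial>M) - (\<integral>x. g u0 x \<partial>M)) / (y - u0)) \<circ> X) \<longlonglongrightarrow> (\<integral>x. G x \<partial>M)"
      by (simp add: o_def eq)
  qed
  then show "\<exists>f'. ((\<lambda>u. \<integral>x. g u x \<partial>M) has_field_derivative f') (at u0)"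
    using d by (auto simp: at_within_open[of u0 "ball u0 d"])
qed

lemma integral_sums_dominated:
  fixes f :: "nat \<Rightarrow> 'a \<Rightarrow> complex"
  assumes meas: "\<And>j. f j \<in> borel_measurable M" and w: "integrable M w"
    and bd: "\<And>n x. x \<in> space M \<Longrightarrow> (\<Sum>j<n. norm (f j x)) \<le> w x"
    and sm: "\<And>x. x \<in> space M \<Longrightarrow> (\<lambda>j. f j x) sums F x"
  shows "(\<lambda>j. \<integral>x. f j x \<partial>M) sums (\<integral>x. F x \<partial>M)" and "\<And>j. integrable M (f j)"
proof -
  show int: "integrable M (f j)" for j
  proof (rule Bochner_Integration.integrable_bound[OF w meas], rule AE_I2)
    fix x assume x: "x \<in> space M"
    have "norm (f j x) \<le> (\<Sum>i<Suc j. norm (f i x))" by (simp add: sum_nonneg)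
    then show "norm (f j x) \<le> norm (w x)" using bd[OF x, of "Suc j"] by simp
  qed
  have "(\<lambda>n. \<integral>x. (\<Sum>j<n. f j x) \<partial>M) \<longlonglongrightarrow> (\<integral>x. F x \<partial>M)"
  proof (rule integral_dominated_convergence[where w = w])
    show "F \<in> borel_measurable M"
      by (rule borel_measurable_LIMSEQ_metric[of "\<lambda>n x. \<Sum>j<n. f j x"]) (use meas sm in \<open>auto simp: sums_def\<close>)
    show "AE x in M. (\<lambda>n. \<Sum>j<n. f j x) \<longlonglongrightarrow> F x" using sm by (auto simp: sums_def)
    show "AE x in M. norm (\<Sum>j<n. f j x) \<le> w x" for n
      using bd by (intro AE_I2) (auto intro: order_trans[OF norm_sum])
  qed (use meas w in auto)
  then show "(\<lambda>j. \<integral>x. f j x \<partial>M) sums (\<integral>x. F x \<partial>M)"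
    using int by (simp add: sums_def)
qed

text \<open>The change of variables theorem speaks of \<open>absolutely_integrable_on\<close>;
  continuity provides the Borel measurability that carries it over to \<open>lborel\<close>.\<close>

lemma set_integral_substitution:
  fixes f g g' :: "real \<Rightarrow> real"
  assumes S: "S \<in> sets borel" "T \<in> sets borel"
    and der: "\<And>x. x \<in> S \<Longrightarrow> (g has_field_derivative g' x) (at x)"
    and inj: "inj_on g S" and img: "g ` S = T"
    and cont: "continuous_on T f" "continuous_on S (\<lambda>x. \<bar>g' x\<bar> * f (g x))"
  shows "set_integrable lborel S (\<lambda>x. \<bar>g' x\<bar> * f (g x)) \<longleftrightarrow> set_integrable lborel T f"
    and "set_integrable lborel T f \<Longrightarrow> (LINT x:S|lborel. \<bar>g' x\<bar> * f (g x)) = (LINT x:T|lborel. f x)"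
proof -
  have m: "(\<lambda>x. indicat_real T x *\<^sub>R f x) \<in> borel_measurable lborel"
    "(\<lambda>x. indicat_real S x *\<^sub>R (\<bar>g' x\<bar> * f (g x))) \<in> borel_measurable lborel"
    using borel_measurable_continuous_on_indicator[OF S(2) cont(1)] borel_measurable_continuous_on_indicator[OF S(1) cont(2)]
    by simp_all
  have eq: "set_integrable lborel A h \<longleftrightarrow> h absolutely_integrable_on A"
    if "(\<lambda>x. indicat_real A x *\<^sub>R h x) \<in> borel_measurable lborel" for A and h :: "real \<Rightarrow> real"
    using integrable_completion[OF that] by (simp add: set_integrable_def)
  have *: "(\<lambda>x. \<bar>g' x\<bar> * f (g x)) absolutely_integrable_on S \<and>
           integral S (\<lambda>x. \<bar>g' x\<bar> * f (g x)) = b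
     \<longleftrightarrow> f absolutely_integrable_on T \<and> integral T f = b" for b
    using has_absolute_integral_change_of_variables_1'[of S g g' f b] S der inj img
    by (auto intro: has_field_derivative_at_within)
  show 1: "set_integrable lborel S (\<lambda>x. \<bar>g' x\<bar> * f (g x)) \<longleftrightarrow> set_integrable lborel T f"
    using * eq[OF m(1)] eq[OF m(2)] by blast
  assume "set_integrable lborel T f"
  then show "(LINT x:S|lborel. \<bar>g' x\<bar> * f (g x)) = (LINT x:T|lborel. f x)"
    using * 1 set_borel_integral_eq_integral(2) eq m by metis
qed

text \<open>Substitute \<open>v * y powr b\<close> in Gamma's integral. The exponent
  \<open>(s + 1) / b\<close> is the one for which the Jacobian leaves
  \<open>y powr s\<close>.\<close>

lemma powr_exp_integral:
  fixes b s v :: real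
  assumes b: "b > 0" and s: "s > -1" and v: "v > 0"
  shows "set_integrable lborel {0<..} (\<lambda>y. y powr s * exp (- (v * y powr b)))"
    and "(LINT y:{0<..}|lborel. y powr s * exp (- (v * y powr b))) = Gamma ((s + 1) / b) * v powr (- ((s + 1) / b)) / b"
proof -
  define a where "a = (s + 1) / b"
  have a: "a > 0" using b s by (simp add: a_def)
  define f where "f = (\<lambda>t::real. t powr (a - 1) * exp (- t))"
  have fG: "(f has_integral Gamma a) {0..}"
    using Gamma_integral_real[OF a] by (simp add: f_def exp_minus divide_inverse)
  have "{x \<in> {0..} - {0<..}. f x \<noteq> 0} = {}" "{x \<in> {0<..} - {0..}. f x \<noteq> 0} = {}"
    by (auto simp: f_def)
  then have fG': "(f has_integral Gamma a) {0<..}"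
    using fG has_integral_spike_set_eq[of "{0..}" "{0<..}" f "Gamma a"] by (metis negligible_empty)
  have "f absolutely_integrable_on {0<..}"
    using fG' by (intro nonnegative_absolutely_integrable_1) (auto simp: f_def has_integral_iff)
  moreover have cf: "continuous_on {0<..} f" unfolding f_def by (intro continuous_intros) auto
  then have "(\<lambda>x. indicat_real {0<..} x *\<^sub>R f x) \<in> borel_measurable lborel"
    using borel_measurable_continuous_on_indicator[of "{0<..}" f] by simp
  ultimately have fi: "set_integrable lborel {0<..} f"
    using integrable_completion[of "\<lambda>x. indicat_real {0<..} x *\<^sub>R f x" lborel] by (simp add: set_integrable_def)
  then have fI: "(LINT x:{0<..}|lborel. f x) = Gamma a"
    using set_borel_integral_eq_integral(2) fG' by (metis has_integral_iff)
  let ?g = "\<lambda>y. v * y powr b" and ?g' = "\<lambda>y. v * b * y powr (b - 1)"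
  have img: "?g ` {0<..} = {0<..}"
  proof (intro equalityI subsetI)
    fix t :: real assume "t \<in> {0<..}"
    then have "t = ?g ((t / v) powr (1 / b))" "0 < (t / v) powr (1 / b)" using v b by (auto simp: powr_powr)
    then show "t \<in> ?g ` {0<..}" by blast
  qed (use v in auto)
  have der: "(?g has_field_derivative ?g' y) (at y)" if "y \<in> {0<..}" for y
    using that by (auto intro!: derivative_eq_intros)
  have inj: "inj_on ?g {0<..}"
  proof (rule inj_onI)
    fix x y assume xy: "x \<in> {0<..}" "y \<in> {0<..}" "v * x powr b = v * y powr b"
    then have "(x powr b) powr (1 / b) = (y powr b) powr (1 / b)" using v by simp
    then show "x = y" using xy b by (simp add: powr_powr)
  qed
  have eq: "\<bar>?g' y\<bar> * f (?g y) = b * v powr a * (y powr s * exp (- (v * y powr b)))" if "y > 0" for y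
  proof -
    have "b - 1 + b * (a - 1) = s" using b by (simp add: a_def field_simps)
    then have "y powr (b - 1) * (y powr b) powr (a - 1) = y powr s"
      by (simp only: powr_powr powr_add[symmetric])
    moreover have "v * v powr (a - 1) = v powr a" using v by (simp add: powr_mult_base)
    ultimately have "\<bar>?g' y\<bar> * (?g y) powr (a - 1) = b * (v powr a * y powr s)"
      using that v b by (simp add: powr_mult abs_mult) (metis (no_types, lifting) mult.assoc mult.left_commute)
    then show ?thesis by (simp add: f_def mult_ac)
  qed
  have cS: "continuous_on {0<..} (\<lambda>x. \<bar>?g' x\<bar> * f (?g x))"
    using v unfolding f_def by (intro continuous_intros) auto
  note sub = set_integral_substitution[of "{0<..}" "{0<..}" ?g ?g' f, OF _ _ der inj img cf cS]
  have cg: "set_integrable lborel {0<..} (\<lambda>y. \<bar>?g' y\<bar> * f (?g y)) \<longleftrightarrow>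
      set_integrable lborel {0<..} (\<lambda>y. b * v powr a * (y powr s * exp (- (v * y powr b))))"
    by (intro set_integrable_cong) (use eq in auto)
  have i1: "set_integrable lborel {0<..} (\<lambda>y. b * v powr a * (y powr s * exp (- (v * y powr b))))"
    using sub(1) fi cg by auto
  then have "set_integrable lborel {0<..} (\<lambda>y. inverse (b * v powr a) * (b * v powr a * (y powr s * exp (- (v * y powr b)))))"
    by (rule set_integrable_mult_right)
  moreover have "(\<lambda>y. inverse (b * v powr a) * (b * v powr a * (y powr s * exp (- (v * y powr b))))) =
      (\<lambda>y. y powr s * exp (- (v * y powr b)))"
    using b v by (simp add: fun_eq_iff field_simps)
  ultimately show i2: "set_integrable lborel {0<..} (\<lambda>y. y powr s * exp (- (v * y powr b)))" by simp
  have "(LINT y:{0<..}|lborel. b * v powr a * (y powr s * exp (- (v * y powr b)))) = (LINT y:{0<..}|lborel. \<bar>?g' y\<bar> * f (?g y))"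
    by (intro set_lebesgue_integral_cong) (use eq in auto)
  also have "\<dots> = Gamma a" using sub(2) fi fI by auto
  finally have "b * v powr a * (LINT y:{0<..}|lborel. y powr s * exp (- (v * y powr b))) = Gamma a"
    by (simp only: set_integral_mult_right)
  moreover have "v powr a > 0" using v by simp
  ultimately show "(LINT y:{0<..}|lborel. y powr s * exp (- (v * y powr b))) = Gamma ((s + 1) / b) * v powr (- ((s + 1) / b)) / b"
    unfolding a_def[symmetric] powr_minus using b by (simp add: divide_simps) (simp add: mult_ac)
qed

section \<open>Tools for integrals over a ray and over the whole line\<close>

lemma borel_measurable_indicator_continuous:
  fixes f :: "real \<Rightarrow> 'a::real_normed_vector"
  assumes "A \<in> sets borel" "continuous_on A f"
  shows "(\<lambda>x. indicat_real A x *\<^sub>R f x) \<in> borel_measurable lborel"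
  using borel_measurable_continuous_on_indicator[OF assms] by simp

lemma powr_polar:
  assumes "\<rho> > 0" "-pi < \<phi>" "\<phi> \<le> pi"
  shows "(of_real \<rho> * cis \<phi>) powr of_real s = of_real (\<rho> powr s) * cis (s * \<phi>)"
proof -
  have "of_real \<rho> * cis \<phi> = exp (Complex (ln \<rho>) \<phi>)"
    using assms by (simp add: exp_eq_polar)
  moreover have "Ln (exp (Complex (ln \<rho>) \<phi>)) = Complex (ln \<rho>) \<phi>" using assms by (intro Ln_exp) auto
  ultimately have "(of_real \<rho> * cis \<phi>) powr of_real s = exp (of_real s * Complex (ln \<rho>) \<phi>)"
    by (simp add: powr_def)
  also have "\<dots> = of_real (\<rho> powr s) * cis (s * \<phi>)"
    using assms by (simp add: exp_eq_polar powr_def)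
  finally show ?thesis .
qed

lemma integrable_even_extension:
  fixes h :: "real \<Rightarrow> real"
  assumes "set_integrable lborel {0<..} h"
  shows "integrable lborel (\<lambda>y. if y = 0 then 0 else h \<bar>y\<bar>)"
proof -
  let ?H = "\<lambda>y. indicat_real {0<..} y *\<^sub>R h y"
  have 1: "integrable lborel ?H" using assms by (simp add: set_integrable_def)
  have 2: "integrable lborel (\<lambda>y. ?H (0 + (-1) * y))"
    by (rule lborel_integrable_real_affine[OF 1]) simp
  have "integrable lborel (\<lambda>y. ?H y + ?H (0 + (-1) * y))" using 1 2 by (rule Bochner_Integration.integrable_add)
  moreover have "(\<lambda>y. ?H y + ?H (0 + (-1) * y)) = (\<lambda>y. if y = 0 then 0 else h \<bar>y\<bar>)"
    by (auto simp: fun_eq_iff indicator_def)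
  ultimately show ?thesis by simp
qed

lemma integrable_exp_minus_abs: "integrable lborel (\<lambda>y::real. exp (- \<bar>y\<bar>))"
proof -
  have "integrable lborel (\<lambda>y::real. if y = 0 then 0 else \<bar>y\<bar> powr 0 * exp (- (1 * \<bar>y\<bar> powr 1)))"
    by (rule integrable_even_extension[OF powr_exp_integral(1)]) auto
  then have "integrable lborel (\<lambda>y::real. if y = 0 then 0 else exp (- \<bar>y\<bar>))"
    by (rule Bochner_Integration.integrable_cong[THEN iffD1, rotated -1]) auto
  then show ?thesis
  proof (rule integrable_cong_AE_imp)
    show "AE y::real in lborel. (if y = 0 then 0 else exp (- \<bar>y\<bar>)) = exp (- \<bar>y\<bar>)"
      using AE_lborel_singleton[of "0::real"] by (rule AE_mp) (rule AE_I2, auto)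
  qed simp
qed

lemma integral_split_at_zero:
  fixes F :: "real \<Rightarrow> complex"
  assumes F: "integrable lborel F" and F0: "F 0 = 0"
  shows "integral\<^sup>L lborel F = (LINT y:{0<..}|lborel. F y) + (LINT y:{0<..}|lborel. F (- y))"
proof -
  have i: "set_integrable lborel {0<..} F" "set_integrable lborel {..<0} F"
    using F by (auto simp: set_integrable_def intro!: integrable_mult_indicator)
  have "integral\<^sup>L lborel F = (\<integral>y. indicat_real {0<..} y *\<^sub>R F y + indicat_real {..<0} y *\<^sub>R F y \<partial>lborel)"
    using F0 by (intro Bochner_Integration.integral_cong) (auto simp: indicator_def not_less order_less_le)
  also have "\<dots> = (LINT y:{0<..}|lborel. F y) + (LINT y:{..<0}|lborel. F y)"
    using i unfolding set_integrable_def set_lebesgue_integral_def by (rule Bochner_Integration.integral_add)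
  also have "(LINT y:{..<0}|lborel. F y) = (\<integral>y. indicat_real {..<0} (0 + (-1) * y) *\<^sub>R F (0 + (-1) * y) \<partial>lborel)"
    unfolding set_lebesgue_integral_def
    using lborel_integral_real_affine[of "-1" "\<lambda>y. indicat_real {..<0} y *\<^sub>R F y" 0] by simp
  also have "\<dots> = (LINT y:{0<..}|lborel. F (- y))"
    unfolding set_lebesgue_integral_def
    by (intro Bochner_Integration.integral_cong) (auto simp: indicator_def)
  finally show ?thesis .
qed

text \<open>Rotation of the ray of integration in Gamma's integral: both sides are holomorphic in \<open>v\<close>
  and agree for \<open>v > 0\<close>.\<close>

lemma powr_exp_integral_complex:
  fixes b s :: real and v :: complex
  assumes b: "b > 0" and s: "s > -1" and v: "Re v > 0"
  shows "(LINT y:{0<..}|lborel. of_real (y powr s) * exp (- (v * of_real (y powr b)))) =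
     of_real (Gamma ((s + 1) / b) / b) * v powr of_real (- ((s + 1) / b))"
proof -
  let ?U = "{v. Re v > 0}"
  let ?g = "\<lambda>(v::complex) y. indicat_real {0<..} y *\<^sub>R (of_real (y powr s) * exp (- (v * of_real (y powr b))))"
  let ?f = "\<lambda>v. (\<integral>y. ?g v y \<partial>lborel) - of_real (Gamma ((s + 1) / b) / b) * v powr of_real (- ((s + 1) / b))"
  have U: "open ?U" by (rule open_halfspace_Re_gt)
  have "(\<lambda>v. \<integral>y. ?g v y \<partial>lborel) holomorphic_on ?U"
  proof (rule holomorphic_integral[OF U])
    fix v show "?g v \<in> borel_measurable lborel"
      by (intro borel_measurable_indicator_continuous, simp) (intro continuous_intros; force)
  next
    fix v0 :: complex assume v0: "v0 \<in> ?U"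
    define w where "w = (\<lambda>y. indicat_real {0<..} y *\<^sub>R (y powr s * exp (- (Re v0 / 2 * y powr b))))"
    have "integrable lborel w"
      using powr_exp_integral(1)[OF b s, of "Re v0 / 2"] v0 by (simp add: w_def set_integrable_def)
    moreover have "norm (?g v y) \<le> w y" if "v \<in> ball v0 (Re v0 / 2)" for v y
    proof -
      have "Re v0 - Re v \<le> norm (v0 - v)" using complex_Re_le_cmod[of "v0 - v"] by simp
      then have "Re v0 / 2 \<le> Re v" using that by (auto simp: dist_norm)
      then show ?thesis
        by (auto simp: w_def indicator_def norm_mult intro!: mult_left_mono mult_right_mono)
    qed
    ultimately show "\<exists>e>0. \<exists>w. integrable lborel w \<and> (\<forall>v\<in>ball v0 e \<inter> ?U. \<forall>y\<in>space lborel. norm (?g v y) \<le> w y)"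
      using v0 by (intro exI[of _ "Re v0 / 2"] conjI exI[of _ w]) auto
  qed (auto intro!: holomorphic_intros)
  moreover have "(\<lambda>v. v powr of_real (- ((s + 1) / b))) holomorphic_on ?U"
    by (intro holomorphic_intros) (auto simp: complex_nonpos_Reals_iff)
  ultimately have hol: "?f holomorphic_on ?U"
    by (intro holomorphic_on_diff holomorphic_on_mult holomorphic_on_const)
  have real: "?f (of_real x) = 0" if x: "x > 0" for x
  proof -
    have "(\<integral>y. ?g (of_real x) y \<partial>lborel) = (\<integral>y. of_real (indicat_real {0<..} y *\<^sub>R (y powr s * exp (- (x * y powr b)))) \<partial>lborel)"
      by (intro Bochner_Integration.integral_cong) (auto simp: exp_of_real[symmetric] scaleR_conv_of_real)
    also have "\<dots> = of_real (Gamma ((s + 1) / b) * x powr (- ((s + 1) / b)) / b)"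
      unfolding integral_complex_of_real
      using powr_exp_integral(2)[OF b s x] by (simp add: set_lebesgue_integral_def)
    finally have i: "(\<integral>y. ?g (of_real x) y \<partial>lborel) = of_real (Gamma ((s + 1) / b) * x powr (- ((s + 1) / b)) / b)" .
    have "complex_of_real x powr of_real (- ((s + 1) / b)) = of_real (x powr (- ((s + 1) / b)))"
      using x by (intro powr_of_real) auto
    then show ?thesis unfolding i by (simp only: of_real_mult of_real_divide) simp
  qed
  have "?f v = 0"
  proof (rule analytic_continuation[OF hol U _ _ _ _ _ , of "of_real ` {0<..}" 1])
    show "connected ?U" by (intro convex_connected convex_halfspace_Re_gt)
    show "(1::complex) islimpt of_real ` {0<..}"
      unfolding islimpt_approachable
    proof (intro allI impI)
      fix e :: real assume e: "e > 0"
      show "\<exists>x'\<in>of_real ` {0<..}. x' \<noteq> (1::complex) \<and> dist x' 1 < e"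
      proof (rule bexI)
        show "complex_of_real (1 + e / 2) \<noteq> 1 \<and> dist (complex_of_real (1 + e / 2)) 1 < e"
          using e by (auto simp: dist_norm)
        show "complex_of_real (1 + e / 2) \<in> of_real ` {0<..}" using e by (intro imageI) auto
      qed
    qed
  qed (use real v in auto)
  then show ?thesis by (simp add: set_lebesgue_integral_def)
qed

text \<open>Far out in a vertical strip the argument of w is close to a right angle, and since b
  exceeds 1 the argument of \<open>w powr b\<close> lies beyond it, where the real part is negative.
  The angle \<psi> lies midway between \<open>pi / (2 * b)\<close>, where that real part changes
  sign, and \<open>pi / 2\<close>.\<close>

lemma norm_exp_powr_le:
  fixes b :: real
  assumes b: "1 < b" "b < 2"
  obtains \<kappa> where "\<kappa> > 0"
    "\<And>c0. \<exists>C>0. \<forall>w. 0 \<le> Re w \<and> Re w \<le> c0 \<longrightarrow> norm (exp (w powr of_real b)) \<le> C * exp (- (\<kappa> * norm w powr b))"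
proof -
  define \<psi> where "\<psi> = (pi / (2 * b) + pi / 2) / 2"
  have "pi / (2 * b) < pi / 2" using b by (simp add: field_simps)
  then have \<psi>: "pi / (2 * b) < \<psi>" "\<psi> < pi / 2" by (auto simp: \<psi>_def)
  have "0 < pi / (2 * b)" using b by simp
  then have \<psi>0: "0 < \<psi>" using \<psi>(1) by linarith
  have b\<psi>: "pi / 2 < b * \<psi>" "b * \<psi> < pi"
  proof -
    show "pi / 2 < b * \<psi>" using \<psi>(1) b by (simp add: field_simps)
    have "b * \<psi> < 2 * (pi / 2)" using \<psi> \<psi>0 b by (intro mult_strict_mono) auto
    then show "b * \<psi> < pi" by simp
  qed
  define \<kappa> where "\<kappa> = - cos (b * \<psi>)"
  have "cos (b * \<psi>) < cos (pi / 2)" using b\<psi> by (intro cos_monotone_0_pi) auto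
  then have \<kappa>: "\<kappa> > 0" by (simp add: \<kappa>_def)
  show thesis
  proof (rule that[OF \<kappa>])
    fix c0 :: real
    \<comment> \<open>If the argument of w is below \<psi>, the bound on \<open>Re w\<close>
      confines w to the disc of radius W; a constant factor then makes up for the missing
      decay.\<close>
    define W where "W = max c0 0 / cos \<psi>"
    have cos\<psi>: "cos \<psi> > 0" using \<psi> \<psi>0 by (intro cos_gt_zero) auto
    have "norm (exp (w powr of_real b)) \<le> exp ((1 + \<kappa>) * W powr b) * exp (- (\<kappa> * norm w powr b))"
      if w: "0 \<le> Re w" "Re w \<le> c0" for w :: complex
    proof (cases "w = 0")
      case False
      have Arg: "\<bar>Arg w\<bar> \<le> pi / 2" using w(1) False Arg_Re_nonneg by blast
      have "w = of_real (norm w) * cis (Arg w)" using False by (simp add: cis_Arg sgn_div_norm scaleR_conv_of_real)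
      then have "w powr of_real b = of_real (norm w powr b) * cis (b * Arg w)"
        using powr_polar[of "norm w" "Arg w" b] False Arg_bounded[of w] by simp
      then have re: "Re (w powr of_real b) = norm w powr b * cos (b * \<bar>Arg w\<bar>)"
        by (simp add: abs_if)
      have "Re (w powr of_real b) \<le> (1 + \<kappa>) * W powr b - \<kappa> * norm w powr b"
      proof (cases "\<psi> \<le> \<bar>Arg w\<bar>")
        case True
        have "b * \<bar>Arg w\<bar> \<le> 2 * (pi / 2)" using Arg b by (intro mult_mono) auto
        then have "cos (b * \<bar>Arg w\<bar>) \<le> - \<kappa>"
          unfolding \<kappa>_def minus_minus using True \<psi> \<psi>0 b by (intro cos_monotone_0_pi_le) auto
        then have "norm w powr b * cos (b * \<bar>Arg w\<bar>) \<le> norm w powr b * - \<kappa>" by (intro mult_left_mono) auto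
        moreover have "0 \<le> (1 + \<kappa>) * W powr b" using \<kappa> by simp
        ultimately show ?thesis using re by (simp add: mult.commute)
      next
        case False
        then have "cos \<psi> \<le> cos \<bar>Arg w\<bar>" using \<psi> by (intro cos_monotone_0_pi_le) auto
        then have "norm w * cos \<psi> \<le> norm w * cos (Arg w)" by (intro mult_left_mono) auto
        also have "\<dots> = Re w" by (metis Re_rcis rcis_cmod_Arg)
        also have "\<dots> \<le> max c0 0" using w by auto
        finally have "norm w \<le> W" using cos\<psi> by (simp add: W_def field_simps)
        then have *: "norm w powr b \<le> W powr b" using b by (intro powr_mono2) auto
        have "norm w powr b * cos (b * \<bar>Arg w\<bar>) \<le> norm w powr b * 1" by (intro mult_left_mono) auto
        then have "Re (w powr of_real b) \<le> W powr b" using re * by simp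
        moreover have "\<kappa> * norm w powr b \<le> \<kappa> * W powr b" using * \<kappa> by simp
        ultimately show ?thesis by (simp add: algebra_simps)
      qed
      then show ?thesis by (simp flip: exp_add)
    qed (use \<kappa> in simp)
    then show "\<exists>C>0. \<forall>w. 0 \<le> Re w \<and> Re w \<le> c0 \<longrightarrow>
        norm (exp (w powr of_real b)) \<le> C * exp (- (\<kappa> * norm w powr b))"
      by (intro exI[of _ "exp ((1 + \<kappa>) * W powr b)"]) auto
  qed
qed

text \<open>The norm of \<open>w powr s\<close> is at most polynomial in \<open>norm w\<close> times
  \<open>exp (R * pi)\<close>, the latter from the argument of w and the imaginary part of s. As
  \<open>b > 1\<close>, the decay in \<open>norm w powr b\<close> dominates. The lower bound c1
  keeps negative powers bounded.\<close>

lemma norm_exp_powr_mult_powr_le: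
  fixes b c1 c2 R :: real
  assumes b: "1 < b" "b < 2" and c: "0 < c1" and R: "0 \<le> R"
  obtains C where "C \<ge> 0"
    "\<And>w s. c1 \<le> Re w \<Longrightarrow> Re w \<le> c2 \<Longrightarrow> norm s \<le> R \<Longrightarrow>
       norm (exp (w powr of_real b) * w powr s) \<le> C * exp (- norm w)"
proof -
  obtain \<kappa> C0 where \<kappa>: "\<kappa> > 0" and C0: "C0 > 0"
    "\<And>w. 0 \<le> Re w \<Longrightarrow> Re w \<le> c2 \<Longrightarrow> norm (exp (w powr of_real b)) \<le> C0 * exp (- (\<kappa> * norm w powr b))"
    using norm_exp_powr_le[OF b] by metis
  obtain N :: nat where N: "R \<le> real N" using real_arch_simple by blast
  obtain D where D: "D \<ge> 0" "\<And>x::real. 0 \<le> x \<Longrightarrow> x ^ N \<le> D * exp (x powr 1)"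
    using power_le_exp_powr[of 1 N] by auto
  define E where "E = (D * exp 1 + c1 powr (- R)) * exp (R * pi)"
  \<comment> \<open>With this C2, \<open>2 * x \<le> \<kappa> * x powr b + C2\<close> holds on both
    sides of the point where \<open>x powr (b - 1) = 2 / \<kappa>\<close>.\<close>
  define C2 where "C2 = 2 * (2 / \<kappa>) powr (1 / (b - 1))"
  have E: "E \<ge> 0" using D by (simp add: E_def)
  have x: "2 * x \<le> \<kappa> * x powr b + C2" if "x > 0" for x
  proof (cases "x powr (b - 1) \<ge> 2 / \<kappa>")
    case True
    have "2 * x \<le> \<kappa> * (x powr (b - 1) * x)" using True \<kappa> that by (simp add: field_simps)
    also have "x powr (b - 1) * x = x powr b" using that by (simp add: powr_mult_base[of x "b - 1"] mult.commute)
    finally show ?thesis by (simp add: C2_def add_increasing2)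
  next
    case False
    have "x = (x powr (b - 1)) powr (1 / (b - 1))" using that b by (simp add: powr_powr)
    also have "\<dots> \<le> (2 / \<kappa>) powr (1 / (b - 1))" using False b by (intro powr_mono2) auto
    finally show ?thesis using \<kappa> by (simp add: C2_def add_increasing)
  qed
  show thesis
  proof (rule that[of "C0 * exp C2 * E"])
    fix w s :: complex assume w: "c1 \<le> Re w" "Re w \<le> c2" and s: "norm s \<le> R"
    have nw: "c1 \<le> norm w" using w complex_Re_le_cmod[of w] by simp
    have Rs: "\<bar>Re s\<bar> \<le> R" "\<bar>Im s\<bar> \<le> R" using s abs_Re_le_cmod[of s] abs_Im_le_cmod[of s] by auto
    have "norm w powr Re s \<le> D * exp 1 * exp (norm w) + c1 powr (- R)"
    proof (cases "norm w \<ge> 1")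
      case True
      have "norm w powr Re s \<le> norm w powr real N" using True Rs N by (intro powr_mono) auto
      also have "\<dots> = norm w ^ N" using nw c by (intro powr_realpow) auto
      also have "\<dots> \<le> (1 + norm w) ^ N" by (intro power_mono) auto
      also have "\<dots> \<le> D * exp (1 + norm w)" using D(2)[of "1 + norm w"] by simp
      finally show ?thesis by (simp add: exp_add mult.assoc add_increasing2)
    next
      case False
      have "norm w powr Re s \<le> norm w powr (- R)" using False nw c Rs by (intro powr_mono') auto
      also have "\<dots> \<le> c1 powr (- R)" using nw c R by (intro powr_mono2') auto
      finally show ?thesis using D by (simp add: add_increasing)
    qed
    also have "\<dots> \<le> D * exp 1 * exp (norm w) + c1 powr (- R) * exp (norm w)"
      using mult_left_mono[of 1 "exp (norm w)" "c1 powr (- R)"] by simp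
    finally have 1: "norm w powr Re s \<le> (D * exp 1 + c1 powr (- R)) * exp (norm w)" by (simp add: algebra_simps)
    have "- Im s * Arg w \<le> \<bar>Im s\<bar> * \<bar>Arg w\<bar>" by (metis abs_ge_minus_self abs_mult minus_mult_left)
    also have "\<dots> \<le> R * pi" using Rs Arg_bounded[of w] by (intro mult_mono) auto
    finally have 2: "exp (- Im s * Arg w) \<le> exp (R * pi)" by simp
    have "norm (w powr s) = norm w powr Re s * exp (- Im s * Arg w)" by (rule norm_powr_complex)
    also have "\<dots> \<le> ((D * exp 1 + c1 powr (- R)) * exp (norm w)) * exp (R * pi)"
      using 1 2 by (intro mult_mono) (auto intro: order_trans[OF powr_ge_zero])
    finally have 3: "norm (w powr s) \<le> E * exp (norm w)" by (simp add: E_def mult_ac)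
    have "norm (exp (w powr of_real b) * w powr s) \<le> (C0 * exp (- (\<kappa> * norm w powr b))) * (E * exp (norm w))"
      unfolding norm_mult using C0 3 w c E by (intro mult_mono) auto
    also have "\<dots> = C0 * E * exp (norm w - \<kappa> * norm w powr b)" by (simp add: exp_diff exp_minus field_simps)
    also have "\<dots> \<le> C0 * E * exp (C2 - norm w)"
    proof -
      have "norm w > 0" using nw c by linarith
      then have "norm w - \<kappa> * norm w powr b \<le> C2 - norm w" using x[of "norm w"] by linarith
      then show ?thesis using C0 E by (intro mult_left_mono) auto
    qed
    finally show "norm (exp (w powr of_real b) * w powr s) \<le> C0 * exp C2 * E * exp (- norm w)"
      by (simp add: exp_diff exp_minus field_simps)
  qed (use C0 E in auto)
qed

text \<open>This is Hankel's contour integral for the reciprocal Gamma function in the variable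
  \<open>w powr b\<close>, which for \<open>1 < b < 2\<close> allows a vertical line through c as
  contour. Hankel's exponent \<open>- z\<close> and the Jacobian together give
  \<open>s = b - 1 - b * z\<close>; the constant \<open>b / (2 * pi)\<close> is left
  outside.\<close>

definition hankel_integral :: "real \<Rightarrow> complex \<Rightarrow> complex \<Rightarrow> complex" where
  "hankel_integral b s c =
     (\<integral>y. exp ((c + \<i> * of_real y) powr of_real b) * (c + \<i> * of_real y) powr s \<partial>lborel)"

lemma hankel_integrand_measurable:
  assumes "Re c > 0"
  shows "(\<lambda>y. exp ((c + \<i> * of_real y) powr of_real b) * (c + \<i> * of_real y) powr s) \<in> borel_measurable lborel"
proof -
  have ne: "c + \<i> * of_real y \<noteq> 0" for y :: real using assms by (auto simp: complex_eq_iff)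
  have "continuous_on UNIV (\<lambda>y. exp ((c + \<i> * of_real y) powr of_real b) * (c + \<i> * of_real y) powr s)"
    using assms ne by (intro continuous_intros) auto
  then show ?thesis using borel_measurable_continuous_onI by simp
qed

text \<open>The integral is holomorphic in c. An imaginary shift of c is a translation of y, so the
  integral is constant on the line \<open>Re c = 1\<close>, hence everywhere by the identity
  theorem. This replaces a deformation of infinite contours.\<close>

lemma hankel_integral_const:
  assumes b: "1 < b" "b < 2" and c: "Re c > 0"
  shows "hankel_integral b s c = hankel_integral b s 1"
proof -
  let ?U = "{c. Re c > 0}"
  have U: "open ?U" by (rule open_halfspace_Re_gt)
  have "hankel_integral b s holomorphic_on ?U"
    unfolding hankel_integral_def
  proof (rule holomorphic_integral[OF U])
    fix y :: real
    have "c + \<i> * of_real y \<notin> \<real>\<^sub>\<le>\<^sub>0" if "Re c > 0" for c :: complex using that by (auto simp: complex_nonpos_Reals_iff)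
    then show "(\<lambda>c. exp ((c + \<i> * of_real y) powr of_real b) * (c + \<i> * of_real y) powr s) holomorphic_on ?U"
      by (intro holomorphic_intros) auto
  next
    fix c0 :: complex assume "c0 \<in> ?U"
    then have c0: "Re c0 > 0" by simp
    define e where "e = Re c0 / 2"
    obtain C where C: "C \<ge> 0" "\<And>w. Re c0 / 2 \<le> Re w \<Longrightarrow> Re w \<le> 2 * Re c0 \<Longrightarrow>
        norm (exp (w powr of_real b) * w powr s) \<le> C * exp (- norm w)"
      using norm_exp_powr_mult_powr_le[OF b, of "Re c0 / 2" "norm s" "2 * Re c0"] c0 by (metis half_gt_zero norm_ge_zero order_refl)
    have "norm (exp ((c + \<i> * of_real y) powr of_real b) * (c + \<i> * of_real y) powr s) \<le> C * exp (\<bar>Im c0\<bar> + e) * exp (- \<bar>y\<bar>)"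
      if "c \<in> ball c0 e" for c y
    proof -
      let ?w = "c + \<i> * of_real y"
      have "norm (c - c0) < e" using that by (simp add: dist_norm norm_minus_commute)
      then have "\<bar>Re c - Re c0\<bar> < e" "\<bar>Im c - Im c0\<bar> < e"
        using abs_Re_le_cmod[of "c - c0"] abs_Im_le_cmod[of "c - c0"] by auto
      then have *: "- e < Re c - Re c0" "Re c - Re c0 < e" "- e < Im c - Im c0" "Im c - Im c0 < e"
        unfolding abs_less_iff by auto
      have "norm (exp (?w powr of_real b) * ?w powr s) \<le> C * exp (- norm ?w)"
        by (rule C(2)) (use * c0 in \<open>auto simp: e_def\<close>)
      also have "\<bar>Im ?w\<bar> \<le> norm ?w" by (rule abs_Im_le_cmod)
      then have "- norm ?w \<le> \<bar>Im c0\<bar> + e - \<bar>y\<bar>" using * by auto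
      then have "C * exp (- norm ?w) \<le> C * exp (\<bar>Im c0\<bar> + e - \<bar>y\<bar>)" using C by (intro mult_left_mono) auto
      finally show ?thesis by (simp add: exp_diff exp_minus field_simps)
    qed
    then show "\<exists>e>0. \<exists>w. integrable lborel w \<and> (\<forall>c\<in>ball c0 e \<inter> ?U. \<forall>y\<in>space lborel.
        norm (exp ((c + \<i> * of_real y) powr of_real b) * (c + \<i> * of_real y) powr s) \<le> w y)"
      using c0 integrable_exp_minus_abs
      by (intro exI[of _ e] conjI exI[of _ "\<lambda>y. C * exp (\<bar>Im c0\<bar> + e) * exp (- \<bar>y\<bar>)"]) (auto simp: e_def)
  qed (use hankel_integrand_measurable in simp)
  then have hol: "(\<lambda>c. hankel_integral b s c - hankel_integral b s 1) holomorphic_on ?U"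
    by (intro holomorphic_intros)
  have line: "hankel_integral b s c - hankel_integral b s 1 = 0" if "Re c = 1" for c
  proof -
    have c: "c = 1 + \<i> * of_real (Im c)" using that by (simp add: complex_eq_iff)
    have "hankel_integral b s c = hankel_integral b s (1 + \<i> * of_real (Im c))" using c by simp
    then show ?thesis
      using lborel_integral_real_affine[of 1 "\<lambda>y. exp ((1 + \<i> * of_real y) powr of_real b) * (1 + \<i> * of_real y) powr s" "Im c"]
      unfolding hankel_integral_def by (simp add: algebra_simps)
  qed
  have "hankel_integral b s c - hankel_integral b s 1 = 0"
  proof (rule analytic_continuation[OF hol U _ _ _ _ line, of "{c. Re c = 1}" 1])
    show "connected ?U" by (intro convex_connected convex_halfspace_Re_gt)
    show "(1::complex) islimpt {c. Re c = 1}"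
      unfolding islimpt_approachable
    proof (intro allI impI)
      fix e :: real assume "e > 0"
      then show "\<exists>x'\<in>{c. Re c = 1}. x' \<noteq> (1::complex) \<and> dist x' 1 < e"
        by (intro bexI[of _ "1 + \<i> * of_real (e / 2)"]) (auto simp: dist_norm norm_mult)
    qed
  qed (use c in auto)
  then show ?thesis by simp
qed

text \<open>For \<open>0 < 1 - x\<close> small the line of integration can be moved to the imaginary axis, where the
  integral splits into two rotated Gamma integrals; Euler's reflection formula then gives
  \<open>1 / Gamma x\<close>.\<close>

lemma hankel_real:
  assumes b: "1 < b" "b < 2" and x: "(b - 1) / b \<le> x" "x < 1"
  shows "rGamma (complex_of_real x) = of_real (b / (2 * pi)) * hankel_integral b (of_real (b - 1 - b * x)) 1"
proof -
  define s where "s = b - 1 - b * x"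
  \<comment> \<open>These signs explain the interval for x: \<open>-1 < s\<close> makes
    \<open>\<bar>y\<bar> powr s\<close> integrable at 0, and \<open>s \<le> 0\<close> makes it a
    bound for \<open>norm w powr s\<close> on all lines at once.\<close>
  have s: "-1 < s" "s \<le> 0" using b x by (auto simp: s_def field_simps)
  define F where "F = (\<lambda>w::complex. exp (w powr of_real b) * w powr of_real s)"
  obtain \<kappa> C0 where \<kappa>: "\<kappa> > 0" and C0: "C0 > 0"
    "\<And>w. 0 \<le> Re w \<Longrightarrow> Re w \<le> 1 \<Longrightarrow> norm (exp (w powr of_real b)) \<le> C0 * exp (- (\<kappa> * norm w powr b))"
    using norm_exp_powr_le[OF b] by metis
  define W where "W = (\<lambda>y::real. C0 * (if y = 0 then 0 else \<bar>y\<bar> powr s * exp (- (\<kappa> * \<bar>y\<bar> powr b))))"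
  have W: "integrable lborel W"
    unfolding W_def using integrable_even_extension[OF powr_exp_integral(1)[of b s \<kappa>]] b s \<kappa>
    by (intro integrable_mult_right) auto
  have FW: "norm (F (of_real c + \<i> * of_real y)) \<le> W y" if c: "0 \<le> c" "c \<le> 1" and y: "y \<noteq> 0" for c y :: real
  proof -
    let ?w = "of_real c + \<i> * of_real y"
    have yw: "\<bar>y\<bar> \<le> norm ?w" using abs_Im_le_cmod[of ?w] by simp
    have "norm (F ?w) = norm (exp (?w powr of_real b)) * norm ?w powr s"
      by (simp add: F_def norm_mult norm_powr_real_powr')
    also have "\<dots> \<le> (C0 * exp (- (\<kappa> * norm ?w powr b))) * \<bar>y\<bar> powr s"
      using C0 c y s yw by (intro mult_mono powr_mono2') auto
    also have "\<dots> \<le> (C0 * exp (- (\<kappa> * \<bar>y\<bar> powr b))) * \<bar>y\<bar> powr s"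
      using C0 \<kappa> yw b by (intro mult_right_mono mult_left_mono) (auto intro!: powr_mono2)
    finally show ?thesis using y by (simp add: W_def mult_ac)
  qed
  have meas0: "(\<lambda>y. F (\<i> * of_real y)) \<in> borel_measurable lborel"
  proof -
    have "continuous_on (UNIV - {0}) (\<lambda>y::real. F (\<i> * of_real y))"
      unfolding F_def by (intro continuous_intros) (auto simp: complex_nonpos_Reals_iff)
    then have "(\<lambda>y. indicat_real (UNIV - {0}) y *\<^sub>R F (\<i> * of_real y)) \<in> borel_measurable lborel"
      by (intro borel_measurable_indicator_continuous) auto
    moreover have "(\<lambda>y. indicat_real (UNIV - {0}) y *\<^sub>R F (\<i> * of_real y)) = (\<lambda>y. F (\<i> * of_real y))"
      by (auto simp: fun_eq_iff indicator_def F_def)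
    ultimately show ?thesis by simp
  qed
  define c where "c = (\<lambda>n::nat. 1 / (real n + 1))"
  have c: "0 < c n" "c n \<le> 1" for n by (auto simp: c_def)
  have clim: "c \<longlonglongrightarrow> 0" unfolding c_def by real_asymp
  have ne: "AE y::real in lborel. y \<noteq> 0" by (rule AE_lborel_singleton)
  have "(\<lambda>n. \<integral>y. F (of_real (c n) + \<i> * of_real y) \<partial>lborel) \<longlonglongrightarrow> (\<integral>y. F (\<i> * of_real y) \<partial>lborel)"
  proof (rule integral_dominated_convergence[where w = W])
    show "AE y in lborel. norm (F (of_real (c n) + \<i> * of_real y)) \<le> W y" for n
      using ne by (rule AE_mp) (rule AE_I2, use FW[of "c n"] c[of n] in auto)
    have "(\<lambda>n. F (of_real (c n) + \<i> * of_real y)) \<longlonglongrightarrow> F (\<i> * of_real y)" if "y \<noteq> 0" for y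
    proof -
      have "(\<lambda>n. of_real (c n) + \<i> * of_real y) \<longlonglongrightarrow> of_real 0 + \<i> * of_real y"
        by (intro tendsto_intros clim)
      then have 1: "(\<lambda>n. of_real (c n) + \<i> * of_real y) \<longlonglongrightarrow> \<i> * of_real y" by simp
      have 2: "\<i> * of_real y \<notin> \<real>\<^sub>\<le>\<^sub>0" using that by (auto simp: complex_nonpos_Reals_iff)
      show ?thesis unfolding F_def
        by (intro tendsto_intros tendsto_powr_complex 1 2)
    qed
    then show "AE y in lborel. (\<lambda>n. F (of_real (c n) + \<i> * of_real y)) \<longlonglongrightarrow> F (\<i> * of_real y)"
      by - (rule AE_mp[OF ne], rule AE_I2, simp)
    show "(\<lambda>y. F (of_real (c n) + \<i> * of_real y)) \<in> borel_measurable lborel" for n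
      unfolding F_def using hankel_integrand_measurable[of "of_real (c n)" b "of_real s"] c[of n] by simp
  qed (use W meas0 in auto)
  moreover have "(\<integral>y. F (of_real (c n) + \<i> * of_real y) \<partial>lborel) = hankel_integral b (of_real s) 1" for n
    using hankel_integral_const[OF b, of "of_real (c n)" "of_real s"] c[of n]
    by (simp add: hankel_integral_def F_def)
  ultimately have "(\<lambda>n::nat. hankel_integral b (of_real s) 1) \<longlonglongrightarrow> (\<integral>y. F (\<i> * of_real y) \<partial>lborel)" by simp
  then have "hankel_integral b (of_real s) 1 = (\<integral>y. F (\<i> * of_real y) \<partial>lborel)"
    by (simp add: LIMSEQ_const_iff)
  also have "\<dots> = (LINT y:{0<..}|lborel. F (\<i> * of_real y)) + (LINT y:{0<..}|lborel. F (\<i> * of_real (- y)))"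
  proof (rule integral_split_at_zero)
    show "integrable lborel (\<lambda>y. F (\<i> * of_real y))"
    proof (rule Bochner_Integration.integrable_bound[OF W meas0])
      show "AE y in lborel. norm (F (\<i> * of_real y)) \<le> norm (W y)"
        using ne by (rule AE_mp) (rule AE_I2, use FW[of 0] in \<open>auto intro: order_trans[OF _ abs_ge_self]\<close>)
    qed
  qed (simp add: F_def)
  also have half: "(LINT y:{0<..}|lborel. F (\<i> * of_real (\<sigma> * y))) =
      of_real (Gamma (1 - x) / b) * cis (\<sigma> * (pi * (1 - x) - pi / 2))" if \<sigma>: "\<sigma> = 1 \<or> \<sigma> = -1" for \<sigma> :: real
  proof -
    \<comment> \<open>Here \<open>- v\<close> is the power b of
      \<open>\<i> * of_real \<sigma>\<close>. For b between 1 and 2 its real part is negative, so v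
      is admissible in \<open>powr_exp_integral_complex\<close>.\<close>
    define v where "v = cis (\<sigma> * (b * pi / 2 - pi))"
    have "cos (b * pi / 2) < cos (pi / 2)" using b by (intro cos_monotone_0_pi) auto
    then have "Re v > 0" using \<sigma> by (auto simp: v_def cos_diff)
    have Fv: "F (\<i> * of_real (\<sigma> * y)) = cis (\<sigma> * (s * pi / 2)) * (of_real (y powr s) * exp (- (v * of_real (y powr b))))"
      if "y > 0" for y
    proof -
      have z: "\<i> * of_real (\<sigma> * y) = of_real y * cis (\<sigma> * (pi / 2))" using \<sigma> by (auto simp: complex_eq_iff)
      have pw: "(of_real y * cis (\<sigma> * (pi / 2))) powr of_real t = of_real (y powr t) * cis (\<sigma> * (t * pi / 2))" for t
        using powr_polar[of y "\<sigma> * (pi / 2)" t] that \<sigma> by (auto simp: mult_ac)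
      have "- v = cis (\<sigma> * (b * pi / 2))"
        using \<sigma> by (auto simp: v_def complex_eq_iff cos_diff sin_diff)
      then have e: "of_real (y powr b) * cis (\<sigma> * (b * pi / 2)) = - (v * of_real (y powr b))"
        by (metis mult.commute mult_minus_left)
      show ?thesis unfolding F_def z pw e by (simp add: mult_ac)
    qed
    have "(LINT y:{0<..}|lborel. F (\<i> * of_real (\<sigma> * y))) =
        (LINT y:{0<..}|lborel. cis (\<sigma> * (s * pi / 2)) * (of_real (y powr s) * exp (- (v * of_real (y powr b)))))"
      by (intro set_lebesgue_integral_cong) (use Fv in auto)
    also have "\<dots> = cis (\<sigma> * (s * pi / 2)) * (LINT y:{0<..}|lborel. of_real (y powr s) * exp (- (v * of_real (y powr b))))"
      by (rule set_integral_mult_right)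
    also have "(LINT y:{0<..}|lborel. of_real (y powr s) * exp (- (v * of_real (y powr b)))) =
        of_real (Gamma ((s + 1) / b) / b) * v powr of_real (- ((s + 1) / b))"
      by (rule powr_exp_integral_complex) (use b s \<open>Re v > 0\<close> in auto)
    also have "(s + 1) / b = 1 - x" using b by (simp add: s_def field_simps)
    also have "v powr of_real (- (1 - x)) = cis (- (1 - x) * (\<sigma> * (b * pi / 2 - pi)))"
    proof -
      have "b * pi / 2 - pi < pi" "- pi < b * pi / 2 - pi" "b * pi / 2 - pi \<le> 0" using b by auto
      then show ?thesis
        using powr_polar[of 1 "\<sigma> * (b * pi / 2 - pi)" "- (1 - x)"] \<sigma> by (auto simp: v_def)
    qed
    also have "cis (\<sigma> * (s * pi / 2)) * (of_real (Gamma (1 - x) / b) * cis (- (1 - x) * (\<sigma> * (b * pi / 2 - pi)))) =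
        of_real (Gamma (1 - x) / b) * cis (\<sigma> * (pi * (1 - x) - pi / 2))"
    proof -
      have "\<sigma> * (s * pi / 2) + - (1 - x) * (\<sigma> * (b * pi / 2 - pi)) = \<sigma> * (pi * (1 - x) - pi / 2)"
        by (simp add: s_def algebra_simps) (simp add: field_simps)
      then show ?thesis by (metis cis_mult mult.left_commute)
    qed
    finally show ?thesis .
  qed
  \<comment> \<open>The two rotated Gamma integrals are complex conjugates, and their sum produces
    the sine of the reflection formula.\<close>
  have "(LINT y:{0<..}|lborel. F (\<i> * of_real y)) + (LINT y:{0<..}|lborel. F (\<i> * of_real (- y))) =
     of_real (Gamma (1 - x) / b) * (cis (pi * (1 - x) - pi / 2) + cis (- (pi * (1 - x) - pi / 2)))"
    using half[of 1] half[of "-1"] by (simp add: algebra_simps)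
  also have "cis (pi * (1 - x) - pi / 2) + cis (- (pi * (1 - x) - pi / 2)) = of_real (2 * sin (pi * x))"
    by (simp add: complex_eq_iff cos_diff sin_diff algebra_simps)
  finally have "hankel_integral b (of_real s) 1 = of_real (Gamma (1 - x) / b) * of_real (2 * sin (pi * x))" by simp
  then have "of_real (b / (2 * pi)) * hankel_integral b (of_real s) 1 = of_real (sin (pi * x) * Gamma (1 - x) / pi)"
    using b by simp
  also have "\<dots> = rGamma (complex_of_real x)"
  proof -
    have "0 < x" using b x by (smt (verit) divide_pos_pos)
    have "Gamma (of_real x :: complex) * Gamma (1 - of_real x) = of_real pi / sin (of_real pi * of_real x)"
      by (rule Gamma_reflection_complex)
    then have "Gamma x * Gamma (1 - x) = pi / sin (pi * x)"
      by (metis (mono_tags, lifting) Gamma_complex_of_real of_real_1 of_real_diff of_real_divide of_real_eq_iff of_real_mult sin_of_real)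
    moreover have "sin (pi * x) > 0" using \<open>0 < x\<close> x by (intro sin_gt_zero) auto
    moreover have "Gamma x > 0" using \<open>0 < x\<close> by simp
    ultimately have "sin (pi * x) * Gamma (1 - x) / pi = 1 / Gamma x" by (simp add: field_simps)
    also have "\<dots> = rGamma x" by (simp add: rGamma_inverse_Gamma divide_inverse)
    finally show ?thesis by (simp add: rGamma_complex_of_real)
  qed
  finally show ?thesis by (simp add: s_def)
qed

section \<open>The Mittag-Leffler function\<close>

text \<open>Both sides are entire in z, so the real interval treated in \<open>hankel_real\<close>
  is enough.\<close>

lemma hankel:
  assumes b: "1 < b" "b < 2"
  shows "rGamma z = of_real (b / (2 * pi)) * hankel_integral b (of_real (b - 1) - of_real b * z) 1"
proof -
  let ?h = "\<lambda>z. hankel_integral b (of_real (b - 1) - of_real b * z) 1"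
  have ne: "1 + \<i> * of_real y \<noteq> 0" for y :: real by (auto simp: complex_eq_iff)
  have "?h holomorphic_on UNIV"
    unfolding hankel_integral_def
  proof (rule holomorphic_integral[OF open_UNIV])
    fix y :: real
    show "(\<lambda>z. exp ((1 + \<i> * of_real y) powr of_real b) * (1 + \<i> * of_real y) powr (of_real (b - 1) - of_real b * z)) holomorphic_on UNIV"
      using ne[of y] by (intro holomorphic_intros)
  next
    fix z0 :: complex
    define R where "R = b + b * (norm z0 + 1)"
    have R: "R \<ge> 0" using b by (simp add: R_def)
    obtain C where C: "C \<ge> 0" "\<And>w s. 1 \<le> Re w \<Longrightarrow> Re w \<le> 1 \<Longrightarrow> norm s \<le> R \<Longrightarrow>
        norm (exp (w powr of_real b) * w powr s) \<le> C * exp (- norm w)"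
      using norm_exp_powr_mult_powr_le[OF b zero_less_one R, of 1] by metis
    have "norm (exp ((1 + \<i> * of_real y) powr of_real b) * (1 + \<i> * of_real y) powr (of_real (b - 1) - of_real b * z)) \<le> C * exp (- \<bar>y\<bar>)"
      if "z \<in> ball z0 1" for z y
    proof -
      have "norm z \<le> norm z0 + norm (z - z0)" by (metis add.commute diff_add_cancel norm_triangle_ineq)
      then have z: "norm z \<le> norm z0 + 1" using that by (simp add: dist_norm norm_minus_commute)
      have "norm (of_real (b - 1) - of_real b * z) \<le> norm (complex_of_real (b - 1)) + norm (of_real b * z)" by (rule norm_triangle_ineq4)
      also have "\<dots> \<le> b + b * (norm z0 + 1)"
        unfolding norm_mult norm_of_real using b z by (intro add_mono mult_mono) auto
      finally have "norm (exp ((1 + \<i> * of_real y) powr of_real b) * (1 + \<i> * of_real y) powr (of_real (b - 1) - of_real b * z)) \<le> C * exp (- norm (1 + \<i> * of_real y))"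
        by (intro C(2)) (auto simp: R_def)
      also have "\<dots> \<le> C * exp (- \<bar>y\<bar>)"
        using C abs_Im_le_cmod[of "1 + \<i> * of_real y"] by (intro mult_left_mono) auto
      finally show ?thesis .
    qed
    then show "\<exists>e>0. \<exists>w. integrable lborel w \<and> (\<forall>z\<in>ball z0 e \<inter> UNIV. \<forall>y\<in>space lborel.
        norm (exp ((1 + \<i> * of_real y) powr of_real b) * (1 + \<i> * of_real y) powr (of_real (b - 1) - of_real b * z)) \<le> w y)"
      using integrable_exp_minus_abs
      by (intro exI[of _ 1] conjI exI[of _ "\<lambda>y. C * exp (- \<bar>y\<bar>)"]) auto
  qed (use hankel_integrand_measurable[of 1] in simp)
  then have hol: "(\<lambda>z. rGamma z - of_real (b / (2 * pi)) * ?h z) holomorphic_on UNIV"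
    by (intro holomorphic_on_diff holomorphic_on_mult holomorphic_on_const holomorphic_rGamma)
  define x0 where "x0 = ((b - 1) / b + 1) / 2"
  have lt: "(b - 1) / b < 1" using b by (simp add: field_simps)
  have "rGamma z - of_real (b / (2 * pi)) * ?h z = 0"
  proof (rule analytic_continuation[OF hol open_UNIV connected_UNIV, of "of_real ` {(b - 1) / b..<1}" "of_real x0"])
    show "complex_of_real x0 islimpt of_real ` {(b - 1) / b..<1}"
      unfolding islimpt_approachable
    proof (intro allI impI)
      fix e :: real assume e: "e > 0"
      define x where "x = (x0 + min 1 (x0 + e)) / 2"
      have mid: "a < (a + m) / 2 \<and> (a + m) / 2 < m" if "a < m" for a m :: real using that by simp
      from mid[OF lt] have x0: "(b - 1) / b < x0" and x01: "x0 < 1" by (simp_all only: x0_def)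
      have "x0 < min 1 (x0 + e)" using e x01 by simp
      from mid[OF this] have "x0 < x" "x < min 1 (x0 + e)" by (simp_all only: x_def)
      then have x: "x0 < x" "x < 1" "x - x0 < e" by auto
      show "\<exists>x'\<in>of_real ` {(b - 1) / b..<1}. x' \<noteq> complex_of_real x0 \<and> dist x' (of_real x0) < e"
      proof (rule bexI)
        show "complex_of_real x \<noteq> of_real x0 \<and> dist (complex_of_real x) (of_real x0) < e"
          using x by (simp add: dist_of_real dist_real_def)
        show "complex_of_real x \<in> of_real ` {(b - 1) / b..<1}" using x x0 by (intro imageI) auto
      qed
    qed
    fix z assume "z \<in> complex_of_real ` {(b - 1) / b..<1}"
    then obtain x where "z = of_real x" "(b - 1) / b \<le> x" "x < 1" by auto
    then show "rGamma z - of_real (b / (2 * pi)) * ?h z = 0"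
      using hankel_real[OF b, of x] by simp
  qed auto
  then show ?thesis by simp
qed

section \<open>Entire power series, angular margins and bounds for the Mittag-Leffler series\<close>

lemma entire_power_series:
  assumes "\<And>t. (\<lambda>j. c j * t ^ j) sums E t"
  shows "E holomorphic_on A"
proof -
  have "E holomorphic_on UNIV"
    unfolding holomorphic_on_open[OF open_UNIV]
  proof
    fix t :: complex
    have "E holomorphic_on ball 0 (norm t + 1)"
      by (rule power_series_holomorphic[of _ _ c]) (use assms in simp)
    then show "\<exists>f'. (E has_field_derivative f') (at t)"
      unfolding holomorphic_on_open[OF open_ball] by auto
  qed
  then show ?thesis using holomorphic_on_subset by blast
qed

lemma cos_le_cos_margin:
  assumes "0 \<le> \<eta>" "\<eta> \<le> x" "x \<le> 2 * pi - \<eta>"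
  shows "cos x \<le> cos \<eta>"
proof (cases "x \<le> pi")
  case True
  then show ?thesis using assms by (intro cos_monotone_0_pi_le) auto
next
  case False
  have "cos x = cos (2 * pi - x)" by simp
  also have "\<dots> \<le> cos \<eta>" using assms False by (intro cos_monotone_0_pi_le) auto
  finally show ?thesis .
qed

text \<open>With \<open>k = max (cos \<eta>) 0\<close> the squared norm is at least
  \<open>(1 - k) * (1 + \<rho>\<^sup>2)\<close>. The first bound keeps the denominators of geometric
  series away from 0, the second supplies decay for large \<rho>.\<close>

lemma norm_polar_minus_one_ge:
  assumes \<eta>: "0 < \<eta>" "\<eta> \<le> pi"
  obtains \<mu> where "\<mu> > 0" "\<And>\<rho> x. 0 \<le> \<rho> \<Longrightarrow> \<eta> \<le> x \<Longrightarrow> x \<le> 2 * pi - \<eta> \<Longrightarrow> \<mu> \<le> norm (1 - of_real \<rho> * cis x)"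
    "\<And>\<rho> x. 0 \<le> \<rho> \<Longrightarrow> \<eta> \<le> x \<Longrightarrow> x \<le> 2 * pi - \<eta> \<Longrightarrow> \<mu> * \<rho> \<le> norm (1 - of_real \<rho> * cis x)"
proof -
  define k where "k = max (cos \<eta>) 0"
  have "cos \<eta> < cos 0" using \<eta> by (intro cos_monotone_0_pi) auto
  then have k: "0 \<le> k" "k < 1" by (auto simp: k_def)
  have *: "(1 - k) * (1 + \<rho>\<^sup>2) \<le> (norm (1 - of_real \<rho> * cis x))\<^sup>2"
    if "0 \<le> \<rho>" "\<eta> \<le> x" "x \<le> 2 * pi - \<eta>" for \<rho> x
  proof -
    have "cos x \<le> k" using cos_le_cos_margin[of \<eta> x] that \<eta> by (auto simp: k_def)
    then have "2 * \<rho> * cos x \<le> 2 * \<rho> * k" using that by (intro mult_left_mono) auto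
    moreover have "0 \<le> k * (1 - \<rho>)\<^sup>2" using k by simp
    then have "2 * \<rho> * k \<le> k * (1 + \<rho>\<^sup>2)" by (simp add: power2_eq_square algebra_simps)
    ultimately have le: "2 * \<rho> * cos x \<le> k * (1 + \<rho>\<^sup>2)" by simp
    have "(norm (1 - of_real \<rho> * cis x))\<^sup>2 = (1 - \<rho> * cos x)\<^sup>2 + (\<rho> * sin x)\<^sup>2"
      by (simp add: cmod_power2)
    also have "\<dots> = 1 - 2 * \<rho> * cos x + \<rho>\<^sup>2 * ((cos x)\<^sup>2 + (sin x)\<^sup>2)"
      by algebra
    finally have "(norm (1 - of_real \<rho> * cis x))\<^sup>2 = 1 + \<rho>\<^sup>2 - 2 * \<rho> * cos x" by simp
    with le show ?thesis by (simp add: algebra_simps)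
  qed
  show thesis
  proof (rule that[of "sqrt (1 - k)"])
    fix \<rho> x :: real assume h: "0 \<le> \<rho>" "\<eta> \<le> x" "x \<le> 2 * pi - \<eta>"
    have "(1 - k) * 1 \<le> (1 - k) * (1 + \<rho>\<^sup>2)" "(1 - k) * \<rho>\<^sup>2 \<le> (1 - k) * (1 + \<rho>\<^sup>2)"
      using k by (intro mult_left_mono; simp)+
    then have "1 - k \<le> (norm (1 - of_real \<rho> * cis x))\<^sup>2" "(1 - k) * \<rho>\<^sup>2 \<le> (norm (1 - of_real \<rho> * cis x))\<^sup>2"
      using order_trans[OF _ *[OF h]] by fastforce+
    then have sq: "(sqrt (1 - k))\<^sup>2 \<le> (norm (1 - of_real \<rho> * cis x))\<^sup>2"
      "(sqrt (1 - k) * \<rho>)\<^sup>2 \<le> (norm (1 - of_real \<rho> * cis x))\<^sup>2"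
      using k by (simp_all add: power_mult_distrib)
    show "sqrt (1 - k) \<le> norm (1 - of_real \<rho> * cis x)" by (rule power2_le_imp_le[OF sq(1) norm_ge_zero])
    show "sqrt (1 - k) * \<rho> \<le> norm (1 - of_real \<rho> * cis x)" by (rule power2_le_imp_le[OF sq(2) norm_ge_zero])
  qed (use k in auto)
qed

definition mittag_leffler :: "real \<Rightarrow> complex \<Rightarrow> complex" where
  "mittag_leffler K t = (\<Sum>j. of_real (1 / Gamma (1 + real j / K)) * t ^ j)"

text \<open>Keep only the part of Gamma's integral beyond X, where \<open>t powr s\<close> is at
  least \<open>X powr s\<close>.\<close>

lemma powr_le_exp_Gamma:
  fixes X s :: real
  assumes "0 < X" "0 \<le> s"
  shows "X powr s \<le> exp X * Gamma (1 + s)"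
proof -
  have G: "((\<lambda>t. t powr s / exp t) has_integral Gamma (1 + s)) {0..}"
    using Gamma_integral_real[of "1 + s"] assms by simp
  have "((\<lambda>t. X powr s * exp (- 1 * t)) has_integral X powr s * (exp (- 1 * X) / 1)) {X..}"
    by (intro has_integral_mult_right has_integral_exp_minus_to_infinity) auto
  then have "((\<lambda>t. if t \<in> {X..} then X powr s * exp (- 1 * t) else 0) has_integral X powr s * (exp (- 1 * X) / 1)) {0..}"
    by (subst has_integral_restrict) (use assms in auto)
  moreover have "(if t \<in> {X..} then X powr s * exp (- 1 * t) else 0) \<le> t powr s / exp t" for t
    using assms by (auto simp: exp_minus divide_inverse intro!: powr_mono2 mult_right_mono)
  ultimately have "X powr s * (exp (- 1 * X) / 1) \<le> Gamma (1 + s)"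
    by (intro has_integral_le[OF _ G]) auto
  then show ?thesis by (simp add: exp_minus field_simps)
qed

text \<open>The lower bound for Gamma is taken at \<open>X = (2 * \<rho>) powr K\<close>. The factor
  2 makes the terms geometric, so they can be summed.\<close>

lemma mittag_leffler_term_le:
  assumes K: "K > 0" and \<rho>: "0 \<le> \<rho>"
  shows "\<rho> ^ j / Gamma (1 + real j / K) \<le> (1 / 2) ^ j * exp (2 powr K * \<rho> powr K)"
proof (cases "\<rho> = 0")
  case True
  then show ?thesis by (cases j) auto
next
  case False
  have G: "Gamma (1 + real j / K) > 0" using K by (intro Gamma_real_pos) (simp add: add_pos_nonneg)
  have "((2 * \<rho>) powr K) powr (real j / K) \<le> exp ((2 * \<rho>) powr K) * Gamma (1 + real j / K)"
    using False \<rho> K by (intro powr_le_exp_Gamma) auto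
  moreover have "((2 * \<rho>) powr K) powr (real j / K) = (2 * \<rho>) ^ j"
    using False \<rho> K by (simp add: powr_powr powr_realpow)
  ultimately show ?thesis using G \<rho> by (simp add: field_simps powr_mult power_mult_distrib)
qed

lemma mittag_leffler_real:
  assumes K: "K > 0" and \<rho>: "0 \<le> \<rho>"
  shows "summable (\<lambda>j. 1 / Gamma (1 + real j / K) * \<rho> ^ j)"
    and "(\<Sum>j. 1 / Gamma (1 + real j / K) * \<rho> ^ j) \<le> 2 * exp (2 powr K * \<rho> powr K)"
proof -
  have G: "Gamma (1 + real j / K) > 0" for j using K by (intro Gamma_real_pos) (simp add: add_pos_nonneg)
  have le: "1 / Gamma (1 + real j / K) * \<rho> ^ j \<le> (1 / 2) ^ j * exp (2 powr K * \<rho> powr K)" for j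
    using mittag_leffler_term_le[OF assms, of j] by simp
  have geo: "(\<lambda>j. (1 / 2) ^ j * exp (2 powr K * \<rho> powr K)) sums (2 * exp (2 powr K * \<rho> powr K))"
    using sums_mult2[OF geometric_sums[of "1 / 2 :: real"]] by simp
  show s: "summable (\<lambda>j. 1 / Gamma (1 + real j / K) * \<rho> ^ j)"
    by (rule summable_comparison_test'[OF sums_summable[OF geo], of 0])
       (use le G \<rho> in \<open>auto simp: abs_of_pos less_imp_le\<close>)
  show "(\<Sum>j. 1 / Gamma (1 + real j / K) * \<rho> ^ j) \<le> 2 * exp (2 powr K * \<rho> powr K)"
    using suminf_le[OF le s sums_summable[OF geo]] geo by (simp add: sums_iff)
qed

lemma mittag_leffler_sums:
  assumes K: "K > 0"
  shows "(\<lambda>j. of_real (1 / Gamma (1 + real j / K)) * t ^ j) sums mittag_leffler K t"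
  unfolding mittag_leffler_def
proof (rule summable_sums, rule summable_norm_cancel)
  have G: "Gamma (1 + real j / K) > 0" for j using K by (intro Gamma_real_pos) (simp add: add_pos_nonneg)
  show "summable (\<lambda>j. norm (complex_of_real (1 / Gamma (1 + real j / K)) * t ^ j))"
    using mittag_leffler_real(1)[OF K norm_ge_zero[of t]] G by (simp add: norm_mult norm_power norm_divide abs_of_pos)
qed

text \<open>Inserting Hankel's integral for the reciprocal Gamma values and summing the geometric series
  under the integral represents the Mittag-Leffler function outside the sector where it grows.\<close>

lemma mittag_leffler_ray:
  assumes K: "K > 1 / 2" and \<gamma>: "pi / (2 * K) < \<gamma>" "\<gamma> < 2 * pi - pi / (2 * K)"
  obtains C where "\<And>\<rho>. 0 < \<rho> \<Longrightarrow> norm (mittag_leffler K (of_real \<rho> * cis \<gamma>)) \<le> C / \<rho>"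
proof -
  define \<phi>0 where "\<phi>0 = pi / (2 * K)"
  define \<gamma>' where "\<gamma>' = min \<gamma> (2 * pi - \<gamma>)"
  have \<phi>0: "0 < \<phi>0" using K by (simp add: \<phi>0_def)
  have \<gamma>': "\<phi>0 < \<gamma>'" "\<gamma>' \<le> pi" using \<gamma> by (auto simp: \<gamma>'_def \<phi>0_def)
  \<comment> \<open>On the line, \<open>w powr (b / K)\<close> has an argument of modulus at most
    \<open>b * \<phi>0\<close>. Taking b close to 1 keeps this below \<gamma>', and Hankel's
    integral asks for b below 2.\<close>
  define b where "b = min ((1 + \<gamma>' / \<phi>0) / 2) (3 / 2)"
  have 1: "1 < \<gamma>' / \<phi>0" using \<phi>0 \<gamma>' by simp
  have "1 < min ((1 + u) / 2) (3 / 2) \<and> min ((1 + u) / 2) (3 / 2) < 2 \<and> min ((1 + u) / 2) (3 / 2) < u"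
    if "1 < u" for u :: real using that by (auto simp: min_def)
  from this[OF 1] have b: "1 < b" "b < 2" "b < \<gamma>' / \<phi>0" by (auto simp: b_def)
  then have b\<phi>0: "b * \<phi>0 < \<gamma>'" using \<phi>0 b(3) by (metis pos_less_divide_eq)
  define \<phi>1 where "\<phi>1 = (b * \<phi>0 + \<gamma>') / 2"
  \<comment> \<open>S excludes the angles up to \<phi>1, which leaves the margin \<eta> between the
    arguments of \<open>t * q y\<close> and the positive axis.\<close>
  define \<eta> where "\<eta> = \<phi>1 - b * \<phi>0"
  have \<phi>1: "b * \<phi>0 < \<phi>1" "\<phi>1 < \<gamma>'"
    using less_half_sum[OF b\<phi>0] gt_half_sum[OF b\<phi>0] by (simp_all only: \<phi>1_def one_add_one)
  have "0 < b * \<phi>0" using b \<phi>0 by simp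
  then have \<eta>: "0 < \<eta>" "\<eta> \<le> pi" using \<phi>1 \<gamma>' by (auto simp: \<eta>_def)
  obtain \<mu> where \<mu>: "\<mu> > 0"
    "\<And>\<rho> x. 0 \<le> \<rho> \<Longrightarrow> \<eta> \<le> x \<Longrightarrow> x \<le> 2 * pi - \<eta> \<Longrightarrow> \<mu> \<le> norm (1 - of_real \<rho> * cis x)"
    "\<And>\<rho> x. 0 \<le> \<rho> \<Longrightarrow> \<eta> \<le> x \<Longrightarrow> x \<le> 2 * pi - \<eta> \<Longrightarrow> \<mu> * \<rho> \<le> norm (1 - of_real \<rho> * cis x)"
    using norm_polar_minus_one_ge[OF \<eta>] by metis
  define w where "w = (\<lambda>y. 1 + \<i> * complex_of_real y)"
  \<comment> \<open>The exponent \<open>- 1\<close> is \<open>b - 1 - b * z\<close> at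
    \<open>z = 1\<close>. As q is the power \<open>- 1 / K\<close> of Hankel's variable
    \<open>w powr b\<close>, the factor \<open>q y ^ j\<close> moves z from 1 to
    \<open>1 + real j / K\<close>.\<close>
  define e where "e = (\<lambda>y. exp (w y powr of_real b) * w y powr (- 1))"
  define q where "q = (\<lambda>y. w y powr of_real (- (b / K)))"
  define S where "S = sector pi (2 * pi - 2 * \<phi>1)"
  define G where "G = (\<lambda>t. \<integral>y. e y / (1 - t * q y) \<partial>lborel)"
  have w0: "w y \<noteq> 0" "Re (w y) = 1" for y by (auto simp: w_def complex_eq_iff)
  have nw: "1 \<le> norm (w y)" "\<bar>y\<bar> \<le> norm (w y)" for y
    using complex_Re_le_cmod[of "w y"] abs_Im_le_cmod[of "w y"] by (auto simp: w_def)
  have q_polar: "q y = of_real (norm (w y) powr (- (b / K))) * cis (- (b / K * Arg (w y)))" for y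
  proof -
    have "w y = of_real (norm (w y)) * cis (Arg (w y))" using w0 by (simp add: cis_Arg sgn_div_norm scaleR_conv_of_real)
    then show ?thesis
      using powr_polar[of "norm (w y)" "Arg (w y)" "- (b / K)"] w0[of y] Arg_bounded[of "w y"] by (simp add: q_def)
  qed
  have Argw: "\<bar>b / K * Arg (w y)\<bar> \<le> b * \<phi>0" for y
  proof -
    have "\<bar>Arg (w y)\<bar> \<le> pi / 2" using w0[of y] Arg_Re_nonneg by (metis zero_le_one)
    then have "b / K * \<bar>Arg (w y)\<bar> \<le> b / K * (pi / 2)" using b K by (intro mult_left_mono) auto
    then show ?thesis using b K by (simp add: abs_mult \<phi>0_def)
  qed
  have S_bound: "\<mu> \<le> norm (1 - t * q y) \<and> \<mu> * (norm t * norm (w y) powr (- (b / K))) \<le> norm (1 - t * q y)"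
    if "t \<in> S" for t y
  proof -
    from that have "t \<in> sector pi (2 * pi - 2 * \<phi>1)" by (simp add: S_def)
    then obtain \<rho> \<psi> where t: "t = of_real \<rho> * cis \<psi>" "0 < \<rho>"
        "\<bar>\<psi> - pi\<bar> < (2 * pi - 2 * \<phi>1) / 2" "norm t = \<rho>"
      by (rule sectorE)
    have tq: "t * q y = of_real (\<rho> * norm (w y) powr (- (b / K))) * cis (\<psi> - b / K * Arg (w y))"
    proof -
      have c: "cis \<psi> * cis (- (b / K * Arg (w y))) = cis (\<psi> - b / K * Arg (w y))" by (simp add: cis_mult)
      have "t * q y = of_real (\<rho> * norm (w y) powr (- (b / K))) * (cis \<psi> * cis (- (b / K * Arg (w y))))"
        unfolding t(1) q_polar by simp
      then show ?thesis unfolding c .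
    qed
    have "\<bar>\<psi> - pi\<bar> < pi - \<phi>1" using t(3) by simp
    then have "\<phi>1 < \<psi>" "\<psi> < 2 * pi - \<phi>1" unfolding abs_less_iff by auto
    moreover have "- (b * \<phi>0) \<le> b / K * Arg (w y)" "b / K * Arg (w y) \<le> b * \<phi>0"
      using Argw[of y] unfolding abs_le_iff by auto
    ultimately have x: "\<eta> \<le> \<psi> - b / K * Arg (w y)" "\<psi> - b / K * Arg (w y) \<le> 2 * pi - \<eta>"
      unfolding \<eta>_def by (simp_all only: le_diff_eq diff_le_eq)
    have "0 \<le> \<rho> * norm (w y) powr (- (b / K))" using t by simp
    from \<mu>(2)[OF this x] \<mu>(3)[OF this x] show ?thesis unfolding tq t(4) by blast
  qed
  \<comment> \<open>R admits the exponents \<open>- 1\<close> and \<open>b / K - 1\<close>; the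
    second arises on division by \<open>norm (q y)\<close> in the final estimate.\<close>
  define R where "R = 1 + \<bar>b / K - 1\<bar>"
  obtain C where C: "C \<ge> 0" "\<And>w s. 1 \<le> Re w \<Longrightarrow> Re w \<le> 1 \<Longrightarrow> norm s \<le> R \<Longrightarrow>
        norm (exp (w powr of_real b) * w powr s) \<le> C * exp (- norm w)"
    using norm_exp_powr_mult_powr_le[OF b(1,2) zero_less_one, of R 1] by (auto simp: R_def)
  have Cw: "norm (exp (w y powr of_real b) * w y powr s) \<le> C * exp (- \<bar>y\<bar>)" if "norm s \<le> R" for s y
  proof -
    have "norm (exp (w y powr of_real b) * w y powr s) \<le> C * exp (- norm (w y))"
      using C(2)[of "w y" s] w0 that by simp
    also have "\<dots> \<le> C * exp (- \<bar>y\<bar>)" using C nw by (intro mult_left_mono) auto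
    finally show ?thesis .
  qed
  have e_bound: "norm (e y) \<le> C * exp (- \<bar>y\<bar>)" for y
    unfolding e_def by (rule Cw) (simp add: R_def)
  have cont: "continuous_on UNIV e" "continuous_on UNIV q"
    unfolding e_def q_def w_def
    by (intro continuous_intros; use w0 in \<open>force simp: w_def complex_eq_iff\<close>)+
  have meas: "(\<lambda>y. e y / (1 - t * q y)) \<in> borel_measurable lborel" if "\<And>y. 1 - t * q y \<noteq> 0" for t
  proof -
    have "continuous_on UNIV (\<lambda>y. e y / (1 - t * q y))"
      by (intro continuous_intros cont) (use that in auto)
    then show ?thesis using borel_measurable_continuous_onI by simp
  qed
  have ne: "1 - t * q y \<noteq> 0" if "t \<in> S" for t y using S_bound[OF that, of y] \<mu>(1) by auto
  have G_hol: "G holomorphic_on S"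
    unfolding G_def
  proof (rule holomorphic_integral)
    show "open S" by (simp add: S_def open_sector)
    show "(\<lambda>t. e y / (1 - t * q y)) holomorphic_on S" for y
      using ne by (intro holomorphic_intros) auto
    fix t0 assume "t0 \<in> S"
    have "norm (e y / (1 - t * q y)) \<le> C * exp (- \<bar>y\<bar>) / \<mu>" if "t \<in> S" for t y
      unfolding norm_divide using S_bound[OF that, of y] \<mu>(1) e_bound[of y] C by (intro frac_le) auto
    then show "\<exists>e'>0. \<exists>w. integrable lborel w \<and> (\<forall>t\<in>ball t0 e' \<inter> S. \<forall>y\<in>space lborel. norm (e y / (1 - t * q y)) \<le> w y)"
      using integrable_exp_minus_abs
      by (intro exI[of _ 1] conjI exI[of _ "\<lambda>y. C * exp (- \<bar>y\<bar>) / \<mu>"]) auto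
  qed (use meas ne in auto)
  have coeff: "of_real (b / (2 * pi)) * (\<integral>y. e y * q y ^ j \<partial>lborel) = of_real (1 / Gamma (1 + real j / K))" for j
  proof -
    have "e y * q y ^ j = exp (w y powr of_real b) * w y powr (of_real (b - 1) - of_real b * of_real (1 + real j / K))" for y
    proof -
      have "q y = exp (of_real (- (b / K)) * Ln (w y))" unfolding q_def powr_def using w0(1)[of y] by simp
      then have "q y ^ j = exp (of_nat j * (of_real (- (b / K)) * Ln (w y)))"
        by (simp only: exp_of_nat_mult)
      moreover have "w y powr (- 1) = exp (- 1 * Ln (w y))" unfolding powr_def using w0(1)[of y] by simp
      ultimately have "w y powr (- 1) * q y ^ j = exp (- 1 * Ln (w y) + of_nat j * (of_real (- (b / K)) * Ln (w y)))"
        by (simp only: exp_add)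
      also have "\<dots> = w y powr (- 1 + of_nat j * of_real (- (b / K)))"
        unfolding powr_def using w0(1)[of y] by (simp only: ring_distribs mult.assoc if_False)
      also have "- 1 + of_nat j * complex_of_real (- (b / K)) = of_real (b - 1) - of_real b * of_real (1 + real j / K)"
        by (simp add: field_simps)
      finally show ?thesis by (simp add: e_def mult.assoc)
    qed
    then have "of_real (b / (2 * pi)) * (\<integral>y. e y * q y ^ j \<partial>lborel) = rGamma (complex_of_real (1 + real j / K))"
      unfolding hankel[OF b(1,2), of "complex_of_real (1 + real j / K)"] hankel_integral_def by (simp add: w_def)
    also have "\<dots> = of_real (rGamma (1 + real j / K))" by (rule rGamma_complex_of_real)
    also have "rGamma (1 + real j / K) = 1 / Gamma (1 + real j / K)"
      by (simp add: rGamma_inverse_Gamma divide_inverse)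
    finally show ?thesis .
  qed
  \<comment> \<open>As \<open>norm (w y) \<ge> 1\<close>, q has norm at most 1 and the geometric
    series converges in the unit disc; \<open>eq\<close> carries the formula to all of S.\<close>
  have G_small: "of_real (b / (2 * pi)) * G t = mittag_leffler K t" if t: "norm t < 1" for t
  proof -
    have q1: "norm (q y) \<le> 1" for y
    proof -
      have "norm (w y) powr (- (b / K)) \<le> 1 powr (- (b / K))" using nw[of y] b K by (intro powr_mono2') auto
      then show ?thesis by (simp add: q_polar norm_mult)
    qed
    have tq: "norm (t * q y) \<le> norm t" for y using mult_left_mono[OF q1[of y], of "norm t"] by (simp add: norm_mult)
    have "(\<lambda>j. \<integral>y. t ^ j * (e y * q y ^ j) \<partial>lborel) sums (\<integral>y. e y / (1 - t * q y) \<partial>lborel)"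
    proof (rule integral_sums_dominated(1)[where w = "\<lambda>y. C * exp (- \<bar>y\<bar>) / (1 - norm t)"])
      show "(\<lambda>y. t ^ j * (e y * q y ^ j)) \<in> borel_measurable lborel" for j
        using borel_measurable_continuous_onI[of "\<lambda>y. t ^ j * (e y * q y ^ j)"] by (simp add: continuous_intros cont)
      show "integrable lborel (\<lambda>y. C * exp (- \<bar>y\<bar>) / (1 - norm t))" using integrable_exp_minus_abs by auto
      fix y :: real
      have "(\<lambda>j. e y * (t * q y) ^ j) sums (e y * (1 / (1 - t * q y)))"
        using tq[of y] t by (intro sums_mult geometric_sums) auto
      then show "(\<lambda>j. t ^ j * (e y * q y ^ j)) sums (e y / (1 - t * q y))"
        by (simp add: power_mult_distrib mult_ac)
      fix n
      have "(\<Sum>j<n. norm (t ^ j * (e y * q y ^ j))) = norm (e y) * (\<Sum>j<n. norm (t * q y) ^ j)"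
        by (simp add: sum_distrib_left norm_mult norm_power power_mult_distrib mult_ac)
      also have "\<dots> \<le> (C * exp (- \<bar>y\<bar>)) * (1 / (1 - norm t))"
      proof (rule mult_mono[OF e_bound])
        have "(\<Sum>j<n. norm (t * q y) ^ j) \<le> (\<Sum>j<n. norm t ^ j)" by (intro sum_mono power_mono tq) auto
        also have "\<dots> \<le> (\<Sum>j. norm t ^ j)" using t by (intro sum_le_suminf) (auto intro: summable_geometric)
        finally show "(\<Sum>j<n. norm (t * q y) ^ j) \<le> 1 / (1 - norm t)" using t by (simp add: suminf_geometric)
      qed (use C in \<open>auto intro: sum_nonneg\<close>)
      finally show "(\<Sum>j<n. norm (t ^ j * (e y * q y ^ j))) \<le> C * exp (- \<bar>y\<bar>) / (1 - norm t)" by simp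
    qed
    from sums_mult[OF this, of "of_real (b / (2 * pi))"]
    have "(\<lambda>j. of_real (b / (2 * pi)) * (\<integral>y. t ^ j * (e y * q y ^ j) \<partial>lborel)) sums (of_real (b / (2 * pi)) * G t)"
      by (simp add: G_def)
    moreover have "of_real (b / (2 * pi)) * (\<integral>y. t ^ j * (e y * q y ^ j) \<partial>lborel) = of_real (1 / Gamma (1 + real j / K)) * t ^ j" for j
      unfolding coeff[symmetric] by (subst Bochner_Integration.integral_mult_right_zero) (simp only: mult_ac)
    ultimately show ?thesis
      using mittag_leffler_sums[of K t] K by (auto dest: sums_unique2)
  qed
  have eq: "of_real (b / (2 * pi)) * G t - mittag_leffler K t = 0" if t: "t \<in> S" for t
  proof -
    have Sw: "S = wedge \<phi>1 (2 * pi - \<phi>1)" by (simp add: S_def sector_eq_wedge diff_divide_distrib)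
    have ne: "S \<inter> ball 0 1 \<noteq> {}" unfolding Sw by (rule wedge_Int_ball_nonempty) (use \<phi>1 \<gamma>' in auto)
    then obtain \<xi> where \<xi>: "\<xi> \<in> S \<inter> ball 0 1" by blast
    show ?thesis
    proof (rule analytic_continuation[of "\<lambda>t. of_real (b / (2 * pi)) * G t - mittag_leffler K t" S "S \<inter> ball 0 1" \<xi>])
      show "(\<lambda>t. of_real (b / (2 * pi)) * G t - mittag_leffler K t) holomorphic_on S"
        using G_hol entire_power_series[OF mittag_leffler_sums, of K] K by (intro holomorphic_intros) auto
      show "\<xi> islimpt S \<inter> ball 0 1"
        by (rule open_imp_islimpt) (use \<xi> in \<open>auto simp: S_def open_sector\<close>)
      show "open S" "connected S" by (simp_all only: Sw open_wedge connected_wedge)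
    qed (use \<xi> t G_small in auto)
  qed
  define I where "I = (\<integral>y. C * exp (- \<bar>y\<bar>) \<partial>lborel) / \<mu>"
  show thesis
  proof (rule that[of "b / (2 * pi) * I"])
    fix \<rho> :: real assume \<rho>: "0 < \<rho>"
    define t where "t = of_real \<rho> * cis \<gamma>"
    have tS: "t \<in> S" unfolding S_def
    proof (rule sectorI[OF t_def \<rho>])
      have "\<phi>1 < \<gamma>" "\<phi>1 < 2 * pi - \<gamma>" using \<phi>1 by (auto simp: \<gamma>'_def)
      then have "\<bar>\<gamma> - pi\<bar> < pi - \<phi>1" unfolding abs_less_iff by auto
      then show "\<bar>\<gamma> - pi\<bar> < (2 * pi - 2 * \<phi>1) / 2" by simp
    qed
    have nt: "norm t = \<rho>" using \<rho> by (simp add: t_def norm_mult)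
    \<comment> \<open>The second lower bound in \<open>S_bound\<close> gives the factor
      \<open>1 / \<rho>\<close>; the growth of \<open>1 / q y\<close> is absorbed by the decay of
      the exponential along the line.\<close>
    have le: "norm (e y / (1 - t * q y)) \<le> C * exp (- \<bar>y\<bar>) / (\<mu> * \<rho>)" for y
    proof -
      have p: "0 < \<mu> * (\<rho> * norm (w y) powr (- (b / K)))" using \<mu>(1) \<rho> w0 by simp
      have q: "\<mu> * (\<rho> * norm (w y) powr (- (b / K))) \<le> norm (1 - t * q y)" using S_bound[OF tS, of y] unfolding nt by blast
      have "norm (e y / (1 - t * q y)) \<le> norm (e y) / (\<mu> * (\<rho> * norm (w y) powr (- (b / K))))"
        unfolding norm_divide by (intro divide_left_mono norm_ge_zero mult_pos_pos less_le_trans[OF p q] p q)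
      also have "\<dots> = norm (exp (w y powr of_real b) * w y powr of_real (b / K - 1)) / (\<mu> * \<rho>)"
      proof -
        have "norm (w y powr (- 1)) = norm (w y) powr (- 1)"
          using norm_powr_real_powr'[of "- 1 :: complex" "w y"] by simp
        moreover have "norm (w y powr of_real (b / K - 1)) = norm (w y) powr (b / K - 1)"
          using norm_powr_real_powr'[of "of_real (b / K - 1)" "w y"] by simp
        moreover have "norm (w y) powr (b / K - 1) = norm (w y) powr (- 1) / norm (w y) powr (- (b / K))"
          using w0 by (simp add: powr_diff powr_minus field_simps)
        ultimately show ?thesis by (simp add: e_def norm_mult)
      qed
      also have "\<dots> \<le> C * exp (- \<bar>y\<bar>) / (\<mu> * \<rho>)"
      proof -
        have "norm (complex_of_real (b / K - 1)) \<le> R" unfolding R_def norm_of_real by simp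
        from Cw[OF this] show ?thesis using \<mu>(1) \<rho> by (intro divide_right_mono) auto
      qed
      finally show ?thesis .
    qed
    have int1: "integrable lborel (\<lambda>y::real. C * exp (- \<bar>y\<bar>) / (\<mu> * \<rho>))"
      using integrable_exp_minus_abs by simp
    have int2: "integrable lborel (\<lambda>y. e y / (1 - t * q y))"
    proof (rule Bochner_Integration.integrable_bound[OF int1])
      show "(\<lambda>y. e y / (1 - t * q y)) \<in> borel_measurable lborel" by (rule meas[OF ne[OF tS]])
      show "AE y in lborel. norm (e y / (1 - t * q y)) \<le> norm (C * exp (- \<bar>y\<bar>) / (\<mu> * \<rho>))"
        using le by (intro AE_I2) (metis abs_ge_self order_trans real_norm_def)
    qed
    have "norm (G t) \<le> (\<integral>y. C * exp (- \<bar>y\<bar>) / (\<mu> * \<rho>) \<partial>lborel)"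
      unfolding G_def by (rule Bochner_Integration.integral_norm_bound_integral[OF int2 int1]) (rule le)
    also have "\<dots> = I / \<rho>" by (simp add: I_def)
    finally have "norm (G t) \<le> I / \<rho>" .
    then have "norm (of_real (b / (2 * pi)) * G t) \<le> b / (2 * pi) * (I / \<rho>)"
      unfolding norm_mult norm_of_real using b by (intro mult_mono) auto
    then show "norm (mittag_leffler K (of_real \<rho> * cis \<gamma>)) \<le> b / (2 * pi) * I / \<rho>"
      using eq[OF tS] by (simp add: t_def)
  qed
qed

section \<open>A multiplier theorem\<close>

text \<open>Series and integral are compared on a single ray, where the kernel is evaluated at
  positive numbers; this lemma extends the agreement to the sector.\<close>

lemma agree_on_wedge:
  assumes f: "f holomorphic_on wedge x y \<inter> ball 0 r" and g: "g holomorphic_on wedge x y \<inter> ball 0 r"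
    and \<gamma>: "x < \<gamma>" "\<gamma> < y" and r: "r > 0"
    and eq: "\<And>\<sigma>. 0 < \<sigma> \<Longrightarrow> \<sigma> < r \<Longrightarrow> f (of_real \<sigma> * cis \<gamma>) = g (of_real \<sigma> * cis \<gamma>)"
    and t: "t \<in> wedge x y \<inter> ball 0 r"
  shows "f t = g t"
proof -
  let ?S = "wedge x y \<inter> ball 0 r" and ?U = "(\<lambda>\<sigma>. of_real \<sigma> * cis \<gamma>) ` {0<..<r}"
  have U: "?U \<subseteq> ?S"
  proof
    fix z assume "z \<in> ?U"
    then obtain \<sigma> where \<sigma>: "z = of_real \<sigma> * cis \<gamma>" "0 < \<sigma>" "\<sigma> < r" by auto
    then have "z \<in> wedge x y" unfolding wedge_def using \<gamma> by blast
    then show "z \<in> ?S" using \<sigma> by (simp add: norm_mult)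
  qed
  have "f t - g t = 0"
  proof (rule analytic_continuation[of "\<lambda>t. f t - g t" ?S ?U "of_real (r / 2) * cis \<gamma>"])
    show "of_real (r / 2) * cis \<gamma> islimpt ?U"
      unfolding islimpt_approachable
    proof (intro allI impI)
      fix e :: real assume e: "e > 0"
      define \<sigma> where "\<sigma> = (r / 2 + min r (r / 2 + e)) / 2"
      have "r / 2 < min r (r / 2 + e)" using r e by simp
      then have "r / 2 < \<sigma>" "\<sigma> < min r (r / 2 + e)" unfolding \<sigma>_def by (auto simp del: min_less_iff_conj)
      then have \<sigma>: "r / 2 < \<sigma>" "\<sigma> < r" "\<sigma> - r / 2 < e" by auto
      show "\<exists>x'\<in>?U. x' \<noteq> of_real (r / 2) * cis \<gamma> \<and> dist x' (of_real (r / 2) * cis \<gamma>) < e"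
      proof (rule bexI)
        have "of_real \<sigma> * cis \<gamma> - of_real (r / 2) * cis \<gamma> = of_real (\<sigma> - r / 2) * cis \<gamma>" by (simp add: algebra_simps)
        then have "dist (of_real \<sigma> * cis \<gamma>) (of_real (r / 2) * cis \<gamma>) = \<sigma> - r / 2"
          unfolding dist_norm using \<sigma> by (simp only: norm_mult norm_of_real norm_cis) simp
        moreover have "of_real \<sigma> * cis \<gamma> \<noteq> of_real (r / 2) * cis \<gamma>" using calculation \<sigma> by (metis diff_gt_0_iff_gt dist_self less_irrefl)
        ultimately show "of_real \<sigma> * cis \<gamma> \<noteq> of_real (r / 2) * cis \<gamma> \<and> dist (of_real \<sigma> * cis \<gamma>) (of_real (r / 2) * cis \<gamma>) < e"
          using \<sigma> by simp
        have "0 < \<sigma>" using \<sigma> r by linarith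
        then show "of_real \<sigma> * cis \<gamma> \<in> ?U" using \<sigma> by auto
      qed
    qed
    show "of_real (r / 2) * cis \<gamma> \<in> ?S" by (rule subsetD[OF U imageI]) (use r in simp)
    show "(\<lambda>t. f t - g t) holomorphic_on ?S" by (intro holomorphic_intros f g)
  qed (use U t eq r in \<open>auto simp: open_wedge connected_wedge_Int_ball open_Int\<close>)
  then show ?thesis by simp
qed

text \<open>The inequality between arithmetic and geometric means, applied to the two powers of
  order K: their product is free of u. So the decay in \<rho> becomes uniform in u at the price of
  the admissible growth \<open>exp (u powr K)\<close>.\<close>

lemma exp_minus_quotient_le:
  fixes \<rho> L u K :: real
  assumes "0 < \<rho>" "0 < L" "0 < u"
  shows "exp (- ((\<rho> / u / L) powr K)) \<le> exp (u powr K) * exp (- (2 * (\<rho> / L) powr (K / 2)))"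
proof -
  let ?X = "(\<rho> / u / L) powr K" and ?Y = "u powr K"
  have "?X * ?Y = ((\<rho> / L) powr (K / 2))\<^sup>2"
  proof -
    have "?X * ?Y = (\<rho> / u / L * u) powr K" using assms by (intro powr_mult[symmetric])
    also have "\<rho> / u / L * u = \<rho> / L" using assms by simp
    also have "(\<rho> / L) powr K = ((\<rho> / L) powr (K / 2))\<^sup>2"
      using assms by (simp add: powr_power)
    finally show ?thesis .
  qed
  then have "sqrt (?X * ?Y) = (\<rho> / L) powr (K / 2)" by simp
  moreover have "sqrt (?X * ?Y) \<le> (?X + ?Y) / 2" by (rule arith_geo_mean_sqrt) auto
  ultimately have "2 * (\<rho> / L) powr (K / 2) \<le> ?X + ?Y" by simp
  then show ?thesis by (simp flip: exp_add)
qed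

text \<open>With \<open>E(t) = (\<Sum>j. \<epsilon> j * t ^ j)\<close> the power series with coefficients \<open>h n\<close> is, up to its constant
  term, the integral of \<open>(E(t * x) - \<epsilon> 0) * e n x / x\<close> over the positive axis. Turning the ray of
  integration inside the sector where \<open>e n\<close> decays moves \<open>t * x\<close> to a ray where \<open>E\<close> is integrable,
  and this works for every direction of \<open>t\<close> other than the positive axis.\<close>

lemma kernel_multiplier:
  fixes K :: real and e :: "nat \<Rightarrow> complex \<Rightarrow> complex" and \<epsilon> :: "nat \<Rightarrow> real"
  assumes K: "K > 1 / 2"
    and e_hol: "\<And>n. e n holomorphic_on sector 0 (pi / K)"
    and e_bd: "\<And>\<delta>. \<delta> > 0 \<Longrightarrow> \<exists>L>0. \<exists>c\<ge>0. \<exists>A>0. \<forall>n t. t \<noteq> 0 \<and> 2 * K * \<bar>Arg t\<bar> \<le> pi - \<delta> \<longrightarrow>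
        norm (e n t) \<le> c * A ^ n * B n * exp (- ((norm t / L) powr K))"
    and \<epsilon>: "\<And>j. 0 \<le> \<epsilon> j" and sm: "\<And>\<rho>. 0 \<le> \<rho> \<Longrightarrow> summable (\<lambda>j. \<epsilon> j * \<rho> ^ j)"
    and M: "M \<ge> 0" and N: "N \<ge> 0"
    and growth: "\<And>\<rho>. 0 \<le> \<rho> \<Longrightarrow> (\<Sum>j. \<epsilon> j * \<rho> ^ j) \<le> M * exp (N * \<rho> powr K)"
    and ray: "\<And>\<gamma>. pi / (2 * K) < \<gamma> \<Longrightarrow> \<gamma> < 2 * pi - pi / (2 * K) \<Longrightarrow>
        set_integrable lborel {1..} (\<lambda>\<rho>. norm (\<Sum>j. of_real (\<epsilon> j) * (of_real \<rho> * cis \<gamma>) ^ j) / \<rho>)"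
    and h: "\<And>n j. h n (Suc j) = of_real (\<epsilon> (Suc j)) * (LINT x:{0<..}|lborel. of_real (x ^ j) * e n (of_real x))"
    and h0: "C0 \<ge> 0" "A0 > 0" "\<And>n. norm (h n 0) \<le> C0 * A0 ^ n * B n"
    and B: "\<And>n. 0 \<le> B n" and \<psi>: "0 < \<psi>" "\<psi> < 2 * pi"
  shows "uniformly_continuable K \<psi> B h"
proof -
  define E where "E = (\<lambda>t::complex. \<Sum>j. of_real (\<epsilon> j) * t ^ j)"
  \<comment> \<open>Since \<open>\<gamma> - pi = (\<psi> - pi) * (1 - 1 / (2 * K))\<close>, this
    turns \<psi> towards \<open>pi\<close> by less than the half-opening \<open>pi / (2 * K)\<close>
    of the sector of \<open>e n\<close>, and lands in the range of \<open>ray\<close>.\<close>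
  define \<gamma> where "\<gamma> = \<psi> + (pi - \<psi>) / (2 * K)"
  define \<delta>0 where "\<delta>0 = pi / (2 * K) - \<bar>\<gamma> - \<psi>\<bar>"
  have K0: "K > 0" using K by simp
  have "\<bar>pi - \<psi>\<bar> < pi" using \<psi> by (auto simp: abs_less_iff)
  then have "\<bar>\<gamma> - \<psi>\<bar> < pi / (2 * K)" using K0 by (simp add: \<gamma>_def abs_mult divide_strict_right_mono)
  then have \<delta>0: "\<delta>0 > 0" by (simp add: \<delta>0_def)
  have \<gamma>: "pi / (2 * K) < \<gamma>" "\<gamma> < 2 * pi - pi / (2 * K)"
  proof -
    have "1 / (2 * K) < 1" using K by simp
    then have 1: "0 < 1 - 1 / (2 * K)" by simp
    have "\<gamma> - pi / (2 * K) = \<psi> * (1 - 1 / (2 * K))" by (simp add: \<gamma>_def algebra_simps diff_divide_distrib)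
    then show "pi / (2 * K) < \<gamma>" using mult_pos_pos[OF \<psi>(1) 1] by linarith
    have "2 * pi - pi / (2 * K) - \<gamma> = (2 * pi - \<psi>) * (1 - 1 / (2 * K))"
      by (simp add: \<gamma>_def algebra_simps diff_divide_distrib)
    moreover have "0 < (2 * pi - \<psi>) * (1 - 1 / (2 * K))" using \<psi> 1 by (intro mult_pos_pos) auto
    ultimately show "\<gamma> < 2 * pi - pi / (2 * K)" by linarith
  qed
  have piK: "pi / (2 * K) < pi" using K by (simp add: field_simps)
  \<comment> \<open>\<delta>0 is the angle left over by that rotation. One half of it is the room in
    which u may vary, the other half keeps the quotient where \<open>e_bd\<close> applies, as
    \<open>2 * K * \<beta> = pi - K * \<delta>0\<close>.\<close>
  define \<beta> where "\<beta> = pi / (2 * K) - \<delta>0 / 2"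
  have \<beta>: "\<beta> < pi" "0 < \<beta>" "\<bar>\<gamma> - \<psi>\<bar> + \<delta>0 / 2 = \<beta>"
  proof -
    have *: "a - (a - x) / 2 < p \<and> 0 < a - (a - x) / 2 \<and> x + (a - x) / 2 = a - (a - x) / 2"
      if "0 \<le> x" "x < a" "a < p" for a x p :: real
      using that by (simp add: field_simps)
    show "\<beta> < pi" "0 < \<beta>" "\<bar>\<gamma> - \<psi>\<bar> + \<delta>0 / 2 = \<beta>"
      unfolding \<beta>_def \<delta>0_def using *[OF abs_ge_zero \<open>\<bar>\<gamma> - \<psi>\<bar> < pi / (2 * K)\<close> piK] by blast+
  qed
  define S where "S = wedge (\<gamma> - \<beta>) (\<gamma> + \<beta>)"
  obtain L c A where L: "L > 0" and c: "c \<ge> 0" "A > 0"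
    and e_le: "\<And>n t. t \<noteq> 0 \<Longrightarrow> 2 * K * \<bar>Arg t\<bar> \<le> pi - K * \<delta>0 \<Longrightarrow>
        norm (e n t) \<le> c * A ^ n * B n * exp (- ((norm t / L) powr K))"
    using e_bd[of "K * \<delta>0"] \<delta>0 K0 by (metis mult_pos_pos)
  define D where "D = (\<lambda>n. c * A ^ n * B n)"
  have D: "D n \<ge> 0" for n using c B by (simp add: D_def)
  have S_polar: "\<exists>\<sigma> \<phi>. u = of_real \<sigma> * cis \<phi> \<and> 0 < \<sigma> \<and> norm u = \<sigma> \<and> \<bar>\<gamma> - \<phi>\<bar> < \<beta>" if u: "u \<in> S" for u
  proof -
    obtain \<sigma> \<phi> where *: "u = of_real \<sigma> * cis \<phi>" "0 < \<sigma>" "\<gamma> - \<beta> < \<phi>" "\<phi> < \<gamma> + \<beta>"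
      using u unfolding S_def wedge_def by blast
    then have "\<bar>\<gamma> - \<phi>\<bar> < \<beta>" by (simp only: abs_less_iff) auto
    then show ?thesis using * by (intro exI[of _ \<sigma>] exI[of _ \<phi>]) (simp add: norm_mult)
  qed
  define T where "T = {t. \<exists>\<rho> \<phi>. t = of_real \<rho> * cis \<phi> \<and> 0 < \<rho> \<and> \<bar>\<phi>\<bar> < \<beta>}"
  have T_le: "norm (e n t) \<le> D n * exp (- ((norm t / L) powr K))" if tT: "t \<in> T" for n t
  proof -
    obtain \<rho> \<phi> where t: "t = of_real \<rho> * cis \<phi>" "0 < \<rho>" "\<bar>\<phi>\<bar> < \<beta>" using tT unfolding T_def by blast
    have "Arg t = Arg (cis \<phi>)" using t by (simp add: Arg_times_of_real)
    also have "\<dots> = \<phi>" using t \<beta> by (intro Arg_cis) (auto simp: abs_less_iff)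
    finally have "Arg t = \<phi>" .
    moreover have "2 * K * \<bar>\<phi>\<bar> \<le> 2 * K * \<beta>" using t K0 by (intro mult_left_mono) auto
    moreover have "2 * K * \<beta> = pi - K * \<delta>0" using K0 by (simp add: \<beta>_def field_simps)
    moreover have "t \<noteq> 0" using t by simp
    ultimately show ?thesis unfolding D_def by (intro e_le) auto
  qed
  have T_sec: "T \<subseteq> sector 0 (pi / K)"
  proof
    fix t assume "t \<in> T"
    then obtain \<rho> \<phi> where t: "t = of_real \<rho> * cis \<phi>" "0 < \<rho>" "\<bar>\<phi>\<bar> < \<beta>" unfolding T_def by blast
    have "\<beta> < pi / (2 * K)" using \<delta>0 by (simp add: \<beta>_def)
    then show "t \<in> sector 0 (pi / K)" using t by (intro sectorI[of t \<rho> \<phi>]) (auto simp: field_simps)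
  qed
  have T_pos: "of_real x \<in> T" if "x > 0" for x
    using that \<beta> unfolding T_def by (intro CollectI exI[of _ x] exI[of _ 0]) auto
  have quot: "of_real \<rho> * cis \<gamma> / u \<in> T" "norm (of_real \<rho> * cis \<gamma> / u) = \<rho> / norm u" if u: "u \<in> S" and \<rho>: "\<rho> > 0" for u \<rho>
  proof -
    obtain \<sigma> \<phi> where *: "u = of_real \<sigma> * cis \<phi>" "0 < \<sigma>" "norm u = \<sigma>" "\<bar>\<gamma> - \<phi>\<bar> < \<beta>" using S_polar[OF u] by blast
    have "of_real \<rho> * cis \<gamma> / u = of_real (\<rho> / \<sigma>) * cis (\<gamma> - \<phi>)" using * by (simp add: cis_divide[symmetric])
    then show "of_real \<rho> * cis \<gamma> / u \<in> T"
      unfolding T_def using * \<rho> by (intro CollectI exI[of _ "\<rho> / \<sigma>"] exI[of _ "\<gamma> - \<phi>"]) auto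
    show "norm (of_real \<rho> * cis \<gamma> / u) = \<rho> / norm u" using \<rho> by (simp add: norm_divide norm_mult)
  qed
  have E_sums: "(\<lambda>j. of_real (\<epsilon> j) * t ^ j) sums E t" for t
    unfolding E_def
    by (rule summable_sums, rule summable_norm_cancel) (use sm[of "norm t"] \<epsilon> in \<open>simp add: norm_mult norm_power abs_of_nonneg\<close>)
  define M1 where "M1 = M * exp N"
  have M1: "M1 \<ge> 0" using M by (simp add: M1_def)
  have part: "(\<Sum>j<n. \<epsilon> (Suc j) * \<rho> ^ j) \<le> M1 * exp (N * \<rho> powr K)" if \<rho>: "\<rho> > 0" for n and \<rho> :: real
  proof -
    \<comment> \<open>Passing to \<open>max 1 \<rho>\<close> permits the missing factor to be
      inserted, at the cost of \<open>exp N\<close>.\<close>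
    define \<rho>' where "\<rho>' = max 1 \<rho>"
    have "(\<Sum>j<n. \<epsilon> (Suc j) * \<rho> ^ j) \<le> (\<Sum>j<n. \<epsilon> (Suc j) * \<rho>' ^ Suc j)"
    proof (intro sum_mono mult_left_mono \<epsilon>)
      fix j
      have "\<rho> ^ j \<le> \<rho>' ^ j" using \<rho> by (intro power_mono) (auto simp: \<rho>'_def)
      also have "\<dots> \<le> \<rho>' ^ Suc j" by (intro power_increasing) (auto simp: \<rho>'_def)
      finally show "\<rho> ^ j \<le> \<rho>' ^ Suc j" .
    qed
    also have "\<dots> \<le> (\<Sum>j<Suc n. \<epsilon> j * \<rho>' ^ j)" unfolding sum.lessThan_Suc_shift using \<epsilon>[of 0] by simp
    also have "\<dots> \<le> (\<Sum>j. \<epsilon> j * \<rho>' ^ j)" using sm[of \<rho>'] \<epsilon> by (intro sum_le_suminf) (auto simp: \<rho>'_def)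
    also have "\<dots> \<le> M * exp (N * \<rho>' powr K)" by (rule growth) (simp add: \<rho>'_def)
    also have "\<dots> \<le> M * exp (N + N * \<rho> powr K)"
    proof -
      have "\<rho>' powr K \<le> 1 + \<rho> powr K" by (auto simp: \<rho>'_def max_def)
      from mult_left_mono[OF this N] show ?thesis using M by (intro mult_left_mono) (auto simp: algebra_simps)
    qed
    finally show ?thesis by (simp add: M1_def exp_add mult.assoc)
  qed
  have E1: "norm (E t - of_real (\<epsilon> 0)) \<le> norm t * (M1 * exp (N * norm t powr K))" for t
  proof (cases "t = 0")
    case True
    have "E 0 = of_real (\<epsilon> 0)" using sums_unique2[OF E_sums[of 0] powser_sums_zero[of "\<lambda>j. of_real (\<epsilon> j)"]] .
    then show ?thesis using True by simp
  next
    case False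
    have "(\<lambda>j. of_real (\<epsilon> (Suc j)) * t ^ Suc j) sums (E t - of_real (\<epsilon> 0))"
      using E_sums[of t] by (subst sums_Suc_iff) simp
    then have "(\<lambda>n. norm (\<Sum>j<n. of_real (\<epsilon> (Suc j)) * t ^ Suc j)) \<longlonglongrightarrow> norm (E t - of_real (\<epsilon> 0))"
      unfolding sums_def by (rule tendsto_norm)
    then show ?thesis
    proof (rule LIMSEQ_le_const2, intro exI allI impI)
      fix n :: nat
      have "norm (\<Sum>j<n. of_real (\<epsilon> (Suc j)) * t ^ Suc j) \<le> (\<Sum>j<n. norm t * (\<epsilon> (Suc j) * norm t ^ j))"
        by (rule order_trans[OF norm_sum]) (intro sum_mono, use \<epsilon> in \<open>simp add: norm_mult norm_power abs_of_nonneg\<close>)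
      also have "\<dots> = norm t * (\<Sum>j<n. \<epsilon> (Suc j) * norm t ^ j)" by (simp add: sum_distrib_left)
      also have "\<dots> \<le> norm t * (M1 * exp (N * norm t powr K))" using part[of "norm t" n] False by (intro mult_left_mono) auto
      finally show "norm (\<Sum>j<n. of_real (\<epsilon> (Suc j)) * t ^ Suc j) \<le> norm t * (M1 * exp (N * norm t powr K))" .
    qed
  qed
  have E_cont: "continuous_on UNIV E"
  proof (rule holomorphic_on_imp_continuous_on)
    show "E holomorphic_on UNIV"
      unfolding holomorphic_on_open[OF open_UNIV]
    proof
      fix t :: complex
      have "E holomorphic_on ball 0 (norm t + 1)"
        by (rule power_series_holomorphic[of _ _ "\<lambda>j. of_real (\<epsilon> j)"]) (use E_sums in simp)
      then show "\<exists>f'. (E has_field_derivative f') (at t)"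
        unfolding holomorphic_on_open[OF open_ball] by auto
    qed
  qed
  \<comment> \<open>The three parts dominate: the bounded quotient of
    \<open>E - \<epsilon> 0\<close> near 0; \<open>E\<close> itself beyond 1, by \<open>ray\<close>;
    and the constant \<open>\<epsilon> 0\<close> beyond 1, which needs the decay of
    \<open>e n\<close> in the form of \<open>exp_minus_quotient_le\<close>, hence the exponent
    \<open>K / 2\<close>.\<close>
  define V where "V = (\<lambda>\<rho>. indicat_real {0<..1} \<rho> *\<^sub>R (M1 * exp N) + indicat_real {1..} \<rho> *\<^sub>R (norm (E (of_real \<rho> * cis \<gamma>)) / \<rho>)
      + \<epsilon> 0 * (indicat_real {0<..} \<rho> *\<^sub>R (\<rho> powr 0 * exp (- (2 / L powr (K / 2) * \<rho> powr (K / 2))))))"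
  have V_int: "integrable lborel V"
  proof -
    have 1: "integrable lborel (\<lambda>\<rho>::real. indicat_real {0<..1} \<rho> *\<^sub>R (M1 * exp N))"
    proof -
      have "integrable lborel (indicat_real {0<..1::real})" by (rule integrable_real_indicator) simp_all
      then show ?thesis by (intro integrable_scaleR_left)
    qed
    have 2: "integrable lborel (\<lambda>\<rho>. indicat_real {1..} \<rho> *\<^sub>R (norm (E (of_real \<rho> * cis \<gamma>)) / \<rho>))"
      using ray[OF \<gamma>] by (simp add: set_integrable_def E_def)
    have 3: "integrable lborel (\<lambda>\<rho>. indicat_real {0<..} \<rho> *\<^sub>R (\<rho> powr 0 * exp (- (2 / L powr (K / 2) * \<rho> powr (K / 2)))))"
      using powr_exp_integral(1)[of "K / 2" 0 "2 / L powr (K / 2)"] K0 L by (simp add: set_integrable_def)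
    show ?thesis unfolding V_def
      by (intro Bochner_Integration.integrable_add 1 2 integrable_mult_right 3)
  qed
  have V_nonneg: "0 \<le> V \<rho>" for \<rho> using M1 \<epsilon>[of 0] by (auto simp: V_def indicator_def)
  \<comment> \<open>This is the integrand after the substitution
    \<open>\<rho> * cis \<gamma> = u * x\<close>, which leaves \<open>dx / x\<close> unchanged. The
    parameter u now occurs in the argument of \<open>e n\<close> only, while \<open>E\<close> is
    evaluated on a fixed ray.\<close>
  define k where "k = (\<lambda>n u \<rho>. indicat_real {0<..} \<rho> *\<^sub>R (e n (of_real \<rho> * cis \<gamma> / u) * ((E (of_real \<rho> * cis \<gamma>) - of_real (\<epsilon> 0)) / of_real \<rho>)))"
  have k_le: "norm (k n u \<rho>) \<le> D n * exp (norm u powr K) * V \<rho>" if u: "u \<in> S" for n u \<rho>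
  proof (cases "\<rho> > 0")
    case False
    then show ?thesis using V_nonneg[of \<rho>] D[of n] by (simp add: k_def)
  next
    case \<rho>: True
    have nu: "norm u > 0" using S_polar[OF u] by auto
    have e1: "norm (e n (of_real \<rho> * cis \<gamma> / u)) \<le> D n * exp (- ((\<rho> / norm u / L) powr K))"
      using T_le[OF quot(1)[OF u \<rho>], of n] quot(2)[OF u \<rho>] by simp
    also have "\<dots> \<le> D n * 1" using D by (intro mult_left_mono) auto
    finally have e2: "norm (e n (of_real \<rho> * cis \<gamma> / u)) \<le> D n" by simp
    have ex: "1 \<le> exp (norm u powr K)" by simp
    show ?thesis
    proof (cases "\<rho> \<le> 1")
      case True
      have "norm (E (of_real \<rho> * cis \<gamma>) - of_real (\<epsilon> 0)) \<le> \<rho> * (M1 * exp (N * \<rho> powr K))"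
        using E1[of "of_real \<rho> * cis \<gamma>"] \<rho> by (simp add: norm_mult)
      also have "\<dots> \<le> \<rho> * (M1 * exp N)"
        using \<rho> M1 N True powr_mono2[of K \<rho> 1] K0 by (intro mult_left_mono) (auto simp: mult_left_le)
      finally have "norm ((E (of_real \<rho> * cis \<gamma>) - of_real (\<epsilon> 0)) / of_real \<rho>) \<le> M1 * exp N"
        using \<rho> by (simp add: norm_divide field_simps)
      also have "\<dots> \<le> V \<rho>" using \<rho> True \<epsilon>[of 0] by (auto simp: V_def indicator_def)
      finally have q: "norm ((E (of_real \<rho> * cis \<gamma>) - of_real (\<epsilon> 0)) / of_real \<rho>) \<le> V \<rho>" .
      have "norm (k n u \<rho>) = norm (e n (of_real \<rho> * cis \<gamma> / u)) * norm ((E (of_real \<rho> * cis \<gamma>) - of_real (\<epsilon> 0)) / of_real \<rho>)"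
        using \<rho> by (simp add: k_def norm_mult norm_divide)
      also have "\<dots> \<le> D n * V \<rho>" by (rule mult_mono[OF e2 q D]) simp
      also have "\<dots> \<le> D n * exp (norm u powr K) * V \<rho>"
        using mult_right_mono[OF mult_left_mono[OF ex D[of n]] V_nonneg[of \<rho>]] by simp
      finally show ?thesis .
    next
      case False
      have "norm (E (of_real \<rho> * cis \<gamma>) - of_real (\<epsilon> 0)) / \<rho> \<le> (norm (E (of_real \<rho> * cis \<gamma>)) + \<epsilon> 0) / \<rho>"
        using \<rho> \<epsilon>[of 0] norm_triangle_ineq4[of "E (of_real \<rho> * cis \<gamma>)" "of_real (\<epsilon> 0)"] by (intro divide_right_mono) auto
      also have "\<dots> \<le> norm (E (of_real \<rho> * cis \<gamma>)) / \<rho> + \<epsilon> 0"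
        unfolding add_divide_distrib using False mult_left_mono[of 1 \<rho> "\<epsilon> 0"] \<epsilon>[of 0] by (intro add_left_mono) (simp add: divide_le_eq)
      finally have q: "norm (E (of_real \<rho> * cis \<gamma>) - of_real (\<epsilon> 0)) / \<rho> \<le> norm (E (of_real \<rho> * cis \<gamma>)) / \<rho> + \<epsilon> 0" .
      have "exp (- ((\<rho> / norm u / L) powr K)) \<le> exp (norm u powr K) * exp (- (2 * (\<rho> / L) powr (K / 2)))"
        by (rule exp_minus_quotient_le) (use \<rho> L nu in auto)
      also have "(\<rho> / L) powr (K / 2) = \<rho> powr (K / 2) / L powr (K / 2)" using \<rho> L by (simp add: powr_divide)
      finally have x1: "exp (- ((\<rho> / norm u / L) powr K)) \<le> exp (norm u powr K) * exp (- (2 / L powr (K / 2) * \<rho> powr (K / 2)))" by simp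
      have x2: "exp (- ((\<rho> / norm u / L) powr K)) \<le> exp (norm u powr K)" by (rule order_trans[OF _ ex]) simp
      have "norm (k n u \<rho>) = norm (e n (of_real \<rho> * cis \<gamma> / u)) * (norm (E (of_real \<rho> * cis \<gamma>) - of_real (\<epsilon> 0)) / \<rho>)"
        using \<rho> by (simp add: k_def norm_mult norm_divide)
      also have "\<dots> \<le> (D n * exp (- ((\<rho> / norm u / L) powr K))) * (norm (E (of_real \<rho> * cis \<gamma>)) / \<rho> + \<epsilon> 0)"
        using e1 q D \<rho> by (intro mult_mono) auto
      also have "\<dots> = D n * (exp (- ((\<rho> / norm u / L) powr K)) * (norm (E (of_real \<rho> * cis \<gamma>)) / \<rho>) + \<epsilon> 0 * exp (- ((\<rho> / norm u / L) powr K)))"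
        by (simp add: algebra_simps)
      also have "\<dots> \<le> D n * (exp (norm u powr K) * (norm (E (of_real \<rho> * cis \<gamma>)) / \<rho>) + \<epsilon> 0 * (exp (norm u powr K) * exp (- (2 / L powr (K / 2) * \<rho> powr (K / 2)))))"
        using x1 x2 \<rho> \<epsilon>[of 0] D by (intro mult_left_mono add_mono mult_right_mono) auto
      also have "\<dots> = D n * exp (norm u powr K) * V \<rho>"
        using False \<rho> by (simp add: V_def algebra_simps)
      finally show ?thesis .
    qed
  qed
  have e_cont: "continuous_on T (e n)" for n
    using holomorphic_on_imp_continuous_on[OF e_hol] continuous_on_subset T_sec by blast
  have k_meas: "k n u \<in> borel_measurable lborel" if u: "u \<in> S" for n u
    unfolding k_def
  proof (rule borel_measurable_indicator_continuous)
    have "u \<noteq> 0" using S_polar[OF u] by auto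
    then show "continuous_on {0<..} (\<lambda>\<rho>. e n (of_real \<rho> * cis \<gamma> / u) * ((E (of_real \<rho> * cis \<gamma>) - of_real (\<epsilon> 0)) / of_real \<rho>))"
      using quot(1)[OF u]
      by (intro continuous_on_mult continuous_on_divide continuous_on_diff
            continuous_on_compose2[OF e_cont] continuous_on_compose2[OF E_cont] continuous_intros) auto
  qed simp
  define H where "H = (\<lambda>n u. h n 0 + (\<integral>\<rho>. k n u \<rho> \<partial>lborel))"
  have H_hol: "H n holomorphic_on S" for n
  proof -
    have "(\<lambda>u. \<integral>\<rho>. k n u \<rho> \<partial>lborel) holomorphic_on S"
    proof (rule holomorphic_integral)
      show "open S" by (simp add: S_def open_wedge)
      fix \<rho> :: real
      show "(\<lambda>u. k n u \<rho>) holomorphic_on S"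
      proof (cases "\<rho> > 0")
        case True
        have "(e n \<circ> (\<lambda>u. of_real \<rho> * cis \<gamma> / u)) holomorphic_on S"
        proof (rule holomorphic_on_compose_gen[OF _ e_hol])
          show "(\<lambda>u. of_real \<rho> * cis \<gamma> / u) holomorphic_on S"
            using S_polar by (intro holomorphic_intros) auto
          show "(\<lambda>u. of_real \<rho> * cis \<gamma> / u) ` S \<subseteq> sector 0 (pi / K)"
            using quot(1) True T_sec by blast
        qed
        then show ?thesis using True unfolding k_def by (auto simp: o_def intro!: holomorphic_intros)
      qed (simp add: k_def)
    next
      fix u0 assume "u0 \<in> S"
      have "norm (k n u \<rho>) \<le> D n * exp ((norm u0 + 1) powr K) * V \<rho>" if u: "u \<in> ball u0 1 \<inter> S" for u \<rho>
      proof -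
        have "norm u \<le> norm u0 + norm (u - u0)" by (metis add.commute diff_add_cancel norm_triangle_ineq)
        then have "norm u \<le> norm u0 + 1" using u by (simp add: dist_norm norm_minus_commute)
        then have "norm u powr K \<le> (norm u0 + 1) powr K" using K0 by (intro powr_mono2) auto
        then have "D n * exp (norm u powr K) * V \<rho> \<le> D n * exp ((norm u0 + 1) powr K) * V \<rho>"
          using D V_nonneg by (intro mult_right_mono mult_left_mono) auto
        then show ?thesis using k_le[of u n \<rho>] u by auto
      qed
      then show "\<exists>d>0. \<exists>w. integrable lborel w \<and> (\<forall>u\<in>ball u0 d \<inter> S. \<forall>\<rho>\<in>space lborel. norm (k n u \<rho>) \<le> w \<rho>)"
        using V_int by (intro exI[of _ 1] conjI exI[of _ "\<lambda>\<rho>. D n * exp ((norm u0 + 1) powr K) * V \<rho>"]) auto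
    qed (use k_meas in auto)
    then show ?thesis unfolding H_def by (intro holomorphic_intros)
  qed
  define I where "I = (\<integral>\<rho>. V \<rho> \<partial>lborel)"
  have I: "I \<ge> 0" unfolding I_def using V_nonneg by (intro Bochner_Integration.integral_nonneg) auto
  have H_le: "norm (H n u) \<le> norm (h n 0) + D n * exp (norm u powr K) * I" if u: "u \<in> S" for n u
  proof -
    have w: "integrable lborel (\<lambda>\<rho>. D n * exp (norm u powr K) * V \<rho>)" using V_int by simp
    have ki: "integrable lborel (k n u)"
      by (rule Bochner_Integration.integrable_bound[OF w k_meas[OF u]])
         (use k_le[OF u] in \<open>auto intro!: AE_I2 intro: order_trans[OF _ abs_ge_self]\<close>)
    have "norm (\<integral>\<rho>. k n u \<rho> \<partial>lborel) \<le> (\<integral>\<rho>. D n * exp (norm u powr K) * V \<rho> \<partial>lborel)"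
      by (rule Bochner_Integration.integral_norm_bound_integral[OF ki w]) (use k_le[OF u] in auto)
    also have "\<dots> = D n * exp (norm u powr K) * I" by (simp add: I_def)
    finally show ?thesis unfolding H_def using norm_triangle_ineq order_trans by (metis add_left_mono)
  qed
  \<comment> \<open>Chosen such that \<open>(1 / (\<sigma>0 * L)) powr K = N + 1\<close>: the decay
    of the kernel then exceeds the growth N of the series by one unit, which makes termwise
    integration legitimate.\<close>
  define \<sigma>0 where "\<sigma>0 = (N + 1) powr (- 1 / K) / L"
  have \<sigma>0: "\<sigma>0 > 0" using L N by (simp add: \<sigma>0_def)
  define I0 where "I0 = (\<integral>\<rho>. indicat_real {0<..} \<rho> *\<^sub>R (\<rho> powr 0 * exp (- (1 * \<rho> powr K))) \<partial>lborel)"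
  have I0: "integrable lborel (\<lambda>\<rho>. indicat_real {0<..} \<rho> *\<^sub>R (\<rho> powr 0 * exp (- (1 * \<rho> powr K))))" "I0 \<ge> 0"
    using powr_exp_integral(1)[of K 0 1] K0
    by (auto simp: set_integrable_def I0_def intro!: Bochner_Integration.integral_nonneg)
  \<comment> \<open>On the ray \<open>u = of_real \<sigma> * cis \<gamma>\<close> the argument of
    \<open>e n\<close> is positive, so the terms integrate to the moments in
    \<open>h\<close>.\<close>
  define f where "f = (\<lambda>n \<sigma> j \<rho>. indicat_real {0<..} \<rho> *\<^sub>R
      (e n (of_real (\<rho> / \<sigma>)) * (of_real (\<epsilon> (Suc j)) * cis \<gamma> ^ Suc j * of_real (\<rho> ^ j))))"
  have f_sum: "(\<Sum>j<m. norm (f n \<sigma> j \<rho>)) \<le> D n * M1 * (indicat_real {0<..} \<rho> *\<^sub>R (\<rho> powr 0 * exp (- (1 * \<rho> powr K))))"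
    if \<sigma>: "0 < \<sigma>" "\<sigma> \<le> \<sigma>0" for n \<sigma> m \<rho>
  proof (cases "\<rho> > 0")
    case True
    have "(N + 1) * \<rho> powr K \<le> (\<rho> / \<sigma> / L) powr K"
    proof -
      have "(N + 1) = ((N + 1) powr (1 / K)) powr K" using N K0 by (simp add: powr_powr)
      moreover have "(N + 1) powr (1 / K) = 1 / (\<sigma>0 * L)" using L N by (simp add: \<sigma>0_def powr_minus divide_inverse)
      ultimately have N1: "N + 1 = (1 / (\<sigma>0 * L)) powr K" by metis
      have "(N + 1) * \<rho> powr K = (1 / (\<sigma>0 * L) * \<rho>) powr K"
        unfolding N1 using True \<sigma>0 L by (intro powr_mult[symmetric])
      also have "\<dots> \<le> (\<rho> / \<sigma> / L) powr K"
        using True \<sigma> \<sigma>0 L K0 by (intro powr_mono2) (auto simp: field_simps)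
      finally show ?thesis .
    qed
    then have ex: "exp (- ((\<rho> / \<sigma> / L) powr K)) * exp (N * \<rho> powr K) \<le> exp (- (\<rho> powr K))"
      by (simp add: algebra_simps flip: exp_add)
    have "(\<Sum>j<m. norm (f n \<sigma> j \<rho>)) = norm (e n (of_real (\<rho> / \<sigma>))) * (\<Sum>j<m. \<epsilon> (Suc j) * \<rho> ^ j)"
      using True \<epsilon> by (simp add: f_def norm_mult norm_power sum_distrib_left abs_of_nonneg mult_ac)
    also have "\<dots> \<le> (D n * exp (- ((\<rho> / \<sigma> / L) powr K))) * (M1 * exp (N * \<rho> powr K))"
    proof (rule mult_mono)
      have "norm (complex_of_real (\<rho> / \<sigma>)) = \<rho> / \<sigma>" unfolding norm_of_real using True \<sigma> by simp
      then show "norm (e n (of_real (\<rho> / \<sigma>))) \<le> D n * exp (- ((\<rho> / \<sigma> / L) powr K))"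
        using T_le[OF T_pos[of "\<rho> / \<sigma>"], of n] True \<sigma> by (simp only: divide_pos_pos)
      show "(\<Sum>j<m. \<epsilon> (Suc j) * \<rho> ^ j) \<le> M1 * exp (N * \<rho> powr K)" by (rule part[OF True])
    qed (use True D \<epsilon> in \<open>auto intro!: sum_nonneg\<close>)
    also have "\<dots> = D n * M1 * (exp (- ((\<rho> / \<sigma> / L) powr K)) * exp (N * \<rho> powr K))" by simp
    also have "\<dots> \<le> D n * M1 * exp (- (\<rho> powr K))" using ex D M1 by (intro mult_left_mono) auto
    finally show ?thesis using True by simp
  qed (simp add: f_def)
  have f_meas: "f n \<sigma> j \<in> borel_measurable lborel" if "\<sigma> > 0" for n \<sigma> j
    unfolding f_def
  proof (rule borel_measurable_indicator_continuous)
    show "continuous_on {0<..} (\<lambda>\<rho>. e n (of_real (\<rho> / \<sigma>)) * (of_real (\<epsilon> (Suc j)) * cis \<gamma> ^ Suc j * of_real (\<rho> ^ j)))"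
    proof -
      have "of_real x / of_real \<sigma> \<in> T" if "0 < x" for x using T_pos[of "x / \<sigma>"] \<open>\<sigma> > 0\<close> that by simp
      then show ?thesis using \<open>\<sigma> > 0\<close>
        by (intro continuous_on_mult continuous_on_compose2[OF e_cont] continuous_intros) auto
    qed
  qed simp
  have f_int: "(\<integral>\<rho>. f n \<sigma> j \<rho> \<partial>lborel) = h n (Suc j) * (of_real \<sigma> * cis \<gamma>) ^ Suc j" if \<sigma>: "\<sigma> > 0" for n \<sigma> j
  proof -
    have "(\<integral>\<rho>. f n \<sigma> j \<rho> \<partial>lborel) = \<bar>\<sigma>\<bar> *\<^sub>R (\<integral>x. f n \<sigma> j (0 + \<sigma> * x) \<partial>lborel)"
      by (rule lborel_integral_real_affine) (use \<sigma> in auto)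
    also have "(\<lambda>x. f n \<sigma> j (0 + \<sigma> * x)) = (\<lambda>x. (of_real (\<epsilon> (Suc j)) * cis \<gamma> ^ Suc j * of_real \<sigma> ^ j) *
        (indicat_real {0<..} x *\<^sub>R (of_real (x ^ j) * e n (of_real x))))"
      using \<sigma> by (auto simp: f_def fun_eq_iff indicator_def power_mult_distrib zero_less_mult_iff)
    also have "\<bar>\<sigma>\<bar> *\<^sub>R (\<integral>x. (of_real (\<epsilon> (Suc j)) * cis \<gamma> ^ Suc j * of_real \<sigma> ^ j) *
        (indicat_real {0<..} x *\<^sub>R (of_real (x ^ j) * e n (of_real x))) \<partial>lborel) = h n (Suc j) * (of_real \<sigma> * cis \<gamma>) ^ Suc j"
      unfolding h set_lebesgue_integral_def using \<sigma> by (simp add: scaleR_conv_of_real power_mult_distrib)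
    finally show ?thesis .
  qed
  have f_sums: "(\<lambda>j. f n \<sigma> j \<rho>) sums k n (of_real \<sigma> * cis \<gamma>) \<rho>" if \<sigma>: "\<sigma> > 0" for n \<sigma> \<rho>
  proof (cases "\<rho> > 0")
    case True
    have "(\<lambda>j. of_real (\<epsilon> (Suc j)) * (of_real \<rho> * cis \<gamma>) ^ Suc j) sums (E (of_real \<rho> * cis \<gamma>) - of_real (\<epsilon> 0))"
      using E_sums[of "of_real \<rho> * cis \<gamma>"] by (subst sums_Suc_iff) simp
    from sums_mult[OF sums_divide[OF this, of "of_real \<rho>"], of "e n (of_real (\<rho> / \<sigma>))"]
    show ?thesis using True \<sigma> by (simp add: f_def k_def power_mult_distrib mult_ac)
  qed (simp add: f_def k_def)
  have H_ray: "(\<lambda>j. h n j * (of_real \<sigma> * cis \<gamma>) ^ j) sums H n (of_real \<sigma> * cis \<gamma>)"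
    if \<sigma>: "0 < \<sigma>" "\<sigma> \<le> \<sigma>0" for n \<sigma>
  proof -
    have "(\<lambda>j. \<integral>\<rho>. f n \<sigma> j \<rho> \<partial>lborel) sums (\<integral>\<rho>. k n (of_real \<sigma> * cis \<gamma>) \<rho> \<partial>lborel)"
      by (rule integral_sums_dominated(1)[OF f_meas _ f_sum f_sums]) (use \<sigma> I0 in auto)
    then have "(\<lambda>j. h n (Suc j) * (of_real \<sigma> * cis \<gamma>) ^ Suc j) sums (H n (of_real \<sigma> * cis \<gamma>) - h n 0)"
      using \<sigma> by (simp only: f_int H_def) simp
    then show ?thesis by (subst (asm) sums_Suc_iff) simp
  qed
  define C1 where "C1 = C0 + c * M1 * I0"
  define A1 where "A1 = max A A0"
  have A1: "A1 > 0" "A ^ n \<le> A1 ^ n" "A0 ^ n \<le> A1 ^ n" for n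
    using c h0 by (auto simp: A1_def intro!: power_mono)
  have h0': "norm (h n 0) \<le> C0 * A1 ^ n * B n" for n
    using h0(3)[of n] mult_right_mono[OF mult_left_mono[OF A1(3) h0(1)] B[of n], of n] by linarith
  have D': "D n \<le> c * A1 ^ n * B n" for n
    unfolding D_def using A1 c B by (intro mult_right_mono mult_left_mono) auto
  have C1: "C1 \<ge> 0" using h0 c M1 I0 by (simp add: C1_def)
  \<comment> \<open>Absolute integrability at distance \<sigma>0 plays the role of a Cauchy
    estimate: it bounds the coefficients before the power series is known to converge in a
    disc.\<close>
  have h_le: "norm (h n j) * \<sigma>0 ^ j \<le> C1 * A1 ^ n * B n" for n j
  proof (cases j)
    case 0
    have "C0 * A1 ^ n * B n \<le> C1 * A1 ^ n * B n"
      using A1 B c M1 I0 by (intro mult_right_mono) (auto simp: C1_def)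
    then show ?thesis using h0'[of n] 0 by simp
  next
    case (Suc i)
    have w: "integrable lborel (\<lambda>\<rho>. D n * M1 * (indicat_real {0<..} \<rho> *\<^sub>R (\<rho> powr 0 * exp (- (1 * \<rho> powr K)))))"
      using I0 by simp
    have le: "norm (f n \<sigma>0 i \<rho>) \<le> D n * M1 * (indicat_real {0<..} \<rho> *\<^sub>R (\<rho> powr 0 * exp (- (1 * \<rho> powr K))))" for \<rho>
    proof -
      have "norm (f n \<sigma>0 i \<rho>) \<le> (\<Sum>j<Suc i. norm (f n \<sigma>0 j \<rho>))" by (simp add: sum_nonneg)
      then show ?thesis using f_sum[of \<sigma>0 n \<rho> "Suc i"] \<sigma>0 by simp
    qed
    have fi: "integrable lborel (f n \<sigma>0 i)"
      by (rule integral_sums_dominated(2)[OF f_meas w f_sum f_sums]) (use \<sigma>0 in auto)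
    have "norm (\<integral>\<rho>. f n \<sigma>0 i \<rho> \<partial>lborel) \<le> D n * M1 * I0"
      using Bochner_Integration.integral_norm_bound_integral[OF fi w] le by (simp add: I0_def)
    then have "norm (h n j) * \<sigma>0 ^ j \<le> D n * M1 * I0"
      using f_int[of \<sigma>0 n i] \<sigma>0 Suc by (simp add: norm_mult norm_power)
    also have "\<dots> \<le> (c * A1 ^ n * B n) * M1 * I0" using D' M1 I0 by (intro mult_right_mono) auto
    also have "\<dots> \<le> C1 * A1 ^ n * B n"
      using h0 A1 B by (simp add: C1_def algebra_simps)
    finally show ?thesis .
  qed
  define r where "r = \<sigma>0 / 2"
  have r: "r > 0" "r \<le> \<sigma>0" using \<sigma>0 by (auto simp: r_def)
  have ps: "(\<lambda>j. h n j * t ^ j) sums (\<Sum>j. h n j * t ^ j)" "norm (\<Sum>j. h n j * t ^ j) \<le> 2 * (C1 * A1 ^ n * B n)"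
    if t: "t \<in> ball 0 r" for n t
  proof -
    have geo: "(\<lambda>j. C1 * A1 ^ n * B n * (1 / 2) ^ j) sums (C1 * A1 ^ n * B n * 2)"
      using sums_mult[OF geometric_sums[of "1 / 2 :: real"], of "C1 * A1 ^ n * B n"] by simp
    have le: "norm (h n j * t ^ j) \<le> C1 * A1 ^ n * B n * (1 / 2) ^ j" for j
    proof -
      have "norm t ^ j \<le> (\<sigma>0 / 2) ^ j" using t by (intro power_mono) (auto simp: r_def)
      then have "norm (h n j * t ^ j) \<le> norm (h n j) * (\<sigma>0 / 2) ^ j"
        by (simp add: norm_mult norm_power mult_left_mono)
      also have "\<dots> = (norm (h n j) * \<sigma>0 ^ j) * (1 / 2) ^ j" by (simp add: power_divide)
      also have "\<dots> \<le> C1 * A1 ^ n * B n * (1 / 2) ^ j" by (intro mult_right_mono h_le) auto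
      finally show ?thesis .
    qed
    have sn: "summable (\<lambda>j. norm (h n j * t ^ j))"
      by (rule summable_comparison_test'[OF sums_summable[OF geo], of 0]) (use le in auto)
    then show "(\<lambda>j. h n j * t ^ j) sums (\<Sum>j. h n j * t ^ j)" by (rule summable_sums[OF summable_norm_cancel])
    have "norm (\<Sum>j. h n j * t ^ j) \<le> (\<Sum>j. norm (h n j * t ^ j))" by (rule summable_norm[OF sn])
    also have "\<dots> \<le> (\<Sum>j. C1 * A1 ^ n * B n * (1 / 2) ^ j)" by (rule suminf_le[OF le sn sums_summable[OF geo]])
    also have "\<dots> = 2 * (C1 * A1 ^ n * B n)" using geo by (simp add: sums_iff)
    finally show "norm (\<Sum>j. h n j * t ^ j) \<le> 2 * (C1 * A1 ^ n * B n)" .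
  qed
  define F where "F = (\<lambda>n t. \<Sum>j. h n j * t ^ j)"
  have F_hol: "F n holomorphic_on ball 0 r" for n
    by (rule power_series_holomorphic[of _ _ "h n"]) (use ps in \<open>simp add: F_def\<close>)
  have agree: "F n t = H n t" if "t \<in> S \<inter> ball 0 r" for n t
  proof (rule agree_on_wedge[of "F n" "\<gamma> - \<beta>" "\<gamma> + \<beta>" r "H n" \<gamma>])
    show "F n holomorphic_on wedge (\<gamma> - \<beta>) (\<gamma> + \<beta>) \<inter> ball 0 r" using F_hol holomorphic_on_subset by blast
    show "H n holomorphic_on wedge (\<gamma> - \<beta>) (\<gamma> + \<beta>) \<inter> ball 0 r"
      using H_hol holomorphic_on_subset unfolding S_def by blast
    fix \<sigma> assume "0 < \<sigma>" "\<sigma> < r"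
    then show "F n (of_real \<sigma> * cis \<gamma>) = H n (of_real \<sigma> * cis \<gamma>)"
      using H_ray[of \<sigma> n] r by (simp add: F_def sums_iff)
  qed (use that \<beta> r in \<open>auto simp: S_def\<close>)
  have sec: "sector \<psi> \<delta>0 \<subseteq> S"
    unfolding sector_eq_wedge S_def using \<beta>(3) by (intro wedge_mono) (auto simp: abs_le_iff)
  define C where "C = C0 + c * I + 2 * C1"
  have C: "C \<ge> 0" using h0 c I C1 by (simp add: C_def)
  show ?thesis
  proof (rule uniformly_continuableI[of \<delta>0 r C A1 1])
    fix n
    define g where "g = (\<lambda>t. if t \<in> ball 0 r then F n t else H n t)"
    have Bn: "0 \<le> A1 ^ n * B n" using A1 B by simp
    show "\<exists>g. sector_extension K \<psi> \<delta>0 r (C * A1 ^ n * B n) 1 (h n) g"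
      unfolding sector_extension_def
    proof (intro exI[of _ g] conjI ballI)
      have "g holomorphic_on ball 0 r \<union> S"
        unfolding g_def by (intro holomorphic_on_If_Un F_hol H_hol agree) (auto simp: S_def open_wedge)
      then show "g holomorphic_on disc_sector \<psi> \<delta>0 r"
        by (rule holomorphic_on_subset) (use sec in \<open>auto simp: disc_sector_def\<close>)
    next
      fix t assume t: "t \<in> disc_sector \<psi> \<delta>0 r"
      have ex: "1 \<le> exp (norm t powr K)" by simp
      show "norm (g t) \<le> C * A1 ^ n * B n * exp (1 * norm t powr K)"
      proof (cases "t \<in> ball 0 r")
        case True
        have "norm (g t) \<le> (2 * C1) * (A1 ^ n * B n)" using ps(2)[OF True, of n] True by (simp add: g_def F_def mult.assoc)
        also have "\<dots> \<le> C * (A1 ^ n * B n)" using h0 c I Bn by (intro mult_right_mono) (auto simp: C_def)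
        also have "\<dots> \<le> C * (A1 ^ n * B n) * exp (norm t powr K)"
          using mult_left_mono[OF ex, of "C * (A1 ^ n * B n)"] C Bn by simp
        finally show ?thesis by (simp add: mult.assoc)
      next
        case False
        then have tS: "t \<in> S" using t sec by (auto simp: disc_sector_def)
        have "norm (g t) \<le> C0 * (A1 ^ n * B n) + c * (A1 ^ n * B n) * exp (norm t powr K) * I"
        proof -
          have "D n * exp (norm t powr K) * I \<le> c * (A1 ^ n * B n) * exp (norm t powr K) * I"
            using D'[of n] I by (intro mult_right_mono) (auto simp: mult.assoc)
          moreover have "norm (g t) \<le> norm (h n 0) + D n * exp (norm t powr K) * I"
            using H_le[OF tS, of n] False by (simp add: g_def mult_ac)
          moreover have "norm (h n 0) \<le> C0 * (A1 ^ n * B n)" using h0'[of n] by (simp add: mult.assoc)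
          ultimately show ?thesis by linarith
        qed
        also have "\<dots> \<le> C0 * (A1 ^ n * B n) * exp (norm t powr K) + c * (A1 ^ n * B n) * exp (norm t powr K) * I"
          using mult_left_mono[OF ex, of "C0 * (A1 ^ n * B n)"] h0 Bn by simp
        also have "\<dots> = (C0 + c * I) * (A1 ^ n * B n) * exp (norm t powr K)" by (simp add: algebra_simps)
        also have "\<dots> \<le> C * (A1 ^ n * B n) * exp (norm t powr K)"
          using C1 Bn by (intro mult_right_mono) (auto simp: C_def)
        finally show ?thesis by (simp add: mult.assoc)
      qed
    next
      fix t assume t: "t \<in> ball (0::complex) r"
      then show "(\<lambda>j. h n j * t ^ j) sums g t" using ps(1)[OF t, of n] by (simp add: g_def F_def)
    qed
  qed (use \<delta>0 r C A1 in auto)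
qed

section \<open>Gluing continuations in neighbouring directions\<close>

lemma cis_inj_on_circle:
  assumes "cis \<phi> = cis \<phi>'" "\<bar>\<phi> - \<phi>'\<bar> < 2 * pi"
  shows "\<phi> = \<phi>'"
proof -
  have "sin \<phi> = sin \<phi>' \<and> cos \<phi> = cos \<phi>'" using assms(1) by (simp add: complex_eq_iff)
  then obtain n :: int where n: "\<phi> = \<phi>' + 2 * pi * n" unfolding sin_cos_eq_iff by blast
  then have "2 * pi * \<bar>real_of_int n\<bar> < 2 * pi * 1" using assms(2) by (simp add: abs_mult)
  then have "\<bar>real_of_int n\<bar> < 1" by (subst (asm) mult_less_cancel_left_pos) auto
  then have "n = 0" by linarith
  then show ?thesis using n by simp
qed

text \<open>End angles within a single turn give each point one angle, so the overlap is a single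
  sector; otherwise the two could meet again after a full turn.\<close>

lemma wedge_Int_wedge:
  assumes "0 \<le> x" "y \<le> 2 * pi" "0 \<le> x'" "y' \<le> 2 * pi"
  shows "wedge x y \<inter> wedge x' y' = wedge (max x x') (min y y')"
proof (intro set_eqI iffI)
  fix t assume t: "t \<in> wedge x y \<inter> wedge x' y'"
  obtain \<rho> \<phi> where 1: "t = of_real \<rho> * cis \<phi>" "0 < \<rho>" "x < \<phi>" "\<phi> < y"
    using t unfolding wedge_def by blast
  obtain \<rho>' \<phi>' where 2: "t = of_real \<rho>' * cis \<phi>'" "0 < \<rho>'" "x' < \<phi>'" "\<phi>' < y'"
    using t unfolding wedge_def by blast
  have "norm t = \<rho>" unfolding 1(1) using 1(2) by (simp add: norm_mult)
  moreover have "norm t = \<rho>'" unfolding 2(1) using 2(2) by (simp add: norm_mult)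
  ultimately have "\<rho> = \<rho>'" by simp
  then have "cis \<phi> = cis \<phi>'" using 1 2 by simp
  moreover have "\<bar>\<phi> - \<phi>'\<bar> < 2 * pi" using 1 2 assms unfolding abs_less_iff by auto
  ultimately have "\<phi> = \<phi>'" by (rule cis_inj_on_circle)
  then show "t \<in> wedge (max x x') (min y y')" using 1 2 unfolding wedge_def by auto
next
  fix t assume t: "t \<in> wedge (max x x') (min y y')"
  have "wedge (max x x') (min y y') \<subseteq> wedge x y" "wedge (max x x') (min y y') \<subseteq> wedge x' y'"
    by (rule wedge_mono; simp)+
  then show "t \<in> wedge x y \<inter> wedge x' y'" using t by blast
qed

lemma disc_sector_eq_wedge: "disc_sector ((x + y) / 2) (y - x) r = wedge x y \<union> ball 0 r"
proof -
  have "(x + y) / 2 - (y - x) / 2 = x" "(x + y) / 2 + (y - x) / 2 = y" by (simp_all add: field_simps)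
  then show ?thesis unfolding disc_sector_def sector_eq_wedge by simp
qed

text \<open>In the disc both extensions are sums of the same series. The overlap of the sectors is
  connected and meets the disc, so they agree there as well.\<close>

lemma sector_extension_glue:
  assumes g1: "sector_extension K ((x1 + y1) / 2) (y1 - x1) r M a c g1"
    and g2: "sector_extension K ((x2 + y2) / 2) (y2 - x2) r M a c g2"
    and r: "0 < r" and xy: "0 \<le> x1" "y1 \<le> 2 * pi" "0 \<le> x2" "y2 \<le> 2 * pi" "x2 < y1" "max x1 x2 < min y1 y2"
  shows "\<exists>g. sector_extension K ((x1 + y2) / 2) (y2 - x1) r M a c g"
proof -
  let ?W1 = "wedge x1 y1 \<union> ball 0 r" and ?W2 = "wedge x2 y2 \<union> ball 0 r" and ?W = "wedge x1 y2 \<union> ball 0 r"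
  have h1: "g1 holomorphic_on ?W1" "\<And>t. t \<in> ?W1 \<Longrightarrow> norm (g1 t) \<le> M * exp (a * norm t powr K)"
      "\<And>t. t \<in> ball 0 r \<Longrightarrow> (\<lambda>j. c j * t ^ j) sums g1 t"
    using g1 unfolding sector_extension_def disc_sector_eq_wedge by auto
  have h2: "g2 holomorphic_on ?W2" "\<And>t. t \<in> ?W2 \<Longrightarrow> norm (g2 t) \<le> M * exp (a * norm t powr K)"
      "\<And>t. t \<in> ball 0 r \<Longrightarrow> (\<lambda>j. c j * t ^ j) sums g2 t"
    using g2 unfolding sector_extension_def disc_sector_eq_wedge by auto
  have ball: "g1 t = g2 t" if "t \<in> ball 0 r" for t using h1(3)[OF that] h2(3)[OF that] by (rule sums_unique2)
  have wedge: "g1 t = g2 t" if t: "t \<in> wedge x1 y1 \<inter> wedge x2 y2" for t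
  proof -
    let ?V = "wedge (max x1 x2) (min y1 y2)"
    have V: "wedge x1 y1 \<inter> wedge x2 y2 = ?V" by (rule wedge_Int_wedge) (use xy in auto)
    show ?thesis
    proof (rule analytic_continuation_open[where s = "?V \<inter> ball 0 r" and s' = ?V and f = g1 and g = g2])
      show "?V \<inter> ball 0 r \<noteq> {}" by (rule wedge_Int_ball_nonempty) (use xy r in auto)
      show "g1 holomorphic_on ?V" by (rule holomorphic_on_subset[OF h1(1)]) (use V in blast)
      show "g2 holomorphic_on ?V" by (rule holomorphic_on_subset[OF h2(1)]) (use V in blast)
    qed (use t V ball in \<open>auto simp: open_wedge connected_wedge open_Int\<close>)
  qed
  have sub: "?W \<subseteq> ?W1 \<union> ?W2"
  proof
    fix t assume "t \<in> ?W"
    then consider "t \<in> ball 0 r" | "t \<in> wedge x1 y2" by blast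
    then show "t \<in> ?W1 \<union> ?W2"
    proof cases
      case 2
      then obtain \<rho> \<phi> where *: "t = of_real \<rho> * cis \<phi>" "0 < \<rho>" "x1 < \<phi>" "\<phi> < y2" unfolding wedge_def by blast
      show ?thesis
      proof (cases "\<phi> < y1")
        case True
        then show ?thesis using * unfolding wedge_def by blast
      next
        case False
        then have "x2 < \<phi>" using xy by linarith
        then show ?thesis using * unfolding wedge_def by blast
      qed
    qed auto
  qed
  define g where "g = (\<lambda>t. if t \<in> ?W1 then g1 t else g2 t)"
  have "g holomorphic_on ?W1 \<union> ?W2"
    unfolding g_def by (rule holomorphic_on_If_Un[OF h1(1) h2(1)]) (use ball wedge in \<open>auto simp: open_wedge open_Un\<close>)
  then have "g holomorphic_on ?W" using sub by (rule holomorphic_on_subset)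
  moreover have "norm (g t) \<le> M * exp (a * norm t powr K)" if "t \<in> ?W" for t
    using h1(2)[of t] h2(2)[of t] that sub unfolding g_def by auto
  moreover have "(\<lambda>j. c j * t ^ j) sums g t" if "t \<in> ball 0 r" for t
    using h1(3)[OF that] that by (simp add: g_def)
  ultimately show ?thesis unfolding sector_extension_def disc_sector_eq_wedge by blast
qed

text \<open>Compactness of the angles between \<delta> and \<open>2 * pi - \<delta>\<close>, in the
  form of bisection: each direction has a continuation nearby, and adjacent ones are glued with the
  worse of their constants. One set of constants thus serves almost the whole plane.\<close>

lemma sector_extension_all_directions:
  assumes c: "\<And>\<psi>. 0 < \<psi> \<Longrightarrow> \<psi> < 2 * pi \<Longrightarrow> uniformly_continuable K \<psi> B c"
    and B: "\<And>n. 0 \<le> B n" and \<delta>: "0 < \<delta>" "\<delta> < pi"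
  shows "\<exists>r>0. \<exists>C\<ge>0. \<exists>A>0. \<exists>a\<ge>0. \<forall>n. \<exists>g. sector_extension K pi (2 * pi - 2 * \<delta>) r (C * A ^ n * B n) a (c n) g"
proof -
  define Q where "Q = (\<lambda>x y. \<exists>r>0. \<exists>C\<ge>0. \<exists>A>0. \<exists>a\<ge>0. \<forall>n. \<exists>g.
      sector_extension K ((x + y) / 2) (y - x) r (C * A ^ n * B n) a (c n) g)"
  \<comment> \<open>The sector reaches strictly beyond u and v, so that the sectors for adjacent
    intervals overlap.\<close>
  define P where "P = (\<lambda>u v. u \<le> v \<longrightarrow> (\<exists>x y. 0 \<le> x \<and> x < u \<and> v < y \<and> y \<le> 2 * pi \<and> Q x y))"
  have "P \<delta> (2 * pi - \<delta>)"
  proof (rule Bolzano)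
    show "\<delta> \<le> 2 * pi - \<delta>" using \<delta> by simp
  next
    fix u v w assume "P u v" "P v w" and uv: "u \<le> v" "v \<le> w"
    then obtain x1 y1 x2 y2 where *: "0 \<le> x1" "x1 < u" "v < y1" "y1 \<le> 2 * pi" "Q x1 y1"
        "0 \<le> x2" "x2 < v" "w < y2" "y2 \<le> 2 * pi" "Q x2 y2"
      unfolding P_def by blast
    obtain r1 C1 A1 a1 where 1: "r1 > 0" "C1 \<ge> 0" "A1 > 0" "a1 \<ge> 0"
      "\<forall>n. \<exists>g. sector_extension K ((x1 + y1) / 2) (y1 - x1) r1 (C1 * A1 ^ n * B n) a1 (c n) g"
      using *(5) unfolding Q_def by blast
    obtain r2 C2 A2 a2 where 2: "r2 > 0" "C2 \<ge> 0" "A2 > 0" "a2 \<ge> 0"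
      "\<forall>n. \<exists>g. sector_extension K ((x2 + y2) / 2) (y2 - x2) r2 (C2 * A2 ^ n * B n) a2 (c n) g"
      using *(10) unfolding Q_def by blast
    define r C A a where d: "r = min r1 r2" "C = max C1 C2" "A = max A1 A2" "a = max a1 a2"
    have "\<exists>g. sector_extension K ((x1 + y2) / 2) (y2 - x1) r (C * A ^ n * B n) a (c n) g" for n
    proof -
      obtain g1 where g1: "sector_extension K ((x1 + y1) / 2) (y1 - x1) r1 (C1 * A1 ^ n * B n) a1 (c n) g1" using 1 by blast
      obtain g2 where g2: "sector_extension K ((x2 + y2) / 2) (y2 - x2) r2 (C2 * A2 ^ n * B n) a2 (c n) g2" using 2 by blast
      have M1: "C1 * A1 ^ n * B n \<le> C * A ^ n * B n" and M2: "C2 * A2 ^ n * B n \<le> C * A ^ n * B n"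
        using 1 2 B by (auto simp: d intro!: mult_mono power_mono mult_nonneg_nonneg)
      have M0: "0 \<le> C * A ^ n * B n" using 1 2 B by (auto simp: d intro!: mult_nonneg_nonneg)
      have g1': "sector_extension K ((x1 + y1) / 2) (y1 - x1) r (C * A ^ n * B n) a (c n) g1"
        by (rule sector_extension_mono[OF g1]) (use M1 M0 in \<open>auto simp: d\<close>)
      have g2': "sector_extension K ((x2 + y2) / 2) (y2 - x2) r (C * A ^ n * B n) a (c n) g2"
        by (rule sector_extension_mono[OF g2]) (use M2 M0 in \<open>auto simp: d\<close>)
      show ?thesis
        by (rule sector_extension_glue[OF g1' g2']) (use * uv 1 2 in \<open>auto simp: d\<close>)
    qed
    moreover have "r > 0" "C \<ge> 0" "A > 0" "a \<ge> 0" using 1 2 by (auto simp: d)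
    ultimately have "Q x1 y2" unfolding Q_def by blast
    then show "P u w" unfolding P_def using * by blast
  next
    fix x assume "\<delta> \<le> x" "x \<le> 2 * pi - \<delta>"
    then have x: "0 < x" "x < 2 * pi" using \<delta> by auto
    \<comment> \<open>The cap on the opening keeps the local sector within a single turn, as gluing
      demands.\<close>
    obtain \<alpha> r C A a g where g: "0 < \<alpha>" "\<alpha> \<le> 2 * min x (2 * pi - x)" "0 < r" "0 \<le> C" "0 < A" "0 \<le> a"
       "\<forall>n. sector_extension K x \<alpha> r (C * A ^ n * B n) a (c n) (g n)"
      by (rule uniformly_continuableE[OF c[OF x] B, of "2 * min x (2 * pi - x)"]) (use x in auto)
    have e: "((x - \<alpha> / 2) + (x + \<alpha> / 2)) / 2 = x" "(x + \<alpha> / 2) - (x - \<alpha> / 2) = \<alpha>" by simp_all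
    have "Q (x - \<alpha> / 2) (x + \<alpha> / 2)" unfolding Q_def e using g by blast
    moreover have "\<alpha> / 2 \<le> x" "\<alpha> / 2 \<le> 2 * pi - x" using g(2) unfolding min_def by (auto split: if_splits)
    ultimately have "\<forall>u v. u \<le> x \<and> x \<le> v \<and> v - u < \<alpha> / 2 \<longrightarrow> P u v"
      unfolding P_def by (intro allI impI exI[of _ "x - \<alpha> / 2"] exI[of _ "x + \<alpha> / 2"]) auto
    then show "\<exists>d>0. \<forall>u v. u \<le> x \<and> x \<le> v \<and> v - u < d \<longrightarrow> P u v" using g(1) by (intro exI[of _ "\<alpha> / 2"]) auto
  qed
  then obtain x y where xy: "0 \<le> x" "x < \<delta>" "2 * pi - \<delta> < y" "y \<le> 2 * pi" "Q x y"
    unfolding P_def using \<delta> by auto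
  then obtain r C A a where 1: "r > 0" "C \<ge> 0" "A > 0" "a \<ge> 0"
      "\<forall>n. \<exists>g. sector_extension K ((x + y) / 2) (y - x) r (C * A ^ n * B n) a (c n) g"
    unfolding Q_def by blast
  have "\<exists>g. sector_extension K pi (2 * pi - 2 * \<delta>) r (C * A ^ n * B n) a (c n) g" for n
  proof -
    obtain g where g: "sector_extension K ((x + y) / 2) (y - x) r (C * A ^ n * B n) a (c n) g" using 1 by blast
    have e: "pi - (2 * pi - 2 * \<delta>) / 2 = \<delta>" "pi + (2 * pi - 2 * \<delta>) / 2 = 2 * pi - \<delta>" by (simp_all add: field_simps)
    have "disc_sector pi (2 * pi - 2 * \<delta>) r \<subseteq> disc_sector ((x + y) / 2) (y - x) r"
      unfolding disc_sector_eq_wedge unfolding disc_sector_def sector_eq_wedge e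
      using wedge_mono[of x \<delta> "2 * pi - \<delta>" y] xy by auto
    then have "sector_extension K pi (2 * pi - 2 * \<delta>) r (C * A ^ n * B n) a (c n) g"
      using g unfolding sector_extension_def by (blast intro: holomorphic_on_subset)
    then show ?thesis by blast
  qed
  then show ?thesis using 1 by blast
qed

section \<open>Contour integrals in the logarithmic coordinate\<close>

lemma linepath_integral_sums:
  assumes cont: "\<And>j. continuous_on (closed_segment p q) (F j)"
    and le: "\<And>j \<zeta>. \<zeta> \<in> closed_segment p q \<Longrightarrow> norm (F j \<zeta>) \<le> M j" and M: "summable M"
    and sm: "\<And>\<zeta>. \<zeta> \<in> closed_segment p q \<Longrightarrow> (\<lambda>j. F j \<zeta>) sums G \<zeta>"
  shows "(\<lambda>j. contour_integral (linepath p q) (F j)) sums contour_integral (linepath p q) G"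
proof -
  have int: "F j contour_integrable_on linepath p q" for j
    by (rule contour_integrable_continuous_linepath[OF cont])
  have "uniform_limit (closed_segment p q) (\<lambda>n \<zeta>. \<Sum>j<n. F j \<zeta>) (\<lambda>\<zeta>. \<Sum>j. F j \<zeta>) sequentially"
    by (rule Weierstrass_m_test[OF le M])
  then have ul: "uniform_limit (path_image (linepath p q)) (\<lambda>n \<zeta>. \<Sum>j<n. F j \<zeta>) G sequentially"
    using sm by (subst (asm) uniform_limit_cong'[of _ _ _ _ G]) (auto simp: sums_iff)
  have "(\<lambda>n. contour_integral (linepath p q) (\<lambda>\<zeta>. \<Sum>j<n. F j \<zeta>)) \<longlonglongrightarrow> contour_integral (linepath p q) G"
    by (rule contour_integral_uniform_limit(2)[OF _ ul, of "norm (q - p)"])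
       (use int in \<open>auto intro!: always_eventually contour_integrable_sum simp: vector_derivative_linepath_at\<close>)
  then show ?thesis unfolding sums_def using int by (simp add: contour_integral_sum)
qed

lemma vertical_integral_exp:
  fixes l :: int
  shows "contour_integral (linepath q (q + 2 * of_real pi * \<i>)) (\<lambda>\<zeta>. exp (of_int l * \<zeta>)) = (if l = 0 then 2 * of_real pi * \<i> else 0)"
proof (cases "l = 0")
  case False
  have "((\<lambda>\<zeta>. exp (of_int l * \<zeta>)) has_contour_integral
      (exp (of_int l * pathfinish (linepath q (q + 2 * of_real pi * \<i>))) / of_int l - exp (of_int l * pathstart (linepath q (q + 2 * of_real pi * \<i>))) / of_int l))
      (linepath q (q + 2 * of_real pi * \<i>))"
    by (rule contour_integral_primitive[of UNIV])
       (use False in \<open>auto intro!: derivative_eq_intros\<close>)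
  moreover have "exp (of_int l * (q + 2 * of_real pi * \<i>)) = exp (of_int l * q)"
  proof -
    have "exp (of_int l * (2 * of_real pi * \<i>)) = 1"
      using exp_eq_1[of "of_int l * (2 * of_real pi * \<i>)"] by auto
    then show ?thesis by (simp add: distrib_left exp_add)
  qed
  ultimately show ?thesis using False by (auto dest: contour_integral_unique)
qed simp

text \<open>Cauchy's coefficient formula: under \<open>exp\<close> the segment of length
  \<open>2 * pi\<close> runs once round the circle of radius \<open>exp (Re q)\<close>. The usual
  extra factor \<open>1 / s\<close> is cancelled by the differential of
  \<open>s = exp \<zeta>\<close>.\<close>

lemma vertical_integral_coefficient:
  assumes f: "\<And>t. t \<in> ball 0 r \<Longrightarrow> (\<lambda>j. c j * t ^ j) sums f t" and q: "exp (Re q) < r"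
  shows "contour_integral (linepath q (q + 2 * of_real pi * \<i>)) (\<lambda>\<zeta>. f (exp \<zeta>) * exp (- (of_nat l * \<zeta>))) = 2 * of_real pi * \<i> * c l"
proof -
  let ?p = "q + 2 * of_real pi * \<i>"
  have re: "Re \<zeta> = Re q" if "\<zeta> \<in> closed_segment q ?p" for \<zeta>
    using that by (auto simp: closed_segment_def algebra_simps)
  have "norm (exp q) < norm (of_real ((exp (Re q) + r) / 2) :: complex)" 
    unfolding norm_of_real norm_exp_eq_Re using less_half_sum[OF q] gt_half_sum[OF q] exp_gt_zero[of "Re q"]
    by (simp only: one_add_one)
  moreover have "summable (\<lambda>j. c j * of_real ((exp (Re q) + r) / 2) ^ j)"
  proof (rule sums_summable[OF f])
    have "0 < r" using q by (meson exp_gt_zero less_trans)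
    then have "0 < (exp (Re q) + r) / 2" by (simp add: add_pos_pos)
    then have "\<bar>(exp (Re q) + r) / 2\<bar> < r"
      using gt_half_sum[OF q] by (simp only: one_add_one abs_of_pos)
    then show "complex_of_real ((exp (Re q) + r) / 2) \<in> ball 0 r"
      by (simp only: mem_ball_0 norm_of_real)
  qed
  ultimately have ss: "summable (\<lambda>j. norm (c j * exp q ^ j))" by (intro powser_insidea)
  have eq: "c j * exp \<zeta> ^ j * exp (- (of_nat l * \<zeta>)) = c j * exp (of_int (int j - int l) * \<zeta>)" for j \<zeta>
    by (simp add: exp_of_nat_mult[symmetric] algebra_simps flip: exp_add)
  have "(\<lambda>j. contour_integral (linepath q ?p) (\<lambda>\<zeta>. c j * exp (of_int (int j - int l) * \<zeta>))) sums
      contour_integral (linepath q ?p) (\<lambda>\<zeta>. f (exp \<zeta>) * exp (- (of_nat l * \<zeta>)))"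
  proof (rule linepath_integral_sums[where M = "\<lambda>j. norm (c j * exp q ^ j) * exp (- (real l * Re q))"])
    fix j \<zeta> assume "\<zeta> \<in> closed_segment q ?p"
    then show "norm (c j * exp (of_int (int j - int l) * \<zeta>)) \<le> norm (c j * exp q ^ j) * exp (- (real l * Re q))"
      unfolding eq[symmetric] using re[of \<zeta>] by (simp add: norm_mult norm_power)
  next
    fix \<zeta> assume \<zeta>: "\<zeta> \<in> closed_segment q ?p"
    have "(\<lambda>j. c j * exp \<zeta> ^ j * exp (- (of_nat l * \<zeta>))) sums (f (exp \<zeta>) * exp (- (of_nat l * \<zeta>)))"
      by (intro sums_mult2 f) (use re[OF \<zeta>] q in simp)
    then show "(\<lambda>j. c j * exp (of_int (int j - int l) * \<zeta>)) sums (f (exp \<zeta>) * exp (- (of_nat l * \<zeta>)))"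
      by (simp only: eq)
  qed (use ss in \<open>auto intro!: continuous_intros summable_mult2\<close>)
  moreover have "contour_integral (linepath q ?p) (\<lambda>\<zeta>. c j * exp (of_int (int j - int l) * \<zeta>)) = (if j = l then 2 * of_real pi * \<i> * c l else 0)" for j
  proof -
    have "(\<lambda>\<zeta>. exp (of_int (int j - int l) * \<zeta>)) contour_integrable_on linepath q ?p"
      by (intro contour_integrable_continuous_linepath continuous_intros)
    then show ?thesis by (simp add: contour_integral_lmul vertical_integral_exp del: of_int_diff)
  qed
  ultimately have "(\<lambda>j. if j = l then 2 * of_real pi * \<i> * c l else 0) sums
      contour_integral (linepath q ?p) (\<lambda>\<zeta>. f (exp \<zeta>) * exp (- (of_nat l * \<zeta>)))" by simp
  moreover have "(\<lambda>j. if j = l then 2 * of_real pi * \<i> * c l else 0) sums (2 * of_real pi * \<i> * c l)"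
    using sums_single[of l "\<lambda>_. 2 * of_real pi * \<i> * c l"] by simp
  ultimately show ?thesis by (rule sums_unique2)
qed

lemma linepath_integral_holomorphic:
  assumes G: "continuous_on (closed_segment p q) G" and H: "H holomorphic_on D" and D: "open D"
    and U: "open U" and sub: "\<And>\<tau> \<zeta>. \<tau> \<in> U \<Longrightarrow> \<zeta> \<in> closed_segment p q \<Longrightarrow> \<tau> * exp (- \<zeta>) \<in> D"
  shows "(\<lambda>\<tau>. contour_integral (linepath p q) (\<lambda>\<zeta>. G \<zeta> * H (\<tau> * exp (- \<zeta>)))) holomorphic_on U"
  unfolding holomorphic_on_open[OF U]
proof
  fix \<tau>0 assume "\<tau>0 \<in> U"
  then obtain e where e: "e > 0" "ball \<tau>0 e \<subseteq> U" using U open_contains_ball by blast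
  let ?L = "linepath p q"
  define f where "f = (\<lambda>\<tau> t. G (?L t) * H (\<tau> * exp (- ?L t)) * (q - p))"
  define fx where "fx = (\<lambda>\<tau> t. G (?L t) * (deriv H (\<tau> * exp (- ?L t)) * exp (- ?L t)) * (q - p))"
  have L: "?L t \<in> closed_segment p q" if "t \<in> {0..1}" for t using that linepath_in_path by blast
  have inD: "\<tau> * exp (- ?L t) \<in> D" if "\<tau> \<in> ball \<tau>0 e" "t \<in> {0..1}" for \<tau> t
    using sub[OF _ L] that e by blast
  have cG: "continuous_on {0..1} (\<lambda>t. G (?L t))"
    by (rule continuous_on_compose2[OF G continuous_on_linepath]) (use L in auto)
  have cH: "continuous_on D H" "continuous_on D (deriv H)"
    using H holomorphic_deriv[OF H D] holomorphic_on_imp_continuous_on by blast+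
  have "(\<lambda>\<tau>. integral (cbox 0 1) (f \<tau>)) holomorphic_on ball \<tau>0 e"
  proof (rule leibniz_rule_holomorphic[where fx = fx])
    fix \<tau> and t :: real assume \<tau>: "\<tau> \<in> ball \<tau>0 e" and t: "t \<in> cbox 0 1"
    have "(H has_field_derivative deriv H (\<tau> * exp (- ?L t))) (at (\<tau> * exp (- ?L t)))"
      by (rule holomorphic_derivI[OF H D inD]) (use \<tau> t in auto)
    then have "((\<lambda>\<tau>. H (\<tau> * exp (- ?L t))) has_field_derivative deriv H (\<tau> * exp (- ?L t)) * exp (- ?L t)) (at \<tau> within ball \<tau>0 e)"
      by (rule DERIV_chain2[OF _ ]) (auto intro!: derivative_eq_intros)
    then show "((\<lambda>\<tau>. f \<tau> t) has_field_derivative fx \<tau> t) (at \<tau> within ball \<tau>0 e)"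
      unfolding f_def fx_def by (intro DERIV_cmult_right DERIV_cmult)
  next
    fix \<tau> assume \<tau>: "\<tau> \<in> ball \<tau>0 e"
    have "continuous_on {0..1} (f \<tau>)" unfolding f_def
      by (intro continuous_intros cG continuous_on_compose2[OF cH(1)]) (use inD[OF \<tau>] in auto)
    then show "f \<tau> integrable_on cbox 0 1" using integrable_continuous_interval by (simp add: cbox_interval)
  next
    have cL: "continuous_on (ball \<tau>0 e \<times> {0..1}) (\<lambda>x. ?L (snd x))"
      by (rule continuous_on_compose2[OF continuous_on_linepath[of UNIV]]) (auto intro!: continuous_intros)
    have "continuous_on (ball \<tau>0 e \<times> {0..1}) (\<lambda>x. fx (fst x) (snd x))"
      unfolding fx_def
      by (intro continuous_on_mult continuous_on_const continuous_on_compose2[OF cG continuous_on_snd]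
            continuous_on_compose2[OF cH(2)] continuous_on_exp continuous_on_minus cL continuous_on_fst continuous_on_id)
         (use inD in auto)
    then show "continuous_on (ball \<tau>0 e \<times> cbox 0 1) (\<lambda>(\<tau>, t). fx \<tau> t)"
      by (simp add: case_prod_unfold cbox_interval)
  qed simp
  moreover have "integral (cbox 0 1) (f \<tau>) = contour_integral ?L (\<lambda>\<zeta>. G \<zeta> * H (\<tau> * exp (- \<zeta>)))" for \<tau>
    unfolding contour_integral_integral f_def by (simp add: vector_derivative_linepath_at cbox_interval)
  ultimately have "(\<lambda>\<tau>. contour_integral ?L (\<lambda>\<zeta>. G \<zeta> * H (\<tau> * exp (- \<zeta>)))) holomorphic_on ball \<tau>0 e" by simp
  then show "\<exists>f'. ((\<lambda>\<tau>. contour_integral ?L (\<lambda>\<zeta>. G \<zeta> * H (\<tau> * exp (- \<zeta>)))) has_field_derivative f') (at \<tau>0)"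
    unfolding holomorphic_on_open[OF open_ball] using e(1) by auto
qed

section \<open>Hadamard products\<close>

text \<open>The Hadamard product at \<open>\<tau>\<close> is the integral of \<open>f s * H (\<tau> / s) / (2 * pi * \<i> * s)\<close> over a small
  circle. In the coordinate \<open>s = exp \<zeta>\<close> the arc of the circle inside the sector of \<open>f\<close> is replaced by
  two radial segments and an arc of radius \<open>T\<close>: for \<open>\<tau>\<close> in a smaller sector with
  \<open>norm \<tau> < T * R\<close>, the quotient \<open>\<tau> / s\<close> then stays in the disc of \<open>H\<close> or away from the positive
  axis.\<close>

lemma hadamard_extension:
  assumes K: "K > 0" and fext: "sector_extension K \<theta> \<alpha> r Mf af fc f"
    and \<alpha>: "0 < \<alpha>" "\<alpha> \<le> pi" and r: "0 < r" and Mf: "0 \<le> Mf" and af: "0 \<le> af" and R: "0 < R" and b: "0 \<le> b"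
  obtains \<rho> C a where "\<rho> > 0" "C \<ge> 0" "a \<ge> 0"
    "\<And>H h M s. 0 \<le> M \<Longrightarrow> sector_extension K pi (2 * pi - \<alpha> / 4) R M b h H \<Longrightarrow>
       \<exists>\<phi>. sector_extension K \<theta> (\<alpha> / 2) \<rho> (C * (2 / r) ^ s * M) a (\<lambda>j. fc (s + j) * h j) \<phi>"
proof -
  \<comment> \<open>\<beta> lies midway between the half-openings \<open>\<alpha> / 4\<close> of the
    result and \<open>\<alpha> / 2\<close> of f. The quotient then keeps an angle of more than
    \<open>\<alpha> / 8\<close> from the positive axis, which is exactly the gap that the domain of
    H leaves.\<close>
  define \<beta> where "\<beta> = 3 * \<alpha> / 8"
  define r0 where "r0 = r / 2"
  have r0: "0 < r0" "r0 < r" using r by (auto simp: r0_def)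
  have \<beta>: "0 < \<beta>" "\<beta> < \<alpha> / 2" "\<beta> < pi" "\<beta> - \<alpha> / 4 = \<alpha> / 8" "\<beta> + \<alpha> / 4 = 5 * \<alpha> / 8" using \<alpha> by (auto simp: \<beta>_def)
  define DF where "DF = disc_sector \<theta> \<alpha> r"
  define DH where "DH = disc_sector pi (2 * pi - \<alpha> / 4) R"
  have f_hol: "f holomorphic_on DF" and f_le: "\<And>t. t \<in> DF \<Longrightarrow> norm (f t) \<le> Mf * exp (af * norm t powr K)"
    and f_sums: "\<And>t. t \<in> ball 0 r \<Longrightarrow> (\<lambda>j. fc j * t ^ j) sums f t"
    using fext unfolding sector_extension_def DF_def by auto
  have DF_disc: "exp \<zeta> \<in> DF" if "exp (Re \<zeta>) < r" for \<zeta> using that by (simp add: DF_def disc_sector_def)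
  have DF_sec: "exp \<zeta> \<in> DF" if "\<bar>Im \<zeta> - \<theta>\<bar> < \<alpha> / 2" for \<zeta>
    using exp_in_sector[OF that] by (simp add: DF_def disc_sector_def)
  have DH_sec: "\<tau> * exp (- \<zeta>) \<in> DH"
    if \<tau>: "\<tau> \<in> sector \<theta> (\<alpha> / 2)" and \<zeta>: "\<beta> \<le> Im \<zeta> - \<theta> \<and> Im \<zeta> - \<theta> \<le> 2 * pi - \<beta> \<or> Im \<zeta> - \<theta> = - \<beta>" for \<tau> \<zeta>
  proof -
    obtain \<sigma> \<psi> where *: "\<tau> = of_real \<sigma> * cis \<psi>" "0 < \<sigma>" "\<bar>\<psi> - \<theta>\<bar> < \<alpha> / 2 / 2" using \<tau> by (rule sectorE)
    have ps: "- (\<alpha> / 4) < \<psi> - \<theta>" "\<psi> - \<theta> < \<alpha> / 4" using *(3) unfolding abs_less_iff by auto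
    have eq: "\<tau> * exp (- \<zeta>) = of_real (\<sigma> * exp (- Re \<zeta>)) * cis (\<psi> - Im \<zeta>)"
      by (simp add: * exp_eq_polar[of "- \<zeta>"] cis_mult mult_ac)
    have pos: "0 < \<sigma> * exp (- Re \<zeta>)" using * by simp
    have "\<exists>\<omega>. cis (\<psi> - Im \<zeta>) = cis \<omega> \<and> \<alpha> / 8 < \<omega> \<and> \<omega> < 2 * pi - \<alpha> / 8"
    proof (cases "Im \<zeta> - \<theta> = - \<beta>")
      case True
      have "\<alpha> / 8 < \<psi> - Im \<zeta>" "\<psi> - Im \<zeta> < 5 * \<alpha> / 8" using True ps \<beta> by argo+
      moreover have "5 * \<alpha> / 8 \<le> 2 * pi - \<alpha> / 8" using \<alpha> by argo
      ultimately show ?thesis by (intro exI[of _ "\<psi> - Im \<zeta>"]) auto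
    next
      case False
      \<comment> \<open>The kept arc is parametrised by increasing angles from
        \<open>\<theta> + \<beta>\<close> on, so a full turn brings the angle of the quotient into
        the range of H.\<close>
      have "cis (\<psi> - Im \<zeta>) = cis (\<psi> - Im \<zeta> + 2 * pi)" by (simp add: cis_mult[symmetric] complex_eq_iff)
      moreover have "\<alpha> / 8 < \<psi> - Im \<zeta> + 2 * pi" "\<psi> - Im \<zeta> + 2 * pi < 2 * pi - \<alpha> / 8" using False \<zeta> ps \<beta> by argo+
      ultimately show ?thesis by blast
    qed
    then obtain \<omega> where \<omega>: "cis (\<psi> - Im \<zeta>) = cis \<omega>" "\<alpha> / 8 < \<omega>" "\<omega> < 2 * pi - \<alpha> / 8" by blast
    have "\<tau> * exp (- \<zeta>) \<in> sector pi (2 * pi - \<alpha> / 4)"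
    proof (rule sectorI[OF _ pos])
      show "\<tau> * exp (- \<zeta>) = of_real (\<sigma> * exp (- Re \<zeta>)) * cis \<omega>" using eq \<omega>(1) by simp
      have "\<bar>\<omega> - pi\<bar> < pi - \<alpha> / 8" using \<omega>(2,3) unfolding abs_less_iff by auto
      then show "\<bar>\<omega> - pi\<bar> < (2 * pi - \<alpha> / 4) / 2" by (simp add: diff_divide_distrib)
    qed
    then show ?thesis by (simp add: DH_def disc_sector_def)
  qed
  have DH_disc: "\<tau> * exp (- \<zeta>) \<in> DH" if "norm \<tau> * exp (- Re \<zeta>) < R" for \<tau> \<zeta>
    using that by (simp add: DH_def disc_sector_def norm_mult)
  \<comment> \<open>Corners of the contours in the coordinate \<zeta>. On the circle of radius r0
    the kept arc runs from p1 to p2, the replaced one from q1 to p1, and p2 is q1 one turn later; q2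
    and q3 have modulus T.\<close>
  define p1 p2 q1 where "p1 = Complex (ln r0) (\<theta> + \<beta>)" and "p2 = Complex (ln r0) (\<theta> + 2 * pi - \<beta>)"
    and "q1 = Complex (ln r0) (\<theta> - \<beta>)"
  define q2 q3 where "q2 = (\<lambda>T. Complex (ln T) (\<theta> - \<beta>))" and "q3 = (\<lambda>T. Complex (ln T) (\<theta> + \<beta>))"
  have p2: "p2 = q1 + 2 * of_real pi * \<i>" by (simp add: p2_def q1_def complex_eq_iff)
  have seg1: "Re \<zeta> = ln r0 \<and> \<beta> \<le> Im \<zeta> - \<theta> \<and> Im \<zeta> - \<theta> \<le> 2 * pi - \<beta>" if "\<zeta> \<in> closed_segment p1 p2" for \<zeta>
  proof -
    from that obtain u where u: "\<zeta> = (1 - u) *\<^sub>R p1 + u *\<^sub>R p2" "0 \<le> u" "u \<le> 1" unfolding closed_segment_def by blast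
    have "Im \<zeta> - \<theta> - \<beta> = u * (2 * pi - 2 * \<beta>)" "2 * pi - \<beta> - (Im \<zeta> - \<theta>) = (1 - u) * (2 * pi - 2 * \<beta>)"
      by (simp_all add: u(1) p1_def p2_def algebra_simps)
    moreover have "0 \<le> u * (2 * pi - 2 * \<beta>)" "0 \<le> (1 - u) * (2 * pi - 2 * \<beta>)" using u \<beta> by auto
    ultimately have "0 \<le> Im \<zeta> - \<theta> - \<beta>" "0 \<le> 2 * pi - \<beta> - (Im \<zeta> - \<theta>)" by (simp_all only:)
    moreover have "Re \<zeta> = ln r0" by (simp add: u(1) p1_def p2_def algebra_simps)
    ultimately show ?thesis by auto
  qed
  have segq: "Re \<zeta> = ln r0 \<and> \<bar>Im \<zeta> - \<theta>\<bar> \<le> \<beta>" if "\<zeta> \<in> closed_segment q1 p1" for \<zeta>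
  proof -
    from that obtain u where u: "\<zeta> = (1 - u) *\<^sub>R q1 + u *\<^sub>R p1" "0 \<le> u" "u \<le> 1" unfolding closed_segment_def by blast
    have "\<beta> - (Im \<zeta> - \<theta>) = (1 - u) * (2 * \<beta>)" "\<beta> + (Im \<zeta> - \<theta>) = u * (2 * \<beta>)"
      by (simp_all add: u(1) p1_def q1_def algebra_simps)
    moreover have "0 \<le> u * (2 * \<beta>)" "0 \<le> (1 - u) * (2 * \<beta>)" using u \<beta> by auto
    ultimately have "0 \<le> \<beta> - (Im \<zeta> - \<theta>)" "0 \<le> \<beta> + (Im \<zeta> - \<theta>)" by (simp_all only:)
    moreover have "Re \<zeta> = ln r0" by (simp add: u(1) p1_def q1_def algebra_simps)
    ultimately show ?thesis unfolding abs_le_iff by auto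
  qed
  have seg2: "Im \<zeta> - \<theta> = - \<beta> \<and> ln r0 \<le> Re \<zeta> \<and> Re \<zeta> \<le> ln T" if \<zeta>: "\<zeta> \<in> closed_segment q1 (q2 T)" and T: "r0 \<le> T" for \<zeta> T
  proof -
    from \<zeta> obtain u where u: "\<zeta> = (1 - u) *\<^sub>R q1 + u *\<^sub>R q2 T" "0 \<le> u" "u \<le> 1" unfolding closed_segment_def by blast
    have "Re \<zeta> - ln r0 = u * (ln T - ln r0)" "ln T - Re \<zeta> = (1 - u) * (ln T - ln r0)"
      by (simp_all add: u(1) q1_def q2_def algebra_simps)
    moreover have "0 \<le> u * (ln T - ln r0)" "0 \<le> (1 - u) * (ln T - ln r0)" using u T r0 by auto
    ultimately have "0 \<le> Re \<zeta> - ln r0" "0 \<le> ln T - Re \<zeta>" by (simp_all only:)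
    moreover have "Im \<zeta> - \<theta> = - \<beta>" by (simp add: u(1) q1_def q2_def algebra_simps)
    ultimately show ?thesis by auto
  qed
  have seg4: "Im \<zeta> - \<theta> = \<beta> \<and> ln r0 \<le> Re \<zeta> \<and> Re \<zeta> \<le> ln T" if \<zeta>: "\<zeta> \<in> closed_segment (q3 T) p1" and T: "r0 \<le> T" for \<zeta> T
  proof -
    from \<zeta> obtain u where u: "\<zeta> = (1 - u) *\<^sub>R q3 T + u *\<^sub>R p1" "0 \<le> u" "u \<le> 1" unfolding closed_segment_def by blast
    have "Re \<zeta> - ln r0 = (1 - u) * (ln T - ln r0)" "ln T - Re \<zeta> = u * (ln T - ln r0)"
      by (simp_all add: u(1) p1_def q3_def algebra_simps)
    moreover have "0 \<le> u * (ln T - ln r0)" "0 \<le> (1 - u) * (ln T - ln r0)" using u T r0 by auto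
    ultimately have "0 \<le> Re \<zeta> - ln r0" "0 \<le> ln T - Re \<zeta>" by (simp_all only:)
    moreover have "Im \<zeta> - \<theta> = \<beta>" by (simp add: u(1) p1_def q3_def algebra_simps)
    ultimately show ?thesis by auto
  qed
  have seg3: "Re \<zeta> = ln T \<and> \<bar>Im \<zeta> - \<theta>\<bar> \<le> \<beta>" if "\<zeta> \<in> closed_segment (q2 T) (q3 T)" for \<zeta> T
  proof -
    from that obtain u where u: "\<zeta> = (1 - u) *\<^sub>R q2 T + u *\<^sub>R q3 T" "0 \<le> u" "u \<le> 1" unfolding closed_segment_def by blast
    have "\<beta> - (Im \<zeta> - \<theta>) = (1 - u) * (2 * \<beta>)" "\<beta> + (Im \<zeta> - \<theta>) = u * (2 * \<beta>)"
      by (simp_all add: u(1) q2_def q3_def algebra_simps)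
    moreover have "0 \<le> u * (2 * \<beta>)" "0 \<le> (1 - u) * (2 * \<beta>)" using u \<beta> by auto
    ultimately have "0 \<le> \<beta> - (Im \<zeta> - \<theta>)" "0 \<le> \<beta> + (Im \<zeta> - \<theta>)" by (simp_all only:)
    moreover have "Re \<zeta> = ln T" by (simp add: u(1) q2_def q3_def algebra_simps)
    ultimately show ?thesis unfolding abs_le_iff by auto
  qed
  define \<rho> where "\<rho> = r0 * R / 2"
  have \<rho>: "0 < \<rho>" "\<rho> < r0 * R" using r0 R by (auto simp: \<rho>_def)
  obtain D where D: "D \<ge> 0" "\<And>x::real. 0 \<le> x \<Longrightarrow> x ^ 1 \<le> D * exp (x powr K)"
    using power_le_exp_powr[OF K] by blast
  define C1 where "C1 = Mf * exp (af * (2 * r0) powr K) * (2 * (1 + D / (R * r0)))"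
  define C2 where "C2 = Mf * exp (af * r0 powr K) * exp (b * R powr K)"
  \<comment> \<open>The summands are: the growth of f at an outer radius of at most
    \<open>2 * r0\<close> or \<open>4 / R * norm \<tau>\<close>; the growth of H at quotients of
    size at most \<open>norm \<tau> / r0\<close>; and 1 for the length of the radial
    segments.\<close>
  define a where "a = af * (4 / R) powr K + b * (1 / r0) powr K + 1"
  have C12: "C1 \<ge> 0" "C2 \<ge> 0" using Mf D R r0 by (auto simp: C1_def C2_def)
  have a: "a \<ge> 0" using af b by (simp add: a_def)
  have main: "\<exists>\<phi>. sector_extension K \<theta> (\<alpha> / 2) \<rho> ((C1 + C2) * (2 / r) ^ s * M) a (\<lambda>j. fc (s + j) * h j) \<phi>"
    if M: "0 \<le> M" and Hext: "sector_extension K pi (2 * pi - \<alpha> / 4) R M b h H" for H h M s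
  proof -
    have H_hol: "H holomorphic_on DH" and H_le: "\<And>t. t \<in> DH \<Longrightarrow> norm (H t) \<le> M * exp (b * norm t powr K)"
      and H_sums: "\<And>t. t \<in> ball 0 R \<Longrightarrow> (\<lambda>j. h j * t ^ j) sums H t"
      using Hext unfolding sector_extension_def DH_def by auto
    have DH_open: "open DH" and DF_open: "open DF" by (simp_all add: DH_def DF_def open_disc_sector)
    define G where "G = (\<lambda>\<zeta>. f (exp \<zeta>) * exp (- (of_nat s * \<zeta>)))"
    define \<Phi> where "\<Phi> = (\<lambda>\<tau> \<zeta>. G \<zeta> * H (\<tau> * exp (- \<zeta>)))"
    define I where "I = (\<lambda>p q \<tau>. contour_integral (linepath p q) (\<Phi> \<tau>))"
    \<comment> \<open>Instead of the arc from q1 to p1, the contour goes out to radius T, along the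
      arc there, and back.\<close>
    define J where "J = (\<lambda>T \<tau>. I p1 p2 \<tau> + (I q1 (q2 T) \<tau> + I (q2 T) (q3 T) \<tau> + I (q3 T) p1 \<tau>))"
    define \<Omega> where "\<Omega> = (\<lambda>T. sector \<theta> (\<alpha> / 2) \<inter> ball 0 (T * R))"
    have G_cont: "continuous_on S G" if "\<And>\<zeta>. \<zeta> \<in> S \<Longrightarrow> exp \<zeta> \<in> DF" for S
      unfolding G_def
      by (intro continuous_on_mult continuous_on_compose2[OF holomorphic_on_imp_continuous_on[OF f_hol]] continuous_intros)
         (use that in auto)
    have \<Phi>_cont: "continuous_on S (\<Phi> \<tau>)" if "\<And>\<zeta>. \<zeta> \<in> S \<Longrightarrow> exp \<zeta> \<in> DF" "\<And>\<zeta>. \<zeta> \<in> S \<Longrightarrow> \<tau> * exp (- \<zeta>) \<in> DH" for S \<tau>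
      unfolding \<Phi>_def
      by (intro continuous_on_mult G_cont continuous_on_compose2[OF holomorphic_on_imp_continuous_on[OF H_hol]] continuous_intros)
         (use that in auto)
    have S1: "exp \<zeta> \<in> DF" if "\<zeta> \<in> closed_segment p1 p2" for \<zeta>
      by (rule DF_disc) (use seg1[OF that] r0 in simp)
    have Sq: "exp \<zeta> \<in> DF" if "\<zeta> \<in> closed_segment q1 p1" for \<zeta>
      by (rule DF_disc) (use segq[OF that] r0 in simp)
    have S2: "exp \<zeta> \<in> DF" if "\<zeta> \<in> closed_segment q1 (q2 T)" "r0 \<le> T" for \<zeta> T
      by (rule DF_sec) (use seg2[OF that] \<beta> in simp)
    have S3: "exp \<zeta> \<in> DF" if "\<zeta> \<in> closed_segment (q2 T) (q3 T)" for \<zeta> T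
      by (rule DF_sec) (use seg3[OF that] \<beta> in auto)
    have S4: "exp \<zeta> \<in> DF" if "\<zeta> \<in> closed_segment (q3 T) p1" "r0 \<le> T" for \<zeta> T
      by (rule DF_sec) (use seg4[OF that] \<beta> in simp)
    have \<Omega>1: "\<tau> * exp (- \<zeta>) \<in> DH" if "\<tau> \<in> sector \<theta> (\<alpha> / 2)" "\<zeta> \<in> closed_segment p1 p2" for \<tau> \<zeta>
      using DH_sec[OF that(1)] seg1[OF that(2)] by blast
    have \<Omega>2: "\<tau> * exp (- \<zeta>) \<in> DH" if "\<tau> \<in> sector \<theta> (\<alpha> / 2)" "\<zeta> \<in> closed_segment q1 (q2 T)" "r0 \<le> T" for \<tau> \<zeta> T
      using DH_sec[OF that(1)] seg2[OF that(2,3)] by blast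
    have \<Omega>4: "\<tau> * exp (- \<zeta>) \<in> DH" if "\<tau> \<in> sector \<theta> (\<alpha> / 2)" "\<zeta> \<in> closed_segment (q3 T) p1" "r0 \<le> T" for \<tau> \<zeta> T
    proof -
      have "Im \<zeta> - \<theta> = \<beta>" using seg4[OF that(2,3)] by blast
      moreover have "\<beta> \<le> 2 * pi - \<beta>" using \<beta> by auto
      ultimately show ?thesis using DH_sec[OF that(1), of \<zeta>] by simp
    qed
    have \<Omega>3: "\<tau> * exp (- \<zeta>) \<in> DH" if "norm \<tau> < T * R" "\<zeta> \<in> closed_segment (q2 T) (q3 T)" "r0 \<le> T" for \<tau> \<zeta> T
    proof (rule DH_disc)
      have "exp (- Re \<zeta>) = 1 / T" using seg3[OF that(2)] that(3) r0 by (simp add: exp_minus divide_inverse)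
      moreover have "norm \<tau> / T < R" using that r0 by (simp add: pos_divide_less_eq mult.commute)
      ultimately show "norm \<tau> * exp (- Re \<zeta>) < R" by simp
    qed
    have J_hol: "J T holomorphic_on \<Omega> T" if T: "r0 \<le> T" for T
    proof -
      have op: "open (\<Omega> T)" by (simp add: \<Omega>_def open_sector open_Int)
      have "I p1 p2 holomorphic_on \<Omega> T" unfolding I_def \<Phi>_def
        by (rule linepath_integral_holomorphic[OF G_cont H_hol DH_open op]) (use S1 \<Omega>1 in \<open>auto simp: \<Omega>_def\<close>)
      moreover have "I q1 (q2 T) holomorphic_on \<Omega> T" unfolding I_def \<Phi>_def
        by (rule linepath_integral_holomorphic[OF G_cont H_hol DH_open op]) (use S2 \<Omega>2 T in \<open>auto simp: \<Omega>_def\<close>)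
      moreover have "I (q2 T) (q3 T) holomorphic_on \<Omega> T" unfolding I_def \<Phi>_def
        by (rule linepath_integral_holomorphic[OF G_cont H_hol DH_open op]) (use S3 \<Omega>3 T in \<open>auto simp: \<Omega>_def\<close>)
      moreover have "I (q3 T) p1 holomorphic_on \<Omega> T" unfolding I_def \<Phi>_def
        by (rule linepath_integral_holomorphic[OF G_cont H_hol DH_open op]) (use S4 \<Omega>4 T in \<open>auto simp: \<Omega>_def\<close>)
      ultimately show ?thesis unfolding J_def by (intro holomorphic_intros)
    qed
    have line_DH: "\<tau> * exp (- \<zeta>) \<in> DH" if "norm \<tau> < r0 * R" "Re \<zeta> = ln r0" for \<tau> \<zeta>
    proof (rule DH_disc)
      have "exp (- Re \<zeta>) = 1 / r0" using that(2) r0 by (simp add: exp_minus divide_inverse)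
      moreover have "norm \<tau> / r0 < R" using that(1) r0 by (simp add: pos_divide_less_eq mult.commute)
      ultimately show "norm \<tau> * exp (- Re \<zeta>) < R" by simp
    qed
    have line_re: "Re \<zeta> = ln r0" if "\<zeta> \<in> closed_segment q1 p2" for \<zeta>
    proof -
      from that obtain u where u: "\<zeta> = (1 - u) *\<^sub>R q1 + u *\<^sub>R p2" unfolding closed_segment_def by blast
      show ?thesis by (simp add: u q1_def p2_def algebra_simps)
    qed
    have ex0: "exp (Re \<zeta>) = r0" if "\<zeta> \<in> closed_segment q1 p2" for \<zeta> using line_re[OF that] r0 by simp
    have circle: "(\<lambda>j. 2 * of_real pi * \<i> * (fc (s + j) * h j * \<tau> ^ j)) sums I q1 p2 \<tau>" if \<tau>: "norm \<tau> < r0 * R" for \<tau>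
    proof -
      have Gseg: "continuous_on (closed_segment q1 p2) G"
      proof (rule G_cont, rule DF_disc)
        show "exp (Re \<zeta>) < r" if "\<zeta> \<in> closed_segment q1 p2" for \<zeta> using ex0[OF that] r0(2) by (simp only:)
      qed
      obtain MG where MG: "\<And>\<zeta>. \<zeta> \<in> closed_segment q1 p2 \<Longrightarrow> norm (G \<zeta>) \<le> MG"
      proof -
        have "bounded (G ` closed_segment q1 p2)"
          by (intro compact_imp_bounded compact_continuous_image Gseg compact_segment)
        then show thesis using that unfolding bounded_iff by (metis imageI)
      qed
      have "(\<lambda>j. contour_integral (linepath q1 p2) (\<lambda>\<zeta>. G \<zeta> * (h j * (\<tau> * exp (- \<zeta>)) ^ j))) sums I q1 p2 \<tau>"
        unfolding I_def \<Phi>_def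
      proof (rule linepath_integral_sums[where M = "\<lambda>j. MG * norm (h j * of_real (norm \<tau> / r0) ^ j)"])
        fix j
        show "continuous_on (closed_segment q1 p2) (\<lambda>\<zeta>. G \<zeta> * (h j * (\<tau> * exp (- \<zeta>)) ^ j))"
          by (intro continuous_intros Gseg)
        fix \<zeta> assume \<zeta>: "\<zeta> \<in> closed_segment q1 p2"
        have nn: "norm (\<tau> * exp (- \<zeta>)) = norm \<tau> / r0"
          using ex0[OF \<zeta>] unfolding norm_mult norm_exp_eq_Re by (simp add: exp_minus divide_inverse)
        have "norm (G \<zeta> * (h j * (\<tau> * exp (- \<zeta>)) ^ j)) = norm (G \<zeta>) * norm (h j * of_real (norm \<tau> / r0) ^ j)"
          unfolding norm_mult[of "G \<zeta>"] norm_mult[of "h j"] norm_power nn using r0 by (simp add: norm_divide)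
        also have "\<dots> \<le> MG * norm (h j * of_real (norm \<tau> / r0) ^ j)" by (intro mult_right_mono MG \<zeta>) simp
        finally show "norm (G \<zeta> * (h j * (\<tau> * exp (- \<zeta>)) ^ j)) \<le> MG * norm (h j * of_real (norm \<tau> / r0) ^ j)" .
        have "norm (\<tau> * exp (- \<zeta>)) < R" unfolding nn using \<tau> r0 by (simp add: field_simps)
      next
        have lt: "norm \<tau> / r0 < R" using \<tau> r0 by (simp add: field_simps)
        define x where "x = (norm \<tau> / r0 + R) / 2"
        have x: "norm \<tau> / r0 < x" "x < R" using less_half_sum[OF lt] gt_half_sum[OF lt] by (simp_all only: x_def one_add_one)
        have x0: "0 \<le> norm \<tau> / r0" using r0 by simp
        have "summable (\<lambda>j. norm (h j * of_real (norm \<tau> / r0) ^ j))"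
        proof (rule powser_insidea)
          show "summable (\<lambda>j. h j * of_real x ^ j)" by (rule sums_summable[OF H_sums]) (use x x0 in auto)
          show "norm (complex_of_real (norm \<tau> / r0)) < norm (complex_of_real x)" using x x0 unfolding norm_of_real by auto
        qed
        then show "summable (\<lambda>j. MG * norm (h j * of_real (norm \<tau> / r0) ^ j))" by (rule summable_mult)
      next
        fix \<zeta> assume \<zeta>: "\<zeta> \<in> closed_segment q1 p2"
        have "norm (\<tau> * exp (- \<zeta>)) = norm \<tau> / r0"
          using ex0[OF \<zeta>] unfolding norm_mult norm_exp_eq_Re by (simp add: exp_minus divide_inverse)
        also have "\<dots> < R" using \<tau> r0 by (simp add: field_simps)
        finally show "(\<lambda>j. G \<zeta> * (h j * (\<tau> * exp (- \<zeta>)) ^ j)) sums (G \<zeta> * H (\<tau> * exp (- \<zeta>)))"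
          by (intro sums_mult H_sums) simp
      qed
      moreover have "contour_integral (linepath q1 p2) (\<lambda>\<zeta>. G \<zeta> * (h j * (\<tau> * exp (- \<zeta>)) ^ j)) = 2 * of_real pi * \<i> * (fc (s + j) * h j * \<tau> ^ j)" for j
      proof -
        have eq: "(\<lambda>\<zeta>. G \<zeta> * (h j * (\<tau> * exp (- \<zeta>)) ^ j)) = (\<lambda>\<zeta>. (h j * \<tau> ^ j) * (f (exp \<zeta>) * exp (- (of_nat (s + j) * \<zeta>))))"
        proof
          fix \<zeta> :: complex
          have "exp (- \<zeta>) ^ j = exp (- (of_nat j * \<zeta>))" using exp_of_nat_mult[of j "- \<zeta>"] by simp
          moreover have "exp (- (of_nat (s + j) * \<zeta>)) = exp (- (of_nat s * \<zeta>)) * exp (- (of_nat j * \<zeta>))"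
            by (simp add: algebra_simps flip: exp_add)
          ultimately show "G \<zeta> * (h j * (\<tau> * exp (- \<zeta>)) ^ j) = (h j * \<tau> ^ j) * (f (exp \<zeta>) * exp (- (of_nat (s + j) * \<zeta>)))"
            by (simp add: G_def power_mult_distrib mult_ac)
        qed
        have q1r: "exp (Re q1) < r" using r0 by (simp add: q1_def)
        have Gdom: "exp ` closed_segment q1 p2 \<subseteq> DF" using DF_disc ex0 r0(2) by (metis image_subsetI)
        have "continuous_on (closed_segment q1 p2) (\<lambda>\<zeta>. f (exp \<zeta>) * exp (- (of_nat (s + j) * \<zeta>)))"
          by (intro continuous_on_mult continuous_on_compose2[OF holomorphic_on_imp_continuous_on[OF f_hol]] continuous_intros)
             (use Gdom in blast)
        then have int: "(\<lambda>\<zeta>. f (exp \<zeta>) * exp (- (of_nat (s + j) * \<zeta>))) contour_integrable_on linepath q1 p2"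
          by (rule contour_integrable_continuous_linepath)
        have "contour_integral (linepath q1 p2) (\<lambda>\<zeta>. f (exp \<zeta>) * exp (- (of_nat (s + j) * \<zeta>))) = 2 * of_real pi * \<i> * fc (s + j)"
          unfolding p2 by (rule vertical_integral_coefficient[OF f_sums q1r])
        then show ?thesis unfolding eq contour_integral_lmul[OF int] by (simp only: mult_ac)
      qed
      ultimately show ?thesis by simp
    qed
    \<comment> \<open>As long as \<open>norm \<tau> < r0 * R\<close>, the integrand is holomorphic
      on a convex half-strip containing both the old arc and the detour, so a primitive shows that
      the detour changes nothing.\<close>
    have J_small: "J T \<tau> = I q1 p2 \<tau>" if T: "r0 \<le> T" and \<tau>: "norm \<tau> < r0 * R" for T \<tau>
    proof -
      \<comment> \<open>With x strictly between, the quotient stays in the disc of H to the right of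
        \<open>ln x\<close>, and the line \<open>Re \<zeta> = ln r0\<close> is interior to that
        half-plane.\<close>
      define x where "x = (norm \<tau> / R + r0) / 2"
      have lt: "norm \<tau> / R < r0" using \<tau> R by (simp add: field_simps)
      have x: "norm \<tau> / R < x" "x < r0" using less_half_sum[OF lt] gt_half_sum[OF lt] by (simp_all only: x_def one_add_one)
      have "0 \<le> norm \<tau> / R" using R by simp
      then have x0: "0 < x" using x by linarith
      define Z where "Z = {\<zeta>. \<theta> - \<alpha> / 2 < Im \<zeta> \<and> Im \<zeta> < \<theta> + \<alpha> / 2 \<and> ln x < Re \<zeta>}"
      have Z_convex: "convex Z" unfolding Z_def Collect_conj_eq
        by (intro convex_Int convex_halfspace_Im_gt convex_halfspace_Im_lt convex_halfspace_Re_gt)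
      have Z_open: "open Z" unfolding Z_def
        by (intro open_Collect_conj open_Collect_less continuous_intros)
      have Z_DF: "exp \<zeta> \<in> DF" if "\<zeta> \<in> Z" for \<zeta>
      proof (rule DF_sec)
        show "\<bar>Im \<zeta> - \<theta>\<bar> < \<alpha> / 2" using that unfolding Z_def abs_less_iff by auto
      qed
      have Z_DH: "\<tau> * exp (- \<zeta>) \<in> DH" if "\<zeta> \<in> Z" for \<zeta>
      proof (rule DH_disc)
        have "ln x < Re \<zeta>" using that by (simp add: Z_def)
        then have "x < exp (Re \<zeta>)" using x0 by (metis exp_less_cancel_iff exp_ln)
        then have "norm \<tau> < exp (Re \<zeta>) * R" using x(1) R by (simp add: divide_less_eq) (meson less_trans mult_strict_right_mono)
        then show "norm \<tau> * exp (- Re \<zeta>) < R" by (simp add: exp_minus field_simps)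
      qed
      have "\<Phi> \<tau> holomorphic_on Z" unfolding \<Phi>_def G_def
        by (intro holomorphic_on_mult holomorphic_on_compose_gen[OF _ f_hol, unfolded o_def]
              holomorphic_on_compose_gen[OF _ H_hol, unfolded o_def] holomorphic_intros)
           (use Z_DF Z_DH in auto)
      then obtain F where F: "\<And>\<zeta>. \<zeta> \<in> Z \<Longrightarrow> (F has_field_derivative \<Phi> \<tau> \<zeta>) (at \<zeta> within Z)"
        using holomorphic_convex_primitive'[of Z "\<Phi> \<tau>"] Z_convex Z_open by blast
      have prim: "I p q \<tau> = F q - F p" if "p \<in> Z" "q \<in> Z" for p q
      proof -
        have "closed_segment p q \<subseteq> Z" using Z_convex that by (simp add: closed_segment_subset)
        then have "(\<Phi> \<tau> has_contour_integral (F (pathfinish (linepath p q)) - F (pathstart (linepath p q)))) (linepath p q)"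
          by (intro contour_integral_primitive[of Z]) (use F in auto)
        then show ?thesis unfolding I_def by (simp add: contour_integral_unique)
      qed
      have lnx: "ln x < ln r0" "ln r0 \<le> ln T" using x x0 r0 T by auto
      have inZ: "p1 \<in> Z" "q1 \<in> Z" "q2 T \<in> Z" "q3 T \<in> Z"
        using lnx \<beta> by (auto simp: Z_def p1_def q1_def q2_def q3_def)
      have "I q1 p2 \<tau> = I q1 p1 \<tau> + I p1 p2 \<tau>"
        unfolding I_def
      proof (rule contour_integral_split_linepath)
        show "continuous_on (closed_segment q1 p2) (\<Phi> \<tau>)"
          by (rule \<Phi>_cont, rule DF_disc) (use ex0 r0(2) line_DH[OF \<tau> line_re] in metis)+
        show "p1 \<in> closed_segment q1 p2"
          unfolding closed_segment_def
        proof (intro CollectI exI[of _ "\<beta> / pi"] conjI)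
          show "p1 = (1 - \<beta> / pi) *\<^sub>R q1 + (\<beta> / pi) *\<^sub>R p2"
            by (simp add: p1_def q1_def p2_def complex_eq_iff field_simps)
        qed (use \<beta> in auto)
      qed
      then show ?thesis unfolding J_def by (simp add: prim inZ)
    qed
    have ps: "(\<lambda>j. fc (s + j) * h j * \<tau> ^ j) sums (I q1 p2 \<tau> / (2 * of_real pi * \<i>))" if "norm \<tau> < r0 * R" for \<tau>
      using sums_divide[OF circle[OF that], of "2 * of_real pi * \<i>"] by simp
    have \<Omega>_wedge: "\<Omega> T = wedge (\<theta> - \<alpha> / 2 / 2) (\<theta> + \<alpha> / 2 / 2) \<inter> ball 0 (T * R)" for T
      by (simp only: \<Omega>_def sector_eq_wedge)
    \<comment> \<open>Integrals with different outer radii agree near 0 by \<open>J_small\<close>,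
      hence on their connected common domain. So the outer radius may depend on \<tau> without harm
      to holomorphy.\<close>
    have J_eq: "J T \<tau> = J T' \<tau>" if T: "r0 \<le> T" "r0 \<le> T'" and \<tau>: "\<tau> \<in> \<Omega> T" "\<tau> \<in> \<Omega> T'" for T T' \<tau>
    proof -
      define T0 where "T0 = min T T'"
      have sub: "\<Omega> T0 \<subseteq> \<Omega> T" "\<Omega> T0 \<subseteq> \<Omega> T'" "\<Omega> r0 \<subseteq> \<Omega> T0"
      proof -
        have "T0 * R \<le> T * R" "T0 * R \<le> T' * R" "r0 * R \<le> T0 * R"
          using T R by (auto simp: T0_def intro!: mult_right_mono)
        then show "\<Omega> T0 \<subseteq> \<Omega> T" "\<Omega> T0 \<subseteq> \<Omega> T'" "\<Omega> r0 \<subseteq> \<Omega> T0" by (auto simp: \<Omega>_def)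
      qed
      show ?thesis
      proof (rule analytic_continuation_open[where s = "\<Omega> r0" and s' = "\<Omega> T0" and f = "J T" and g = "J T'"])
        show "\<Omega> r0 \<noteq> {}" unfolding \<Omega>_wedge by (rule wedge_Int_ball_nonempty) (use \<alpha> r0 R in auto)
        have "0 < T0 * R" using T r0 R by (simp add: T0_def)
        then show "connected (\<Omega> T0)" unfolding \<Omega>_wedge by (rule connected_wedge_Int_ball)
        show "J T holomorphic_on \<Omega> T0" using J_hol[OF T(1)] sub holomorphic_on_subset by blast
        show "J T' holomorphic_on \<Omega> T0" using J_hol[OF T(2)] sub holomorphic_on_subset by blast
        show "J T z = J T' z" if "z \<in> \<Omega> r0" for z
          using J_small[OF T(1)] J_small[OF T(2)] that by (simp add: \<Omega>_def)
        show "\<tau> \<in> \<Omega> T0" using \<tau> by (simp add: \<Omega>_def T0_def min_def)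
      qed (use sub in \<open>auto simp: \<Omega>_def open_sector open_Int\<close>)
    qed
    \<comment> \<open>T is linear, so growth of order K in the outer radius is growth of order K in
      \<open>norm \<tau>\<close>; its slope \<open>2 / R\<close> ensures \<open>x < T x * R\<close>,
      which puts \<tau> in the domain.\<close>
    define T where "T = (\<lambda>x. r0 + 2 * x / R)"
    have T: "r0 \<le> T x" "x < T x * R" "T x * R = r0 * R + 2 * x" if "0 \<le> x" for x
    proof -
      show e: "T x * R = r0 * R + 2 * x" using R by (simp add: T_def distrib_right)
      show "r0 \<le> T x" using that R by (simp add: T_def)
      have "0 < r0 * R" using r0 R by simp
      then show "x < T x * R" unfolding e using that by linarith
    qed
    define c where "c = 2 * of_real pi * \<i>"
    have c: "c \<noteq> 0" "norm c = 2 * pi" by (simp_all add: c_def norm_mult)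
    define \<phi> where "\<phi> = (\<lambda>\<tau>. if \<tau> \<in> ball 0 \<rho> then I q1 p2 \<tau> / c else J (T (norm \<tau>)) \<tau> / c)"
    have \<phi>_J: "\<phi> \<tau> = J T' \<tau> / c" if "r0 \<le> T'" "\<tau> \<in> \<Omega> T'" for T' \<tau>
    proof (cases "\<tau> \<in> ball 0 \<rho>")
      case True
      then show ?thesis using J_small[OF that(1), of \<tau>] \<rho> by (simp add: \<phi>_def)
    next
      case False
      have "\<tau> \<in> \<Omega> (T (norm \<tau>))" using that T[of "norm \<tau>"] by (simp add: \<Omega>_def)
      then show ?thesis using J_eq[OF T(1) that(1) _ that(2), of "norm \<tau>"] False by (simp add: \<phi>_def)
    qed
    have \<phi>_sums: "(\<lambda>j. fc (s + j) * h j * \<tau> ^ j) sums \<phi> \<tau>" if "\<tau> \<in> ball 0 \<rho>" for \<tau>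
      using ps[of \<tau>] that \<rho> by (simp add: \<phi>_def c_def)
    have hol1: "\<phi> holomorphic_on ball 0 \<rho>"
      by (rule power_series_holomorphic[of _ _ "\<lambda>j. fc (s + j) * h j"]) (use \<phi>_sums in simp)
    have hol2: "\<phi> holomorphic_on sector \<theta> (\<alpha> / 2)"
      unfolding holomorphic_on_open[OF open_sector]
    proof
      fix \<tau>0 assume \<tau>0: "\<tau>0 \<in> sector \<theta> (\<alpha> / 2)"
      let ?T = "T (norm \<tau>0)"
      have op: "open (\<Omega> ?T)" by (simp add: \<Omega>_def open_sector open_Int)
      have "(\<lambda>\<tau>. J ?T \<tau> / c) holomorphic_on \<Omega> ?T" using J_hol[OF T(1)] c by (intro holomorphic_intros) auto
      then have "\<phi> holomorphic_on \<Omega> ?T"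
        by (rule holomorphic_transform) (rule \<phi>_J[OF T(1)[OF norm_ge_zero], symmetric])
      moreover have "\<tau>0 \<in> \<Omega> ?T" using \<tau>0 T[of "norm \<tau>0"] by (simp add: \<Omega>_def)
      ultimately show "\<exists>f'. (\<phi> has_field_derivative f') (at \<tau>0)"
        unfolding holomorphic_on_open[OF op] by blast
    qed
    \<comment> \<open>No contour enters the disc of radius r0, so the shift by s costs the factor
      \<open>(1 / r0) ^ s = (2 / r) ^ s\<close>, geometric in s.\<close>
    have q_s: "norm (exp (- (of_nat s * \<zeta>))) \<le> (1 / r0) ^ s" if "ln r0 \<le> Re \<zeta>" for \<zeta> :: complex
    proof -
      have "exp (- Re \<zeta>) \<le> exp (- ln r0)" using that by simp
      also have "\<dots> = 1 / r0" using r0 by (simp add: exp_minus divide_inverse)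
      finally have "exp (- Re \<zeta>) ^ s \<le> (1 / r0) ^ s" by (intro power_mono) auto
      then show ?thesis using exp_of_nat_mult[of s "- Re \<zeta>"] by simp
    qed
    have \<Phi>_le: "norm (\<Phi> \<tau> \<zeta>) \<le> (Mf * exp (af * X powr K)) * (1 / r0) ^ s * (M * exp (b * Y powr K))"
      if "exp \<zeta> \<in> DF" "\<tau> * exp (- \<zeta>) \<in> DH" "ln r0 \<le> Re \<zeta>" "exp (Re \<zeta>) \<le> X" "norm \<tau> / r0 \<le> Y" for \<tau> \<zeta> X Y
    proof -
      have "exp (Re \<zeta>) powr K \<le> X powr K" using that K by (intro powr_mono2) auto
      then have "af * exp (Re \<zeta>) powr K \<le> af * X powr K" using af by (intro mult_left_mono) auto
      then have 1: "norm (f (exp \<zeta>)) \<le> Mf * exp (af * X powr K)"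
        using f_le[OF that(1)] Mf by (auto elim!: order_trans intro!: mult_left_mono)
      have "exp (- Re \<zeta>) \<le> exp (- ln r0)" using that by simp
      also have "\<dots> = 1 / r0" using r0 by (simp add: exp_minus divide_inverse)
      finally have "norm (\<tau> * exp (- \<zeta>)) \<le> norm \<tau> * (1 / r0)" unfolding norm_mult by (intro mult_left_mono) auto
      then have "norm (\<tau> * exp (- \<zeta>)) \<le> Y" using that(5) by simp
      then have "norm (\<tau> * exp (- \<zeta>)) powr K \<le> Y powr K" using K by (intro powr_mono2) auto
      then have "b * norm (\<tau> * exp (- \<zeta>)) powr K \<le> b * Y powr K" using b by (intro mult_left_mono) auto
      then have 2: "norm (H (\<tau> * exp (- \<zeta>))) \<le> M * exp (b * Y powr K)"
        using H_le[OF that(2)] M by (auto elim!: order_trans intro!: mult_left_mono)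
      show ?thesis unfolding \<Phi>_def G_def norm_mult
        using 1 2 q_s[OF that(3)] Mf r0 by (intro mult_mono) auto
    qed
    have I_le: "norm (I p q \<tau>) \<le> (Mf * exp (af * X powr K)) * (1 / r0) ^ s * (M * exp (b * Y powr K)) * norm (q - p)"
      if "\<And>\<zeta>. \<zeta> \<in> closed_segment p q \<Longrightarrow> exp \<zeta> \<in> DF \<and> \<tau> * exp (- \<zeta>) \<in> DH \<and> ln r0 \<le> Re \<zeta> \<and> exp (Re \<zeta>) \<le> X"
        "norm \<tau> / r0 \<le> Y" for p q \<tau> X Y
      unfolding I_def
    proof (rule contour_integral_bound_linepath)
      show "\<Phi> \<tau> contour_integrable_on linepath p q"
        by (rule contour_integrable_continuous_linepath, rule \<Phi>_cont) (use that in auto)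
      show "0 \<le> Mf * exp (af * X powr K) * (1 / r0) ^ s * (M * exp (b * Y powr K))" using Mf M r0 by simp
      show "norm (\<Phi> \<tau> \<zeta>) \<le> Mf * exp (af * X powr K) * (1 / r0) ^ s * (M * exp (b * Y powr K))" if "\<zeta> \<in> closed_segment p q" for \<zeta>
        by (rule \<Phi>_le) (use that \<open>\<And>\<zeta>. \<zeta> \<in> closed_segment p q \<Longrightarrow> exp \<zeta> \<in> DF \<and> \<tau> * exp (- \<zeta>) \<in> DH \<and> ln r0 \<le> Re \<zeta> \<and> exp (Re \<zeta>) \<le> X\<close> \<open>norm \<tau> / r0 \<le> Y\<close> in auto)
    qed
    have qs0: "0 \<le> (2 / r) ^ s * M" using M r by simp
    have bound: "norm (\<phi> \<tau>) \<le> (C1 + C2) * (2 / r) ^ s * M * exp (a * norm \<tau> powr K)" if \<tau>: "\<tau> \<in> disc_sector \<theta> (\<alpha> / 2) \<rho>" for \<tau>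
    proof (cases "\<tau> \<in> ball 0 \<rho>")
      case True
      have "norm (I q1 p2 \<tau>) \<le> (Mf * exp (af * r0 powr K)) * (1 / r0) ^ s * (M * exp (b * R powr K)) * norm (p2 - q1)"
      proof (rule I_le)
        fix \<zeta> assume "\<zeta> \<in> closed_segment q1 p2"
        then show "exp \<zeta> \<in> DF \<and> \<tau> * exp (- \<zeta>) \<in> DH \<and> ln r0 \<le> Re \<zeta> \<and> exp (Re \<zeta>) \<le> r0"
          using line_re[of \<zeta>] line_DH[of \<tau> \<zeta>] DF_disc[of \<zeta>] r0 True \<rho> by simp
      next
        show "norm \<tau> / r0 \<le> R" using True \<rho> r0 by (simp add: field_simps)
      qed
      moreover have "norm (p2 - q1) = norm c" unfolding p2 c_def by simp
      ultimately have "norm (\<phi> \<tau>) \<le> (Mf * exp (af * r0 powr K)) * (1 / r0) ^ s * (M * exp (b * R powr K))"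
        using True c by (simp add: \<phi>_def norm_divide divide_le_eq)
      also have "\<dots> = C2 * ((2 / r) ^ s * M) * 1" by (simp add: C2_def r0_def)
      also have "\<dots> \<le> (C1 + C2) * ((2 / r) ^ s * M) * exp (a * norm \<tau> powr K)"
        using C12 qs0 a M r by (intro mult_mono) auto
      finally show ?thesis by (simp add: mult.assoc)
    next
      case False
      then have ts: "\<tau> \<in> sector \<theta> (\<alpha> / 2)" using \<tau> by (auto simp: disc_sector_def)
      define t where "t = norm \<tau>"
      have t0: "0 \<le> t" by (simp add: t_def)
      let ?T = "T t"
      note Tt = T[OF t0]
      have T0: "0 < ?T" using Tt r0 by linarith
      let ?X = "(Mf * exp (af * ?T powr K)) * (1 / r0) ^ s * (M * exp (b * (t / r0) powr K))"
      have X0: "0 \<le> ?X" using Mf M r0 by simp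
      have eT: "exp (ln ?T) = ?T" using T0 by simp
      have b1: "norm (I p1 p2 \<tau>) \<le> ?X * norm (p2 - p1)"
        by (rule I_le) (use S1 \<Omega>1[OF ts] seg1 r0 Tt in \<open>auto simp: t_def\<close>)
      have b2: "norm (I q1 (q2 ?T) \<tau>) \<le> ?X * norm (q2 ?T - q1)"
      proof (rule I_le)
        fix \<zeta> assume z: "\<zeta> \<in> closed_segment q1 (q2 ?T)"
        have "exp (Re \<zeta>) \<le> exp (ln ?T)" using seg2[OF z Tt(1)] by simp
        then show "exp \<zeta> \<in> DF \<and> \<tau> * exp (- \<zeta>) \<in> DH \<and> ln r0 \<le> Re \<zeta> \<and> exp (Re \<zeta>) \<le> ?T"
          using S2[OF z Tt(1)] \<Omega>2[OF ts z Tt(1)] seg2[OF z Tt(1)] eT by simp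
      qed (simp add: t_def)
      have b3: "norm (I (q2 ?T) (q3 ?T) \<tau>) \<le> ?X * norm (q3 ?T - q2 ?T)"
      proof (rule I_le)
        fix \<zeta> assume z: "\<zeta> \<in> closed_segment (q2 ?T) (q3 ?T)"
        show "exp \<zeta> \<in> DF \<and> \<tau> * exp (- \<zeta>) \<in> DH \<and> ln r0 \<le> Re \<zeta> \<and> exp (Re \<zeta>) \<le> ?T"
          using S3[OF z] \<Omega>3[OF _ z Tt(1), of \<tau>] Tt seg3[OF z] r0 T0 by (simp add: t_def)
      qed (simp add: t_def)
      have b4: "norm (I (q3 ?T) p1 \<tau>) \<le> ?X * norm (p1 - q3 ?T)"
      proof (rule I_le)
        fix \<zeta> assume z: "\<zeta> \<in> closed_segment (q3 ?T) p1"
        have "exp (Re \<zeta>) \<le> exp (ln ?T)" using seg4[OF z Tt(1)] by simp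
        then show "exp \<zeta> \<in> DF \<and> \<tau> * exp (- \<zeta>) \<in> DH \<and> ln r0 \<le> Re \<zeta> \<and> exp (Re \<zeta>) \<le> ?T"
          using S4[OF z Tt(1)] \<Omega>4[OF ts z Tt(1)] seg4[OF z Tt(1)] eT by simp
      qed (simp add: t_def)
      \<comment> \<open>The radial length is logarithmic in T. A linear bound is good enough,
        because a linear factor disappears in growth of order K.\<close>
      define l where "l = ln ?T - ln r0"
      have l0: "0 \<le> l" using Tt r0 T0 by (simp add: l_def)
      have "l = ln (?T / r0)" using T0 r0 by (simp add: l_def ln_div)
      also have "\<dots> \<le> ?T / r0 - 1" by (rule ln_le_minus_one) (use T0 r0 in simp)
      also have "\<dots> = 2 * t / (R * r0)" using r0 R by (simp add: T_def field_simps)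
      finally have l1: "l \<le> 2 * t / (R * r0)" .
      have n1: "norm (p2 - p1) \<le> 2 * pi"
      proof -
        have "p2 - p1 = \<i> * of_real (2 * pi - 2 * \<beta>)" by (simp add: p1_def p2_def complex_eq_iff)
        then have "norm (p2 - p1) = \<bar>2 * pi - 2 * \<beta>\<bar>" by (simp only: norm_mult norm_ii norm_of_real) simp
        then show ?thesis using \<beta> by simp
      qed
      have n2: "norm (q2 ?T - q1) = l"
      proof -
        have "q2 ?T - q1 = of_real l" by (simp add: q1_def q2_def l_def complex_eq_iff)
        then show ?thesis using l0 by (simp only: norm_of_real abs_of_nonneg)
      qed
      have n3: "norm (q3 ?T - q2 ?T) \<le> 2 * pi"
      proof -
        have "q3 ?T - q2 ?T = \<i> * of_real (2 * \<beta>)" by (simp add: q3_def q2_def complex_eq_iff)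
        then have "norm (q3 ?T - q2 ?T) = \<bar>2 * \<beta>\<bar>" by (simp only: norm_mult norm_ii norm_of_real mult_1)
        then show ?thesis using \<beta> by simp
      qed
      have n4: "norm (p1 - q3 ?T) = l"
      proof -
        have "p1 - q3 ?T = - of_real l" by (simp add: p1_def q3_def l_def complex_eq_iff)
        then show ?thesis using l0 by (simp only: norm_minus_cancel norm_of_real abs_of_nonneg)
      qed
      have "norm (J ?T \<tau>) \<le> norm (I p1 p2 \<tau>) + (norm (I q1 (q2 ?T) \<tau>) + norm (I (q2 ?T) (q3 ?T) \<tau>) + norm (I (q3 ?T) p1 \<tau>))"
        unfolding J_def by (intro order_trans[OF norm_triangle_ineq] add_mono order_refl)
      also have "\<dots> \<le> ?X * norm (p2 - p1) + (?X * norm (q2 ?T - q1) + ?X * norm (q3 ?T - q2 ?T) + ?X * norm (p1 - q3 ?T))"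
        using b1 b2 b3 b4 by (intro add_mono)
      also have "\<dots> = ?X * (norm (p2 - p1) + norm (q2 ?T - q1) + norm (q3 ?T - q2 ?T) + norm (p1 - q3 ?T))"
        by (simp only: distrib_left add.assoc)
      also have "\<dots> \<le> ?X * (4 * pi + 2 * (2 * t / (R * r0)))"
        using n1 n2 n3 n4 l1 by (intro mult_left_mono[OF _ X0]) simp
      also have "\<dots> \<le> ?X * (2 * pi * (2 * (1 + t / (R * r0))))"
      proof (rule mult_left_mono[OF _ X0])
        define y where "y = t / (R * r0)"
        have "1 * y \<le> pi * y" using pi_ge_two t0 R r0 by (intro mult_right_mono) (auto simp: y_def)
        moreover have "2 * t / (R * r0) = 2 * y" by (simp add: y_def)
        ultimately show "4 * pi + 2 * (2 * t / (R * r0)) \<le> 2 * pi * (2 * (1 + t / (R * r0)))"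
          unfolding y_def[symmetric] by (simp only:) (simp add: algebra_simps)
      qed
      finally have "norm (J ?T \<tau>) \<le> ?X * (2 * pi * (2 * (1 + t / (R * r0))))" .
      note J_le = this
      have cancel: "u * (2 * pi * v) / (2 * pi) = u * v" for u v :: real by simp
      have "norm (\<phi> \<tau>) = norm (J ?T \<tau>) / (2 * pi)" using False c by (simp add: \<phi>_def norm_divide t_def)
      also have "\<dots> \<le> ?X * (2 * pi * (2 * (1 + t / (R * r0)))) / (2 * pi)" by (rule divide_right_mono[OF J_le]) simp
      also have "\<dots> = ?X * (2 * (1 + t / (R * r0)))" by (rule cancel)
      also have "\<dots> \<le> ?X * (2 * (1 + D / (R * r0)) * exp (t powr K))"
      proof (rule mult_left_mono[OF _ X0])
        have "t / (R * r0) \<le> D * exp (t powr K) / (R * r0)" using D(2)[OF t0] R r0 by (intro divide_right_mono) auto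
        then have "1 + t / (R * r0) \<le> exp (t powr K) + D / (R * r0) * exp (t powr K)" by (intro add_mono) auto
        then show "2 * (1 + t / (R * r0)) \<le> 2 * (1 + D / (R * r0)) * exp (t powr K)"
          unfolding distrib_left[of 2] distrib_right by linarith
      qed
      also have "\<dots> \<le> (Mf * (exp (af * (2 * r0) powr K) * exp (af * (4 / R) powr K * t powr K))) * (1 / r0) ^ s *
          (M * exp (b * (1 / r0) powr K * t powr K)) * (2 * (1 + D / (R * r0)) * exp (t powr K))"
      proof (rule mult_right_mono)
        have "?T \<le> 2 * r0 \<or> ?T \<le> 4 / R * t" by (auto simp: T_def)
        then have "?T powr K \<le> (2 * r0) powr K \<or> ?T powr K \<le> (4 / R * t) powr K"
          using K T0 by (auto intro: powr_mono2)
        then have "?T powr K \<le> (2 * r0) powr K + (4 / R * t) powr K"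
          using powr_ge_zero[of "2 * r0" K] powr_ge_zero[of "4 / R * t" K] by linarith
        also have "(4 / R * t) powr K = (4 / R) powr K * t powr K" by (rule powr_mult)
        finally have "af * ?T powr K \<le> af * (2 * r0) powr K + af * (4 / R) powr K * t powr K"
          using mult_left_mono[OF _ af] by (fastforce simp: algebra_simps)
        then have "exp (af * ?T powr K) \<le> exp (af * (2 * r0) powr K) * exp (af * (4 / R) powr K * t powr K)"
          by (simp flip: exp_add)
        moreover have "(t / r0) powr K = (1 / r0) powr K * t powr K" using r0 t0 by (simp add: powr_mult[symmetric])
        ultimately show "?X \<le> (Mf * (exp (af * (2 * r0) powr K) * exp (af * (4 / R) powr K * t powr K))) * (1 / r0) ^ s *
          (M * exp (b * (1 / r0) powr K * t powr K))"
          using Mf M r0 by (intro mult_mono) (auto simp: mult.assoc)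
        show "0 \<le> 2 * (1 + D / (R * r0)) * exp (t powr K)" using D R r0 by simp
      qed
      also have "\<dots> = C1 * ((2 / r) ^ s * M) * exp (a * t powr K)"
      proof -
        have "exp (a * t powr K) = exp (af * (4 / R) powr K * t powr K) * exp (b * (1 / r0) powr K * t powr K) * exp (t powr K)"
          by (simp add: a_def distrib_right flip: exp_add)
        moreover have "1 / r0 = 2 / r" by (simp add: r0_def)
        ultimately show ?thesis by (simp add: C1_def mult_ac)
      qed
      also have "\<dots> \<le> (C1 + C2) * ((2 / r) ^ s * M) * exp (a * t powr K)"
        using C12 qs0 by (intro mult_right_mono) auto
      finally show ?thesis by (simp add: mult.assoc t_def)
    qed
    show ?thesis
    proof (intro exI[of _ \<phi>])
      have "\<phi> holomorphic_on disc_sector \<theta> (\<alpha> / 2) \<rho>"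
        unfolding disc_sector_def by (rule holomorphic_on_Un[OF hol2 hol1 open_sector open_ball])
      then show "sector_extension K \<theta> (\<alpha> / 2) \<rho> ((C1 + C2) * (2 / r) ^ s * M) a (\<lambda>j. fc (s + j) * h j) \<phi>"
        unfolding sector_extension_def using bound \<phi>_sums by auto
    qed
  qed
  show thesis
    by (rule that[of \<rho> "C1 + C2" a]) (use \<rho> C12 a main in auto)
qed

section \<open>Formal solutions and Borel sums\<close>

lemma moment_deriv_funpow_nth:
  assumes "\<And>n. m n \<noteq> 0"
  shows "fps_nth ((moment_deriv m ^^ j) F) n = of_real (m (n + j)) / of_real (m n) * fps_nth F (n + j)"
proof (induction j arbitrary: n)
  case (Suc j)
  have "fps_nth ((moment_deriv m ^^ Suc j) F) n =
      of_real (m (Suc n)) * fps_nth ((moment_deriv m ^^ j) F) (Suc n) / of_real (m n)"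
    by (simp add: moment_deriv_def)
  also have "\<dots> = of_real (m (n + Suc j)) / of_real (m n) * fps_nth F (n + Suc j)"
    using assms[of "Suc n"] by (simp add: Suc.IH)
  finally show ?case .
qed (use assms in simp)

lemma eps_moment_deriv_funpow_nth:
  "fps_nth ((eps_moment_deriv m k ^^ j) X) i = (if i < k * j then 0 else (moment_deriv m ^^ j) (fps_nth X (i - k * j)))"
proof (induction j arbitrary: i)
  case (Suc j)
  have 0: "moment_deriv m 0 = 0" by (simp add: moment_deriv_def fps_eq_iff)
  have "fps_nth ((eps_moment_deriv m k ^^ Suc j) X) i =
      (if i < k then 0 else moment_deriv m (fps_nth ((eps_moment_deriv m k ^^ j) X) (i - k)))"
    by (simp add: eps_moment_deriv_def fps_X_power_mult_nth)
  also have "\<dots> = (if i < k * Suc j then 0 else (moment_deriv m ^^ Suc j) (fps_nth X (i - k * Suc j)))"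
    using 0 by (auto simp: Suc.IH)
  finally show ?case .
qed simp

definition inverse_coeff :: "complex poly \<Rightarrow> nat \<Rightarrow> complex" where
  "inverse_coeff P j = fps_nth (inverse (fps_of_poly P)) j"

lemma sum_coeff_inverse_coeff:
  assumes "poly P 0 \<noteq> 0"
  shows "(\<Sum>j\<le>l. coeff P j * inverse_coeff P (l - j)) = (if l = 0 then 1 else 0)"
proof -
  have "fps_of_poly P * inverse (fps_of_poly P) = 1"
    using assms by (intro inverse_mult_eq_1') (simp add: poly_0_coeff_0)
  then have "fps_nth (fps_of_poly P * inverse (fps_of_poly P)) l = fps_nth 1 l" by simp
  then show ?thesis by (simp add: fps_mult_nth inverse_coeff_def atLeast0AtMost)
qed

text \<open>The equation is a recursion in i with leading factor \<open>coeff P 0\<close>, so it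
  determines the series. It remains to check that the claimed coefficients solve it, which reduces
  to the product of \<open>P\<close> and its inverse series being 1.\<close>

lemma formal_solution_coeff:
  assumes k: "k \<ge> 1" and m: "\<And>n. m n \<noteq> 0" and P0: "poly P 0 \<noteq> 0" and sol: "formal_solution P k m f x"
  shows "fps_nth (fps_expansion (x i) 0) n =
    (if k dvd i then inverse_coeff P (i div k) * (of_real (m (n + i div k)) / of_real (m n)) *
       fps_nth (fps_expansion f 0) (n + i div k) else 0)"
proof -
  define X where "X = (\<lambda>i n. fps_nth (fps_expansion (x i) 0) n)"
  define F where "F = (\<lambda>n. fps_nth (fps_expansion f 0) n)"
  define b where "b = inverse_coeff P"
  define Y where "Y = (\<lambda>i n. if k dvd i then b (i div k) * (of_real (m (n + i div k)) / of_real (m n)) * F (n + i div k) else 0)"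
  define S where "S = (\<lambda>Z i n. \<Sum>j\<le>degree P. coeff P j * (if i < k * j then 0 else
      of_real (m (n + j)) / of_real (m n) * Z (i - k * j) (n + j) :: complex))"
  have SX: "S X i n = (if i = 0 then F n else 0)" for i n
  proof -
    have "fps_nth (fps_nth (poly_operator P (eps_moment_deriv m k) (Abs_fps (\<lambda>n. fps_expansion (x n) 0))) i) n =
        fps_nth (fps_nth (fps_const (fps_expansion f 0)) i) n"
      using sol by (simp add: formal_solution_def)
    moreover have "fps_nth (fps_nth (poly_operator P (eps_moment_deriv m k) (Abs_fps (\<lambda>n. fps_expansion (x n) 0))) i) n = S X i n"
      unfolding poly_operator_def S_def fps_sum_nth fps_mult_left_const_nth eps_moment_deriv_funpow_nth
      by (intro sum.cong refl) (simp add: moment_deriv_funpow_nth[OF m] X_def)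
    ultimately show ?thesis by (auto simp: F_def)
  qed
  have SY: "S Y i n = (if i = 0 then F n else 0)" for i n
  proof (cases "k dvd i")
    case False
    have "coeff P j * (if i < k * j then 0 else of_real (m (n + j)) / of_real (m n) * Y (i - k * j) (n + j)) = 0" for j
      using False dvd_diffD1[of k "k * j" i] by (cases "i < k * j") (auto simp: Y_def dvd_diff_nat not_less dest: dvd_diffD)
    then have "S Y i n = 0" unfolding S_def by (intro sum.neutral ballI)
    moreover have "i \<noteq> 0" using False by (metis dvd_0_right)
    ultimately show ?thesis by simp
  next
    case True
    then obtain l where l: "i = k * l" by (auto elim: dvdE)
    have "S Y i n = (\<Sum>j\<le>degree P. (if j \<le> l then of_real (m (n + l)) / of_real (m n) * F (n + l) * (coeff P j * b (l - j)) else 0))"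
      unfolding S_def
    proof (intro sum.cong refl)
      fix j
      show "coeff P j * (if i < k * j then 0 else of_real (m (n + j)) / of_real (m n) * Y (i - k * j) (n + j)) =
        (if j \<le> l then of_real (m (n + l)) / of_real (m n) * F (n + l) * (coeff P j * b (l - j)) else 0)"
      proof (cases "j \<le> l")
        case True
        have e: "k * l - k * j = k * (l - j)" by (simp add: diff_mult_distrib2)
        have "Y (i - k * j) (n + j) = b (l - j) * (of_real (m (n + l)) / of_real (m (n + j))) * F (n + l)"
          unfolding l e using k True by (simp add: Y_def)
        then show ?thesis using True m[of "n + j"] k by (simp add: l)
      qed (use k in \<open>simp add: l\<close>)
    qed
    also have "\<dots> = (\<Sum>j\<in>{..degree P} \<inter> {..l}. of_real (m (n + l)) / of_real (m n) * F (n + l) * (coeff P j * b (l - j)))"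
      by (subst sum.inter_restrict) (auto intro: sum.cong)
    also have "\<dots> = (\<Sum>j\<le>l. of_real (m (n + l)) / of_real (m n) * F (n + l) * (coeff P j * b (l - j)))"
      by (intro sum.mono_neutral_left) (auto simp: coeff_eq_0)
    also have "\<dots> = of_real (m (n + l)) / of_real (m n) * F (n + l) * (if l = 0 then 1 else 0)"
      unfolding sum_distrib_left[symmetric] b_def sum_coeff_inverse_coeff[OF P0] ..
    also have "\<dots> = (if i = 0 then F n else 0)" using m[of n] k by (simp add: l)
    finally show ?thesis .
  qed
  have "X i n = Y i n" for i n
  proof (induction i arbitrary: n rule: less_induct)
    case (less i)
    have split: "S Z i n = coeff P 0 * Z i n + (\<Sum>j\<in>{..degree P} - {0}. coeff P j * (if i < k * j then 0 else
      of_real (m (n + j)) / of_real (m n) * Z (i - k * j) (n + j)))" for Z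
      unfolding S_def using m[of n] by (subst sum.remove[of _ 0]) auto
    have "(\<Sum>j\<in>{..degree P} - {0}. coeff P j * (if i < k * j then 0 else of_real (m (n + j)) / of_real (m n) * X (i - k * j) (n + j))) =
        (\<Sum>j\<in>{..degree P} - {0}. coeff P j * (if i < k * j then 0 else of_real (m (n + j)) / of_real (m n) * Y (i - k * j) (n + j)))"
    proof (intro sum.cong refl)
      fix j assume "j \<in> {..degree P} - {0}"
      then have "0 < k * j" using k by simp
      then have "\<not> i < k * j \<Longrightarrow> i - k * j < i" by linarith
      then show "coeff P j * (if i < k * j then 0 else of_real (m (n + j)) / of_real (m n) * X (i - k * j) (n + j)) =
          coeff P j * (if i < k * j then 0 else of_real (m (n + j)) / of_real (m n) * Y (i - k * j) (n + j))"
        using less.IH by simp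
    qed
    moreover have "S X i n = S Y i n" using SX SY by simp
    ultimately have "coeff P 0 * X i n = coeff P 0 * Y i n"
      unfolding split by (simp only: add_right_cancel)
    then show ?case using P0 by (simp add: poly_0_coeff_0)
  qed
  then show ?thesis by (simp add: X_def Y_def F_def b_def)
qed

section \<open>Partial fractions of the reciprocal polynomial\<close>

lemma inverse_linear_power:
  fixes a :: complex
  assumes a: "a \<noteq> 0"
  shows "inverse (fps_of_poly [:- a, 1:] ^ n) =
    fps_const (inverse ((- a) ^ n)) * inverse ((1 - fps_const (1 / a) * fps_X) ^ n)"
proof -
  have "fps_nth (fps_of_poly [:- a, 1:]) j = fps_nth (fps_const (- a) * (1 - fps_const (1 / a) * fps_X)) j" for j
  proof -
    have "fps_const (- a) * (1 - fps_const (1 / a) * fps_X) = fps_const (- a) - fps_const (- a) * fps_const (1 / a) * fps_X"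
      by (simp only: right_diff_distrib mult_1_right mult.assoc)
    also have "fps_nth \<dots> j = coeff [:- a, 1:] j" using a by (simp add: coeff_pCons split: nat.split)
    finally show ?thesis by simp
  qed
  then have L: "fps_of_poly [:- a, 1:] = fps_const (- a) * (1 - fps_const (1 / a) * fps_X)" by (rule fps_ext)
  show ?thesis
    unfolding L power_mult_distrib by (simp only: fps_const_power fps_inverse_mult fps_const_inverse)
qed

text \<open>Partial fractions, in the form of an induction over proper rational functions: subtracting
  \<open>N a / (Q a * (z - a) ^ s)\<close> lowers the degree of the denominator \<open>(z - a) ^ s * Q\<close>.\<close>

lemma proper_rational_induct:
  fixes good :: "complex fps \<Rightarrow> bool"
  assumes add: "\<And>F G. good F \<Longrightarrow> good G \<Longrightarrow> good (F + G)" and cmult: "\<And>c F. good F \<Longrightarrow> good (fps_const c * F)"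
    and pole: "\<And>a s. a \<in> A \<Longrightarrow> good (inverse ((1 - fps_const (1 / a) * fps_X) ^ Suc s))"
    and P: "poly P 0 \<noteq> 0" "\<And>a. poly P a = 0 \<Longrightarrow> a \<in> A" and N: "degree N < degree P"
  shows "good (fps_of_poly N * inverse (fps_of_poly P))"
  using P N
proof (induction "degree P" arbitrary: P N rule: less_induct)
  case less
  have "degree P \<noteq> 0" using less.prems by simp
  then obtain a where a: "poly P a = 0"
    using alg_closed_imp_poly_has_root[of P] by auto
  have P0: "P \<noteq> 0" using less.prems by auto
  have a0: "a \<noteq> 0" using a less.prems by auto
  obtain Q where Q: "P = [:-a, 1:] ^ order a P * Q" "\<not> [:-a, 1:] dvd Q" using order_decomp[OF P0] by blast
  have "order a P \<noteq> 0" using a P0 by (simp add: order_root)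
  then obtain s where s: "order a P = Suc s" using not0_implies_Suc by blast
  define L where "L = [:-a, 1:]"
  have PL: "P = L ^ Suc s * Q" using Q s by (simp add: L_def)
  have Qa: "poly Q a \<noteq> 0" using Q(2) by (simp add: poly_eq_0_iff_dvd)
  then have Q0: "Q \<noteq> 0" by auto
  define c where "c = poly N a / poly Q a"
  have "poly (N - smult c Q) a = 0" using Qa by (simp add: c_def)
  then obtain R where R: "N - smult c Q = L * R" unfolding L_def poly_eq_0_iff_dvd by (auto elim: dvdE)
  define P' where "P' = L ^ s * Q"
  have PP': "P = L * P'" by (simp add: PL P'_def mult_ac)
  have L: "degree L = 1" "L \<noteq> 0" by (auto simp: L_def)
  have P'0: "P' \<noteq> 0" using P0 PP' by auto
  have dP: "degree P = Suc (degree P')" unfolding PP' using L P'0 by (simp add: degree_mult_eq)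
  have dQ: "degree Q \<le> degree P'" unfolding P'_def using L Q0 by (simp add: degree_mult_eq)
  have p0: "poly P 0 = poly L 0 * poly P' 0" "poly P' 0 = poly L 0 ^ s * poly Q 0" by (simp_all add: PP' P'_def)
  then have nz: "poly L 0 \<noteq> 0" "poly P' 0 \<noteq> 0" "poly Q 0 \<noteq> 0" using less.prems(1) by auto
  have inv: "fps_of_poly G * inverse (fps_of_poly G) = 1" if "poly G 0 \<noteq> 0" for G :: "complex poly"
    using that by (intro inverse_mult_eq_1') (simp add: poly_0_coeff_0)
  have pole': "good (inverse (fps_of_poly L ^ Suc s))"
    unfolding L_def inverse_linear_power[OF a0]
    by (rule cmult, rule pole, rule less.prems(2)[OF a])
  have eq: "fps_of_poly N * inverse (fps_of_poly P) =
      fps_const c * inverse (fps_of_poly L ^ Suc s) + fps_of_poly R * inverse (fps_of_poly P')"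
  proof -
    have "N = smult c Q + L * R" using R by (simp add: algebra_simps)
    then have Nf: "fps_of_poly N = fps_const c * fps_of_poly Q + fps_of_poly L * fps_of_poly R"
      by (simp add: fps_of_poly_add fps_of_poly_smult fps_of_poly_mult)
    have i1: "inverse (fps_of_poly P) = inverse (fps_of_poly L ^ Suc s) * inverse (fps_of_poly Q)"
      unfolding PL fps_of_poly_mult fps_of_poly_power fps_inverse_mult ..
    have i2: "inverse (fps_of_poly P) = inverse (fps_of_poly L) * inverse (fps_of_poly P')"
      unfolding PP' fps_of_poly_mult fps_inverse_mult ..
    have "fps_const c * fps_of_poly Q * inverse (fps_of_poly P) =
        fps_const c * inverse (fps_of_poly L ^ Suc s) * (fps_of_poly Q * inverse (fps_of_poly Q))"
      unfolding i1 by (simp only: mult_ac)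
    moreover have "fps_of_poly L * fps_of_poly R * inverse (fps_of_poly P) =
        fps_of_poly R * inverse (fps_of_poly P') * (fps_of_poly L * inverse (fps_of_poly L))"
      unfolding i2 by (simp only: mult_ac)
    ultimately show ?thesis unfolding Nf distrib_right by (simp only: inv[OF nz(1)] inv[OF nz(3)] mult_1_right)
  qed
  show ?case
  proof (cases "R = 0")
    case True
    then show ?thesis unfolding eq using cmult[OF pole'] by simp
  next
    case False
    \<comment> \<open>N and \<open>smult c Q\<close> both have degree at most that of P'; division
      by L lowers the degree once more, so the remaining fraction is proper again.\<close>
    have "degree (L * R) \<le> max (degree N) (degree (smult c Q))" unfolding R[symmetric] by (rule degree_diff_le_max)
    also have "\<dots> \<le> degree P'" using less.prems(3) dP dQ degree_smult_le[of c Q] by simp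
    finally have "Suc (degree R) \<le> degree P'" using L False by (simp add: degree_mult_eq)
    then have "good (fps_of_poly R * inverse (fps_of_poly P'))"
      using nz less.prems(2) dP by (intro less.hyps) (auto simp: PP')
    then show ?thesis unfolding eq by (intro add cmult[OF pole'])
  qed
qed

lemma norm_coefficient_le:
  fixes c :: "nat \<Rightarrow> complex"
  assumes c: "\<And>t. t \<in> ball 0 r \<Longrightarrow> (\<lambda>j. c j * t ^ j) sums g t" and \<rho>: "0 < \<rho>" "\<rho> < r"
    and le: "\<And>t. norm t = \<rho> \<Longrightarrow> norm (g t) \<le> M"
  shows "norm (c l) \<le> M / \<rho> ^ l"
proof -
  define q where "q = complex_of_real (ln \<rho>)"
  let ?p = "q + 2 * of_real pi * \<i>"
  have q: "exp (Re q) = \<rho>" using \<rho> by (simp add: q_def)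
  have re: "Re \<zeta> = Re q" if "\<zeta> \<in> closed_segment q ?p" for \<zeta>
    using that by (auto simp: closed_segment_def algebra_simps)
  have ne: "norm (exp \<zeta>) = \<rho>" if "\<zeta> \<in> closed_segment q ?p" for \<zeta> using re[OF that] q by simp
  have M0: "0 \<le> M" using order_trans[OF norm_ge_zero le[of "of_real \<rho>"]] \<rho> by simp
  have g: "continuous_on (ball 0 r) g"
    using power_series_holomorphic[of 0 r c g] c holomorphic_on_imp_continuous_on by auto
  have "norm (contour_integral (linepath q ?p) (\<lambda>\<zeta>. g (exp \<zeta>) * exp (- (of_nat l * \<zeta>)))) \<le> (M / \<rho> ^ l) * norm (?p - q)"
  proof (rule contour_integral_bound_linepath)
    show "(\<lambda>\<zeta>. g (exp \<zeta>) * exp (- (of_nat l * \<zeta>))) contour_integrable_on linepath q ?p"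
      by (intro contour_integrable_continuous_linepath continuous_on_mult continuous_on_compose2[OF g] continuous_intros)
         (use ne \<rho> in auto)
    show "0 \<le> M / \<rho> ^ l" using M0 \<rho> by simp
    fix \<zeta> assume \<zeta>: "\<zeta> \<in> closed_segment q ?p"
    have "norm (exp (- (of_nat l * \<zeta>))) = 1 / \<rho> ^ l"
    proof -
      have "exp (- (real l * Re \<zeta>)) = exp (- Re \<zeta>) ^ l" using exp_of_nat_mult[of l "- Re \<zeta>"] by simp
      also have "exp (- Re \<zeta>) = 1 / \<rho>" using re[OF \<zeta>] q by (simp add: exp_minus divide_inverse)
      finally show ?thesis by (simp add: power_one_over)
    qed
    then show "norm (g (exp \<zeta>) * exp (- (of_nat l * \<zeta>))) \<le> M / \<rho> ^ l"
      using le[OF ne[OF \<zeta>]] \<rho> by (simp add: norm_mult divide_right_mono)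
  qed
  then have "norm (2 * of_real pi * \<i> * c l) \<le> (M / \<rho> ^ l) * (2 * pi)"
    using vertical_integral_coefficient[OF c, where q = q and l = l] q \<rho> by (simp add: norm_mult)
  then have "norm (c l) * (2 * pi) \<le> (M / \<rho> ^ l) * (2 * pi)" by (simp add: norm_mult mult_ac)
  then show ?thesis by (rule mult_right_le_imp_le) simp
qed

section \<open>Sums and derivatives in the norm of the disc space\<close>

lemma disc_norm_le:
  assumes "0 \<le> r" "\<And>z. norm z \<le> r \<Longrightarrow> norm (\<phi> z) \<le> M"
  shows "disc_norm r \<phi> \<le> M"
  unfolding disc_norm_def by (rule cSUP_least) (use assms in auto)

text \<open>For a limit 0 the supremum must be controlled from below too. The bound excludes an
  unspecified supremum of an unbounded set, and the value at 0 then shows that it is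
  nonnegative.\<close>

lemma abs_disc_norm_le:
  assumes "0 \<le> r" "\<And>z. norm z \<le> r \<Longrightarrow> norm (\<phi> z) \<le> M"
  shows "\<bar>disc_norm r \<phi>\<bar> \<le> M"
proof -
  have "norm (\<phi> 0) \<le> disc_norm r \<phi>"
    unfolding disc_norm_def
    by (rule cSUP_upper) (use assms in \<open>auto intro!: bdd_aboveI2[where M = M]\<close>)
  then have "0 \<le> disc_norm r \<phi>" using norm_ge_zero order_trans by blast
  then show ?thesis using disc_norm_le[OF assms] by simp
qed

lemma norm_le_disc_norm:
  assumes "continuous_on (cball 0 r) \<phi>" "norm z \<le> r"
  shows "norm (\<phi> z) \<le> disc_norm r \<phi>"
  unfolding disc_norm_def
proof (rule cSUP_upper)
  have "compact ((\<lambda>z. norm (\<phi> z)) ` cball 0 r)"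
    by (intro compact_continuous_image continuous_intros assms compact_cball)
  then show "bdd_above ((\<lambda>z. norm (\<phi> z)) ` cball 0 r)" by (intro bounded_imp_bdd_above compact_imp_bounded)
qed (use assms in auto)

text \<open>Two Cauchy estimates, each using up one \<epsilon> of the radius, bound the second
  derivative. The result is linear in M, so a factor geometric in n survives and the errors of
  infinitely many coefficients can be summed.\<close>

lemma difference_quotient_le:
  assumes g: "g holomorphic_on S" and S: "open S" and \<epsilon>: "\<epsilon> > 0" "cball t (3 * \<epsilon>) \<subseteq> S"
    and le: "\<And>s. s \<in> cball t (3 * \<epsilon>) \<Longrightarrow> norm (g s) \<le> M" and s: "norm (s - t) < \<epsilon>" "s \<noteq> t"
  shows "norm ((g s - g t) / (s - t) - deriv g t) \<le> M / \<epsilon>\<^sup>2 * norm (s - t)"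
proof -
  have d1: "norm (deriv g v) \<le> M / \<epsilon>" if "v \<in> cball t (2 * \<epsilon>)" for v
  proof (rule norm_deriv_le[OF g S _ \<epsilon>(1)])
    have sub: "cball v \<epsilon> \<subseteq> cball t (3 * \<epsilon>)"
    proof
      fix w assume "w \<in> cball v \<epsilon>"
      then have "dist t w \<le> 2 * \<epsilon> + \<epsilon>" using that dist_triangle[of t w v] by simp
      then show "w \<in> cball t (3 * \<epsilon>)" by simp
    qed
    then show "cball v \<epsilon> \<subseteq> S" using \<epsilon> by blast
    show "norm (g w) \<le> M" if "w \<in> cball v \<epsilon>" for w using le sub that by blast
  qed
  have d2: "norm (deriv (deriv g) v) \<le> M / \<epsilon> / \<epsilon>" if "v \<in> cball t \<epsilon>" for v
  proof (rule norm_deriv_le[OF holomorphic_deriv[OF g S] S _ \<epsilon>(1)])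
    have sub: "cball v \<epsilon> \<subseteq> cball t (2 * \<epsilon>)"
    proof
      fix w assume "w \<in> cball v \<epsilon>"
      then have "dist t w \<le> \<epsilon> + \<epsilon>" using that dist_triangle[of t w v] by simp
      then show "w \<in> cball t (2 * \<epsilon>)" by simp
    qed
    moreover have "cball t (2 * \<epsilon>) \<subseteq> S"
      by (rule order_trans[OF subset_cball \<epsilon>(2)]) (use \<epsilon>(1) in simp)
    ultimately show "cball v \<epsilon> \<subseteq> S" by blast
    show "norm (deriv g w) \<le> M / \<epsilon>" if "w \<in> cball v \<epsilon>" for w using d1 sub that by blast
  qed
  have inS: "cball t \<epsilon> \<subseteq> S"
    by (rule order_trans[OF subset_cball \<epsilon>(2)]) (use \<epsilon>(1) in simp)
  have lip: "norm (deriv g v - deriv g t) \<le> M / \<epsilon> / \<epsilon> * norm (v - t)" if "v \<in> cball t \<epsilon>" for v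
  proof (rule field_differentiable_bound[where S = "cball t \<epsilon>" and f' = "deriv (deriv g)"])
    fix w assume "w \<in> cball t \<epsilon>"
    then have "w \<in> S" using inS by blast
    then show "(deriv g has_field_derivative deriv (deriv g) w) (at w within cball t \<epsilon>)"
      by (rule has_field_derivative_at_within[OF holomorphic_derivI[OF holomorphic_deriv[OF g S] S]])
  qed (use d2 \<epsilon> that in auto)
  define h where "h = (\<lambda>v. g v - deriv g t * v)"
  define \<delta> where "\<delta> = norm (s - t)"
  have "norm (h s - h t) \<le> M / \<epsilon> / \<epsilon> * \<delta> * norm (s - t)"
  proof (rule field_differentiable_bound[where S = "cball t \<delta>" and f' = "\<lambda>v. deriv g v - deriv g t"])
    fix w assume w: "w \<in> cball t \<delta>"
    then have w': "w \<in> cball t \<epsilon>" using s by (simp add: \<delta>_def)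
    then have "w \<in> S" using inS by blast
    then have "(g has_field_derivative deriv g w) (at w within cball t \<delta>)" by (rule holomorphic_derivI[OF g S])
    then show "(h has_field_derivative deriv g w - deriv g t) (at w within cball t \<delta>)"
      unfolding h_def by (auto intro!: derivative_eq_intros)
    have e0: "0 \<le> M / \<epsilon> / \<epsilon>" using order_trans[OF norm_ge_zero le[of t]] \<epsilon> by simp
    show "norm (deriv g w - deriv g t) \<le> M / \<epsilon> / \<epsilon> * \<delta>"
      by (rule order_trans[OF lip[OF w'] mult_left_mono[OF _ e0]]) (use w in \<open>simp add: dist_norm norm_minus_commute\<close>)
  qed (auto simp: \<delta>_def dist_norm norm_minus_commute)
  moreover have "h s - h t = ((g s - g t) / (s - t) - deriv g t) * (s - t)"
    using s by (simp add: h_def field_simps)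
  ultimately have "norm ((g s - g t) / (s - t) - deriv g t) * norm (s - t) \<le> (M / \<epsilon>\<^sup>2 * norm (s - t)) * norm (s - t)"
    by (simp add: norm_mult \<delta>_def power2_eq_square)
  then show ?thesis by (rule mult_right_le_imp_le) (use s in simp)
qed

text \<open>The condition \<open>2 * A * r \<le> 1\<close> makes the ratio at most one half, whence
  the factor 2. This is where decreasing the radius absorbs the losses \<open>A ^ n\<close>.\<close>

lemma disc_series:
  assumes c: "\<And>n. norm (c n) \<le> M * A ^ n" and A: "0 < A" and r: "0 < r" "2 * A * r \<le> 1"
  shows "(\<lambda>z. \<Sum>n. c n * z ^ n) \<in> disc_space r"
    and "norm z \<le> r \<Longrightarrow> summable (\<lambda>n. c n * z ^ n)"
    and "disc_norm r (\<lambda>z. \<Sum>n. c n * z ^ n) \<le> 2 * M"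
proof -
  have M0: "0 \<le> M" using order_trans[OF norm_ge_zero c[of 0]] by simp
  have term_le: "norm (c n * z ^ n) \<le> M * (A * norm z) ^ n" for n z
    using mult_right_mono[OF c[of n], of "norm z ^ n"] by (simp add: norm_mult norm_power power_mult_distrib mult_ac)
  have sn: "summable (\<lambda>n. norm (c n * z ^ n))" if "A * norm z < 1" for z
  proof (rule summable_comparison_test'[of _ 0])
    show "summable (\<lambda>n. M * (A * norm z) ^ n)" using that A by (intro summable_mult summable_geometric) simp
  qed (use term_le in simp)
  have inside: "A * norm z < 1" if "norm z \<le> r" for z
  proof -
    have "A * norm z \<le> A * r" using that A by (intro mult_left_mono) auto
    also have "\<dots> < 1" using r(2) mult_pos_pos[OF A r(1)] by linarith
    finally show ?thesis .
  qed
  show sum: "summable (\<lambda>n. c n * z ^ n)" if "norm z \<le> r" for z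
    by (rule summable_norm_cancel[OF sn[OF inside[OF that]]])
  have hol: "(\<lambda>z. \<Sum>n. c n * z ^ n) holomorphic_on ball 0 (1 / A)"
  proof (rule power_series_holomorphic[of _ _ c])
    fix w :: complex assume "w \<in> ball 0 (1 / A)"
    then have "A * norm w < 1" using A by (simp add: field_simps)
    then show "(\<lambda>n. c n * (w - 0) ^ n) sums (\<Sum>n. c n * w ^ n)"
      using summable_norm_cancel[OF sn] by (simp add: summable_sums)
  qed
  have sub: "cball (0::complex) r \<subseteq> ball 0 (1 / A)" using inside A by (auto simp: field_simps)
  show "(\<lambda>z. \<Sum>n. c n * z ^ n) \<in> disc_space r"
    unfolding disc_space_def mem_Collect_eq
    by (intro conjI holomorphic_on_subset[OF hol order_trans[OF ball_subset_cball sub]]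
      continuous_on_subset[OF holomorphic_on_imp_continuous_on[OF hol] sub])
  show "disc_norm r (\<lambda>z. \<Sum>n. c n * z ^ n) \<le> 2 * M"
  proof (rule disc_norm_le)
    fix z :: complex assume z: "norm z \<le> r"
    have "A * norm z \<le> A * r" using z A by (intro mult_left_mono) auto
    then have half: "A * norm z \<le> 1 / 2" using r by simp
    have "norm (c n * z ^ n) \<le> M * (1 / 2) ^ n" for n
    proof -
      have "(A * norm z) ^ n \<le> (1 / 2) ^ n" using half A by (intro power_mono) auto
      then show ?thesis by (rule order_trans[OF term_le mult_left_mono[OF _ M0]])
    qed
    moreover have "(\<lambda>n. M * (1 / 2) ^ n) sums (M * 2)" using sums_mult[OF geometric_sums[of "1 / 2 :: real"], of M] by simp
    ultimately show "norm (\<Sum>n. c n * z ^ n) \<le> 2 * M"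
      using summable_norm[OF sn[OF inside[OF z]]] suminf_le[OF _ sn[OF inside[OF z]], of "\<lambda>n. M * (1 / 2) ^ n"]
      by (auto simp: sums_iff mult.commute)
  qed (use r in simp)
qed

text \<open>The sum \<open>G t z\<close> of the terms \<open>g n t * z ^ n\<close> is the continued
  Borel transform. Bounds geometric in n turn convergence, differentiability and growth of the
  coefficients into the same properties in the norm.\<close>

lemma summable_in_direction_if_continuable:
  assumes K: "K > 0" and Y: "uniformly_continuable K d (\<lambda>_. 1) Y" and r: "r > 0" and x: "\<And>i. x i \<in> disc_space r"
    and xY: "\<And>i n. fps_nth (fps_expansion (x i) 0) n / of_real (Gamma (1 + real i / K)) = Y n i"
  shows "\<exists>r'. 0 < r' \<and> r' \<le> r \<and> summable_in_direction r' K d x"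
proof -
  obtain \<alpha> r1 C A a g where g: "0 < \<alpha>" "0 < r1" "0 \<le> C" "0 < A" "0 \<le> a"
       "\<forall>n. sector_extension K d \<alpha> r1 (C * A ^ n * 1) a (Y n) (g n)"
    by (rule uniformly_continuableE[OF Y, of 1]) auto
  define U where "U = disc_sector d \<alpha> r1"
  have U: "open U" by (simp add: U_def open_disc_sector)
  have g_hol: "g n holomorphic_on U" and g_le: "t \<in> U \<Longrightarrow> norm (g n t) \<le> C * exp (a * norm t powr K) * A ^ n"
    and g_sums: "t \<in> ball 0 r1 \<Longrightarrow> (\<lambda>i. Y n i * t ^ i) sums g n t" for n t
    using g(6) unfolding sector_extension_def U_def by (auto simp: mult_ac)
  define r' where "r' = min (r / 2) (1 / (2 * A))"
  have "2 * A * r' \<le> 2 * A * (1 / (2 * A))" using g(4) by (intro mult_left_mono) (auto simp: r'_def)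
  then have r': "0 < r'" "r' < r" "2 * A * r' \<le> 1" using r g(4) by (auto simp: r'_def)
  define G where "G = (\<lambda>t z. \<Sum>n. g n t * z ^ n)"
  have G_space: "G t \<in> disc_space r'" and G_norm: "disc_norm r' (G t) \<le> 2 * (C * exp (a * norm t powr K))"
    and G_summable: "norm z \<le> r' \<Longrightarrow> summable (\<lambda>n. g n t * z ^ n)" if "t \<in> U" for t z
    unfolding G_def using disc_series[OF g_le[OF that] g(4) r'(1,3)] by blast+
  have x_space: "x i \<in> disc_space r'" for i
    using x[of i] r' unfolding disc_space_def
    by (auto intro: holomorphic_on_subset continuous_on_subset)
  have x_sums: "(\<lambda>n. Y n i * z ^ n) sums borel_transform K x i z" if "norm z \<le> r'" for i z
  proof -
    have "x i holomorphic_on ball 0 r" using x[of i] by (simp add: disc_space_def)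
    then have "(\<lambda>n. (deriv ^^ n) (x i) 0 / fact n * (z - 0) ^ n) sums x i z"
      by (rule holomorphic_power_series) (use that r' in simp)
    then have "(\<lambda>n. fps_nth (fps_expansion (x i) 0) n * z ^ n / of_real (Gamma (1 + real i / K))) sums
        (x i z / of_real (Gamma (1 + real i / K)))"
      by (intro sums_divide) (simp add: fps_expansion_def)
    then show ?thesis unfolding borel_transform_def xY[symmetric] by simp
  qed
  \<comment> \<open>Coefficients are estimated on the circle of radius \<open>3 / 4 * r1\<close> and
    the series is summed for \<open>norm t < r1 / 2\<close>. The ratio is at most
    \<open>2 / 3\<close>, whose geometric series has the sum 3.\<close>
  define \<rho> where "\<rho> = r1 * 3 / 4"
  have \<rho>: "0 < \<rho>" "\<rho> < r1" using g(2) by (auto simp: \<rho>_def)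
  define C' where "C' = C * exp (a * \<rho> powr K)"
  have Y_le: "norm (Y n i) \<le> C' / \<rho> ^ i * A ^ n" for n i
  proof -
    have "norm (Y n i) \<le> (C' * A ^ n) / \<rho> ^ i"
    proof (rule norm_coefficient_le[OF g_sums \<rho>])
      fix t :: complex assume t: "norm t = \<rho>"
      then have "t \<in> U" using \<rho> by (simp add: U_def disc_sector_def)
      from g_le[OF this, of n] show "norm (g n t) \<le> C' * A ^ n" by (simp add: C'_def t)
    qed
    then show ?thesis by simp
  qed
  have partial: "(\<lambda>N. disc_norm r' (\<lambda>z. (\<Sum>i<N. borel_transform K x i z * t ^ i) - G t z)) \<longlonglongrightarrow> 0"
    if t: "t \<in> ball 0 (r1 / 2)" for t
  proof -
    have nt: "norm t < r1 / 2" using t by simp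
    then have t1: "t \<in> ball 0 r1" using g(2) by simp
    then have tU: "t \<in> U" by (simp add: U_def disc_sector_def)
    have C'0: "0 \<le> C'" using g by (simp add: C'_def)
    have q: "norm t / \<rho> \<le> 2 / 3" using nt \<rho> by (simp add: \<rho>_def field_simps)
    have tail: "norm ((\<Sum>i<N. Y n i * t ^ i) - g n t) \<le> 3 * C' * (2 / 3) ^ N * A ^ n" for n N
    proof -
      have s: "(\<lambda>i. Y n (i + N) * t ^ (i + N)) sums (g n t - (\<Sum>i<N. Y n i * t ^ i))"
        using sums_iff_shift[of "\<lambda>i. Y n i * t ^ i" N] g_sums[OF t1, of n] by simp
      have term_le: "norm (Y n (i + N) * t ^ (i + N)) \<le> C' * A ^ n * (2 / 3) ^ N * (2 / 3) ^ i" for i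
      proof -
        have "norm (Y n (i + N) * t ^ (i + N)) \<le> (C' / \<rho> ^ (i + N) * A ^ n) * norm t ^ (i + N)"
          unfolding norm_mult norm_power by (intro mult_right_mono Y_le) auto
        also have "\<dots> = C' * A ^ n * (norm t / \<rho>) ^ (i + N)" by (simp add: power_divide)
        also have "\<dots> \<le> C' * A ^ n * (2 / 3) ^ (i + N)" using q \<rho> C'0 g(4) by (intro mult_left_mono power_mono) auto
        finally show ?thesis by (simp add: power_add mult_ac)
      qed
      have geo: "(\<lambda>i. C' * A ^ n * (2 / 3) ^ N * (2 / 3) ^ i) sums (C' * A ^ n * (2 / 3) ^ N * 3)"
        using sums_mult[OF geometric_sums[of "2 / 3 :: real"], of "C' * A ^ n * (2 / 3) ^ N"] by simp
      have sn: "summable (\<lambda>i. norm (Y n (i + N) * t ^ (i + N)))"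
        by (rule summable_comparison_test'[OF sums_summable[OF geo], of 0]) (use term_le in auto)
      have "norm (g n t - (\<Sum>i<N. Y n i * t ^ i)) \<le> (\<Sum>i. norm (Y n (i + N) * t ^ (i + N)))"
        using summable_norm[OF sn] s by (simp add: sums_iff)
      also have "\<dots> \<le> C' * A ^ n * (2 / 3) ^ N * 3"
        using suminf_le[OF term_le sn sums_summable[OF geo]] geo by (simp add: sums_iff)
      finally show ?thesis by (simp add: norm_minus_commute mult_ac)
    qed
    have le: "\<bar>disc_norm r' (\<lambda>z. (\<Sum>i<N. borel_transform K x i z * t ^ i) - G t z)\<bar> \<le> 2 * (3 * C' * (2 / 3) ^ N)" for N
    proof (rule abs_disc_norm_le)
      fix z :: complex assume z: "norm z \<le> r'"
      note ds = disc_series[OF tail[where N = N] g(4) r'(1,3)]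
      have "(\<lambda>n. (\<Sum>i<N. Y n i * t ^ i) * z ^ n) sums (\<Sum>i<N. borel_transform K x i z * t ^ i)"
      proof -
        have "(\<lambda>n. \<Sum>i<N. (Y n i * z ^ n) * t ^ i) sums (\<Sum>i<N. borel_transform K x i z * t ^ i)"
          by (intro sums_sum sums_mult2 x_sums z)
        moreover have "(\<Sum>i<N. (Y n i * z ^ n) * t ^ i) = (\<Sum>i<N. Y n i * t ^ i) * z ^ n" for n
          unfolding sum_distrib_right by (intro sum.cong refl) (simp only: mult_ac)
        ultimately show ?thesis by (simp only:)
      qed
      moreover have "(\<lambda>n. g n t * z ^ n) sums G t z" unfolding G_def by (rule summable_sums[OF G_summable[OF tU z]])
      ultimately have "(\<lambda>n. (\<Sum>i<N. Y n i * t ^ i) * z ^ n - g n t * z ^ n) sums ((\<Sum>i<N. borel_transform K x i z * t ^ i) - G t z)"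
        by (rule sums_diff)
      then have "(\<Sum>i<N. borel_transform K x i z * t ^ i) - G t z = (\<Sum>n. ((\<Sum>i<N. Y n i * t ^ i) - g n t) * z ^ n)"
        by (simp add: sums_iff left_diff_distrib)
      moreover have "norm (\<Sum>n. ((\<Sum>i<N. Y n i * t ^ i) - g n t) * z ^ n) \<le> 2 * (3 * C' * (2 / 3) ^ N)"
      proof (rule order_trans[OF norm_le_disc_norm ds(3)])
        show "continuous_on (cball 0 r') (\<lambda>z. \<Sum>n. ((\<Sum>i<N. Y n i * t ^ i) - g n t) * z ^ n)"
          using ds(1) by (simp add: disc_space_def)
      qed (use z in simp)
      ultimately show "norm ((\<Sum>i<N. borel_transform K x i z * t ^ i) - G t z) \<le> 2 * (3 * C' * (2 / 3) ^ N)" by simp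
    qed (use r' in simp)
    have "(\<lambda>N. 2 * (3 * C' * (2 / 3) ^ N)) \<longlonglongrightarrow> 2 * (3 * C' * 0)"
      by (intro tendsto_intros LIMSEQ_realpow_zero) auto
    then have lim: "(\<lambda>N. 2 * (3 * C' * (2 / 3) ^ N)) \<longlonglongrightarrow> 0" by simp
    show ?thesis by (rule Lim_null_comparison[OF _ lim]) (use le in auto)
  qed
  have hol: "disc_valued_holomorphic_on r' G U"
    unfolding disc_valued_holomorphic_on_def
  proof (intro conjI ballI)
    fix t assume t: "t \<in> U"
    show "G t \<in> disc_space r'" by (rule G_space[OF t])
    obtain e where e: "e > 0" "cball t e \<subseteq> U" using U t open_contains_cball by blast
    define \<epsilon> where "\<epsilon> = e / 3"
    have \<epsilon>: "\<epsilon> > 0" "3 * \<epsilon> = e" using e by (auto simp: \<epsilon>_def)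
    have sub: "cball t (3 * \<epsilon>) \<subseteq> U" using e \<epsilon> by simp
    have "compact ((\<lambda>s. norm s) ` cball t (3 * \<epsilon>))" by (intro compact_continuous_image continuous_intros compact_cball)
    then obtain R where R: "\<And>s. s \<in> cball t (3 * \<epsilon>) \<Longrightarrow> norm s \<le> R"
      using compact_imp_bounded bounded_imp_bdd_above unfolding bdd_above_def by (metis imageI)
    define M where "M = C * exp (a * R powr K)"
    have gM: "norm (g n s) \<le> M * A ^ n" if "s \<in> cball t (3 * \<epsilon>)" for n s
    proof -
      have "norm s powr K \<le> R powr K" using K R[OF that] by (intro powr_mono2) auto
      then have "C * exp (a * norm s powr K) \<le> M" unfolding M_def using g by (intro mult_left_mono) (auto intro: mult_left_mono)
      then have "C * exp (a * norm s powr K) * A ^ n \<le> M * A ^ n" using g(4) by (intro mult_right_mono) auto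
      then show ?thesis using g_le[of s n] sub that by fastforce
    qed
    have dM: "norm (deriv (g n) t) \<le> M / \<epsilon> * A ^ n" for n
    proof -
      have "norm (deriv (g n) t) \<le> (M * A ^ n) / \<epsilon>"
      proof (rule norm_deriv_le[OF g_hol U _ \<epsilon>(1)])
        have "cball t \<epsilon> \<subseteq> cball t (3 * \<epsilon>)" using \<epsilon> by (intro subset_cball) auto
        then show "cball t \<epsilon> \<subseteq> U" "\<And>s. s \<in> cball t \<epsilon> \<Longrightarrow> norm (g n s) \<le> M * A ^ n" using sub gM by blast+
      qed
      then show ?thesis by simp
    qed
    define D where "D = (\<lambda>z. \<Sum>n. deriv (g n) t * z ^ n)"
    have D_space: "D \<in> disc_space r'" and D_summable: "norm z \<le> r' \<Longrightarrow> summable (\<lambda>n. deriv (g n) t * z ^ n)" for z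
      unfolding D_def using disc_series[OF dM g(4) r'(1,3)] by blast+
    have quot: "\<bar>disc_norm r' (\<lambda>z. (G s z - G t z) / (s - t) - D z)\<bar> \<le> 2 * (M / \<epsilon>\<^sup>2 * norm (s - t))"
      if s: "norm (s - t) < \<epsilon>" "s \<noteq> t" for s
    proof (rule abs_disc_norm_le)
      have q: "norm ((g n s - g n t) / (s - t) - deriv (g n) t) \<le> M / \<epsilon>\<^sup>2 * norm (s - t) * A ^ n" for n
        using difference_quotient_le[OF g_hol U \<epsilon>(1) sub gM s] by (simp add: mult_ac)
      note ds = disc_series[OF q g(4) r'(1,3)]
      have sU: "s \<in> U" using sub s \<epsilon>(1) by (force simp: dist_norm norm_minus_commute)
      fix z :: complex assume z: "norm z \<le> r'"
      have "(\<lambda>n. (g n s * z ^ n - g n t * z ^ n) / (s - t) - deriv (g n) t * z ^ n) sums ((G s z - G t z) / (s - t) - D z)"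
        unfolding G_def D_def
        by (intro sums_diff sums_divide summable_sums G_summable sU t z D_summable)
      then have "(G s z - G t z) / (s - t) - D z = (\<Sum>n. ((g n s - g n t) / (s - t) - deriv (g n) t) * z ^ n)"
        by (simp add: sums_iff algebra_simps diff_divide_distrib)
      moreover have "norm (\<Sum>n. ((g n s - g n t) / (s - t) - deriv (g n) t) * z ^ n) \<le> 2 * (M / \<epsilon>\<^sup>2 * norm (s - t))"
      proof (rule order_trans[OF norm_le_disc_norm ds(3)])
        show "continuous_on (cball 0 r') (\<lambda>z. \<Sum>n. ((g n s - g n t) / (s - t) - deriv (g n) t) * z ^ n)"
          using ds(1) by (simp add: disc_space_def)
      qed (use z in simp)
      ultimately show "norm ((G s z - G t z) / (s - t) - D z) \<le> 2 * (M / \<epsilon>\<^sup>2 * norm (s - t))" by simp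
    qed (use r' in simp)
    have ev: "\<forall>\<^sub>F s in at t within U. norm (disc_norm r' (\<lambda>z. (G s z - G t z) / (s - t) - D z)) \<le> 2 * (M / \<epsilon>\<^sup>2 * norm (s - t))"
      unfolding eventually_at using quot \<epsilon>(1) by (intro exI[of _ \<epsilon>]) (auto simp: dist_norm)
    have "((\<lambda>s. 2 * (M / \<epsilon>\<^sup>2 * norm (s - t))) \<longlongrightarrow> 2 * (M / \<epsilon>\<^sup>2 * norm (t - t))) (at t within U)"
      by (intro tendsto_intros)
    then have lim: "((\<lambda>s. 2 * (M / \<epsilon>\<^sup>2 * norm (s - t))) \<longlongrightarrow> 0) (at t within U)" by simp
    show "\<exists>D\<in>disc_space r'. ((\<lambda>s. disc_norm r' (\<lambda>z. (G s z - G t z) / (s - t) - D z)) \<longlongrightarrow> 0) (at t within U)"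
      using Lim_null_comparison[OF ev lim] D_space by blast
  qed
  have growth: "exp_growth K d \<alpha> r1 (\<lambda>t. disc_norm r' (G t))"
    unfolding exp_growth_def
  proof (intro allI impI)
    fix \<alpha>' r'' assume "0 < \<alpha>' \<and> \<alpha>' < \<alpha> \<and> 0 < r'' \<and> r'' < r1"
    then have "disc_sector d \<alpha>' r'' \<subseteq> U" unfolding U_def by (intro disc_sector_mono) auto
    then show "\<exists>C a. \<forall>t\<in>disc_sector d \<alpha>' r''. disc_norm r' (G t) \<le> C * exp (a * norm t powr K)"
      using G_norm by (intro exI[of _ "2 * C"] exI[of _ a]) (auto simp: mult.assoc)
  qed
  have "summable_in_direction r' K d x"
    unfolding summable_in_direction_def
    using x_space partial hol growth g(1,2) unfolding U_def
    by (intro conjI allI exI[of _ G] exI[of _ \<alpha>] exI[of _ r1] exI[of _ "r1 / 2"]) auto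
  then show ?thesis using r' by (intro exI[of _ r']) auto
qed

text \<open>The l-th Taylor coefficient at 0 is a linear functional, bounded in
  \<open>disc_norm\<close> by Cauchy's inequality; applying it carries convergence, holomorphy and
  growth over to scalar functions. The coefficients are treated one l at a time.\<close>

lemma continuable_if_summable_in_direction:
  assumes sm: "summable_in_direction r K d x" and r: "r > 0"
  shows "uniformly_continuable K d (\<lambda>_. 1)
    (\<lambda>_ i. fps_nth (fps_expansion (x i) 0) l / of_real (Gamma (1 + real i / K)))"
proof -
  obtain g \<alpha> \<rho> \<delta> where x: "\<And>n. x n \<in> disc_space r" and pos: "0 < \<alpha>" "0 < \<rho>" "0 < \<delta>"
    and lim: "\<And>t. t \<in> ball 0 \<delta> \<Longrightarrow> (\<lambda>N. disc_norm r (\<lambda>z. (\<Sum>n<N. borel_transform K x n z * t ^ n) - g t z)) \<longlonglongrightarrow> 0"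
    and hol: "disc_valued_holomorphic_on r g (disc_sector d \<alpha> \<rho>)"
    and growth: "exp_growth K d \<alpha> \<rho> (\<lambda>t. disc_norm r (g t))"
    using sm unfolding summable_in_direction_def by blast
  \<comment> \<open>The coefficient functional just described; linearity holds on the disc space,
    where derivatives exist.\<close>
  define \<Lambda> :: "(complex \<Rightarrow> complex) \<Rightarrow> complex" where "\<Lambda> = (\<lambda>\<phi>. (deriv ^^ l) \<phi> 0 / fact l)"
  have \<Lambda>_le: "norm (\<Lambda> \<phi>) \<le> disc_norm r \<phi> / r ^ l" if "\<phi> \<in> disc_space r" for \<phi>
  proof -
    have "norm ((deriv ^^ l) \<phi> 0) \<le> fact l * disc_norm r \<phi> / r ^ l"
      by (rule Cauchy_inequality) (use that r norm_le_disc_norm in \<open>auto simp: disc_space_def\<close>)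
    then show ?thesis by (simp add: \<Lambda>_def norm_divide field_simps)
  qed
  have \<Lambda>_diff: "\<Lambda> (\<lambda>z. \<phi> z - \<psi> z) = \<Lambda> \<phi> - \<Lambda> \<psi>" if "\<phi> \<in> disc_space r" "\<psi> \<in> disc_space r" for \<phi> \<psi>
    unfolding \<Lambda>_def using that r
    by (subst higher_deriv_diff[where S = "ball 0 r"]) (auto simp: disc_space_def diff_divide_distrib)
  have \<Lambda>_add: "\<Lambda> (\<lambda>z. \<phi> z + \<psi> z) = \<Lambda> \<phi> + \<Lambda> \<psi>" if "\<phi> \<in> disc_space r" "\<psi> \<in> disc_space r" for \<phi> \<psi>
    unfolding \<Lambda>_def using that r
    by (subst higher_deriv_add[where S = "ball 0 r"]) (auto simp: disc_space_def add_divide_distrib)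
  have \<Lambda>_cmult: "\<Lambda> (\<lambda>z. c * \<phi> z) = c * \<Lambda> \<phi>" if "\<phi> \<in> disc_space r" for \<phi> c
    unfolding \<Lambda>_def using that r
    by (subst higher_deriv_cmult[where A = "ball 0 r"]) (auto simp: disc_space_def)
  have sp_diff: "(\<lambda>z. \<phi> z - \<psi> z) \<in> disc_space r" and sp_add: "(\<lambda>z. \<phi> z + \<psi> z) \<in> disc_space r"
    and sp_cmult: "(\<lambda>z. c * \<phi> z) \<in> disc_space r" if "\<phi> \<in> disc_space r" "\<psi> \<in> disc_space r" for \<phi> \<psi> c
    using that unfolding disc_space_def by (auto intro!: holomorphic_intros continuous_intros)
  define U where "U = disc_sector d \<alpha> \<rho>"
  have U: "open U" by (simp add: U_def open_disc_sector)
  have g_space: "g t \<in> disc_space r" if "t \<in> U" for t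
    using hol that unfolding disc_valued_holomorphic_on_def U_def by blast
  define c where "c = (\<lambda>t. \<Lambda> (g t))"
  have c_hol: "c holomorphic_on U"
    unfolding holomorphic_on_open[OF U]
  proof
    fix t assume t: "t \<in> U"
    then obtain D where D: "D \<in> disc_space r"
      "((\<lambda>s. disc_norm r (\<lambda>z. (g s z - g t z) / (s - t) - D z)) \<longlongrightarrow> 0) (at t within U)"
      using hol unfolding disc_valued_holomorphic_on_def U_def by blast
    have eq: "(c s - c t) / (s - t) - \<Lambda> D = \<Lambda> (\<lambda>z. (g s z - g t z) / (s - t) - D z)"
      and sp: "(\<lambda>z. (g s z - g t z) / (s - t) - D z) \<in> disc_space r" if "s \<in> U" for s
    proof -
      have 1: "(\<lambda>z. g s z - g t z) \<in> disc_space r" by (rule sp_diff[OF g_space[OF that] g_space[OF t]])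
      have 2: "(\<lambda>z. inverse (s - t) * (g s z - g t z)) \<in> disc_space r" by (rule sp_cmult[OF 1 1])
      show "(\<lambda>z. (g s z - g t z) / (s - t) - D z) \<in> disc_space r"
        using sp_diff[OF 2 D(1)] by (simp add: divide_inverse mult.commute)
      show "(c s - c t) / (s - t) - \<Lambda> D = \<Lambda> (\<lambda>z. (g s z - g t z) / (s - t) - D z)"
        using \<Lambda>_diff[OF 2 D(1)] \<Lambda>_cmult[OF 1, of "inverse (s - t)"] \<Lambda>_diff[OF g_space[OF that] g_space[OF t]]
        by (simp add: c_def divide_inverse mult.commute)
    qed
    have ev: "\<forall>\<^sub>F s in at t within U. norm ((c s - c t) / (s - t) - \<Lambda> D) \<le> disc_norm r (\<lambda>z. (g s z - g t z) / (s - t) - D z) / r ^ l"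
    proof -
      have "norm ((c s - c t) / (s - t) - \<Lambda> D) \<le> disc_norm r (\<lambda>z. (g s z - g t z) / (s - t) - D z) / r ^ l" if "s \<in> U" for s
        unfolding eq[OF that] by (rule \<Lambda>_le[OF sp[OF that]])
      then show ?thesis unfolding eventually_at by (intro exI[of _ 1]) simp
    qed
    have "((\<lambda>s. disc_norm r (\<lambda>z. (g s z - g t z) / (s - t) - D z) / r ^ l) \<longlongrightarrow> 0 / r ^ l) (at t within U)"
      by (intro tendsto_intros D(2)) (use r in auto)
    then have "((\<lambda>s. (c s - c t) / (s - t) - \<Lambda> D) \<longlongrightarrow> 0) (at t within U)"
      using Lim_null_comparison[OF ev] by simp
    then have "((\<lambda>s. (c s - c t) / (s - t)) \<longlongrightarrow> \<Lambda> D) (at t within U)" by (rule Lim_null[THEN iffD2])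
    then have "(c has_field_derivative \<Lambda> D) (at t within U)" by (simp add: has_field_derivative_iff)
    then show "\<exists>f'. (c has_field_derivative f') (at t)" unfolding at_within_open[OF t U] by (rule exI)
  qed
  have x_sum: "(\<lambda>z. \<Sum>n<N. borel_transform K x n z * t ^ n) \<in> disc_space r \<and>
      \<Lambda> (\<lambda>z. \<Sum>n<N. borel_transform K x n z * t ^ n) = (\<Sum>n<N. \<Lambda> (x n) / of_real (Gamma (1 + real n / K)) * t ^ n)" for N t
  proof (induction N)
    case 0
    have "(\<lambda>z::complex. 0::complex) \<in> disc_space r" by (simp add: disc_space_def)
    from this \<Lambda>_cmult[OF this, of 0] show ?case by simp
  next
    case (Suc N)
    have e: "(\<lambda>z. borel_transform K x N z * t ^ N) = (\<lambda>z. (t ^ N / of_real (Gamma (1 + real N / K))) * x N z)"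
      by (simp add: borel_transform_def mult.commute)
    have e2: "\<Lambda> (\<lambda>z. borel_transform K x N z * t ^ N) = \<Lambda> (x N) / of_real (Gamma (1 + real N / K)) * t ^ N"
      unfolding e \<Lambda>_cmult[OF x] by simp
    have 1: "(\<lambda>z. borel_transform K x N z * t ^ N) \<in> disc_space r" unfolding e by (rule sp_cmult[OF x x])
    show ?case
      using sp_add[OF conjunct1[OF Suc] 1] \<Lambda>_add[OF conjunct1[OF Suc] 1] Suc e2 by simp
  qed
  define \<rho>' where "\<rho>' = min (\<rho> / 2) (\<delta> / 2)"
  have \<rho>': "0 < \<rho>'" "\<rho>' < \<rho>" "\<rho>' < \<delta>" using pos by (auto simp: \<rho>'_def)
  obtain C a where Ca: "\<And>t. t \<in> disc_sector d (\<alpha> / 2) (\<rho> / 2) \<Longrightarrow> disc_norm r (g t) \<le> C * exp (a * norm t powr K)"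
    using growth[unfolded exp_growth_def, rule_format, of "\<alpha> / 2" "\<rho> / 2"] pos by auto
  have subU: "disc_sector d (\<alpha> / 2) (\<rho> / 2) \<subseteq> U" "disc_sector d (\<alpha> / 2) \<rho>' \<subseteq> disc_sector d (\<alpha> / 2) (\<rho> / 2)"
    unfolding U_def by (rule disc_sector_mono; use pos in \<open>simp add: \<rho>'_def\<close>)+
  have "sector_extension K d (\<alpha> / 2) \<rho>' (C / r ^ l) a
      (\<lambda>i. fps_nth (fps_expansion (x i) 0) l / of_real (Gamma (1 + real i / K))) c"
    unfolding sector_extension_def
  proof (intro conjI ballI)
    show "c holomorphic_on disc_sector d (\<alpha> / 2) \<rho>'" using c_hol subU holomorphic_on_subset by blast
    fix t assume t: "t \<in> disc_sector d (\<alpha> / 2) \<rho>'"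
    then have t': "t \<in> disc_sector d (\<alpha> / 2) (\<rho> / 2)" "t \<in> U" using subU by blast+
    have "norm (c t) \<le> disc_norm r (g t) / r ^ l" unfolding c_def by (rule \<Lambda>_le[OF g_space[OF t'(2)]])
    also have "\<dots> \<le> C * exp (a * norm t powr K) / r ^ l" using Ca[OF t'(1)] r by (intro divide_right_mono) auto
    finally show "norm (c t) \<le> C / r ^ l * exp (a * norm t powr K)" by simp
  next
    fix t assume t: "t \<in> ball (0::complex) \<rho>'"
    have tU: "t \<in> U" and t\<delta>: "t \<in> ball 0 \<delta>" using t \<rho>' by (auto simp: U_def disc_sector_def)
    have eq: "(\<Sum>n<N. \<Lambda> (x n) / of_real (Gamma (1 + real n / K)) * t ^ n) - c t =
        \<Lambda> (\<lambda>z. (\<Sum>n<N. borel_transform K x n z * t ^ n) - g t z)" for N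
      using \<Lambda>_diff[OF conjunct1[OF x_sum] g_space[OF tU]] x_sum by (simp add: c_def)
    have le: "norm ((\<Sum>n<N. \<Lambda> (x n) / of_real (Gamma (1 + real n / K)) * t ^ n) - c t) \<le>
        disc_norm r (\<lambda>z. (\<Sum>n<N. borel_transform K x n z * t ^ n) - g t z) / r ^ l" for N
      unfolding eq by (rule \<Lambda>_le[OF sp_diff[OF conjunct1[OF x_sum] g_space[OF tU]]])
    have "(\<lambda>N. disc_norm r (\<lambda>z. (\<Sum>n<N. borel_transform K x n z * t ^ n) - g t z) / r ^ l) \<longlonglongrightarrow> 0 / r ^ l"
      by (intro tendsto_intros lim[OF t\<delta>]) (use r in auto)
    then have "(\<lambda>N. (\<Sum>n<N. \<Lambda> (x n) / of_real (Gamma (1 + real n / K)) * t ^ n) - c t) \<longlonglongrightarrow> 0"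
      using Lim_null_comparison[OF always_eventually[OF allI[OF le]]] by simp
    then have "(\<lambda>n. \<Lambda> (x n) / of_real (Gamma (1 + real n / K)) * t ^ n) sums c t"
      unfolding sums_def by (rule Lim_null[THEN iffD2])
    then show "(\<lambda>i. fps_nth (fps_expansion (x i) 0) l / of_real (Gamma (1 + real i / K)) * t ^ i) sums c t"
      by (simp add: \<Lambda>_def fps_expansion_def)
  qed
  then show ?thesis by (rule uniformly_continuable_const) (use pos \<rho>' in auto)
qed

section \<open>Multipliers given by moments of kernel functions\<close>

text \<open>The shift by \<open>p * n\<close> costs \<open>((2 / r) ^ p) ^ n\<close>, which the
  geometric factor absorbs. The gap \<open>\<alpha> / 8\<close> about the positive axis, where the
  multiplier need not continue, is dictated by the sector of f.\<close>

lemma uniformly_continuable_hadamard: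
  assumes K: "K > 0" and f: "uniformly_continuable K \<theta> (\<lambda>_. 1) (\<lambda>_. fc)"
    and h: "\<And>\<psi>. 0 < \<psi> \<Longrightarrow> \<psi> < 2 * pi \<Longrightarrow> uniformly_continuable K \<psi> B h" and B: "\<And>n. 0 \<le> B n"
  shows "uniformly_continuable K \<theta> B (\<lambda>n j. fc (p * n + j) * h n j)"
proof -
  obtain \<alpha> r C A a g where g: "0 < \<alpha>" "\<alpha> \<le> pi" "0 < r" "0 \<le> C" "0 < A" "0 \<le> a"
       "\<forall>n. sector_extension K \<theta> \<alpha> r (C * A ^ n * 1) a fc (g n)"
    by (rule uniformly_continuableE[OF f, of pi]) auto
  have g0: "sector_extension K \<theta> \<alpha> r C a fc (g 0)" using g(7) by (metis mult.right_neutral power_0)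
  have \<delta>: "0 < \<alpha> / 8" "\<alpha> / 8 < pi" using g by auto
  obtain R C1 A1 b where R: "R > 0" "C1 \<ge> 0" "A1 > 0" "b \<ge> 0"
    "\<forall>n. \<exists>H. sector_extension K pi (2 * pi - 2 * (\<alpha> / 8)) R (C1 * A1 ^ n * B n) b (h n) H"
    using sector_extension_all_directions[OF h B \<delta>] by blast
  have e: "2 * pi - 2 * (\<alpha> / 8) = 2 * pi - \<alpha> / 4" by simp
  obtain \<rho> C2 a2 where \<rho>: "\<rho> > 0" "C2 \<ge> 0" "a2 \<ge> 0" and ext:
    "\<And>H h M s. 0 \<le> M \<Longrightarrow> sector_extension K pi (2 * pi - \<alpha> / 4) R M b h H \<Longrightarrow>
       \<exists>\<phi>. sector_extension K \<theta> (\<alpha> / 2) \<rho> (C2 * (2 / r) ^ s * M) a2 (\<lambda>j. fc (s + j) * h j) \<phi>"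
  proof (rule hadamard_extension[OF K g0 g(1-4) g(6) R(1) R(4)])
    fix \<rho> C a
    assume 1: "\<rho> > 0" "C \<ge> 0" "a \<ge> 0"
      and 2: "\<And>H h M s. 0 \<le> M \<Longrightarrow> sector_extension K pi (2 * pi - \<alpha> / 4) R M b h H \<Longrightarrow>
       \<exists>\<phi>. sector_extension K \<theta> (\<alpha> / 2) \<rho> (C * (2 / r) ^ s * M) a (\<lambda>j. fc (s + j) * h j) \<phi>"
    show thesis by (rule that[OF 1 2])
  qed
  show ?thesis
  proof (rule uniformly_continuableI[of "\<alpha> / 2" \<rho> "C2 * C1" "(2 / r) ^ p * A1" a2])
    fix n
    obtain H where H: "sector_extension K pi (2 * pi - \<alpha> / 4) R (C1 * A1 ^ n * B n) b (h n) H" using R(5) unfolding e by blast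
    have "0 \<le> C1 * A1 ^ n * B n" using R B by simp
    have "C2 * (2 / r) ^ (p * n) * (C1 * A1 ^ n * B n) = C2 * C1 * ((2 / r) ^ p * A1) ^ n * B n"
      by (simp add: power_mult power_mult_distrib)
    with ext[OF \<open>0 \<le> C1 * A1 ^ n * B n\<close> H, of "p * n"]
    show "\<exists>g. sector_extension K \<theta> (\<alpha> / 2) \<rho> (C2 * C1 * ((2 / r) ^ p * A1) ^ n * B n) a2 (\<lambda>j. fc (p * n + j) * h n j) g"
      by (simp only:)
  qed (use g \<rho> R in auto)
qed

text \<open>The inversion \<open>1 / x\<close> moves integrability at the origin to infinity along
  the ray. The allowance \<open>C / \<rho>\<close> becomes \<open>C / \<rho>\<^sup>2\<close> after
  division; it covers the Mittag-Leffler function, with F zero, and the remainders of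
  \<open>E\<close> after removal of initial terms.\<close>

lemma ray_integrable_if_inverse:
  fixes F :: "complex \<Rightarrow> complex"
  assumes F: "continuous_on UNIV F" and C: "0 \<le> C"
    and int: "set_integrable lborel {0<..1} (\<lambda>x. norm (F (cis \<gamma> / of_real x)) / x)"
    and G: "continuous_on UNIV G" and le: "\<And>\<rho>. 1 \<le> \<rho> \<Longrightarrow> norm (G (of_real \<rho> * cis \<gamma>)) \<le> norm (F (of_real \<rho> * cis \<gamma>)) + C / \<rho>"
  shows "set_integrable lborel {1..} (\<lambda>\<rho>. norm (G (of_real \<rho> * cis \<gamma>)) / \<rho>)"
proof -
  define f where "f = (\<lambda>\<rho>. norm (F (of_real \<rho> * cis \<gamma>)) / \<rho> + C / \<rho>\<^sup>2)"
  have img: "(\<lambda>x::real. 1 / x) ` {0<..1} = {1..}"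
  proof (intro equalityI subsetI)
    fix y :: real assume "y \<in> {1..}"
    then have "y = 1 / (1 / y)" "1 / y \<in> {0<..1}" by auto
    then show "y \<in> (\<lambda>x. 1 / x) ` {0<..1}" by blast
  qed auto
  have cf: "continuous_on {1..} f" unfolding f_def
    by (intro continuous_intros continuous_on_compose2[OF F]) auto
  have eq: "\<bar>- 1 / x\<^sup>2\<bar> * f (1 / x) = norm (F (cis \<gamma> / of_real x)) / x + C" if "x \<in> {0<..1}" for x
    using that by (simp add: f_def power2_eq_square field_simps)
  have "set_integrable lborel {0<..1} (\<lambda>x. norm (F (cis \<gamma> / of_real x)) / x + C)"
  proof (rule set_integral_add(1)[OF int])
    have "integrable lborel (indicat_real {0<..1::real})" by (rule integrable_real_indicator) simp_all
    then show "set_integrable lborel {0<..1::real} (\<lambda>x. C)" by (simp add: set_integrable_def)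
  qed
  then have i1: "set_integrable lborel {0<..1} (\<lambda>x. \<bar>- 1 / x\<^sup>2\<bar> * f (1 / x))"
    by (simp only: set_integrable_cong[OF refl refl eq])
  have fi: "set_integrable lborel {1..} f"
  proof (rule set_integral_substitution(1)[THEN iffD1, OF _ _ _ _ img cf _ i1])
    show "((\<lambda>x. 1 / x) has_field_derivative - 1 / x\<^sup>2) (at x)" if "x \<in> {0<..1}" for x :: real
      using that by (auto intro!: derivative_eq_intros simp: power2_eq_square)
    show "inj_on (\<lambda>x::real. 1 / x) {0<..1}" by (auto intro!: inj_onI)
    show "continuous_on {0<..1} (\<lambda>x. \<bar>- 1 / x\<^sup>2\<bar> * f (1 / x))"
      by (rule continuous_on_mult) (auto intro!: continuous_intros continuous_on_compose2[OF cf])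
  qed auto
  show ?thesis
    unfolding set_integrable_def
  proof (rule Bochner_Integration.integrable_bound[OF fi[unfolded set_integrable_def]])
    show "(\<lambda>\<rho>. indicat_real {1..} \<rho> *\<^sub>R (norm (G (of_real \<rho> * cis \<gamma>)) / \<rho>)) \<in> borel_measurable lborel"
      by (rule borel_measurable_indicator_continuous) (auto intro!: continuous_intros continuous_on_compose2[OF G])
    show "AE \<rho> in lborel. norm (indicat_real {1..} \<rho> *\<^sub>R (norm (G (of_real \<rho> * cis \<gamma>)) / \<rho>)) \<le> norm (indicat_real {1..} \<rho> *\<^sub>R f \<rho>)"
    proof (rule AE_I2)
      fix \<rho> :: real
      show "norm (indicat_real {1..} \<rho> *\<^sub>R (norm (G (of_real \<rho> * cis \<gamma>)) / \<rho>)) \<le> norm (indicat_real {1..} \<rho> *\<^sub>R f \<rho>)"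
      proof (cases "1 \<le> \<rho>")
        case True
        have "norm (G (of_real \<rho> * cis \<gamma>)) / \<rho> \<le> (norm (F (of_real \<rho> * cis \<gamma>)) + C / \<rho>) / \<rho>"
          using le[OF True] True by (intro divide_right_mono) auto
        also have "\<dots> = f \<rho>" using True by (simp add: f_def add_divide_distrib power2_eq_square)
        finally show ?thesis using True by simp
      qed simp
    qed
  qed
qed

section \<open>Moments of a kernel of order beyond 1/2\<close>

locale kernel_moments =
  fixes K :: real and e E :: "complex \<Rightarrow> complex"
  assumes pair: "kernel_pair K e E"
begin

definition moment :: "nat \<Rightarrow> real" where "moment j = Re (kernel_moment e (of_nat j))"

lemma K: "K > 1 / 2" "K > 0" using pair by (auto simp: kernel_pair_def)

lemma e_hol: "e holomorphic_on sector 0 (pi / K)" using pair by (simp add: kernel_pair_def)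

lemma e_bound: "\<delta> > 0 \<Longrightarrow> \<exists>c>0. \<exists>L>0. \<forall>t. t \<noteq> 0 \<and> 2 * K * \<bar>Arg t\<bar> \<le> pi - \<delta> \<longrightarrow>
        norm (e t) \<le> c * exp (- ((norm t / L) powr K))"
  using pair by (simp add: kernel_pair_def)

lemma positive_in_sector: "x > 0 \<Longrightarrow> of_real x \<in> sector 0 (pi / K)"
  using K by (intro sectorI[of _ x 0]) auto

lemma kernel_moment_Suc:
  "kernel_moment e (of_nat (Suc j)) = (LINT x:{0<..}|lborel. of_real (x ^ j) * e (of_real x))"
  unfolding kernel_moment_def by (intro set_lebesgue_integral_cong) (auto simp: powr_nat')

lemma e_real: "x > 0 \<Longrightarrow> e (of_real x) = of_real (Re (e (of_real x)))" and e_pos: "x > 0 \<Longrightarrow> 0 < Re (e (of_real x))"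
  using pair by (auto simp: kernel_pair_def complex_is_Real_iff complex_eq_iff)

lemma e_cont: "continuous_on {0<..} (\<lambda>x::real. e (of_real x))"
  by (rule continuous_on_compose2[OF holomorphic_on_imp_continuous_on[OF e_hol]])
     (use positive_in_sector in \<open>auto intro!: continuous_intros\<close>)

lemma moment_integrable: "set_integrable lborel {0<..} (\<lambda>x. x ^ j * Re (e (of_real x)))"
proof -
  \<comment> \<open>With \<open>\<delta> = pi\<close> the decay condition speaks of the positive
    axis alone.\<close>
  obtain c L where c: "c > 0" "L > 0" and le: "\<And>t. t \<noteq> 0 \<Longrightarrow> 2 * K * \<bar>Arg t\<bar> \<le> pi - pi \<Longrightarrow> norm (e t) \<le> c * exp (- ((norm t / L) powr K))"
    using e_bound[OF pi_gt_zero] by metis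
  define w where "w = (\<lambda>x::real. c * (x powr real j * exp (- ((1 / L) powr K * x powr K))))"
  have w: "set_integrable lborel {0<..} w"
    unfolding w_def using powr_exp_integral(1)[of K "real j" "(1 / L) powr K"] K c by (intro set_integrable_mult_right) auto
  show ?thesis
    unfolding set_integrable_def
  proof (rule Bochner_Integration.integrable_bound[OF w[unfolded set_integrable_def]])
    show "(\<lambda>x. indicat_real {0<..} x *\<^sub>R (x ^ j * Re (e (of_real x)))) \<in> borel_measurable lborel"
      by (rule borel_measurable_indicator_continuous) (auto intro!: continuous_intros e_cont)
    show "AE x in lborel. norm (indicat_real {0<..} x *\<^sub>R (x ^ j * Re (e (of_real x)))) \<le> norm (indicat_real {0<..} x *\<^sub>R w x)"
    proof (rule AE_I2)
      fix x :: real
      show "norm (indicat_real {0<..} x *\<^sub>R (x ^ j * Re (e (of_real x)))) \<le> norm (indicat_real {0<..} x *\<^sub>R w x)"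
      proof (cases "x > 0")
        case True
        have "\<bar>Re (e (of_real x))\<bar> \<le> norm (e (of_real x))" by (rule abs_Re_le_cmod)
        also have "\<dots> \<le> c * exp (- ((x / L) powr K))" using le[of "of_real x"] True by (simp add: Arg_of_real)
        also have "(x / L) powr K = (1 / L) powr K * x powr K" using True c by (simp add: powr_divide)
        finally have "x ^ j * \<bar>Re (e (of_real x))\<bar> \<le> x ^ j * (c * exp (- ((1 / L) powr K * x powr K)))"
          using True by (intro mult_left_mono) auto
        then show ?thesis using True c by (simp add: w_def abs_mult powr_realpow mult_ac)
      qed simp
    qed
  qed
qed

lemma kernel_moment_eq_integral: "kernel_moment e (of_nat (Suc j)) = of_real (LINT x:{0<..}|lborel. x ^ j * Re (e (of_real x)))"
proof -
  have "kernel_moment e (of_nat (Suc j)) = (LINT x:{0<..}|lborel. of_real (x ^ j * Re (e (of_real x))))"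
    unfolding kernel_moment_Suc
  proof (intro set_lebesgue_integral_cong allI impI)
    fix x :: real assume "x \<in> {0<..}"
    then have "e (of_real x) = of_real (Re (e (of_real x)))" using e_real by simp
    then show "of_real (x ^ j) * e (of_real x) = of_real (x ^ j * Re (e (of_real x)))" by (metis of_real_mult)
  qed simp
  then show ?thesis by (simp only: set_integral_complex_of_real)
qed

lemma of_real_moment: "of_real (moment j) = kernel_moment e (of_nat j)"
proof (cases j)
  case 0
  then show ?thesis using pair by (simp add: moment_def kernel_pair_def)
next
  case (Suc i)
  then show ?thesis unfolding Suc moment_def kernel_moment_eq_integral by simp
qed

lemma moment_0: "moment 0 = 1" using pair by (simp add: moment_def kernel_pair_def)

text \<open>The integrand is positive and continuous, so its minimum on \<open>{1..2}\<close>
  already bounds the integral away from 0.\<close>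

lemma moment_pos: "0 < moment j"
proof (cases j)
  case 0
  then show ?thesis by (simp add: moment_0)
next
  case (Suc i)
  have "continuous_on {1..2} (\<lambda>x::real. x ^ i * Re (e (of_real x)))"
    by (rule continuous_on_subset[of "{0<..}"]) (auto intro!: continuous_intros e_cont)
  then obtain x0 where x0: "x0 \<in> {1..2::real}" "\<And>x. x \<in> {1..2} \<Longrightarrow> x0 ^ i * Re (e (of_real x0)) \<le> x ^ i * Re (e (of_real x))"
    using continuous_attains_inf[of "{1..2::real}" "\<lambda>x. x ^ i * Re (e (of_real x))"] by auto
  define c where "c = x0 ^ i * Re (e (of_real x0))"
  have c: "0 < c" using x0(1) e_pos[of x0] by (simp add: c_def)
  have "(\<integral>x. c * indicat_real {1..2::real} x \<partial>lborel) \<le> (\<integral>x. indicat_real {0<..} x *\<^sub>R (x ^ i * Re (e (of_real x))) \<partial>lborel)"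
  proof (rule Bochner_Integration.integral_mono)
    show "integrable lborel (\<lambda>x. indicat_real {0<..} x *\<^sub>R (x ^ i * Re (e (of_real x))))"
      using moment_integrable by (simp add: set_integrable_def)
    have "integrable lborel (indicat_real {1..2::real})" by (rule integrable_real_indicator) simp_all
    then show "integrable lborel (\<lambda>x. c * indicat_real {1..2::real} x)" by simp
    fix x :: real
    show "c * indicat_real {1..2} x \<le> indicat_real {0<..} x *\<^sub>R (x ^ i * Re (e (of_real x)))"
      using x0(2)[of x] e_pos[of x] by (auto simp: indicator_def c_def less_imp_le)
  qed
  moreover have "(\<integral>x. c * indicat_real {1..2::real} x \<partial>lborel) = c" by simp
  ultimately have "0 < (LINT x:{0<..}|lborel. x ^ i * Re (e (of_real x)))"
    using c by (simp add: set_lebesgue_integral_def)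
  then show ?thesis unfolding Suc moment_def kernel_moment_eq_integral by simp
qed

lemma E_sums: "(\<lambda>n. of_real (1 / moment n) * t ^ n) sums E t"
proof -
  have "(\<lambda>n. t ^ n / kernel_moment e (of_nat n)) sums E t" using pair by (simp add: kernel_pair_def)
  then show ?thesis unfolding of_real_moment[symmetric] by simp
qed

lemma E_cont: "continuous_on UNIV E"
  using pair holomorphic_on_imp_continuous_on by (auto simp: kernel_pair_def)

lemma real_sums: "(\<lambda>n. 1 / moment n * \<rho> ^ n) sums Re (E (of_real \<rho>))"
  using sums_Re[OF E_sums[of "of_real \<rho>"]] by (simp flip: of_real_power of_real_mult)

text \<open>The multiplier that turns the coefficients of \<open>f\<close> into the Borel transform of the formal
  series with coefficients \<open>moment j * f j\<close>.\<close>

lemma moment_Gamma_multiplier: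
  assumes kt: "kt > 0" and p: "K = real p * kt" and m: "\<And>n. m n = moment (p * n)"
    and c1: "c1 > 0" and m_ge: "\<And>n. c1 ^ n * fact n powr (1 / kt) \<le> m n" and \<psi>: "0 < \<psi>" "\<psi> < 2 * pi"
  shows "uniformly_continuable K \<psi> m (\<lambda>n i. of_real (moment (p * n + i) / Gamma (1 + real i / K)))"
proof (rule kernel_multiplier[where e = "\<lambda>n t. t ^ (p * n) * e t" and \<epsilon> = "\<lambda>j. 1 / Gamma (1 + real j / K)"
      and M = 2 and N = "2 powr K" and ?C0.0 = 1 and ?A0.0 = 1])
  have G: "Gamma (1 + real j / K) > 0" for j using K by (intro Gamma_real_pos) (simp add: add_pos_nonneg)
  show "0 \<le> 1 / Gamma (1 + real j / K)" for j using G[of j] by simp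
  show "K > 1 / 2" by (rule K)
  show "(\<lambda>t. t ^ (p * n) * e t) holomorphic_on sector 0 (pi / K)" for n by (intro holomorphic_intros e_hol)
  have m0: "0 \<le> m n" for n using moment_pos[of "p * n"] by (simp add: m)
  then show "0 \<le> m n" for n .
  show "norm (complex_of_real (moment (p * n + 0) / Gamma (1 + real 0 / K))) \<le> 1 * 1 ^ n * m n" for n
    using m0[of n] by (simp add: m)
  show "summable (\<lambda>j. 1 / Gamma (1 + real j / K) * \<rho> ^ j)" "(\<Sum>j. 1 / Gamma (1 + real j / K) * \<rho> ^ j) \<le> 2 * exp (2 powr K * \<rho> powr K)"
    if "0 \<le> \<rho>" for \<rho> using mittag_leffler_real[OF K(2) that] by blast+
  show "of_real (moment (p * n + Suc j) / Gamma (1 + real (Suc j) / K)) =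
    of_real (1 / Gamma (1 + real (Suc j) / K)) * (LINT x:{0<..}|lborel. of_real (x ^ j) * (of_real x ^ (p * n) * e (of_real x)))" for n j
  proof -
    have "(LINT x:{0<..}|lborel. of_real (x ^ j) * (of_real x ^ (p * n) * e (of_real x))) = kernel_moment e (of_nat (Suc (p * n + j)))"
      unfolding kernel_moment_Suc by (simp add: power_add mult_ac)
    also have "\<dots> = of_real (moment (p * n + Suc j))" by (simp only: of_real_moment add_Suc_right)
    finally show ?thesis by simp
  qed
  show "set_integrable lborel {1..} (\<lambda>\<rho>. norm (\<Sum>j. complex_of_real (1 / Gamma (1 + real j / K)) * (of_real \<rho> * cis \<gamma>) ^ j) / \<rho>)"
    if \<gamma>: "pi / (2 * K) < \<gamma>" "\<gamma> < 2 * pi - pi / (2 * K)" for \<gamma>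
  proof -
    obtain C where C: "\<And>\<rho>. 0 < \<rho> \<Longrightarrow> norm (mittag_leffler K (of_real \<rho> * cis \<gamma>)) \<le> C / \<rho>"
      using mittag_leffler_ray[OF K(1) \<gamma>] by metis
    have "set_integrable lborel {1..} (\<lambda>\<rho>. norm (mittag_leffler K (of_real \<rho> * cis \<gamma>)) / \<rho>)"
    proof (rule ray_integrable_if_inverse[of "\<lambda>_. 0" C])
      show "0 \<le> C" using order_trans[OF norm_ge_zero C[of 1]] by simp
      show "continuous_on UNIV (mittag_leffler K)"
        by (rule holomorphic_on_imp_continuous_on[OF entire_power_series[OF mittag_leffler_sums[OF K(2)]]])
      show "set_integrable lborel {0<..1} (\<lambda>x. norm (0::complex) / x)" by (simp add: set_integrable_def)
    qed (use C in auto)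
    then show ?thesis by (simp only: mittag_leffler_def)
  qed
  show "\<exists>L>0. \<exists>c\<ge>0. \<exists>A>0. \<forall>n t. t \<noteq> 0 \<and> 2 * K * \<bar>Arg t\<bar> \<le> pi - \<delta> \<longrightarrow>
      norm (t ^ (p * n) * e t) \<le> c * A ^ n * m n * exp (- ((norm t / L) powr K))" if \<delta>: "\<delta> > 0" for \<delta>
  proof -
    obtain c L where c: "c > 0" "L > 0" and le: "\<And>t. t \<noteq> 0 \<Longrightarrow> 2 * K * \<bar>Arg t\<bar> \<le> pi - \<delta> \<Longrightarrow> norm (e t) \<le> c * exp (- ((norm t / L) powr K))"
      using e_bound[OF \<delta>] by metis
    \<comment> \<open>Enlarging L by this factor halves the exponent; the half set free,
      \<open>exp (X / 2)\<close>, absorbs \<open>t ^ (p * n)\<close>.\<close>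
    define L' where "L' = 2 powr (1 / K) * L"
    define A where "A = L ^ p * (2 / kt) powr (1 / kt) / c1"
    have A: "A > 0" using c kt c1 by (simp add: A_def)
    have L': "L' > 0" using c by (simp add: L'_def)
    have main: "norm (t ^ (p * n) * e t) \<le> c * A ^ n * m n * exp (- ((norm t / L') powr K))"
      if t: "t \<noteq> 0" "2 * K * \<bar>Arg t\<bar> \<le> pi - \<delta>" for n t
    proof -
      define X where "X = (norm t / L) powr K"
      have X: "X > 0" using t c by (simp add: X_def)
      have half: "(norm t / L') powr K = X / 2"
      proof -
        have "norm t / L' = (norm t / L) / 2 powr (1 / K)" by (simp add: L'_def)
        then have "(norm t / L') powr K = X / (2 powr (1 / K)) powr K" unfolding X_def by (simp only: powr_divide)
        then show ?thesis using K by (simp add: powr_powr)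
      qed
      \<comment> \<open>Y is chosen with \<open>Y / kt = X / 2\<close>. Then
        \<open>Y ^ n \<le> fact n * exp Y\<close>, raised to the power \<open>1 / kt\<close>, leaves
        \<open>fact n powr (1 / kt)\<close>, which \<open>m_ge\<close> bounds by \<open>m n\<close>
        up to a geometric factor.\<close>
      define Y where "Y = kt / 2 * X"
      have Y: "Y > 0" using X kt by (simp add: Y_def)
      have tX: "norm t ^ (p * n) = (L ^ p) ^ n * X powr (real n / kt)"
      proof -
        have "X powr (real n / kt) = (norm t / L) powr (real (p * n))"
          unfolding X_def powr_powr using kt by (simp add: p)
        also have "\<dots> = (norm t / L) ^ (p * n)" using t c by (intro powr_realpow) auto
        finally show ?thesis using c by (simp add: power_divide power_mult)
      qed
      have "Y ^ n \<le> fact n * exp Y" using power_div_fact_le_exp[of Y n] Y by (simp add: field_simps)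
      then have "(Y ^ n) powr (1 / kt) \<le> (fact n * exp Y) powr (1 / kt)" using kt Y by (intro powr_mono2) auto
      also have "\<dots> = fact n powr (1 / kt) * exp (Y / kt)" by (subst powr_mult) (simp add: powr_def)
      also have "Y / kt = X / 2" using kt by (simp add: Y_def)
      finally have Yn: "Y powr (real n / kt) \<le> fact n powr (1 / kt) * exp (X / 2)"
        using Y by (simp add: powr_powr flip: powr_realpow)
      have "X = 2 / kt * Y" using kt by (simp add: Y_def)
      then have "X powr (real n / kt) = (2 / kt) powr (real n / kt) * Y powr (real n / kt)" by (simp only: powr_mult)
      also have "(2 / kt) powr (real n / kt) = ((2 / kt) powr (1 / kt)) ^ n" using kt by (simp add: powr_powr flip: powr_realpow)
      finally have "X powr (real n / kt) \<le> ((2 / kt) powr (1 / kt)) ^ n * (fact n powr (1 / kt) * exp (X / 2))"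
        using Yn by (simp add: mult_left_mono)
      then have "norm t ^ (p * n) \<le> (L ^ p) ^ n * (((2 / kt) powr (1 / kt)) ^ n * (fact n powr (1 / kt) * exp (X / 2)))"
        unfolding tX using c by (intro mult_left_mono) auto
      also have "\<dots> = A ^ n * (c1 ^ n * fact n powr (1 / kt)) * exp (X / 2)"
        using c1 by (simp add: A_def power_mult_distrib power_divide)
      also have "\<dots> \<le> A ^ n * m n * exp (X / 2)" using m_ge[of n] A by (intro mult_right_mono mult_left_mono) auto
      finally have tn: "norm t ^ (p * n) \<le> A ^ n * m n * exp (X / 2)" .
      have "norm (t ^ (p * n) * e t) \<le> (A ^ n * m n * exp (X / 2)) * (c * exp (- X))"
        unfolding norm_mult norm_power using tn le[OF t] A m0[of n] by (intro mult_mono) (auto simp: X_def)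
      also have "\<dots> = c * A ^ n * m n * (exp (X / 2) * exp (- X))" by simp
      also have "exp (X / 2) * exp (- X) = exp (- (X / 2))" by (simp flip: exp_add)
      finally show ?thesis unfolding half .
    qed
    show ?thesis
      by (rule exI[of _ L'], rule conjI[OF L'], rule exI[of _ c], rule conjI[OF less_imp_le[OF c(1)]],
          rule exI[of _ A], rule conjI[OF A]) (use main in blast)
  qed
qed (use \<psi> in auto)

text \<open>The inverse multiplier has to cancel \<open>m (l + j)\<close>, so the series of
  \<open>E\<close> is used from an index l on. Replacing \<rho> by \<open>max 1 \<rho>\<close>
  allows \<open>l\<close> further factors to be inserted; the omitted initial terms are
  nonnegative.\<close>

lemma shifted_real_series:
  assumes \<rho>: "0 \<le> \<rho>"
  shows "summable (\<lambda>j. 1 / moment (j + l) * \<rho> ^ j)"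
    and "(\<Sum>j. 1 / moment (j + l) * \<rho> ^ j) \<le> Re (E (of_real (max 1 \<rho>)))"
proof -
  define \<rho>1 where "\<rho>1 = max 1 \<rho>"
  have s1: "summable (\<lambda>j. 1 / moment (j + l) * \<rho>1 ^ (j + l))"
    using summable_ignore_initial_segment[OF sums_summable[OF real_sums[of \<rho>1]], of l] .
  have le: "1 / moment (j + l) * \<rho> ^ j \<le> 1 / moment (j + l) * \<rho>1 ^ (j + l)" for j
  proof (rule mult_left_mono)
    have "\<rho> ^ j \<le> \<rho>1 ^ j" using \<rho> by (intro power_mono) (auto simp: \<rho>1_def)
    also have "\<dots> \<le> \<rho>1 ^ (j + l)" by (intro power_increasing) (auto simp: \<rho>1_def)
    finally show "\<rho> ^ j \<le> \<rho>1 ^ (j + l)" .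
  qed (use moment_pos[of "j + l"] in simp)
  show s: "summable (\<lambda>j. 1 / moment (j + l) * \<rho> ^ j)"
    by (rule summable_comparison_test'[OF s1, of 0])
       (use le \<rho> moment_pos in \<open>auto simp: abs_of_nonneg less_imp_le\<close>)
  have "(\<Sum>j. 1 / moment (j + l) * \<rho> ^ j) \<le> (\<Sum>j. 1 / moment (j + l) * \<rho>1 ^ (j + l))" by (rule suminf_le[OF le s s1])
  also have "\<dots> = (\<Sum>j. 1 / moment j * \<rho>1 ^ j) - (\<Sum>j<l. 1 / moment j * \<rho>1 ^ j)"
    using suminf_minus_initial_segment[OF sums_summable[OF real_sums[of \<rho>1]], of l] .
  also have "\<dots> \<le> (\<Sum>j. 1 / moment j * \<rho>1 ^ j)"
    using moment_pos by (auto intro!: sum_nonneg simp: \<rho>1_def less_imp_le)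
  finally show "(\<Sum>j. 1 / moment (j + l) * \<rho> ^ j) \<le> Re (E (of_real (max 1 \<rho>)))"
    using real_sums[of \<rho>1] by (simp add: sums_iff \<rho>1_def)
qed

text \<open>Up to the factor \<open>t ^ l\<close> the shifted series is \<open>E\<close> minus a
  polynomial of degree below l. After division by \<open>t ^ l\<close> the polynomial contributes at
  most \<open>C / \<rho>\<close>, so integrability is inherited from \<open>E\<close>.\<close>

lemma shifted_ray_integrable:
  assumes \<gamma>: "pi / (2 * K) < \<gamma>" "\<gamma> < 2 * pi - pi / (2 * K)"
  shows "set_integrable lborel {1..} (\<lambda>\<rho>. norm (\<Sum>j. of_real (1 / moment (j + l)) * (of_real \<rho> * cis \<gamma>) ^ j) / \<rho>)"
proof -
  define G where "G = (\<lambda>t::complex. \<Sum>j. of_real (1 / moment (j + l)) * t ^ j)"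
  define C where "C = (\<Sum>i<l. 1 / moment i)"
  have C: "0 \<le> C" unfolding C_def using moment_pos by (intro sum_nonneg) (simp add: less_imp_le)
  have G_sums: "(\<lambda>j. of_real (1 / moment (j + l)) * t ^ j) sums G t" for t
  proof -
    have "summable (\<lambda>j. norm (complex_of_real (1 / moment (j + l)) * t ^ j))"
      using shifted_real_series(1)[of "norm t" l] moment_pos by (simp add: norm_mult norm_power norm_divide abs_of_pos)
    then show ?thesis unfolding G_def by (rule summable_sums[OF summable_norm_cancel])
  qed
  have "set_integrable lborel {1..} (\<lambda>\<rho>. norm (G (of_real \<rho> * cis \<gamma>)) / \<rho>)"
  proof (rule ray_integrable_if_inverse[OF E_cont C])
    show "continuous_on UNIV G" by (rule holomorphic_on_imp_continuous_on[OF entire_power_series[OF G_sums]])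
    \<comment> \<open>The integrability axiom evaluates \<open>E\<close> at reciprocals, whose
      argument is reversed; \<open>2 * pi - \<gamma>\<close> represents it within the permitted
      range about \<open>pi\<close>.\<close>
    have "\<bar>(2 * pi - \<gamma>) - pi\<bar> < pi - pi / (2 * K)" using \<gamma> unfolding abs_less_iff by auto
    also have "\<dots> = pi * (2 - 1 / K) / 2" by (simp add: field_simps)
    finally have "set_integrable lborel {0<..1} (\<lambda>x. norm (E (1 / (of_real x * cis (2 * pi - \<gamma>)))) / x)"
      using pair unfolding kernel_pair_def by auto
    moreover have "1 / (of_real x * cis (2 * pi - \<gamma>)) = cis \<gamma> / of_real x" for x
    proof -
      have "cis (2 * pi - \<gamma>) = cis (- \<gamma>)" by (simp add: complex_eq_iff)
      then show ?thesis by (simp add: cis_cnj divide_simps cis_mult)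
    qed
    ultimately show "set_integrable lborel {0<..1} (\<lambda>x. norm (E (cis \<gamma> / of_real x)) / x)" by simp
    fix \<rho> :: real assume \<rho>: "1 \<le> \<rho>"
    define t where "t = of_real \<rho> * cis \<gamma>"
    have nt: "norm t = \<rho>" using \<rho> by (simp add: t_def norm_mult)
    then have t0: "t \<noteq> 0" using \<rho> by auto
    have "(\<lambda>j. of_real (1 / moment (j + l)) * t ^ (j + l)) sums (E t - (\<Sum>i<l. of_real (1 / moment i) * t ^ i))"
      using sums_iff_shift[of "\<lambda>j. of_real (1 / moment j) * t ^ j" l] E_sums[of t] by simp
    moreover have "(\<lambda>j. of_real (1 / moment (j + l)) * t ^ (j + l)) sums (G t * t ^ l)"
      using sums_mult2[OF G_sums[of t], of "t ^ l"] by (simp add: power_add mult.assoc)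
    ultimately have eq: "G t * t ^ l = E t - (\<Sum>i<l. of_real (1 / moment i) * t ^ i)" by (rule sums_unique2[rotated])
    have "norm (G t) * \<rho> ^ l \<le> norm (E t) + norm (\<Sum>i<l. of_real (1 / moment i) * t ^ i)"
      using norm_triangle_ineq4[of "E t" "\<Sum>i<l. of_real (1 / moment i) * t ^ i"] arg_cong[OF eq, of norm]
      by (simp add: norm_mult norm_power nt)
    also have "norm (\<Sum>i<l. of_real (1 / moment i) * t ^ i) \<le> (\<Sum>i<l. 1 / moment i * (\<rho> ^ l / \<rho>))"
    proof (rule order_trans[OF norm_sum], rule sum_mono)
      fix i assume "i \<in> {..<l}"
      then have "Suc i \<le> l" by simp
      then have "\<rho> ^ Suc i \<le> \<rho> ^ l" using \<rho> by (intro power_increasing) auto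
      then have "\<rho> ^ i \<le> \<rho> ^ l / \<rho>" using \<rho> by (simp add: field_simps)
      then have "1 / moment i * \<rho> ^ i \<le> 1 / moment i * (\<rho> ^ l / \<rho>)" using moment_pos[of i] by (intro mult_left_mono) auto
      then show "norm (complex_of_real (1 / moment i) * t ^ i) \<le> 1 / moment i * (\<rho> ^ l / \<rho>)"
        using moment_pos[of i] by (simp add: norm_mult norm_power norm_divide nt)
    qed
    also have "\<dots> = C * (\<rho> ^ l / \<rho>)" by (simp only: C_def sum_distrib_right)
    also have "\<dots> = C / \<rho> * \<rho> ^ l" by simp
    also have "norm (E t) + C / \<rho> * \<rho> ^ l \<le> (norm (E t) + C / \<rho>) * \<rho> ^ l"
      using \<rho> mult_left_mono[of 1 "\<rho> ^ l" "norm (E t)"] by (simp add: distrib_right)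
    finally have "norm (G t) * \<rho> ^ l \<le> (norm (E t) + C / \<rho>) * \<rho> ^ l" by simp
    then show "norm (G (of_real \<rho> * cis \<gamma>)) \<le> norm (E (of_real \<rho> * cis \<gamma>)) + C / \<rho>"
      using \<rho> by (simp add: t_def[symmetric])
  qed
  then show ?thesis by (simp only: G_def)
qed

text \<open>The inverse multiplier: here \<open>K t powr K exp (- t powr K)\<close> is the kernel whose moments are
  \<open>Gamma (1 + j / K)\<close>.\<close>

lemma Gamma_moment_multiplier:
  assumes \<psi>: "0 < \<psi>" "\<psi> < 2 * pi"
  shows "uniformly_continuable K \<psi> (\<lambda>_. 1) (\<lambda>_ i. of_real (Gamma (1 + real i / K) / moment (i + l)))"
proof -
  obtain M N where MN: "M > 0" "N > 0" "\<And>t. norm (E t) \<le> M * exp (N * norm t powr K)"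
  proof -
    have "\<exists>M>0. \<exists>N>0. \<forall>t. norm (E t) \<le> M * exp (N * norm t powr K)"
      using pair unfolding kernel_pair_def by (elim conjE)
    then show thesis using that by blast
  qed
  define eG where "eG = (\<lambda>t::complex. of_real K * (t powr of_real K * exp (- (t powr of_real K))))"
  show ?thesis
  proof (rule kernel_multiplier[where e = "\<lambda>_. eG" and \<epsilon> = "\<lambda>j. 1 / moment (j + l)"
      and M = "M * exp N" and N = N and ?C0.0 = "1 / moment l" and ?A0.0 = 1])
    show "K > 1 / 2" by (rule K)
    show "0 \<le> 1 / moment (j + l)" for j using moment_pos[of "j + l"] by simp
    show "summable (\<lambda>j. 1 / moment (j + l) * \<rho> ^ j)" if "0 \<le> \<rho>" for \<rho> by (rule shifted_real_series(1)[OF that])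
    show "(\<Sum>j. 1 / moment (j + l) * \<rho> ^ j) \<le> M * exp N * exp (N * \<rho> powr K)" if \<rho>: "0 \<le> \<rho>" for \<rho>
    proof -
      have "(\<Sum>j. 1 / moment (j + l) * \<rho> ^ j) \<le> Re (E (of_real (max 1 \<rho>)))" by (rule shifted_real_series(2)[OF \<rho>])
      also have "\<dots> \<le> norm (E (of_real (max 1 \<rho>)))" by (rule complex_Re_le_cmod)
      also have "\<dots> \<le> M * exp (N * (max 1 \<rho>) powr K)" using MN(3)[of "of_real (max 1 \<rho>)"] by simp
      also have "\<dots> \<le> M * exp (N + N * \<rho> powr K)"
      proof -
        have "(max 1 \<rho>) powr K \<le> 1 + \<rho> powr K" by (auto simp: max_def)
        then have "N * (max 1 \<rho>) powr K \<le> N * (1 + \<rho> powr K)" using MN by (intro mult_left_mono) auto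
        then show ?thesis using MN by (intro mult_left_mono) (auto simp: distrib_left)
      qed
      finally show ?thesis by (simp add: exp_add mult.assoc)
    qed
    show "set_integrable lborel {1..} (\<lambda>\<rho>. norm (\<Sum>j. complex_of_real (1 / moment (j + l)) * (of_real \<rho> * cis \<gamma>) ^ j) / \<rho>)"
      if "pi / (2 * K) < \<gamma>" "\<gamma> < 2 * pi - pi / (2 * K)" for \<gamma> by (rule shifted_ray_integrable[OF that])
    show "norm (complex_of_real (Gamma (1 + real 0 / K) / moment (0 + l))) \<le> 1 / moment l * 1 ^ n * 1" for n :: nat
      using moment_pos[of l] by (simp add: norm_divide)
    show "eG holomorphic_on sector 0 (pi / K)"
    proof -
      have "t \<notin> \<real>\<^sub>\<le>\<^sub>0" if t: "t \<in> sector 0 (pi / K)" for t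
      proof -
        obtain \<rho> \<phi> where *: "t = of_real \<rho> * cis \<phi>" "0 < \<rho>" "\<bar>\<phi> - 0\<bar> < pi / K / 2" using t by (rule sectorE)
        have "pi / K / 2 < pi" using K by (simp add: field_simps)
        then have "- pi < \<phi>" "\<phi> < pi" using *(3) by auto
        then have "Arg t \<noteq> pi" using * by (simp add: Arg_times_of_real Arg_cis)
        moreover have "t \<noteq> 0" using *(1,2) by simp
        ultimately show ?thesis by (auto simp: Arg_eq_pi complex_nonpos_Reals_iff complex_eq_iff)
      qed
      then show ?thesis unfolding eG_def by (intro holomorphic_intros) auto
    qed
    show "of_real (Gamma (1 + real (Suc j) / K) / moment (Suc j + l)) =
      of_real (1 / moment (Suc j + l)) * (LINT x:{0<..}|lborel. of_real (x ^ j) * eG (of_real x))" for j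
    proof -
      have "(LINT x:{0<..}|lborel. of_real (x ^ j) * eG (of_real x)) =
          (LINT x:{0<..}|lborel. of_real (K * (x powr (real j + K) * exp (- (1 * x powr K)))))"
      proof (intro set_lebesgue_integral_cong allI impI)
        fix x :: real assume "x \<in> {0<..}"
        then have x: "x > 0" by simp
        then have "complex_of_real x powr of_real K = of_real (x powr K)" by (intro powr_of_real) auto
        then show "of_real (x ^ j) * eG (of_real x) = of_real (K * (x powr (real j + K) * exp (- (1 * x powr K))))"
          using x by (simp add: eG_def powr_add powr_realpow exp_of_real[symmetric])
      qed simp
      also have "\<dots> = of_real (K * (LINT x:{0<..}|lborel. x powr (real j + K) * exp (- (1 * x powr K))))"
        by (simp only: set_integral_complex_of_real set_integral_mult_right)
      also have "(LINT x:{0<..}|lborel. x powr (real j + K) * exp (- (1 * x powr K))) = Gamma ((real j + K + 1) / K) / K"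
        using powr_exp_integral(2)[of K "real j + K" 1] K by simp
      also have "(real j + K + 1) / K = 1 + real (Suc j) / K" using K by (simp add: field_simps)
      finally show ?thesis using K by simp
    qed
    show "\<exists>L>0. \<exists>c\<ge>0. \<exists>A>0. \<forall>(n::nat) t. t \<noteq> 0 \<and> 2 * K * \<bar>Arg t\<bar> \<le> pi - \<delta> \<longrightarrow>
        norm (eG t) \<le> c * A ^ n * 1 * exp (- ((norm t / L) powr K))" if \<delta>: "\<delta> > 0" for \<delta>
    proof -
      \<comment> \<open>A lower bound for \<open>cos (K * Arg t)\<close> on the permitted sector.
        The minimum with \<open>pi\<close> keeps it positive for large \<delta>, where no t is
        left.\<close>
      define \<kappa> where "\<kappa> = sin (min \<delta> pi / 2)"
      have "0 < min \<delta> pi / 2" "min \<delta> pi / 2 < pi" using \<delta> pi_gt_zero by (auto simp: min_def)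
      then have \<kappa>: "\<kappa> > 0" unfolding \<kappa>_def by (rule sin_gt_zero)
      \<comment> \<open>Half of the rate \<kappa> absorbs the factor \<open>t powr K\<close> of the
        kernel; the other half is exactly \<open>(norm t / L) powr K\<close>.\<close>
      define L where "L = (2 / \<kappa>) powr (1 / K)"
      have L: "L > 0" using \<kappa> by (simp add: L_def)
      have main: "norm (eG t) \<le> 2 * K / \<kappa> * exp (- ((norm t / L) powr K))" if t: "t \<noteq> 0" "2 * K * \<bar>Arg t\<bar> \<le> pi - \<delta>" for t
      proof -
        define X where "X = norm t powr K"
        have X: "X > 0" using t by (simp add: X_def)
        have "t = of_real (norm t) * cis (Arg t)" using t by (simp add: cis_Arg sgn_div_norm scaleR_conv_of_real)
        then have tK: "t powr of_real K = of_real X * cis (K * Arg t)"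
          using powr_polar[of "norm t" "Arg t" K] t Arg_bounded[of t] by (simp add: X_def)
        have "K * \<bar>Arg t\<bar> \<le> pi / 2 - min \<delta> pi / 2"
        proof -
          have "0 \<le> 2 * K * \<bar>Arg t\<bar>" using K by simp
          then have "\<delta> \<le> pi" using t(2) by linarith
          then show ?thesis using t(2) by (simp add: min_def)
        qed
        moreover have "0 \<le> K * \<bar>Arg t\<bar>" using K by simp
        moreover have "pi / 2 - min \<delta> pi / 2 \<le> pi" using \<open>0 < min \<delta> pi / 2\<close> pi_gt_zero by linarith
        ultimately have "cos (pi / 2 - min \<delta> pi / 2) \<le> cos (K * \<bar>Arg t\<bar>)" by (intro cos_monotone_0_pi_le)
        then have "\<kappa> \<le> cos (K * Arg t)"
          by (simp add: \<kappa>_def cos_diff abs_if split: if_splits)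
        then have "\<kappa> * X \<le> Re (t powr of_real K)" using X by (simp add: tK mult.commute)
        then have "norm (exp (- (t powr of_real K))) \<le> exp (- (\<kappa> * X))" by simp
        then have 1: "norm (eG t) \<le> K * (X * exp (- (\<kappa> * X)))"
          unfolding eG_def norm_mult using K X by (intro mult_mono) (auto simp: tK norm_mult)
        have "\<kappa> / 2 * X \<le> exp (\<kappa> / 2 * X)" using exp_ge_add_one_self[of "\<kappa> / 2 * X"] by linarith
        then have "X \<le> 2 / \<kappa> * exp (\<kappa> / 2 * X)" using \<kappa> by (simp add: field_simps)
        then have "X * exp (- (\<kappa> * X)) \<le> (2 / \<kappa> * exp (\<kappa> / 2 * X)) * exp (- (\<kappa> * X))" by (intro mult_right_mono) auto
        also have "\<dots> = 2 / \<kappa> * exp (\<kappa> / 2 * X - \<kappa> * X)" by (simp only: mult.assoc exp_add[symmetric] diff_conv_add_uminus)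
        also have "\<kappa> / 2 * X - \<kappa> * X = - ((norm t / L) powr K)"
        proof -
          have "(norm t / L) powr K = X / L powr K" unfolding X_def using L by (simp add: powr_divide)
          also have "L powr K = 2 / \<kappa>" using K \<kappa> by (simp add: L_def powr_powr)
          finally show ?thesis by (simp add: field_simps)
        qed
        finally have "K * (X * exp (- (\<kappa> * X))) \<le> K * (2 / \<kappa> * exp (- ((norm t / L) powr K)))" using K by (intro mult_left_mono) auto
        from order_trans[OF 1 this] show ?thesis by (simp add: mult_ac)
      qed
      have pos: "0 \<le> 2 * K / \<kappa>" using K \<kappa> by simp
      show ?thesis
        by (rule exI[of _ L], rule conjI[OF L], rule exI[of _ "2 * K / \<kappa>"], rule conjI[OF pos],
            rule exI[of _ 1], rule conjI[OF zero_less_one]) (use main in simp)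
    qed
  qed (use \<psi> MN moment_pos[of l] in auto)
qed

end

text \<open>Serves constant polynomials, for which no root constrains f and the solution has only
  its term of order 0.\<close>

lemma uniformly_continuable_at_0:
  assumes "\<And>n. norm (c n) \<le> C * A ^ n" "C \<ge> 0" "A > 0"
  shows "uniformly_continuable K \<theta> (\<lambda>_. 1) (\<lambda>n j. if j = 0 then c n else 0)"
proof (rule uniformly_continuableI[of 1 1 C A 0])
  fix n
  have "(\<lambda>j. (if j = 0 then c n else 0) * t ^ j) sums c n" for t
    using sums_single[of 0 "\<lambda>j. c n * t ^ j"] by (simp add: if_distrib[of "\<lambda>x. x * _"] cong: if_cong)
  then show "\<exists>g. sector_extension K \<theta> 1 1 (C * A ^ n * 1) 0 (\<lambda>j. if j = 0 then c n else 0) g"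
    using assms(1)[of n] unfolding sector_extension_def by (intro exI[of _ "\<lambda>_. c n"]) auto
qed (use assms in auto)

section \<open>Moment sequences of arbitrary positive order\<close>

lemma inverse_polar:
  assumes "a \<noteq> 0"
  shows "of_real (1 / norm a) * cis (- Arg a) = 1 / a"
  using rcis_inverse[of "norm a" "Arg a"] unfolding rcis_cmod_Arg by (simp add: rcis_def inverse_eq_divide)

text \<open>Covers both cases of \<open>kernel_functions\<close>: K is the order of the auxiliary
  kernel, kt that of the moment sequence, and \<open>p = 1\<close> for kt beyond 1/2. Regularity is
  recorded as \<open>m_ge\<close>, the product of the lower bounds for successive quotients.\<close>

locale regular_moments = kernel_moments K e E for K :: real and e E :: "complex \<Rightarrow> complex" +
  fixes kt :: real and p :: nat and m :: "nat \<Rightarrow> real" and c1 :: real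
  assumes kt: "kt > 0" and K_eq: "K = real p * kt" and m: "\<And>n. m n = moment (p * n)"
    and c1: "c1 > 0" and m_ge: "\<And>n. c1 ^ n * fact n powr (1 / kt) \<le> m n"
begin

lemma p: "p \<ge> 1" using K(1) K_eq by (cases p) auto

lemma m_pos: "0 < m n" using moment_pos by (simp add: m)

lemma Gamma_pos: "0 < Gamma (1 + real j / kt)"
  using kt by (intro Gamma_real_pos) (simp add: add_pos_nonneg)

text \<open>The variable \<open>t ^ p\<close> raises the order from kt to K, beyond 1/2, where the
  multiplier theorem applies.\<close>

lemma uniformly_continuable_ramified:
  assumes "uniformly_continuable kt \<theta> (\<lambda>_. 1) (\<lambda>_. fc)"
  shows "uniformly_continuable K (\<theta> / real p) (\<lambda>_. 1) (\<lambda>_ i. if p dvd i then fc (i div p) else 0)"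
proof -
  have "\<theta> = real p * (\<theta> / real p) + 0" using p by simp
  from uniformly_continuable_power[OF kt p zero_less_one this assms]
  show ?thesis by (simp add: K_eq cong: if_cong)
qed

lemma ramified_index: "p * j div p = j" "real (p * j) / K = real j / kt"
  using p kt by (auto simp: K_eq)

text \<open>In the ramified variable the coefficients of f sit at multiples of p, and the Hadamard
  product inserts the moments there. The root returns to order kt, and division by
  \<open>m n\<close> turns the weight m into 1.\<close>

lemma uniformly_continuable_moment_shifts:
  assumes "uniformly_continuable kt \<theta> (\<lambda>_. 1) (\<lambda>_. fc)"
  shows "uniformly_continuable kt \<theta> (\<lambda>_. 1)
    (\<lambda>n j. of_real (m (n + j)) / of_real (m n) * fc (n + j) / of_real (Gamma (1 + real j / kt)))"
proof -
  define ft where "ft = (\<lambda>i. if p dvd i then fc (i div p) else 0)"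
  have m0: "0 \<le> m n" for n using m_pos[of n] by simp
  have "uniformly_continuable K (\<theta> / real p) (\<lambda>_. 1) (\<lambda>_. ft)"
    unfolding ft_def by (rule uniformly_continuable_ramified[OF assms])
  then have "uniformly_continuable K (\<theta> / real p) m (\<lambda>n i. ft (p * n + i) * of_real (moment (p * n + i) / Gamma (1 + real i / K)))"
    by (rule uniformly_continuable_hadamard[OF K(2) _ moment_Gamma_multiplier[OF kt K_eq m c1 m_ge] m0])
  then have 1: "uniformly_continuable (real p * kt) (\<theta> / real p) m (\<lambda>n i. ft (p * n + i) * of_real (moment (p * n + i) / Gamma (1 + real i / K)))"
    unfolding K_eq .
  have "uniformly_continuable kt (real p * (\<theta> / real p)) m
      (\<lambda>n j. ft (p * n + p * j) * of_real (moment (p * n + p * j) / Gamma (1 + real (p * j) / K)))"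
    by (rule uniformly_continuable_root[OF kt p 1 _ m0]) (simp add: ft_def dvd_add_right_iff)
  moreover have "ft (p * n + p * j) * of_real (moment (p * n + p * j) / Gamma (1 + real (p * j) / K)) =
      fc (n + j) * of_real (m (n + j) / Gamma (1 + real j / kt))" for n j
    unfolding distrib_left[symmetric] ramified_index(2) m ft_def using ramified_index(1)[of "n + j"] by simp
  moreover have "real p * (\<theta> / real p) = \<theta>" using p by simp
  ultimately have "uniformly_continuable kt \<theta> m (\<lambda>n j. fc (n + j) * of_real (m (n + j) / Gamma (1 + real j / kt)))"
    by (simp only:)
  from uniformly_continuable_reweight[OF this m0 m_pos]
  have "uniformly_continuable kt \<theta> (\<lambda>n. m n / m n) (\<lambda>n j. fc (n + j) * of_real (m (n + j) / Gamma (1 + real j / kt)) / of_real (m n))" .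
  moreover have "m n / m n = 1" for n using m_pos[of n] by simp
  moreover have "fc (n + j) * of_real (m (n + j) / Gamma (1 + real j / kt)) / of_real (m n) =
      of_real (m (n + j)) / of_real (m n) * fc (n + j) / of_real (Gamma (1 + real j / kt))" for n j
    by (simp add: mult.commute)
  ultimately show ?thesis by (simp only:)
qed

text \<open>The inverse multiplier, shifted by \<open>p * l\<close> to match
  \<open>m (l + j)\<close>, removes moments and Gamma values; the sequence b is carried along
  unchanged.\<close>

lemma uniformly_continuable_cancel_moments:
  assumes "uniformly_continuable kt \<theta> (\<lambda>_. 1)
    (\<lambda>_ j. b j * (of_real (m (l + j)) / of_real (m l)) * fc (l + j) / of_real (Gamma (1 + real j / kt)))"
  shows "uniformly_continuable kt \<theta> (\<lambda>_. 1) (\<lambda>_ j. b j * fc (l + j))"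
proof -
  define c where "c = (\<lambda>j. b j * (of_real (m (l + j)) / of_real (m l)) * fc (l + j) / of_real (Gamma (1 + real j / kt)))"
  define ct where "ct = (\<lambda>i. if p dvd i then c (i div p) else 0)"
  have "uniformly_continuable K (\<theta> / real p) (\<lambda>_. 1) (\<lambda>_. ct)"
    unfolding ct_def by (rule uniformly_continuable_ramified) (use assms in \<open>simp only: c_def\<close>)
  from uniformly_continuable_hadamard[OF K(2) this Gamma_moment_multiplier[of _ "p * l"], of 0]
  have 1: "uniformly_continuable (real p * kt) (\<theta> / real p) (\<lambda>_. 1) (\<lambda>_ i. ct i * of_real (Gamma (1 + real i / K) / moment (i + p * l)))"
    unfolding K_eq by simp
  have "uniformly_continuable kt (real p * (\<theta> / real p)) (\<lambda>_. 1)
      (\<lambda>_ j. ct (p * j) * of_real (Gamma (1 + real (p * j) / K) / moment (p * j + p * l)))"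
    by (rule uniformly_continuable_root[OF kt p 1]) (simp_all add: ct_def)
  moreover have "ct (p * j) * of_real (Gamma (1 + real (p * j) / K) / moment (p * j + p * l)) = b j * fc (l + j) / of_real (m l)" for j
  proof -
    have "moment (p * j + p * l) = m (l + j)" by (simp add: m distrib_left add.commute)
    moreover have "ct (p * j) = c j" using ramified_index(1)[of j] by (simp add: ct_def)
    ultimately show ?thesis
      unfolding ramified_index(2) c_def using m_pos[of "l + j"] Gamma_pos[of j] by simp
  qed
  moreover have "real p * (\<theta> / real p) = \<theta>" using p by simp
  ultimately have "uniformly_continuable kt \<theta> (\<lambda>_. 1) (\<lambda>_ j. b j * fc (l + j) / of_real (m l))"
    by (simp only:)
  from uniformly_continuable_cmult[OF this, of "of_real (m l)"]
  show ?thesis using m_pos[of l] by simp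
qed

text \<open>For F the inverse series of \<open>P\<close> these are the coefficients of the Borel
  transform of the solution. A general F makes the expression linear in F, as partial fractions
  require.\<close>

definition borel_coeff :: "nat \<Rightarrow> complex fps \<Rightarrow> (nat \<Rightarrow> complex) \<Rightarrow> nat \<Rightarrow> nat \<Rightarrow> complex" where
  "borel_coeff k F fc n i =
     (if k dvd i then fps_nth F (i div k) * (of_real (m (n + i div k)) / of_real (m n)) * fc (n + i div k) /
        of_real (Gamma (1 + real (i div k) / kt)) else 0)"

text \<open>The binomial weight for \<open>Suc s\<close> is that for s times
  \<open>1 + j / (s + 1)\<close>, hence obtained by an Euler operator. The powers of
  \<open>1 / a\<close> are a scaling with a rotation by \<open>- Arg a\<close>, performed together
  with the substitution of the k-th power.\<close>

lemma uniformly_continuable_borel_coeff_pole: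
  assumes k: "k \<ge> 1" and a: "a \<noteq> 0" and f: "uniformly_continuable kt (real k * d - Arg a) (\<lambda>_. 1) (\<lambda>_. fc)"
  shows "uniformly_continuable (real k * kt) d (\<lambda>_. 1) (borel_coeff k (inverse ((1 - fps_const (1 / a) * fps_X) ^ Suc s)) fc)"
proof -
  define u where "u = (\<lambda>n j. of_real (m (n + j)) / of_real (m n) * fc (n + j) / of_real (Gamma (1 + real j / kt)))"
  have u: "uniformly_continuable kt (real k * d - Arg a) (\<lambda>_. 1) u"
    unfolding u_def by (rule uniformly_continuable_moment_shifts[OF f])
  have "uniformly_continuable kt (real k * d - Arg a) (\<lambda>_. 1) (\<lambda>n j. of_nat (s + j choose s) * u n j)"
  proof (induction s)
    case 0
    then show ?case using u by simp
  next
    case (Suc s)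
    have "uniformly_continuable kt (real k * d - Arg a) (\<lambda>_. 1)
        (\<lambda>n j. of_nat (s + j choose s) * u n j + 1 / of_nat (Suc s) * (of_nat j * (of_nat (s + j choose s) * u n j)))"
      by (intro uniformly_continuable_add uniformly_continuable_cmult uniformly_continuable_times_index kt Suc.IH zero_le_one)
    moreover have "of_nat (s + j choose s) * u n j + 1 / of_nat (Suc s) * (of_nat j * (of_nat (s + j choose s) * u n j)) =
        of_nat (Suc s + j choose Suc s) * u n j" for n j
    proof -
      have "complex_of_nat (Suc s) * of_nat (Suc s + j choose Suc s) = of_nat (Suc s + j) * of_nat (s + j choose s)"
        using Suc_times_binomial[of s "s + j"] by (simp only: of_nat_mult[symmetric] add_Suc)
      moreover have "complex_of_nat (Suc s) \<noteq> 0" by (simp only: of_nat_eq_0_iff)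
      ultimately have "complex_of_nat (Suc s + j choose Suc s) = of_nat (Suc s + j) * of_nat (s + j choose s) / of_nat (Suc s)"
        by (metis nonzero_mult_div_cancel_left)
      moreover have "v * w + 1 / z * (y * (v * w)) = (z + y) * v / z * w" if "z \<noteq> 0" for v w y z :: complex
        using that by (simp add: field_simps)
      ultimately show ?thesis using \<open>complex_of_nat (Suc s) \<noteq> 0\<close> by (simp only: of_nat_add)
    qed
    ultimately show ?case by (simp only:)
  qed
  note v = this
  have "0 < 1 / norm a" "real k * d - Arg a = real k * d + - Arg a" using a by auto
  from uniformly_continuable_power[OF kt k this v zero_le_one]
  have 1: "uniformly_continuable (real k * kt) d (\<lambda>_. 1)
     (\<lambda>n i. if k dvd i then of_nat (s + i div k choose s) * u n (i div k) * (of_real (1 / norm a) * cis (- Arg a)) ^ (i div k) else 0)" .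
  have "inverse ((1 - fps_const (1 / a) * fps_X) ^ Suc s) = Abs_fps (\<lambda>j. of_nat (s + j choose s) * (1 / a) ^ j)"
    by (subst one_minus_const_fps_X_neg_power') (auto simp: binomial_symmetric[of s] fps_eq_iff)
  then have eq: "borel_coeff k (inverse ((1 - fps_const (1 / a) * fps_X) ^ Suc s)) fc n i =
      (if k dvd i then of_nat (s + i div k choose s) * u n (i div k) * (of_real (1 / norm a) * cis (- Arg a)) ^ (i div k) else 0)" for n i
    unfolding inverse_polar[OF a] by (simp add: borel_coeff_def u_def)
  have "borel_coeff k (inverse ((1 - fps_const (1 / a) * fps_X) ^ Suc s)) fc = (\<lambda>n i. if k dvd i then
      of_nat (s + i div k choose s) * u n (i div k) * (of_real (1 / norm a) * cis (- Arg a)) ^ (i div k) else 0)"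
    by (intro ext eq)
  with 1 show ?thesis by (simp only:)
qed

text \<open>By partial fractions the single poles suffice. The fraction \<open>1 / P\<close> is
  proper only for positive degree, so constant \<open>P\<close> is treated apart.\<close>

lemma uniformly_continuable_borel_coeff:
  assumes k: "k \<ge> 1" and P: "poly P 0 \<noteq> 0"
    and f: "\<And>a. poly P a = 0 \<Longrightarrow> uniformly_continuable kt (real k * d - Arg a) (\<lambda>_. 1) (\<lambda>_. fc)"
    and fc: "\<And>n. norm (fc n) \<le> C * A ^ n" "C \<ge> 0" "A > 0"
  shows "uniformly_continuable (real k * kt) d (\<lambda>_. 1) (borel_coeff k (inverse (fps_of_poly P)) fc)"
proof (cases "degree P = 0")
  case True
  then obtain c where c: "P = [:c:]" by (rule degree_eq_zeroE)
  then have c0: "c \<noteq> 0" using P by simp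
  have "inverse (fps_of_poly P) = fps_const (inverse c)" by (simp add: c fps_of_poly_const fps_const_inverse)
  then have "borel_coeff k (inverse (fps_of_poly P)) fc n i = (if i = 0 then inverse c * fc n else 0)" for n i
    using m_pos[of n] k by (auto simp: borel_coeff_def elim!: dvdE)
  then have "borel_coeff k (inverse (fps_of_poly P)) fc = (\<lambda>n i. if i = 0 then inverse c * fc n else 0)" by (intro ext)
  moreover have "uniformly_continuable (real k * kt) d (\<lambda>_. 1) (\<lambda>n i. if i = 0 then inverse c * fc n else 0)"
  proof (rule uniformly_continuable_at_0)
    show "norm (inverse c * fc n) \<le> norm (inverse c) * C * A ^ n" for n
      unfolding norm_mult mult.assoc by (intro mult_left_mono fc norm_ge_zero)
  qed (use fc in auto)
  ultimately show ?thesis by (simp only:)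
next
  case False
  define good where "good = (\<lambda>F. uniformly_continuable (real k * kt) d (\<lambda>_. 1) (borel_coeff k F fc))"
  have "good (fps_of_poly 1 * inverse (fps_of_poly P))"
  proof (rule proper_rational_induct[where A = "{a. poly P a = 0}"])
    fix F G assume "good F" "good G"
    then have "uniformly_continuable (real k * kt) d (\<lambda>_. 1) (\<lambda>n i. borel_coeff k F fc n i + borel_coeff k G fc n i)"
      unfolding good_def by (rule uniformly_continuable_add) simp
    moreover have "borel_coeff k (F + G) fc = (\<lambda>n i. borel_coeff k F fc n i + borel_coeff k G fc n i)"
      by (intro ext) (simp add: borel_coeff_def distrib_right add_divide_distrib)
    ultimately show "good (F + G)" unfolding good_def by (simp only:)
  next
    fix c F assume "good F"
    then have "uniformly_continuable (real k * kt) d (\<lambda>_. 1) (\<lambda>n i. c * borel_coeff k F fc n i)"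
      unfolding good_def by (rule uniformly_continuable_cmult) simp
    moreover have "borel_coeff k (fps_const c * F) fc = (\<lambda>n i. c * borel_coeff k F fc n i)"
      by (intro ext) (simp add: borel_coeff_def mult.assoc)
    ultimately show "good (fps_const c * F)" unfolding good_def by (simp only:)
  next
    fix a s assume "a \<in> {a. poly P a = 0}"
    then show "good (inverse ((1 - fps_const (1 / a) * fps_X) ^ Suc s))"
      unfolding good_def using f P by (intro uniformly_continuable_borel_coeff_pole k) auto
  qed (use P False in auto)
  then show ?thesis by (simp add: good_def)
qed

text \<open>First the moments are cancelled, separately for each coefficient of
  \<open>z ^ l\<close>. Then the cofactor Q of the root a, normalised by
  \<open>P = (1 - \<zeta> / a) * Q\<close>, cancels all of \<open>1 / P\<close> except the geometric
  series of \<open>1 / a\<close>.\<close>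

lemma uniformly_continuable_if_borel_coeff:
  assumes k: "k \<ge> 1" and P: "poly P 0 \<noteq> 0" "poly P a = 0"
    and sm: "\<And>l. uniformly_continuable (real k * kt) d (\<lambda>_. 1) (\<lambda>_. borel_coeff k (inverse (fps_of_poly P)) fc l)"
  shows "uniformly_continuable kt (real k * d - Arg a) (\<lambda>_. 1) (\<lambda>_. fc)"
proof -
  define b where "b = fps_nth (inverse (fps_of_poly P))"
  have a: "a \<noteq> 0" using P by auto
  have b: "uniformly_continuable kt (real k * d) (\<lambda>_. 1) (\<lambda>_ j. b j * fc (l + j))" for l
  proof (rule uniformly_continuable_cancel_moments)
    have "uniformly_continuable kt (real k * d) (\<lambda>_. 1) (\<lambda>_ j. borel_coeff k (inverse (fps_of_poly P)) fc l (k * j))"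
      by (rule uniformly_continuable_root[OF kt k sm]) (simp_all add: borel_coeff_def)
    then show "uniformly_continuable kt (real k * d) (\<lambda>_. 1)
        (\<lambda>_ j. b j * (of_real (m (l + j)) / of_real (m l)) * fc (l + j) / of_real (Gamma (1 + real j / kt)))"
      using k by (simp add: borel_coeff_def b_def)
  qed
  obtain Q0 where Q0: "P = [:- a, 1:] * Q0" using P(2) by (auto simp: poly_eq_0_iff_dvd)
  define Q where "Q = smult (- a) Q0"
  have "[:- a, 1:] = smult (- a) [:1, - (1 / a):]" using a by simp
  then have PQ: "P = [:1, - (1 / a):] * Q" unfolding Q0 Q_def by (simp only: mult_smult_left mult_smult_right)
  have Q: "coeff Q 0 \<noteq> 0" using P(1) by (simp add: PQ poly_0_coeff_0)
  have "fps_of_poly Q * inverse (fps_of_poly P) = inverse (fps_of_poly [:1, - (1 / a):]) * (fps_of_poly Q * inverse (fps_of_poly Q))"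
    unfolding PQ fps_of_poly_mult fps_inverse_mult by (simp only: mult_ac)
  also have "fps_of_poly Q * inverse (fps_of_poly Q) = 1" using Q by (intro inverse_mult_eq_1') simp
  also have "fps_of_poly [:1, - (1 / a):] = (1 - fps_const (1 / a) * fps_X) ^ 1"
    by (simp add: fps_of_poly_pCons fps_eq_iff fps_mult_fps_X_commute)
  also have "inverse ((1 - fps_const (1 / a) * fps_X) ^ 1) = Abs_fps (\<lambda>j. (1 / a) ^ j)"
    by (subst one_minus_const_fps_X_neg_power') simp_all
  finally have QP: "fps_of_poly Q * inverse (fps_of_poly P) = Abs_fps (\<lambda>j. (1 / a) ^ j)" by simp
  \<comment> \<open>The coefficient of \<open>z ^ l\<close> raises the index of \<open>fc\<close> by
    l and the shift lowers it again, so \<open>fc j\<close> factors out and what remains is the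
    convolution of Q with b.\<close>
  have "uniformly_continuable kt (real k * d) (\<lambda>_. 1)
      (\<lambda>_ j. \<Sum>l\<in>{..degree Q}. coeff Q l * (if l \<le> j then b (j - l) * fc (l + (j - l)) else 0))"
    by (intro uniformly_continuable_sum uniformly_continuable_cmult uniformly_continuable_shift kt b) auto
  moreover have "(\<Sum>l\<in>{..degree Q}. coeff Q l * (if l \<le> j then b (j - l) * fc (l + (j - l)) else 0)) = (1 / a) ^ j * fc j" for j
  proof -
    have "(\<Sum>l\<in>{..degree Q}. coeff Q l * (if l \<le> j then b (j - l) * fc (l + (j - l)) else 0)) =
        (\<Sum>l\<in>{..degree Q}. if l \<in> {..j} then coeff Q l * b (j - l) * fc j else 0)"
      by (intro sum.cong) auto
    also have "\<dots> = (\<Sum>l\<in>{..degree Q} \<inter> {..j}. coeff Q l * b (j - l) * fc j)"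
      by (rule sum.inter_restrict[symmetric]) simp
    also have "\<dots> = (\<Sum>l\<le>j. coeff Q l * b (j - l) * fc j)"
      by (intro sum.mono_neutral_left) (auto simp: coeff_eq_0)
    also have "\<dots> = fps_nth (fps_of_poly Q * inverse (fps_of_poly P)) j * fc j"
      by (simp add: fps_mult_nth b_def sum_distrib_right atLeast0AtMost)
    finally show ?thesis by (simp add: QP)
  qed
  ultimately have 1: "uniformly_continuable kt (real k * d) (\<lambda>_. 1) (\<lambda>_ j. (1 / a) ^ j * fc j)" by (simp only:)
  \<comment> \<open>The substitution with exponent 1 and factor a removes \<open>(1 / a) ^ j\<close>
    and turns the direction by \<open>- Arg a\<close>.\<close>
  have "0 < norm a" "real k * d = real 1 * (real k * d - Arg a) + Arg a" using a by auto
  from uniformly_continuable_power[OF kt le_refl this 1]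
  have "uniformly_continuable kt (real k * d - Arg a) (\<lambda>_. 1) (\<lambda>_ i. (1 / a) ^ i * fc i * (of_real (norm a) * cis (Arg a)) ^ i)"
    by simp
  moreover have "(1 / a) ^ i * fc i * (of_real (norm a) * cis (Arg a)) ^ i = fc i" for i
  proof -
    have "of_real (norm a) * cis (Arg a) = a" using rcis_cmod_Arg[of a] by (simp add: rcis_def)
    then show ?thesis using a by (simp add: power_divide)
  qed
  ultimately show ?thesis by (simp only:)
qed

end

text \<open>For kt beyond 1/2 take \<open>p = 1\<close>. The lower bounds for
  \<open>m n / m (n - 1)\<close> multiply up to the factorial bound, starting from
  \<open>m 0 = 1\<close>.\<close>

lemma regular_moment_sequenceE:
  assumes kt: "kt > 0" and reg: "regular_moment_sequence (1 / kt) m"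
  obtains K e E p c where "regular_moments K e E kt p m c"
proof -
  obtain e E \<mu> where \<mu>: "kernel_functions kt e E \<mu>" "\<And>n. of_real (m n) = \<mu> (of_nat n)"
    using reg by (auto simp: regular_moment_sequence_def moment_sequence_def)
  obtain p e' E' where pair: "kernel_pair (real p * kt) e' E'"
    and mk: "\<And>n. of_real (m n) = kernel_moment e' (of_nat (p * n))"
  proof (cases "kt > 1 / 2")
    case True
    show thesis
      by (rule that[of 1 e E]) (use True \<mu> in \<open>auto simp: kernel_functions_def\<close>)
  next
    case False
    then obtain p e' E' where *: "kernel_pair (real p * kt) e' E'" "\<And>u. 0 \<le> Re u \<Longrightarrow> \<mu> u = kernel_moment e' (of_nat p * u)"
      using \<mu>(1) by (auto simp: kernel_functions_def)
    show thesis
      by (rule that[OF *(1)]) (simp add: \<mu>(2) *(2))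
  qed
  interpret kernel_moments "real p * kt" e' E' by unfold_locales (rule pair)
  have m: "m n = moment (p * n)" for n
    using mk[of n] by (simp only: of_real_moment[symmetric] of_real_eq_iff)
  have m_pos: "0 < m n" for n using moment_pos by (simp add: m)
  obtain c where c: "c > 0" "\<And>n. n \<ge> 1 \<Longrightarrow> c * real n powr (1 / kt) \<le> m n / m (n - 1)"
    using reg by (auto simp: regular_moment_sequence_def)
  have "c ^ n * fact n powr (1 / kt) \<le> m n" for n
  proof (induction n)
    case 0
    then show ?case by (simp add: m moment_0)
  next
    case (Suc n)
    have "c ^ Suc n * fact (Suc n) powr (1 / kt) = (c * real (Suc n) powr (1 / kt)) * (c ^ n * fact n powr (1 / kt))"
      by (simp add: powr_mult mult_ac del: of_nat_Suc)
    also have "\<dots> \<le> (m (Suc n) / m n) * m n"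
      using Suc.IH c(2)[of "Suc n"] c(1) m_pos[of n] m_pos[of "Suc n"] by (intro mult_mono) auto
    also have "\<dots> = m (Suc n)" using m_pos[of n] by simp
    finally show ?case .
  qed
  then have "regular_moments (real p * kt) e' E' kt p m c"
    using kt c(1) m by unfold_locales auto
  then show thesis by (rule that)
qed

text \<open>Supplies the geometric bounds that the case of a constant polynomial rests on.\<close>

lemma analytic_coefficient_le:
  assumes "f analytic_on {0}"
  obtains C A where "C \<ge> 0" "A > 0" "\<And>n. norm (fps_nth (fps_expansion f 0) n) \<le> C * A ^ n"
proof -
  have "f has_fps_expansion fps_expansion f 0"
    using assms by (rule analytic_at_imp_has_fps_expansion_0)
  then have "0 < fps_conv_radius (fps_expansion f 0)" by (simp add: has_fps_expansion_def)
  then obtain r where r: "0 < ereal r" "ereal r < fps_conv_radius (fps_expansion f 0)"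
    using ereal_dense2 by blast
  then have r0: "0 < r" by simp
  have "summable (\<lambda>n. fps_nth (fps_expansion f 0) n * of_real r ^ n)"
    by (rule summable_fps) (use r r0 in simp)
  then have "Bseq (\<lambda>n. fps_nth (fps_expansion f 0) n * of_real r ^ n)"
    using summable_LIMSEQ_zero convergent_imp_Bseq convergentI by blast
  then obtain C where C: "C > 0" "\<And>n. norm (fps_nth (fps_expansion f 0) n * of_real r ^ n) \<le> C"
    by (auto elim: BseqE)
  show thesis
  proof (rule that[of C "1 / r"])
    show "norm (fps_nth (fps_expansion f 0) n) \<le> C * (1 / r) ^ n" for n
      using C(2)[of n] r0 by (simp add: norm_mult norm_power power_divide pos_le_divide_eq)
  qed (use C r0 in auto)
qed

text \<open>The possible decrease of the radius is expressed by r'. The principal value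
  \<open>Arg a\<close> may stand for any argument of a, since a sector depends on its direction
  modulo \<open>2 * pi\<close> only.\<close>

theorem theorem2:
  fixes k :: nat and kt d r :: real and m :: "nat \<Rightarrow> real" and P :: "complex poly"
    and f :: "complex \<Rightarrow> complex" and x :: "nat \<Rightarrow> complex \<Rightarrow> complex"
  assumes "k \<ge> 1" and "kt > 0"
    and "regular_moment_sequence (1 / kt) m"
    and "poly P 0 \<noteq> 0"
    and "f analytic_on {0}"
    and "r > 0" and "\<And>n. x n \<in> disc_space r"
    and "formal_solution P k m f x"
  shows "(\<forall>a. poly P a = 0 \<longrightarrow> continues_with_growth kt (real k * d - Arg a) f) \<longleftrightarrow>
         (\<exists>r'. 0 < r' \<and> r' \<le> r \<and> summable_in_direction r' (real k * kt) d x)"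
proof -
  obtain K e E p c where "regular_moments K e E kt p m c"
    by (rule regular_moment_sequenceE[OF assms(2,3)])
  then interpret regular_moments K e E kt p m c .
  define fc where "fc = fps_nth (fps_expansion f 0)"
  have iff: "continues_with_growth kt \<theta> f \<longleftrightarrow> uniformly_continuable kt \<theta> (\<lambda>_. 1) (\<lambda>_. fc)" for \<theta>
    unfolding fc_def by (rule continues_with_growth_iff[OF assms(5)])
  have kK: "0 < real k * kt" using assms by simp
  \<comment> \<open>For \<open>i = k * j\<close> the Gamma argument of order
    \<open>real k * kt\<close> at i equals that of order kt at j; this matches the Borel transform
    in \<epsilon> with the coefficients in \<open>\<epsilon> ^ k\<close>.\<close>
  have coeff: "fps_nth (fps_expansion (x i) 0) n / of_real (Gamma (1 + real i / (real k * kt))) =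
      borel_coeff k (inverse (fps_of_poly P)) fc n i" for i n
  proof -
    have "real i / (real k * kt) = real (i div k) / kt" if "k dvd i"
      using that assms(1) by (auto elim!: dvdE)
    then show ?thesis
      using m_pos formal_solution_coeff[OF assms(1) _ assms(4,8), of i n]
      by (simp add: borel_coeff_def inverse_coeff_def fc_def less_imp_neq[symmetric])
  qed
  show ?thesis
    unfolding iff
  proof
    assume f: "\<forall>a. poly P a = 0 \<longrightarrow> uniformly_continuable kt (real k * d - Arg a) (\<lambda>_. 1) (\<lambda>_. fc)"
    obtain C A where C: "C \<ge> 0" "A > 0" "\<And>n. norm (fc n) \<le> C * A ^ n"
      unfolding fc_def using analytic_coefficient_le[OF assms(5)] by metis
    have "uniformly_continuable (real k * kt) d (\<lambda>_. 1) (borel_coeff k (inverse (fps_of_poly P)) fc)"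
      by (rule uniformly_continuable_borel_coeff[OF assms(1,4) _ C(3,1,2)]) (use f in blast)
    then show "\<exists>r'. 0 < r' \<and> r' \<le> r \<and> summable_in_direction r' (real k * kt) d x"
      by (rule summable_in_direction_if_continuable[OF kK _ assms(6,7) coeff])
  next
    assume "\<exists>r'. 0 < r' \<and> r' \<le> r \<and> summable_in_direction r' (real k * kt) d x"
    then obtain r' where r': "0 < r'" "summable_in_direction r' (real k * kt) d x" by blast
    have "uniformly_continuable (real k * kt) d (\<lambda>_. 1) (\<lambda>_. borel_coeff k (inverse (fps_of_poly P)) fc l)" for l
      using continuable_if_summable_in_direction[OF r'(2,1), of l] unfolding coeff .
    then show "\<forall>a. poly P a = 0 \<longrightarrow> uniformly_continuable kt (real k * d - Arg a) (\<lambda>_. 1) (\<lambda>_. fc)"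
      using uniformly_continuable_if_borel_coeff[OF assms(1,4)] by blast
  qed
qed

end
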